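(* Let $n\ge 1$ and $m\geq 2$ be integers, let $\vec{q_k}=(q_{k1},\dots,q_{kn})$ with $1<q_{kj}<\infty$ for all $k=1,\dots,m$, $j=1,\dots,n$, and define $\vec{q}=(q_1,\dots,q_n)$ by $\frac{1}{q_j}=\sum_{k=1}^m\frac{1}{q_{kj}}$ for $j=1,\dots,n$. Let $\varphi,\varphi_1,\dots,\varphi_m:\mathbb{R}^n\times(0,\infty)\to(0,\infty)$ be Lebesgue measurable functions, and for $i\in\{1,\dots,m\}$ let $(\Phi_i)$ be the condition that there is a constant $C_0>0$ with $$\int_r^\infty\left(1+\ln\frac{t}{r}\right)\frac{\varphi_i(x,t)}{t}\,dt\times\prod_{k=1,\,k\neq i}^m\int_r^\infty\frac{\varphi_k(x,t)}{t}\,dt\le C_0\,\varphi(x,r)\qquad\text{for all }x\in\mathbb{R}^n,\ r>0.$$ Let $\vec b=(b_1,\dots,b_m)$ with $b_1,\dots,b_m\in{\rm BMO}(\mathbb R^n)$. Then: (1) if $i\in\{1,\dots,m\}$ and $(\Phi_i)$ holds, then $M^{\vec b}_{m,i}$ is bounded from $M^{\varphi_1}_{\vec{q_1}}(\mathbb{R}^n)\times\cdots\times M^{\varphi_m}_{\vec{q_m}}(\mathbb{R}^n)$ to $M^{\varphi}_{\vec{q}}(\mathbb{R}^n)$; (2) if $(\Phi_i)$ holds for every $i=1,\dots,m$, then $M^{\vec b}_{m}$ is bounded from $M^{\varphi_1}_{\vec{q_1}}(\mathbb{R}^n)\times\cdots\times M^{\varphi_m}_{\vec{q_m}}(\mathbb{R}^n)$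 to $M^{\varphi}_{\vec{q}}(\mathbb{R}^n)$. Here an operator $S$ is bounded between these spaces if there is $C>0$ with $\|S(\vec f)\|_{M^{\varphi}_{\vec q}}\le C\prod_{k=1}^m\|f_k\|_{M^{\varphi_k}_{\vec{q_k}}}$ for all $f_k\in M^{\varphi_k}_{\vec{q_k}}(\mathbb R^n)$.
   Context: Mixed Lebesgue norm: for $\vec p=(p_1,\dots,p_n)\in(0,\infty)^n$ and measurable $f:\mathbb{R}^n\to\mathbb{C}$, $$\|f\|_{L^{\vec p}}=\left(\int_{\mathbb R}\cdots\left(\int_{\mathbb R}\left(\int_{\mathbb R}|f(x_1,\dots,x_n)|^{p_1}dx_1\right)^{p_2/p_1}dx_2\right)^{p_3/p_2}\cdots dx_n\right)^{1/p_n}.$$ Generalized mixed Morrey spaces: for a measurable $\varphi:\mathbb R^n\times(0,\infty)\to(0,\infty)$, $M^{\varphi}_{\vec q}(\mathbb R^n)$ is the set of measurable $f$ with $$\|f\|_{M^{\varphi}_{\vec q}}=\sup_{x\in\mathbb R^n,\,r>0}\varphi(x,r)^{-1}\|\chi_{B(x,r)}\|_{L^{\vec q}}^{-1}\|f\chi_{B(x,r)}\|_{L^{\vec q}}<\infty,$$ where $B(x,r)$ is the open ball with center $x$ and radius $r$. The same expression is used when some components of $\vec q$ are less than $1$ (it is then a quasi-norm). ${\rm BMO}(\mathbb R^n)$: locally integrable $b$ with $\|b\|_{\rm BMO}=\sup_{B}\frac1{|B|}\int_B|b(y)-b_B|dy<\infty$, the supremum over all balls $B$, $b_B=\frac1{|B|}\int_B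 b$. Multi-sublinear maximal commutators: for $\vec f=(f_1,\dots,f_m)$ with each $f_k\in L^1_{\rm loc}(\mathbb R^n)$, $$M^{\vec b}_{m,i}(\vec f)(x)=\left(\sup_{r>0}\frac{1}{|B(x,r)|}\int_{B(x,r)}|b_i(x)-b_i(y_i)||f_i(y_i)|dy_i\right)\times\left(\sup_{r>0}\prod_{k=1,k\ne i}^m\frac{1}{|B(x,r)|}\int_{B(x,r)}|f_k(y_k)|dy_k\right),$$ and $M^{\vec b}_m(\vec f)=\sum_{i=1}^m M^{\vec b}_{m,i}(\vec f)$. *)

theory Defs
  imports "HOL-Analysis.Analysis"
begin

section \<open>Mixed Lebesgue norms\<close>

text \<open>The power \<open>a\<^sup>s\<close> of an extended nonnegative real; it is only used with \<open>s > 0\<close>.\<close>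

definition ennreal_powr :: "ennreal \<Rightarrow> real \<Rightarrow> ennreal" where
  "ennreal_powr a s = (if a = \<infinity> then \<infinity> else ennreal (enn2real a powr s))"

definition upd_coord :: "real ^ 'n \<Rightarrow> 'n \<Rightarrow> real \<Rightarrow> real ^ 'n" where
  "upd_coord x j t = (\<chi> i. if i = j then t else x $ i)"

text \<open>
  The iterated integral: the coordinates in the list are integrated out one after the other, the
  head first (innermost). The argument \<open>s\<close> is the exponent of the preceding coordinate, so that
  the integrand at coordinate \<open>j\<close> is raised to the power \<open>p\<^sub>j / s\<close>, and when no coordinate is left
  the result is raised to the power \<open>1 / s\<close>. With the initial value \<open>s = 1\<close> the innermost
  integrand is \<open>F\<close> to the power \<open>p\<^sub>1\<close>.
\<close>

primrec iterated_norm ::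
    "real ^ 'n \<Rightarrow> 'n list \<Rightarrow> real \<Rightarrow> (real ^ 'n \<Rightarrow> ennreal) \<Rightarrow> real ^ 'n \<Rightarrow> ennreal" where
  "iterated_norm p [] s F = (\<lambda>x. ennreal_powr (F x) (1 / s))"
| "iterated_norm p (j # js) s F =
     iterated_norm p js (p $ j)
       (\<lambda>x. \<integral>\<^sup>+ t. ennreal_powr (F (upd_coord x j t)) (p $ j / s) \<partial>lebesgue)"

text \<open>
  The mixed norm of a function \<open>f\<close> with modulus \<open>F = \<bar>f\<bar>\<close>. The linear order on the index type \<open>'n\<close>
  is the order of the coordinates \<open>x\<^sub>1, \<dots>, x\<^sub>n\<close>; as all coordinates are integrated out, the base
  point \<open>0\<close> plays no role.
\<close>

definition mixed_norm ::
    "real ^ 'n::{finite,linorder} \<Rightarrow> (real ^ 'n::{finite,linorder} \<Rightarrow> ennreal) \<Rightarrow> ennreal" where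
  "mixed_norm p F = iterated_norm p (sorted_list_of_set UNIV) 1 F 0"


section \<open>Generalized mixed Morrey spaces\<close>

text \<open>Functions \<open>\<real>\<^sup>n \<times> (0,\<infinity>) \<rightarrow> (0,\<infinity>)\<close>; values at \<open>(x, r)\<close> with \<open>r \<le> 0\<close> are never used.\<close>

definition morrey_weight :: "((real ^ 'n) \<times> real \<Rightarrow> real) \<Rightarrow> bool" where
  "morrey_weight \<phi> \<longleftrightarrow>
     \<phi> \<in> borel_measurable (lebesgue_on (UNIV \<times> {0<..})) \<and> (\<forall>x. \<forall>r>0. \<phi> (x, r) > 0)"

definition morrey_norm ::
    "((real ^ 'n::{finite,linorder}) \<times> real \<Rightarrow> real) \<Rightarrow> real ^ 'n::{finite,linorder}
      \<Rightarrow> (real ^ 'n::{finite,linorder} \<Rightarrow> ennreal) \<Rightarrow> ennreal" where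
  "morrey_norm \<phi> q F =
     (SUP x. SUP r\<in>{0<..}.
        inverse (ennreal (\<phi> (x, r))) * inverse (mixed_norm q (indicator (ball x r)))
          * mixed_norm q (\<lambda>y. F y * indicator (ball x r) y))"

definition morrey_space ::
    "((real ^ 'n::{finite,linorder}) \<times> real \<Rightarrow> real) \<Rightarrow> real ^ 'n::{finite,linorder}
      \<Rightarrow> (real ^ 'n::{finite,linorder} \<Rightarrow> complex) set" where
  "morrey_space \<phi> q =
     {f. f \<in> borel_measurable lebesgue \<and> morrey_norm \<phi> q (\<lambda>x. ennreal (norm (f x))) < \<infinity>}"

text \<open>
  Boundedness of an \<open>m\<close>-linear type operator with values in the nonnegative functions. These are
  taken in \<open>[0,\<infinity>]\<close>, since maximal functions may be infinite on a null set. That \<open>S\<close> maps into the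
  target space comprises measurability of \<open>S f\<close>; finiteness of its norm follows from the estimate.
\<close>

definition morrey_bounded ::
    "nat \<Rightarrow> (nat \<Rightarrow> (real ^ 'n::{finite,linorder}) \<times> real \<Rightarrow> real) \<Rightarrow> (nat \<Rightarrow> real ^ 'n::{finite,linorder})
      \<Rightarrow> ((real ^ 'n::{finite,linorder}) \<times> real \<Rightarrow> real) \<Rightarrow> real ^ 'n::{finite,linorder}
      \<Rightarrow> ((nat \<Rightarrow> real ^ 'n::{finite,linorder} \<Rightarrow> complex) \<Rightarrow> real ^ 'n::{finite,linorder} \<Rightarrow> ennreal) \<Rightarrow> bool" where
  "morrey_bounded m \<phi>s qs \<phi> q S \<longleftrightarrow>
     (\<exists>C>0::real. \<forall>f. (\<forall>k\<in>{1..m}. f k \<in> morrey_space (\<phi>s k) (qs k)) \<longrightarrow>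
        S f \<in> borel_measurable lebesgue \<and>
        morrey_norm \<phi> q (S f) \<le>
          ennreal C * (\<Prod>k\<in>{1..m}. morrey_norm (\<phi>s k) (qs k) (\<lambda>x. ennreal (norm (f k x)))))"


section \<open>Functions of bounded mean oscillation\<close>

definition locally_integrable :: "(real ^ 'n \<Rightarrow> complex) \<Rightarrow> bool" where
  "locally_integrable f \<longleftrightarrow> (\<forall>K. compact K \<longrightarrow> set_integrable lebesgue K f)"

definition ball_mean :: "(real ^ 'n \<Rightarrow> complex) \<Rightarrow> real ^ 'n \<Rightarrow> real \<Rightarrow> complex" where
  "ball_mean b x r = (LINT y:ball x r|lebesgue. b y) /\<^sub>R measure lebesgue (ball x r)"

definition bmo_norm :: "(real ^ 'n \<Rightarrow> complex) \<Rightarrow> ennreal" where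
  "bmo_norm b =
     (SUP x. SUP r\<in>{0<..}.
        (\<integral>\<^sup>+ y\<in>ball x r. ennreal (norm (b y - ball_mean b x r)) \<partial>lebesgue)
          / emeasure lebesgue (ball x r))"

definition BMO :: "(real ^ 'n \<Rightarrow> complex) set" where
  "BMO = {b. locally_integrable b \<and> bmo_norm b < \<infinity>}"


section \<open>Multi-sublinear maximal commutators\<close>

definition max_comm_i ::
    "nat \<Rightarrow> (nat \<Rightarrow> real ^ 'n \<Rightarrow> complex) \<Rightarrow> nat
      \<Rightarrow> (nat \<Rightarrow> real ^ 'n \<Rightarrow> complex) \<Rightarrow> real ^ 'n \<Rightarrow> ennreal" where
  "max_comm_i m b i f x =
     (SUP r\<in>{0<..}.
        (\<integral>\<^sup>+ y\<in>ball x r. ennreal (norm (b i x - b i y) * norm (f i y)) \<partial>lebesgue)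
          / emeasure lebesgue (ball x r))
     * (SUP r\<in>{0<..}. \<Prod>k\<in>{1..m} - {i}.
          (\<integral>\<^sup>+ y\<in>ball x r. ennreal (norm (f k y)) \<partial>lebesgue) / emeasure lebesgue (ball x r))"

definition max_comm ::
    "nat \<Rightarrow> (nat \<Rightarrow> real ^ 'n \<Rightarrow> complex)
      \<Rightarrow> (nat \<Rightarrow> real ^ 'n \<Rightarrow> complex) \<Rightarrow> real ^ 'n \<Rightarrow> ennreal" where
  "max_comm m b f x = (\<Sum>i\<in>{1..m}. max_comm_i m b i f x)"

text \<open>The condition \<open>(\<Phi>\<^sub>i)\<close>; the integrals may a priori be infinite, and nothing is
  assumed about measurability of the individual sections \<open>t \<mapsto> \<phi>\<^sub>k(x, t)\<close>.\<close>

definition cond_Phi ::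
    "nat \<Rightarrow> (nat \<Rightarrow> (real ^ 'n) \<times> real \<Rightarrow> real) \<Rightarrow> ((real ^ 'n) \<times> real \<Rightarrow> real) \<Rightarrow> nat \<Rightarrow> bool" where
  "cond_Phi m \<phi>s \<phi> i \<longleftrightarrow>
     (\<exists>C0>0::real. \<forall>x. \<forall>r>0.
        (\<integral>\<^sup>+ t\<in>{r<..}. ennreal ((1 + ln (t / r)) * (\<phi>s i (x, t) / t)) \<partial>lebesgue)
          * (\<Prod>k\<in>{1..m} - {i}. \<integral>\<^sup>+ t\<in>{r<..}. ennreal (\<phi>s k (x, t) / t) \<partial>lebesgue)
        \<le> ennreal (C0 * \<phi> (x, r)))"

end

theory Submission
  imports Defs
begin

text \<open>
  Let \<open>M\<close> be the maximal function of a filtration of nested cells. Summing over the successive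
  stopping times at which the cell means of \<open>f\<close> have grown by a fixed factor bounds
  \<open>\<integral> \<rho>(M f) g\<close> by \<open>\<integral> M (\<rho>(f)) (M g)\<close> for a lattice norm \<open>\<rho>\<close>, as soon as the lattice-valued
  maximal function is of weak type; by the Calderon-Zygmund decomposition, strong type for a single
  exponent suffices for this. Taking for \<open>\<rho>\<close> the mixed norm in the inner coordinates, one bounds the
  one-dimensional maximal functions coordinate by coordinate, hence the dyadic maximal function on
  all mixed-norm spaces with exponents above 1.

  The same stopping argument, now also stopping where the mean oscillation of \<open>b\<close> is large, gives the
  John-Nirenberg inequality and \<open>\<integral> (C\<^sub>b f) g \<le> c \<integral> (M f) (M (M g))\<close> for the dyadic maximal
  commutator \<open>C\<^sub>b\<close>, and duality of the mixed norms turns this into boundedness. Dyadic grids shifted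
  by a third of their top scale transfer both bounds to balls.

  For the Morrey estimate on \<open>B(z, r)\<close> one splits \<open>f\<close> at \<open>B(z, 2r)\<close>. The near part is covered by the global
  bounds; the far part is at most a multiple of the supremum over \<open>t \<ge> 2r\<close> of the normalised norms
  of \<open>f\<close> on \<open>B(z, t)\<close>, with an additional factor \<open>1 + ln (t / r)\<close> for the commutator since means of a
  BMO function over concentric balls drift at most logarithmically. As the norm of \<open>f\<close> on \<open>B(z, t)\<close>
  increases with \<open>t\<close>, the suprema are dominated by the integrals in \<open>(\<Phi>\<^sub>i)\<close>, and Hoelder's inequality
  for mixed norms combines the \<open>m\<close> factors.
\<close>

section \<open>Powers of extended nonnegative reals and Hoelder's inequality\<close>

text \<open>The obstacle is the iteration of the norms: a maximal function in x_j stands inside the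
  norms over x_1, ..., x_{j-1}, so a vector-valued inequality is required. Tonelli's theorem
  provides one only when the exponent in x_j equals that of the outermost inner coordinate; hence
  the passage from one exponent to all others, repeated once per coordinate. Levels are truncated at
  a finite K until the constants are seen not to depend on K. This makes the recursion over stopping
  times finite and the norms finite, so that they can be cancelled. The target exponents q_j may be
  below 1, where duality and the triangle inequality fail. Both are therefore used only in the
  spaces of the single factors, whose exponents exceed 1; for q there remain Hoelder's inequality
  and a quasi-triangle inequality. All estimates are made for Borel functions and Borel measure, and
  null sets are exchanged only at the end. The weights enter through upper bounds under an integral,
  since their sections may fail to be measurable.\<close>

notation ennreal_powr (infixr \<open>powe\<close> 80)

lemma powe_ennreal: "0 \<le> a \<Longrightarrow> ennreal a powe s = ennreal (a powr s)"
  by (simp add: ennreal_powr_def)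

lemma powe_top [simp]: "top powe s = top"
  by (simp add: ennreal_powr_def)

lemma powe_0 [simp]: "0 powe s = 0"
  by (simp add: ennreal_powr_def)

lemma powe_1 [simp]: "1 powe s = 1"
  by (simp add: ennreal_powr_def)

lemma powe_one [simp]: "a powe 1 = a"
  by (cases a) (auto simp: powe_ennreal)

lemma powe_mono: "s \<ge> 0 \<Longrightarrow> a \<le> b \<Longrightarrow> a powe s \<le> b powe s"
  by (cases a; cases b) (auto simp: powe_ennreal powr_mono2 top_unique)

lemma powe_powe: "(a powe s) powe t = a powe (s * t)"
  by (cases a) (auto simp: powe_ennreal powr_powr)

lemma powe_le_iff: "s > 0 \<Longrightarrow> a powe s \<le> b powe s \<longleftrightarrow> a \<le> b"
  using powe_mono[of s a b] powe_mono[of "1/s" "a powe s" "b powe s"] by (auto simp: powe_powe)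

lemma powe_mult: "(a * b) powe s = a powe s * b powe s"
proof -
  have *: "(ennreal x * top) powe s = ennreal x powe s * top"
    "(top * ennreal x) powe s = top * ennreal x powe s" if "0 \<le> x" for x
    using that by (cases "x = 0"; simp add: ennreal_mult_top ennreal_top_mult powe_ennreal)+
  show ?thesis
    by (cases a; cases b) (simp_all add: * powe_ennreal powr_mult ennreal_mult'[symmetric])
qed

text \<open>Holds for exponents of any sign, because 0^s = 0 and top^s = top by convention. A
  negative power is thus not the reciprocal, and reciprocals are written with \<open>inverse\<close>
  below.\<close>

lemma powe_add: "a powe (s + t) = a powe s * a powe t"
  by (cases a) (auto simp: powe_ennreal powr_add ennreal_mult'[symmetric] ennreal_mult_top)

lemma powe_eq_0_iff [simp]: "a powe s = 0 \<longleftrightarrow> a = 0"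
  by (cases a) (auto simp: powe_ennreal)

lemma powe_eq_top_iff [simp]: "a powe s = top \<longleftrightarrow> a = top"
  by (cases a) (auto simp: powe_ennreal)

lemma powe_less_top_iff [simp]: "a powe s < top \<longleftrightarrow> a < top"
  by (simp add: less_top[symmetric])

lemma powe_le_swap: "s > 0 \<Longrightarrow> a \<le> b powe (1/s) \<longleftrightarrow> a powe s \<le> b"
  using powe_le_iff[of s a "b powe (1/s)"] by (simp add: powe_powe)

lemma powe_le_swap': "s > 0 \<Longrightarrow> b powe (1/s) \<le> a \<longleftrightarrow> b \<le> a powe s"
  using powe_le_iff[of s "b powe (1/s)" a] by (simp add: powe_powe)

lemma powe_measurable [measurable]:
  assumes [measurable]: "f \<in> borel_measurable M"
  shows "(\<lambda>x. f x powe s) \<in> borel_measurable M"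
  unfolding ennreal_powr_def by measurable

lemma powe_SUP:
  assumes "s > 0"
  shows "(SUP i\<in>I. a i) powe s = (SUP i\<in>I. a i powe s)"
proof (rule antisym)
  have "(SUP i\<in>I. a i) \<le> (SUP i\<in>I. a i powe s) powe (1/s)"
    by (rule SUP_least) (auto simp: powe_le_swap assms intro: SUP_upper)
  then show "(SUP i\<in>I. a i) powe s \<le> (SUP i\<in>I. a i powe s)"
    by (simp add: powe_le_swap assms)
  show "(SUP i\<in>I. a i powe s) \<le> (SUP i\<in>I. a i) powe s"
    by (rule SUP_least) (use assms in \<open>auto intro!: powe_mono SUP_upper\<close>)
qed

lemma powe_max: "s \<ge> 0 \<Longrightarrow> max a b powe s = max (a powe s) (b powe s)"
  by (metis max_absorb1 max_absorb2 nle_le powe_mono)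

lemma conj_exponent:
  assumes "p > 1" "1/p + 1/q = (1::real)"
  shows "q > 1" "q = p / (p - 1)"
proof -
  have "1/q = (p - 1) / p" using assms by (simp add: field_simps)
  then have "inverse (1/q) = inverse ((p - 1) / p)" by simp
  then show *: "q = p / (p - 1)" by simp
  show "q > 1" unfolding * using assms by (simp add: field_simps)
qed

lemma ennreal_Young:
  assumes pq: "p > 1" "1/p + 1/q = 1"
  shows "a * b \<le> a powe p * ennreal (1/p) + b powe q * ennreal (1/q)"
proof -
  have q: "q > 1" "q > 0" "p > 0"
    using conj_exponent[OF pq] pq by auto
  consider "a = top" "b = 0" | "a = 0" "b = top" | "a = top" "b \<noteq> 0" | "b = top" "a \<noteq> 0"
    | x y where "a = ennreal x" "b = ennreal y" "0 \<le> x" "0 \<le> y"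
    by (cases a; cases b) auto
  then show ?thesis
  proof cases
    case 3 then show ?thesis using q by (simp add: ennreal_top_mult)
  next
    case 4 then show ?thesis using q by (simp add: ennreal_top_mult)
  next
    case 5
    have "x * y \<le> x powr p / p + y powr q / q"
      using Youngs_inequality[of p q x y] assms q 5 by auto
    then show ?thesis using 5 q
      by (simp add: powe_ennreal ennreal_mult'[symmetric] ennreal_plus[symmetric] del: ennreal_plus)
  qed auto
qed

lemma nn_integral_Holder:
  assumes pq: "p > 1" "1/p + 1/q = 1"
    and [measurable]: "f \<in> borel_measurable M" "g \<in> borel_measurable M"
  shows "(\<integral>\<^sup>+x. f x * g x \<partial>M) \<le> (\<integral>\<^sup>+x. f x powe p \<partial>M) powe (1/p) * (\<integral>\<^sup>+x. g x powe q \<partial>M) powe (1/q)"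
proof -
  have q: "q > 1" "q > 0" "p > 0"
    using conj_exponent[OF pq] pq by auto
  define A where "A = (\<integral>\<^sup>+x. f x powe p \<partial>M) powe (1/p)"
  define B where "B = (\<integral>\<^sup>+x. g x powe q \<partial>M) powe (1/q)"
  have AA: "(\<integral>\<^sup>+x. f x powe p \<partial>M) = A powe p" and BB: "(\<integral>\<^sup>+x. g x powe q \<partial>M) = B powe q"
    using q by (auto simp: A_def B_def powe_powe)
  show ?thesis
  proof (cases "A = 0 \<or> B = 0")
    case True
    then have "(AE x in M. f x = 0) \<or> (AE x in M. g x = 0)"
      using AA BB by (auto simp: nn_integral_0_iff_AE)
    then have "AE x in M. f x * g x = 0" by auto
    then have "(\<integral>\<^sup>+x. f x * g x \<partial>M) = (\<integral>\<^sup>+x. 0 \<partial>M)" by (rule nn_integral_cong_AE)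
    then show ?thesis by simp
  next
    case nz: False
    show ?thesis
    proof (cases "A = top \<or> B = top")
      case True
      with nz show ?thesis unfolding A_def[symmetric] B_def[symmetric]
        by (auto simp: ennreal_mult_eq_top_iff)
    next
      case False
      have iv: "inverse A powe p * A powe p = 1" "inverse B powe q * B powe q = 1"
          "inverse A * A = 1" "inverse B * B = 1"
        using nz False by (auto simp: powe_mult[symmetric] ennreal_inverse_mult less_top[symmetric]
          mult.commute[of "inverse _"] ennreal_divide_self divide_ennreal_def[symmetric])
      have "(\<integral>\<^sup>+x. (inverse A * f x) * (inverse B * g x) \<partial>M)
         \<le> (\<integral>\<^sup>+x. (inverse A * f x) powe p * ennreal (1/p) + (inverse B * g x) powe q * ennreal (1/q) \<partial>M)"
        by (intro nn_integral_mono ennreal_Young pq)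
      also have "\<dots> = inverse A powe p * A powe p * ennreal (1/p) + inverse B powe q * B powe q * ennreal (1/q)"
        by (simp add: powe_mult nn_integral_add nn_integral_multc nn_integral_cmult AA BB)
      also have "\<dots> = 1"
        unfolding iv using pq q by (simp add: ennreal_plus[symmetric] del: ennreal_plus)
      finally have 1: "(\<integral>\<^sup>+x. (inverse A * f x) * (inverse B * g x) \<partial>M) \<le> 1" .
      have "(\<integral>\<^sup>+x. f x * g x \<partial>M) = (\<integral>\<^sup>+x. (inverse A * A) * (inverse B * B) * (f x * g x) \<partial>M)"
        by (simp add: iv)
      also have "\<dots> = (\<integral>\<^sup>+x. (A * B) * ((inverse A * f x) * (inverse B * g x)) \<partial>M)"
        by (simp add: ac_simps)
      also have "\<dots> = A * B * (\<integral>\<^sup>+x. (inverse A * f x) * (inverse B * g x) \<partial>M)"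
        by (rule nn_integral_cmult) auto
      also have "\<dots> \<le> A * B * 1" by (intro mult_left_mono 1) auto
      finally show ?thesis by (simp add: A_def B_def)
    qed
  qed
qed

text \<open>Covers r below 1, which occurs for the target exponents: Hoelder's inequality for p/r
  and q/r, both above 1, is applied to the r-th powers of f and g.\<close>

lemma nn_integral_Holder_gen:
  assumes "p > 0" "q > 0" "1/r = 1/p + 1/q"
    and [measurable]: "f \<in> borel_measurable M" "g \<in> borel_measurable M"
  shows "(\<integral>\<^sup>+x. (f x * g x) powe r \<partial>M) powe (1/r)
    \<le> (\<integral>\<^sup>+x. f x powe p \<partial>M) powe (1/p) * (\<integral>\<^sup>+x. g x powe q \<partial>M) powe (1/q)"
proof -
  have r: "r > 0"
  proof -
    have "1/r > 0" unfolding assms using assms by (intro add_pos_pos divide_pos_pos) auto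
    then show ?thesis by simp
  qed
  have "p / r = p * (1 / r)" by simp
  also have "\<dots> = 1 + p / q" unfolding assms using assms by (simp add: distrib_left)
  finally have pr: "p / r > 1" using assms by simp
  have cj: "1/(p/r) + 1/(q/r) = 1"
  proof -
    have "r * (1/p + 1/q) = 1" unfolding assms(3)[symmetric] using r by simp
    then show ?thesis by (simp add: field_simps)
  qed
  have "(\<integral>\<^sup>+x. (f x * g x) powe r \<partial>M) = (\<integral>\<^sup>+x. (f x powe r) * (g x powe r) \<partial>M)"
    by (simp add: powe_mult)
  also have "\<dots> \<le> (\<integral>\<^sup>+x. (f x powe r) powe (p/r) \<partial>M) powe (1/(p/r)) *
       (\<integral>\<^sup>+x. (g x powe r) powe (q/r) \<partial>M) powe (1/(q/r))"
    by (rule nn_integral_Holder) (use pr cj in auto)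
  also have "\<dots> = ((\<integral>\<^sup>+x. f x powe p \<partial>M) powe (1/p) * (\<integral>\<^sup>+x. g x powe q \<partial>M) powe (1/q)) powe r"
    using r by (simp add: powe_powe powe_mult)
  finally show ?thesis using r by (simp add: powe_le_swap')
qed

section \<open>Iterated norms\<close>

lemma upd_coord_same [simp]: "upd_coord x j t $ j = t"
  by (simp add: upd_coord_def)

lemma upd_coord_other [simp]: "i \<noteq> j \<Longrightarrow> upd_coord x j t $ i = x $ i"
  by (simp add: upd_coord_def)

lemma upd_coord_nth: "upd_coord x j t $ i = (if i = j then t else x $ i)"
  by (simp add: upd_coord_def)

lemma upd_coord_upd [simp]: "upd_coord (upd_coord x j s) j t = upd_coord x j t"
  by (simp add: upd_coord_def vec_eq_iff)

lemma upd_coord_id [simp]: "upd_coord x j (x $ j) = x"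
  by (simp add: upd_coord_def vec_eq_iff)

lemma upd_coord_swap: "i \<noteq> j \<Longrightarrow> upd_coord (upd_coord x j s) i t = upd_coord (upd_coord x i t) j s"
  by (auto simp: upd_coord_def vec_eq_iff)

lemma borel_measurable_vec_lambda:
  fixes f :: "'a \<Rightarrow> 'n::finite \<Rightarrow> real"
  assumes "\<And>i. (\<lambda>x. f x i) \<in> borel_measurable M"
  shows "(\<lambda>x. \<chi> i. f x i) \<in> borel_measurable M"
proof (subst borel_measurable_euclidean_space, intro ballI)
  fix b :: "real ^ 'n" assume "b \<in> Basis"
  then obtain i where "b = axis i 1" by (auto simp: Basis_vec_def)
  then show "(\<lambda>x. (\<chi> i. f x i) \<bullet> b) \<in> borel_measurable M"
    using assms[of i] by (simp add: inner_axis)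
qed

lemma measurable_vec_nth [measurable]: "(\<lambda>x. x $ i) \<in> borel_measurable (borel :: (real ^ 'n::finite) measure)"
  by (intro borel_measurable_continuous_onI continuous_intros)

lemma measurable_upd_coord [measurable (raw)]:
  fixes g :: "'a \<Rightarrow> real ^ 'n::finite"
  assumes [measurable]: "g \<in> borel_measurable M" "h \<in> borel_measurable M"
  shows "(\<lambda>x. upd_coord (g x) j (h x)) \<in> borel_measurable M"
  unfolding upd_coord_def by (rule borel_measurable_vec_lambda) auto

text \<open>One coordinate step with the root taken at once, whereas \<open>iterated_norm\<close>
  postpones it. The result is still a function of the whole vector, constant in coordinate j, so
  that the steps for different coordinates compose.\<close>

definition cnorm :: "('n \<Rightarrow> real) \<Rightarrow> 'n \<Rightarrow> (real ^ 'n \<Rightarrow> ennreal) \<Rightarrow> real ^ 'n \<Rightarrow> ennreal" where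
  "cnorm p j f = (\<lambda>x. (\<integral>\<^sup>+ t. f (upd_coord x j t) powe p j \<partial>lborel) powe (1 / p j))"

primrec mnorm :: "('n \<Rightarrow> real) \<Rightarrow> 'n list \<Rightarrow> (real ^ 'n \<Rightarrow> ennreal) \<Rightarrow> real ^ 'n \<Rightarrow> ennreal" where
  "mnorm p [] f = f"
| "mnorm p (j # js) f = mnorm p js (cnorm p j f)"

lemma cnorm_measurable [measurable]:
  fixes f :: "real ^ 'n::finite \<Rightarrow> ennreal"
  assumes [measurable]: "f \<in> borel_measurable borel"
  shows "cnorm p j f \<in> borel_measurable borel"
  unfolding cnorm_def by measurable

lemma mnorm_measurable [measurable]:
  fixes f :: "real ^ 'n::finite \<Rightarrow> ennreal"
  shows "f \<in> borel_measurable borel \<Longrightarrow> mnorm p js f \<in> borel_measurable borel"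
  by (induction js arbitrary: f) auto

lemma cnorm_measurable_param:
  fixes f :: "'s \<Rightarrow> real ^ 'n::finite \<Rightarrow> ennreal"
  assumes [measurable]: "case_prod f \<in> borel_measurable (M \<Otimes>\<^sub>M borel)"
  shows "(\<lambda>(s, x). cnorm p j (f s) x) \<in> borel_measurable (M \<Otimes>\<^sub>M borel)"
  unfolding cnorm_def by measurable

lemma mnorm_measurable_param:
  fixes f :: "'s \<Rightarrow> real ^ 'n::finite \<Rightarrow> ennreal"
  shows "case_prod f \<in> borel_measurable (M \<Otimes>\<^sub>M borel) \<Longrightarrow>
    (\<lambda>(s, x). mnorm p js (f s) x) \<in> borel_measurable (M \<Otimes>\<^sub>M borel)"
proof (induction js arbitrary: f)
  case (Cons j js)
  show ?case using Cons.IH[OF cnorm_measurable_param[OF Cons.prems, where p=p and j=j]] by simp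
qed auto

lemma cnorm_cong_at:
  assumes "\<And>y. (\<And>i. i \<noteq> j \<Longrightarrow> y $ i = x $ i) \<Longrightarrow> f y = g y"
  shows "cnorm p j f x = cnorm p j g x"
  unfolding cnorm_def using assms by simp

lemma mnorm_cong_at:
  assumes "\<And>y. (\<And>i. i \<notin> set js \<Longrightarrow> y $ i = x $ i) \<Longrightarrow> f y = g y"
  shows "mnorm p js f x = mnorm p js g x"
  using assms
proof (induction js arbitrary: f g)
  case Nil then show ?case by simp
next
  case (Cons j js)
  have "mnorm p js (cnorm p j f) x = mnorm p js (cnorm p j g) x"
  proof (rule Cons.IH)
    fix y assume y: "\<And>i. i \<notin> set js \<Longrightarrow> y $ i = x $ i"
    show "cnorm p j f y = cnorm p j g y"
      by (rule cnorm_cong_at, rule Cons.prems) (use y in auto)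
  qed
  then show ?case by simp
qed

lemma cnorm_mono_at:
  assumes "p j > 0" "\<And>y. (\<And>i. i \<noteq> j \<Longrightarrow> y $ i = x $ i) \<Longrightarrow> f y \<le> g y"
  shows "cnorm p j f x \<le> cnorm p j g x"
  unfolding cnorm_def using assms by (intro powe_mono nn_integral_mono) auto

lemma mnorm_mono_at:
  assumes "\<And>j. j \<in> set js \<Longrightarrow> p j > 0" "\<And>y. (\<And>i. i \<notin> set js \<Longrightarrow> y $ i = x $ i) \<Longrightarrow> f y \<le> g y"
  shows "mnorm p js f x \<le> mnorm p js g x"
  using assms
proof (induction js arbitrary: f g)
  case (Cons j js)
  have "mnorm p js (cnorm p j f) x \<le> mnorm p js (cnorm p j g) x"
  proof (rule Cons.IH)
    fix y assume y: "\<And>i. i \<notin> set js \<Longrightarrow> y $ i = x $ i"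
    show "cnorm p j f y \<le> cnorm p j g y"
      by (rule cnorm_mono_at) (use y Cons.prems in auto)
  qed (use Cons.prems in auto)
  then show ?case by simp
qed auto

lemma mnorm_mono:
  assumes "\<And>j. j \<in> set js \<Longrightarrow> p j > 0" "\<And>y. f y \<le> g y"
  shows "mnorm p js f x \<le> mnorm p js g x"
  by (rule mnorm_mono_at) (use assms in auto)

lemma mnorm_append: "mnorm p (js @ js') f = mnorm p js' (mnorm p js f)"
  by (induction js arbitrary: f) auto

lemma mnorm_indep_aux:
  assumes "\<And>y t. g (upd_coord y i t) = g y" "i \<notin> set js"
  shows "mnorm p js g (upd_coord x i t) = mnorm p js g x"
  using assms
proof (induction js arbitrary: g)
  case (Cons k js)
  have "cnorm p k g (upd_coord y i t) = cnorm p k g y" for y t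
  proof -
    have "g (upd_coord (upd_coord y i t) k s) = g (upd_coord y k s)" for s
      using Cons.prems by (auto simp: upd_coord_swap[of k i y t s])
    then show ?thesis by (simp add: cnorm_def)
  qed
  then show ?case using Cons.IH[of "cnorm p k g"] Cons.prems by simp
qed simp

text \<open>The factor \<open>c\<close> may depend on the coordinates that are not integrated out.\<close>

lemma cnorm_cmult_at:
  fixes f :: "real ^ 'n::finite \<Rightarrow> ennreal"
  assumes "p j > 0" "f \<in> borel_measurable borel" "\<And>y. (\<And>i. i \<noteq> j \<Longrightarrow> y $ i = x $ i) \<Longrightarrow> c y = c x"
  shows "cnorm p j (\<lambda>x. c x * f x) x = c x * cnorm p j f x"
proof -
  note [measurable] = assms(2)
  have "cnorm p j (\<lambda>x. c x * f x) x = cnorm p j (\<lambda>y. c x * f y) x"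
  proof (rule cnorm_cong_at)
    fix y assume "\<And>i. i \<noteq> j \<Longrightarrow> y $ i = x $ i"
    then show "c y * f y = c x * f y" using assms(3)[of y] by simp
  qed
  also have "\<dots> = c x * cnorm p j f x"
    using assms(1) by (simp add: cnorm_def powe_mult nn_integral_cmult powe_powe)
  finally show ?thesis .
qed

lemma mnorm_cmult_at:
  fixes f :: "real ^ 'n::finite \<Rightarrow> ennreal"
  assumes "\<And>j. j \<in> set js \<Longrightarrow> p j > 0" "f \<in> borel_measurable borel"
    "\<And>y. (\<And>i. i \<notin> set js \<Longrightarrow> y $ i = x $ i) \<Longrightarrow> c y = c x"
  shows "mnorm p js (\<lambda>x. c x * f x) x = c x * mnorm p js f x"
  using assms
proof (induction js arbitrary: f)
  case Nil
  show ?case by (simp only: mnorm.simps)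
next
  case (Cons j js)
  have "mnorm p js (cnorm p j (\<lambda>x. c x * f x)) x = mnorm p js (\<lambda>x. c x * cnorm p j f x) x"
  proof (rule mnorm_cong_at)
    fix y assume y: "\<And>i. i \<notin> set js \<Longrightarrow> y $ i = x $ i"
    show "cnorm p j (\<lambda>x. c x * f x) y = c y * cnorm p j f y"
    proof (rule cnorm_cmult_at)
      fix z assume z: "\<And>i. i \<noteq> j \<Longrightarrow> z $ i = y $ i"
      have "z $ i = x $ i" if "i \<notin> set (j # js)" for i
        using z[of i] y[of i] that by auto
      then have "c z = c x" by (rule Cons.prems(3))
      moreover have "c y = c x" by (rule Cons.prems(3)) (use y in auto)
      ultimately show "c z = c y" by simp
    qed (use Cons.prems(1,2) in auto)
  qed
  also have "\<dots> = c x * mnorm p js (cnorm p j f) x"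
  proof (rule Cons.IH)
    show "c y = c x" if "\<And>i. i \<notin> set js \<Longrightarrow> y $ i = x $ i" for y
      by (rule Cons.prems(3)) (use that in auto)
  qed (use Cons.prems(1,2) in auto)
  finally show ?case by simp
qed

lemma mnorm_cmult:
  fixes f :: "real ^ 'n::finite \<Rightarrow> ennreal"
  assumes "\<And>j. j \<in> set js \<Longrightarrow> p j > 0" "f \<in> borel_measurable borel"
  shows "mnorm p js (\<lambda>x. c * f x) x = c * mnorm p js f x"
  using mnorm_cmult_at[where c="\<lambda>_. c", OF assms] by simp

lemma cnorm_SUP:
  fixes f :: "nat \<Rightarrow> real ^ 'n::finite \<Rightarrow> ennreal"
  assumes "p j > 0" and [measurable]: "\<And>i. f i \<in> borel_measurable borel" and "incseq f"
  shows "cnorm p j (\<lambda>x. SUP i. f i x) x = (SUP i. cnorm p j (f i) x)"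
proof -
  have "(\<integral>\<^sup>+ t. (SUP i. f i (upd_coord x j t)) powe p j \<partial>lborel) =
      (\<integral>\<^sup>+ t. (SUP i. f i (upd_coord x j t) powe p j) \<partial>lborel)"
    by (simp add: powe_SUP assms)
  also have "\<dots> = (SUP i. \<integral>\<^sup>+ t. f i (upd_coord x j t) powe p j \<partial>lborel)"
    by (rule nn_integral_monotone_convergence_SUP)
      (use assms in \<open>auto simp: incseq_def le_fun_def intro!: powe_mono\<close>)
  finally show ?thesis using assms by (simp add: cnorm_def powe_SUP)
qed

lemma mnorm_SUP:
  fixes f :: "nat \<Rightarrow> real ^ 'n::finite \<Rightarrow> ennreal"
  assumes "\<And>j. j \<in> set js \<Longrightarrow> p j > 0" "\<And>i. f i \<in> borel_measurable borel" "incseq f"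
  shows "mnorm p js (\<lambda>x. SUP i. f i x) x = (SUP i. mnorm p js (f i) x)"
  using assms
proof (induction js arbitrary: f)
  case (Cons j js)
  have "cnorm p j (\<lambda>x. SUP i. f i x) = (\<lambda>x. SUP i. cnorm p j (f i) x)"
    by (rule ext, rule cnorm_SUP) (use Cons.prems in auto)
  moreover have "incseq (\<lambda>i. cnorm p j (f i))"
  proof (unfold incseq_def le_fun_def[of "cnorm _ _ _"], intro allI impI cnorm_mono_at)
    show "f m y \<le> f n y" if "m \<le> n" for m n y
      using incseqD[OF Cons.prems(3) that] by (simp add: le_funD)
  qed (use Cons.prems in auto)
  ultimately show ?case using Cons by simp
qed auto

lemma mnorm_Holder:
  fixes u w :: "real ^ 'n::finite \<Rightarrow> ennreal"
  assumes "\<And>j. j \<in> set js \<Longrightarrow> p j > 0" "\<And>j. j \<in> set js \<Longrightarrow> q j > 0"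
    "\<And>j. j \<in> set js \<Longrightarrow> 1 / r j = 1 / p j + 1 / q j"
    "u \<in> borel_measurable borel" "w \<in> borel_measurable borel"
  shows "mnorm r js (\<lambda>x. u x * w x) x \<le> mnorm p js u x * mnorm q js w x"
  using assms
proof (induction js arbitrary: u w)
  case (Cons j js)
  note [measurable] = Cons.prems(4,5)
  have r: "r i > 0" if "i \<in> set (j # js)" for i
  proof -
    have "1 / r i > 0" using Cons.prems(1-3)[OF that] by (simp add: add_pos_pos)
    then show ?thesis by simp
  qed
  have "cnorm r j (\<lambda>x. u x * w x) y \<le> cnorm p j u y * cnorm q j w y" for y
    unfolding cnorm_def by (rule nn_integral_Holder_gen) (use Cons.prems in auto)
  then have "mnorm r js (cnorm r j (\<lambda>x. u x * w x)) x \<le> mnorm r js (\<lambda>y. cnorm p j u y * cnorm q j w y) x"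
    by (intro mnorm_mono) (use r in auto)
  also have "\<dots> \<le> mnorm p js (cnorm p j u) x * mnorm q js (cnorm q j w) x"
    by (rule Cons.IH) (use Cons.prems in auto)
  finally show ?case by simp
qed auto

lemma mnorm_zero [simp]: "mnorm p js (\<lambda>x. 0) x = 0"
  by (induction js) (simp_all add: cnorm_def)

text \<open>Induction that splits off one factor; s collects the reciprocal exponents of the
  remaining ones. Components of r and s may be below 1.\<close>

lemma mnorm_prod_Holder:
  fixes u :: "'k \<Rightarrow> real ^ 'n::finite \<Rightarrow> ennreal"
  assumes "finite I" "I \<noteq> {}" "\<And>k j. k \<in> I \<Longrightarrow> p k j > 0"
    "\<And>j. 1 / r j = (\<Sum>k\<in>I. 1 / p k j)"
    "\<And>k. k \<in> I \<Longrightarrow> u k \<in> borel_measurable borel"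
  shows "mnorm r js (\<lambda>x. \<Prod>k\<in>I. u k x) x \<le> (\<Prod>k\<in>I. mnorm (p k) js (u k) x)"
  using assms
proof (induction I arbitrary: r rule: finite_ne_induct)
  case (singleton k)
  then have "r = p k" by (auto simp: fun_eq_iff)
  then show ?case by simp
next
  case (insert k I)
  define s where "s j = 1 / (\<Sum>k\<in>I. 1 / p k j)" for j
  have s: "s j > 0" for j
    unfolding s_def using insert by (intro divide_pos_pos sum_pos) auto
  have [measurable]: "\<And>k. k \<in> I \<Longrightarrow> u k \<in> borel_measurable borel" "u k \<in> borel_measurable borel"
    using insert by auto
  have "mnorm r js (\<lambda>x. \<Prod>k\<in>insert k I. u k x) x = mnorm r js (\<lambda>x. u k x * (\<Prod>k\<in>I. u k x)) x"
    using insert by simp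
  also have "\<dots> \<le> mnorm (p k) js (u k) x * mnorm s js (\<lambda>x. \<Prod>k\<in>I. u k x) x"
    by (rule mnorm_Holder) (use insert s in \<open>auto simp: s_def\<close>)
  also have "\<dots> \<le> mnorm (p k) js (u k) x * (\<Prod>k\<in>I. mnorm (p k) js (u k) x)"
    by (intro mult_left_mono insert.IH) (use insert in \<open>auto simp: s_def\<close>)
  finally show ?case using insert by simp
qed

text \<open>Serves twice: with all exponents 1 it gives the volume of boxes for
  \<open>iint_eq_lborel\<close>, with general exponents the norm of a cube in
  \<open>nrm_cube\<close>.\<close>

lemma mnorm_prod:
  assumes "distinct js" and [measurable]: "\<And>i. g i \<in> borel_measurable borel"
    and "\<And>i. i \<in> set js \<Longrightarrow> p i > 0"
  shows "mnorm p js (\<lambda>x :: real ^ 'n::finite. \<Prod>i\<in>set js. g i (x $ i)) x =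
    (\<Prod>i\<in>set js. (\<integral>\<^sup>+ t. g i t powe p i \<partial>lborel) powe (1 / p i))"
  using assms(1,3)
proof (induction js)
  case (Cons j js)
  have "cnorm p j (\<lambda>x. \<Prod>i\<in>set (j # js). g i (x $ i)) =
     (\<lambda>x. (\<integral>\<^sup>+ t. g j t powe p j \<partial>lborel) powe (1 / p j) * (\<Prod>i\<in>set js. g i (x $ i)))"
  proof
    fix x :: "real ^ 'n"
    have "(\<Prod>i\<in>set js. g i (upd_coord x j t $ i)) = (\<Prod>i\<in>set js. g i (x $ i))" for t
      using Cons.prems by (intro prod.cong) (auto simp: upd_coord_nth)
    then show "cnorm p j (\<lambda>x. \<Prod>i\<in>set (j # js). g i (x $ i)) x =
        (\<integral>\<^sup>+ t. g j t powe p j \<partial>lborel) powe (1 / p j) * (\<Prod>i\<in>set js. g i (x $ i))"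
      using Cons.prems less_imp_neq[OF Cons.prems(2)[of j], symmetric]
      by (simp add: cnorm_def nn_integral_multc powe_mult powe_powe)
  qed
  then have "mnorm p (j # js) (\<lambda>x. \<Prod>i\<in>set (j # js). g i (x $ i)) x =
     mnorm p js (\<lambda>x. (\<integral>\<^sup>+ t. g j t powe p j \<partial>lborel) powe (1 / p j) * (\<Prod>i\<in>set js. g i (x $ i))) x" by simp
  also have "\<dots> = (\<integral>\<^sup>+ t. g j t powe p j \<partial>lborel) powe (1 / p j) * mnorm p js (\<lambda>x. \<Prod>i\<in>set js. g i (x $ i)) x"
    using Cons.prems by (intro mnorm_cmult) auto
  finally show ?case using Cons by simp
qed simp

section \<open>The iterated integral\<close>

abbreviation iint :: "'n list \<Rightarrow> (real ^ 'n \<Rightarrow> ennreal) \<Rightarrow> real ^ 'n \<Rightarrow> ennreal" where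
  "iint \<equiv> mnorm (\<lambda>_. 1)"

lemma cnorm_1: "cnorm (\<lambda>_. 1) j f x = (\<integral>\<^sup>+ t. f (upd_coord x j t) \<partial>lborel)"
  by (simp add: cnorm_def)

lemma iint_Tonelli:
  fixes f :: "'s \<Rightarrow> real ^ 'n::finite \<Rightarrow> ennreal"
  assumes "sigma_finite_measure M" "case_prod f \<in> borel_measurable (M \<Otimes>\<^sub>M borel)"
  shows "iint js (\<lambda>x. \<integral>\<^sup>+ s. f s x \<partial>M) x = (\<integral>\<^sup>+ s. iint js (f s) x \<partial>M)"
  using assms(2)
proof (induction js arbitrary: f)
  case Nil then show ?case by simp
next
  case (Cons j js)
  note [measurable] = Cons.prems
  interpret pair_sigma_finite M lborel
    using assms(1) by (simp add: pair_sigma_finite_def lborel.sigma_finite_measure_axioms)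
  have "cnorm (\<lambda>_. 1) j (\<lambda>x. \<integral>\<^sup>+ s. f s x \<partial>M) = (\<lambda>x. \<integral>\<^sup>+ s. cnorm (\<lambda>_. 1) j (f s) x \<partial>M)"
    unfolding cnorm_1 by (rule ext, rule Fubini') measurable
  then show ?case using Cons.IH[OF cnorm_measurable_param[OF Cons.prems, where p="\<lambda>_. 1" and j=j]] by simp
qed

lemma iint_suminf:
  fixes f :: "nat \<Rightarrow> real ^ 'n::finite \<Rightarrow> ennreal"
  assumes "\<And>i. f i \<in> borel_measurable borel"
  shows "iint js (\<lambda>x. \<Sum>i. f i x) x = (\<Sum>i. iint js (f i) x)"
  using assms
proof (induction js arbitrary: f)
  case (Cons j js)
  have "cnorm (\<lambda>_. 1) j (\<lambda>x. \<Sum>i. f i x) = (\<lambda>x. \<Sum>i. cnorm (\<lambda>_. 1) j (f i) x)"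
    unfolding cnorm_1 using Cons.prems by (intro ext nn_integral_suminf) (auto intro!: measurable_upd_coord measurable_compose[OF _ Cons.prems])
  then show ?case using Cons by simp
qed simp

lemma iint_add:
  fixes f g :: "real ^ 'n::finite \<Rightarrow> ennreal"
  assumes "f \<in> borel_measurable borel" "g \<in> borel_measurable borel"
  shows "iint js (\<lambda>x. f x + g x) x = iint js f x + iint js g x"
  using assms
proof (induction js arbitrary: f g)
  case (Cons j js)
  have "cnorm (\<lambda>_. 1) j (\<lambda>x. f x + g x) = (\<lambda>x. cnorm (\<lambda>_. 1) j f x + cnorm (\<lambda>_. 1) j g x)"
    unfolding cnorm_1 by (intro ext nn_integral_add) (auto intro!: measurable_compose[OF _ Cons.prems(1)] measurable_compose[OF _ Cons.prems(2)])
  then show ?case using Cons by simp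
qed simp

text \<open>The iterated integral of indicators is a measure that gives boxes their volume, so it is
  Lebesgue measure by uniqueness; monotone approximation extends this to all functions. In
  particular the order of the coordinates is immaterial.\<close>

lemma iint_eq_lborel:
  fixes f :: "real ^ 'n::finite \<Rightarrow> ennreal"
  assumes js: "distinct js" "set js = UNIV" and f: "f \<in> borel_measurable borel"
  shows "iint js f x = (\<integral>\<^sup>+ y. f y \<partial>lborel)"
proof -
  define N where "N = measure_of UNIV (sets borel) (\<lambda>A. iint js (indicator A) x)"
  have pos: "positive (sets borel) (\<lambda>A :: (real ^ 'n) set. iint js (indicator A) x)"
    proof -
    have "indicator {} = (\<lambda>x :: real ^ 'n. 0 :: ennreal)" by auto
    then show ?thesis by (simp add: positive_def)
  qed
  have ca: "countably_additive (sets borel) (\<lambda>A :: (real ^ 'n) set. iint js (indicator A) x)"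
  proof (rule countably_additiveI)
    fix A :: "nat \<Rightarrow> (real ^ 'n) set"
    assume A: "range A \<subseteq> sets borel" "disjoint_family A"
    have "indicator (\<Union>i. A i) = (\<lambda>x. (\<Sum>i. indicator (A i) x :: ennreal))"
      using suminf_indicator[OF A(2)] by (auto simp: fun_eq_iff)
    then show "(\<Sum>i. iint js (indicator (A i)) x) = iint js (indicator (\<Union>i. A i)) x"
      using A by (simp add: iint_suminf)
  qed
  have sets_N: "sets N = sets borel"
    unfolding N_def using sets.sigma_sets_eq[of "borel :: (real ^ 'n) measure"] by (simp add: sets_measure_of)
  have sa: "sigma_algebra UNIV (sets (borel :: (real ^ 'n) measure))"
    using sets.sigma_algebra_axioms[of "borel :: (real ^ 'n) measure"] by simp
  have em: "emeasure N A = iint js (indicator A) x" if "A \<in> sets borel" for A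
    unfolding N_def by (rule emeasure_measure_of_sigma[OF sa pos ca that])
  have "lborel = N"
  proof (rule lborel_eqI)
    fix l u :: "real ^ 'n" assume lu: "\<And>b. b \<in> Basis \<Longrightarrow> l \<bullet> b \<le> u \<bullet> b"
    have le: "l $ i \<le> u $ i" for i
    proof -
      have "axis i (1 :: real) \<in> Basis" by (auto simp: Basis_vec_def)
      from lu[OF this] show ?thesis by (simp add: inner_axis)
    qed
    have "emeasure N (box l u) = iint js (\<lambda>y. \<Prod>i\<in>set js. indicator {l$i<..<u$i} (y $ i)) x"
    proof (subst em)
      have "indicator (box l u) = (\<lambda>y. \<Prod>i\<in>set js. indicator {l$i<..<u$i} (y $ i) :: ennreal)"
        unfolding js by (auto simp: fun_eq_iff indicator_def mem_box_cart)
      then show "iint js (indicator (box l u)) x = iint js (\<lambda>y. \<Prod>i\<in>set js. indicator {l$i<..<u$i} (y $ i)) x"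
        by simp
    qed simp
    also have "\<dots> = (\<Prod>i\<in>set js. (\<integral>\<^sup>+ t. indicator {l$i<..<u$i} t powe 1 \<partial>lborel) powe (1 / 1))"
      by (rule mnorm_prod) (use js in auto)
    also have "\<dots> = (\<Prod>i\<in>UNIV. ennreal (u$i - l$i))"
      using le by (simp add: js)
    also have "\<dots> = ennreal (\<Prod>i\<in>UNIV. u$i - l$i)"
      using le by (intro prod_ennreal) auto
    also have "(\<Prod>i\<in>UNIV. u$i - l$i) = (\<Prod>b\<in>Basis. (u - l) \<bullet> b)"
    proof -
      have B: "(Basis :: (real ^ 'n) set) = range (\<lambda>i. axis i 1)" by (auto simp: Basis_vec_def)
      have "inj (\<lambda>i :: 'n. axis i (1 :: real))" by (simp add: inj_on_def axis_eq_axis)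
      then show ?thesis unfolding B by (subst prod.reindex) (auto simp: inner_axis)
    qed
    finally show "emeasure N (box l u) = ennreal (\<Prod>b\<in>Basis. (u - l) \<bullet> b)" .
  qed (simp add: sets_N)
  then have L: "emeasure lborel A = iint js (indicator A) x" if "A \<in> sets borel" for A
    using em[OF that] by simp
  show ?thesis using f
  proof (induction rule: borel_measurable_induct)
    case (cong f g)
    then have "f = g" by (auto simp: fun_eq_iff)
    with cong show ?case by simp
  next
    case (set A)
    then show ?case using L[of A] by simp
  next
    case (mult u c)
    then show ?case by (simp add: mnorm_cmult nn_integral_cmult)
  next
    case (add u v)
    then show ?case by (simp add: iint_add nn_integral_add)
  next
    case (seq U)
    have eq: "Sup (range U) = (\<lambda>x. SUP i. U i x)" by (rule ext) (simp add: SUP_apply image_comp)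
    have "iint js (\<lambda>x. SUP i. U i x) x = (SUP i. iint js (U i) x)"
      by (rule mnorm_SUP) (use seq in auto)
    also have "\<dots> = (SUP i. \<integral>\<^sup>+ y. U i y \<partial>lborel)" using seq by simp
    also have "\<dots> = (\<integral>\<^sup>+ y. (SUP i. U i y) \<partial>lborel)"
      by (rule nn_integral_monotone_convergence_SUP[symmetric]) (use seq in auto)
    finally show ?case unfolding eq .
  qed
qed

section \<open>The mixed norm\<close>

text \<open>Tonelli's theorem for null sets, stated for arbitrary F and G: H plays the indicator of
  the null set and is replaced at each step by the integral over its sections. Where that integral
  vanishes, F and G agree almost everywhere on the section, so the inner integrals coincide.\<close>

lemma iterated_norm_null_cong:
  fixes H :: "real ^ 'n::finite \<Rightarrow> ennreal"
  assumes "H \<in> borel_measurable borel" "\<And>x. H x = 0 \<Longrightarrow> F x = G x" "iint js H x = 0"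
  shows "iterated_norm p js s F x = iterated_norm p js s G x"
  using assms
proof (induction js arbitrary: F G H s)
  case (Cons j js)
  note [measurable] = Cons.prems(1)
  have "iterated_norm p js (p $ j) (\<lambda>x. \<integral>\<^sup>+ t. ennreal_powr (F (upd_coord x j t)) (p $ j / s) \<partial>lebesgue) x
      = iterated_norm p js (p $ j) (\<lambda>x. \<integral>\<^sup>+ t. ennreal_powr (G (upd_coord x j t)) (p $ j / s) \<partial>lebesgue) x"
  proof (rule Cons.IH)
    show "cnorm (\<lambda>_. 1) j H \<in> borel_measurable borel" by simp
    show "iint js (cnorm (\<lambda>_. 1) j H) x = 0" using Cons.prems by simp
    fix y assume "cnorm (\<lambda>_. 1) j H y = 0"
    then have "(\<integral>\<^sup>+ t. H (upd_coord y j t) \<partial>lborel) = 0" by (simp add: cnorm_1)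
    then have "AE t in lborel. H (upd_coord y j t) = 0"
      by (subst (asm) nn_integral_0_iff_AE) auto
    then have "AE t in lebesgue. H (upd_coord y j t) = 0"
      by (rule AE_completion)
    then have "AE t in lebesgue. F (upd_coord y j t) powe (p $ j / s) = G (upd_coord y j t) powe (p $ j / s)"
      by eventually_elim (use Cons.prems(2) in auto)
    then show "(\<integral>\<^sup>+ t. F (upd_coord y j t) powe (p $ j / s) \<partial>lebesgue) =
       (\<integral>\<^sup>+ t. G (upd_coord y j t) powe (p $ j / s) \<partial>lebesgue)"
      by (rule nn_integral_cong_AE)
  qed
  then show ?case by simp
qed auto

text \<open>At each stage the function carried by \<open>iterated_norm\<close> is the s-th power of
  the one reached by \<open>mnorm\<close>, where s is the exponent used last.\<close>

lemma iterated_norm_eq_mnorm: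
  fixes F :: "real ^ 'n::finite \<Rightarrow> ennreal"
  assumes "F \<in> borel_measurable borel" "s > 0" "\<And>j. j \<in> set js \<Longrightarrow> p $ j > 0"
  shows "iterated_norm p js s F x = mnorm (($) p) js (\<lambda>x. F x powe (1 / s)) x"
  using assms
proof (induction js arbitrary: F s)
  case (Cons j js)
  note [measurable] = Cons.prems(1)
  have "iterated_norm p (j # js) s F x =
      iterated_norm p js (p $ j) (\<lambda>x. \<integral>\<^sup>+ t. F (upd_coord x j t) powe (p $ j / s) \<partial>lborel) x"
    by (simp add: nn_integral_completion)
  also have "\<dots> = mnorm (($) p) js (\<lambda>x. (\<integral>\<^sup>+ t. F (upd_coord x j t) powe (p $ j / s) \<partial>lborel) powe (1 / p $ j)) x"
    by (rule Cons.IH) (use Cons.prems in auto)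
  finally show ?case by (simp add: cnorm_def powe_powe)
qed auto

abbreviation coords :: "'n::{finite,linorder} list" where
  "coords \<equiv> sorted_list_of_set UNIV"

lemma mixed_norm_eq_mnorm:
  assumes "F \<in> borel_measurable borel" "\<And>j. p $ j > 0"
  shows "mixed_norm p F = mnorm (($) p) coords F 0"
  unfolding mixed_norm_def using assms by (subst iterated_norm_eq_mnorm) auto

lemma mixed_norm_cong_null:
  assumes "N \<in> null_sets lborel" "\<And>x. x \<notin> N \<Longrightarrow> F x = G x"
  shows "mixed_norm p F = mixed_norm p G"
  unfolding mixed_norm_def
proof (rule iterated_norm_null_cong[where H="indicator N"])
  show "iint coords (indicator N) 0 = 0"
    using assms by (subst iint_eq_lborel) (auto simp: null_sets_def)
qed (use assms in \<open>auto simp: null_sets_def indicator_def split: if_splits\<close>)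

section \<open>Duality and Minkowski's inequality for iterated norms\<close>

lemma ennreal_SUP_mult_incseq:
  fixes a b :: "nat \<Rightarrow> ennreal"
  assumes "incseq a" "incseq b"
  shows "(SUP n. a n * b n) = (SUP n. a n) * (SUP n. b n)"
proof (rule antisym)
  show "(SUP n. a n * b n) \<le> (SUP n. a n) * (SUP n. b n)"
    by (intro SUP_least mult_mono SUP_upper) auto
  have "(SUP n. a n) * (SUP n. b n) = (SUP m. SUP n. a n * b m)"
    by (simp add: SUP_mult_left_ennreal[symmetric] SUP_mult_right_ennreal[symmetric] mult.commute)
  also have "\<dots> \<le> (SUP n. a n * b n)"
  proof (intro SUP_least)
    fix m n
    have "a n * b m \<le> a (max m n) * b (max m n)"
      using assms by (intro mult_mono) (auto simp: incseq_def)
    then show "a n * b m \<le> (SUP n. a n * b n)" by (rule SUP_upper2[OF UNIV_I])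
  qed
  finally show "(SUP n. a n) * (SUP n. b n) \<le> (SUP n. a n * b n)" .
qed

text \<open>The norming function is built one coordinate at a time as \<open>g1 * g2\<close>:
  \<open>g1\<close> is the classical (h / H)^(p - 1) for the norm \<open>H\<close> in the innermost
  coordinate, and \<open>g2\<close> norms \<open>H\<close> in the remaining ones. The last clause,
  that g inherits independence of a coordinate from h, makes \<open>g2\<close> constant in
  coordinate j, so that it can be pulled out of the inner integral. The bounds by K and R keep all
  inner norms finite, which makes the division by \<open>H\<close> legitimate.\<close>

lemma mnorm_dual_extremal:
  fixes h :: "real ^ 'n::finite \<Rightarrow> ennreal"
  assumes "distinct js" "\<And>j. j \<in> set js \<Longrightarrow> p j > 1" "\<And>j. j \<in> set js \<Longrightarrow> 1 / p j + 1 / q j = 1"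
    "h \<in> borel_measurable borel" "K < top" "R \<ge> 0"
    "\<And>x. h x \<le> K * indicator {x. \<forall>i\<in>set js. \<bar>x $ i\<bar> \<le> R} x"
  shows "\<exists>g\<in>borel_measurable borel. (\<forall>x. mnorm q js g x \<le> 1) \<and>
    (\<forall>x. iint js (\<lambda>x. h x * g x) x = mnorm p js h x) \<and>
    (\<forall>i. i \<notin> set js \<longrightarrow> (\<forall>x t. h (upd_coord x i t) = h x) \<longrightarrow> (\<forall>x t. g (upd_coord x i t) = g x))"
  using assms
proof (induction js arbitrary: h K)
  case Nil
  show ?case by (intro bexI[of _ "\<lambda>_. 1"]) auto
next
  case (Cons j js)
  note [measurable] = Cons.prems(4)
  have p: "p j > 1" "1 / p j + 1 / q j = 1" using Cons.prems by auto
  note q = conj_exponent[OF p]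
  define H where "H = cnorm p j h"
  have [measurable]: "H \<in> borel_measurable borel" by (simp add: H_def)
  have Hj: "H (upd_coord x j t) = H x" for x t by (simp add: H_def cnorm_def)
  \<comment> \<open>The section of h in coordinate j is bounded by K and lives on an interval of
    length 2 R.\<close>
  define K' where "K' = K * ennreal (2 * R) powe (1 / p j)"
  have K': "K' < top" using Cons.prems(5) by (simp add: K'_def ennreal_mult_less_top)
  have HK: "H x \<le> K' * indicator {x. \<forall>i\<in>set js. \<bar>x $ i\<bar> \<le> R} x" for x
  proof (cases "\<forall>i\<in>set js. \<bar>x $ i\<bar> \<le> R")
    case True
    have "(\<integral>\<^sup>+ t. h (upd_coord x j t) powe p j \<partial>lborel) \<le> (\<integral>\<^sup>+ t. K powe p j * indicator {-R..R} t \<partial>lborel)"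
    proof (rule nn_integral_mono)
      fix t
      have "h (upd_coord x j t) \<le> K * indicator {-R..R} t"
        by (rule order_trans[OF Cons.prems(7)]) (auto simp: indicator_def)
      then have "h (upd_coord x j t) powe p j \<le> (K * indicator {-R..R} t) powe p j"
        using p by (intro powe_mono) auto
      then show "h (upd_coord x j t) powe p j \<le> K powe p j * indicator {-R..R} t"
        by (cases "t \<in> {-R..R}") auto
    qed
    also have "\<dots> = K powe p j * ennreal (2 * R)"
      using Cons.prems(6) by (simp add: nn_integral_cmult)
    finally have "H x \<le> (K powe p j * ennreal (2 * R)) powe (1 / p j)"
      unfolding H_def cnorm_def using p by (intro powe_mono) auto
    also have "\<dots> = K'" using p by (simp add: powe_mult powe_powe K'_def)
    finally show ?thesis using True by simp
  next
    case False
    then obtain i where i: "i \<in> set js" "\<bar>x $ i\<bar> > R" by (auto simp: not_le)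
    have "h (upd_coord x j t) = 0" for t
    proof -
      have "i \<noteq> j" using i Cons.prems(1) by auto
      then have "\<not> (\<forall>i\<in>set (j # js). \<bar>upd_coord x j t $ i\<bar> \<le> R)" using i by force
      then have "indicator {x. \<forall>i\<in>set (j # js). \<bar>x $ i\<bar> \<le> R} (upd_coord x j t) = (0 :: ennreal)" by simp
      then show ?thesis using Cons.prems(7)[of "upd_coord x j t"] by (metis le_zero_eq mult_zero_right)
    qed
    then show ?thesis by (simp add: H_def cnorm_def)
  qed
  have H_top: "H x < top" for x
    by (rule le_less_trans[OF HK]) (use K' in \<open>auto simp: indicator_def\<close>)
  have int_H: "(\<integral>\<^sup>+ t. h (upd_coord x j t) powe p j \<partial>lborel) = H x powe p j" for x
    using p by (simp add: H_def cnorm_def powe_powe)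
  \<comment> \<open>Where \<open>H\<close> vanishes its reciprocal is top; the indicator makes
    \<open>g1\<close> zero there.\<close>
  define g1 where "g1 x = (inverse (H x) powe (p j - 1) * indicator {x. H x \<noteq> 0} x) * h x powe (p j - 1)" for x
  have [measurable]: "g1 \<in> borel_measurable borel" unfolding g1_def by measurable
  have inv: "inverse (H x) powe s * H x powe s = 1" if "H x \<noteq> 0" for x s
    using that H_top[of x] by (simp add: powe_mult[symmetric] mult.commute[of "inverse _"]
      ennreal_divide_self divide_ennreal_def[symmetric])
  have g1_int: "(\<integral>\<^sup>+ t. h (upd_coord x j t) * g1 (upd_coord x j t) \<partial>lborel) = H x" for x
  proof (cases "H x = 0")
    case True then show ?thesis by (simp add: g1_def Hj)
  next
    case False
    have "h y * g1 y = inverse (H y) powe (p j - 1) * indicator {x. H x \<noteq> 0} y * h y powe p j" for y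
      using powe_add[of "h y" "p j - 1" 1] by (simp add: g1_def ac_simps)
    then have "(\<integral>\<^sup>+ t. h (upd_coord x j t) * g1 (upd_coord x j t) \<partial>lborel) =
       (\<integral>\<^sup>+ t. inverse (H x) powe (p j - 1) * h (upd_coord x j t) powe p j \<partial>lborel)"
      using False by (simp add: Hj)
    also have "\<dots> = inverse (H x) powe (p j - 1) * H x powe p j"
      by (simp add: nn_integral_cmult int_H)
    also have "H x powe p j = H x powe (p j - 1) * H x" using powe_add[of "H x" "p j - 1" 1] by simp
    also have "inverse (H x) powe (p j - 1) * (H x powe (p j - 1) * H x) = H x"
      using inv[OF False, of "p j - 1"] by (metis mult.assoc mult_1)
    finally show ?thesis .
  qed
  have g1_norm: "cnorm q j g1 x \<le> 1" for x
  proof (cases "H x = 0")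
    case True then show ?thesis by (simp add: g1_def Hj cnorm_def)
  next
    case False
    have pq: "(p j - 1) * q j = p j" using p q by (simp add: field_simps)
    have "(\<integral>\<^sup>+ t. g1 (upd_coord x j t) powe q j \<partial>lborel) =
       (\<integral>\<^sup>+ t. inverse (H x) powe p j * h (upd_coord x j t) powe p j \<partial>lborel)"
      using False by (simp add: g1_def powe_mult powe_powe pq Hj)
    also have "\<dots> = inverse (H x) powe p j * H x powe p j"
      by (simp add: nn_integral_cmult int_H)
    finally show ?thesis using inv[OF False] by (simp add: cnorm_def)
  qed
  have "\<exists>g\<in>borel_measurable borel. (\<forall>x. mnorm q js g x \<le> 1) \<and>
    (\<forall>x. iint js (\<lambda>x. H x * g x) x = mnorm p js H x) \<and>
    (\<forall>i. i \<notin> set js \<longrightarrow> (\<forall>x t. H (upd_coord x i t) = H x) \<longrightarrow> (\<forall>x t. g (upd_coord x i t) = g x))"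
    by (rule Cons.IH) (use Cons.prems(1-3,6) HK K' in auto)
  then obtain g2 where [measurable]: "g2 \<in> borel_measurable borel"
    and g2_norm: "\<And>x. mnorm q js g2 x \<le> 1"
    and g2_int: "\<And>x. iint js (\<lambda>x. H x * g2 x) x = mnorm p js H x"
    and g2_ind: "\<And>i x t. i \<notin> set js \<Longrightarrow> (\<forall>x t. H (upd_coord x i t) = H x) \<Longrightarrow> g2 (upd_coord x i t) = g2 x"
    by blast
  have g2j: "g2 (upd_coord x j t) = g2 x" for x t
    using g2_ind[of j] Hj Cons.prems(1) by auto
  show ?case
  proof (intro bexI[of _ "\<lambda>x. g1 x * g2 x"] conjI allI impI)
    fix x
    have "cnorm q j (\<lambda>x. g1 x * g2 x) y = g2 y * cnorm q j g1 y" for y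
      using q(1) by (simp add: cnorm_def g2j powe_mult nn_integral_multc powe_powe) (simp add: mult.commute)
    then have "mnorm q js (cnorm q j (\<lambda>x. g1 x * g2 x)) x \<le> mnorm q js g2 x"
    proof (intro mnorm_mono)
      show "q i > 0" if "i \<in> set js" for i
        using conj_exponent[of "p i" "q i"] Cons.prems(2,3)[of i] that by simp
    qed (use mult_left_mono[OF g1_norm] in auto)
    then show "mnorm q (j # js) (\<lambda>x. g1 x * g2 x) x \<le> 1" using g2_norm[of x] by simp
    have "cnorm (\<lambda>_. 1) j (\<lambda>x. h x * (g1 x * g2 x)) = (\<lambda>y. H y * g2 y)"
      unfolding fun_eq_iff cnorm_1 by (simp add: g2j mult.assoc[symmetric] nn_integral_multc g1_int)
    then show "iint (j # js) (\<lambda>x. h x * (g1 x * g2 x)) x = mnorm p (j # js) h x"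
      using g2_int by (simp add: H_def[symmetric])
  next
    fix i x t
    assume i: "i \<notin> set (j # js)" and ind: "\<forall>x t. h (upd_coord x i t) = h x"
    have Hi: "H (upd_coord x i t) = H x" for x t
    proof -
      have "h (upd_coord (upd_coord x i t) j s) = h (upd_coord x j s)" for s
        using i ind by (auto simp: upd_coord_swap[of j i x t s])
      then show ?thesis by (simp add: H_def cnorm_def)
    qed
    show "g1 (upd_coord x i t) * g2 (upd_coord x i t) = g1 x * g2 x"
      using g2_ind[of i] Hi i ind by (simp add: g1_def indicator_def)
  qed measurable
qed

text \<open>Converse of Hoelder's inequality. Truncating f in height and support gives functions
  that possess a norming g, and monotone convergence removes the truncation.\<close>

lemma mnorm_le_dual:
  fixes f :: "real ^ 'n::finite \<Rightarrow> ennreal"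
  assumes js: "distinct js" "\<And>j. j \<in> set js \<Longrightarrow> p j > 1" "\<And>j. j \<in> set js \<Longrightarrow> 1 / p j + 1 / q j = 1"
    and [measurable]: "f \<in> borel_measurable borel"
    and le: "\<And>g. g \<in> borel_measurable borel \<Longrightarrow> (\<And>y. mnorm q js g y \<le> 1) \<Longrightarrow> iint js (\<lambda>x. f x * g x) x \<le> C"
  shows "mnorm p js f x \<le> C"
proof -
  define h where "h n x = min (f x) (of_nat n) * indicator {x. \<forall>i\<in>set js. \<bar>x $ i\<bar> \<le> real n} x" for n x
  have [measurable]: "h n \<in> borel_measurable borel" for n unfolding h_def by measurable
  have inc1: "incseq (\<lambda>n. min (f x) (of_nat n))" for x
    by (auto simp: incseq_def min_le_iff_disj)
  have inc2: "incseq (\<lambda>n. indicator {x. \<forall>i\<in>set js. \<bar>x $ i\<bar> \<le> real n} x :: ennreal)" for x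
    by (fastforce simp: incseq_def indicator_def)
  have inc: "incseq h"
    unfolding incseq_def le_fun_def h_def
    using inc1 inc2 by (auto intro!: mult_mono simp: incseq_def)
  have hf: "h n x \<le> f x" for n x by (simp add: h_def indicator_def)
  have SUP: "(SUP n. h n x) = f x" for x
  proof -
    have 1: "(SUP n. min (f x) (of_nat n)) = f x"
      using inf_SUP[of "f x" "\<lambda>n. of_nat n :: ennreal" UNIV] by (simp add: inf_min ennreal_SUP_of_nat_eq_top)
    obtain n where n: "real n \<ge> norm x" using real_arch_simple by blast
    have 2: "(SUP n. indicator {x. \<forall>i\<in>set js. \<bar>x $ i\<bar> \<le> real n} x) = (1 :: ennreal)"
    proof (rule antisym)
      have "\<bar>x $ i\<bar> \<le> real n" for i using component_le_norm_cart[of x i] n by linarith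
      then show "1 \<le> (SUP n. indicator {x. \<forall>i\<in>set js. \<bar>x $ i\<bar> \<le> real n} x :: ennreal)"
        by (intro SUP_upper2[of n]) auto
    qed (auto intro!: SUP_least simp: indicator_def)
    show ?thesis unfolding h_def using ennreal_SUP_mult_incseq[OF inc1 inc2, of x x] 1 2 by simp
  qed
  have p0: "\<And>j. j \<in> set js \<Longrightarrow> p j > 0" using js(2) by force
  have "mnorm p js (h n) x \<le> C" for n
  proof -
    have "\<exists>g\<in>borel_measurable borel. (\<forall>x. mnorm q js g x \<le> 1) \<and>
      (\<forall>x. iint js (\<lambda>x. h n x * g x) x = mnorm p js (h n) x) \<and>
      (\<forall>i. i \<notin> set js \<longrightarrow> (\<forall>x t. h n (upd_coord x i t) = h n x) \<longrightarrow> (\<forall>x t. g (upd_coord x i t) = g x))"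
    proof (rule mnorm_dual_extremal[where K="of_nat n" and R="real n"])
      show "of_nat n < (top :: ennreal)" by (simp add: ennreal_of_nat_eq_real_of_nat)
      show "h n x \<le> of_nat n * indicator {x. \<forall>i\<in>set js. \<bar>x $ i\<bar> \<le> real n} x" for x
        by (simp add: h_def indicator_def)
    qed (use js in auto)
    then obtain g where g: "g \<in> borel_measurable borel" "\<And>x. mnorm q js g x \<le> 1"
      "iint js (\<lambda>x. h n x * g x) x = mnorm p js (h n) x" by blast
    have "iint js (\<lambda>x. h n x * g x) x \<le> iint js (\<lambda>x. f x * g x) x"
      by (intro mnorm_mono mult_right_mono hf) auto
    also have "\<dots> \<le> C" by (rule le[OF g(1,2)])
    finally show ?thesis using g by simp
  qed
  then have "(SUP n. mnorm p js (h n) x) \<le> C" by (intro SUP_least) auto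
  then show ?thesis using mnorm_SUP[of js p h x] inc p0 by (simp add: SUP)
qed

lemma mnorm_pairing:
  fixes f :: "real ^ 'n::finite \<Rightarrow> ennreal"
  assumes "\<And>j. j \<in> set js \<Longrightarrow> p j > 1" "\<And>j. j \<in> set js \<Longrightarrow> 1 / p j + 1 / q j = 1"
    "f \<in> borel_measurable borel" "g \<in> borel_measurable borel"
  shows "iint js (\<lambda>x. f x * g x) x \<le> mnorm p js f x * mnorm q js g x"
proof (rule mnorm_Holder)
  fix j assume j: "j \<in> set js"
  show "p j > 0" "q j > 0" using conj_exponent[OF assms(1,2)[OF j]] assms(1)[OF j] by auto
  show "1 / 1 = 1 / p j + 1 / q j" using assms(2)[OF j] by simp
qed (use assms in auto)

text \<open>Duality reduces the inequality to Tonelli's theorem for the pairing with g and Hoelder's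
  inequality for each single s.\<close>

lemma mnorm_Minkowski:
  fixes f :: "'s \<Rightarrow> real ^ 'n::finite \<Rightarrow> ennreal"
  assumes "sigma_finite_measure M" and js: "distinct js" "\<And>j. j \<in> set js \<Longrightarrow> p j > 1"
    and f[measurable]: "case_prod f \<in> borel_measurable (M \<Otimes>\<^sub>M borel)"
  shows "mnorm p js (\<lambda>x. \<integral>\<^sup>+ s. f s x \<partial>M) x \<le> (\<integral>\<^sup>+ s. mnorm p js (f s) x \<partial>M)"
proof -
  interpret sigma_finite_measure M by fact
  define q where "q j = p j / (p j - 1)" for j
  have q: "1 / p j + 1 / q j = 1" if "j \<in> set js" for j
    using js(2)[OF that] by (simp add: q_def field_simps)
  have fs[measurable]: "f s \<in> borel_measurable borel" if "s \<in> space M" for s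
    using measurable_Pair2[OF f that] by simp
  show ?thesis
  proof (rule mnorm_le_dual[OF js q])
    fix g :: "real ^ 'n \<Rightarrow> ennreal" assume g[measurable]: "g \<in> borel_measurable borel"
      and g1: "\<And>y. mnorm q js g y \<le> 1"
    have "iint js (\<lambda>x. (\<integral>\<^sup>+ s. f s x \<partial>M) * g x) x = iint js (\<lambda>x. (\<integral>\<^sup>+ s. f s x * g x \<partial>M)) x"
      by (simp add: nn_integral_multc)
    also have "\<dots> = (\<integral>\<^sup>+ s. iint js (\<lambda>x. f s x * g x) x \<partial>M)"
      by (rule iint_Tonelli) (use assms in auto)
    also have "\<dots> \<le> (\<integral>\<^sup>+ s. mnorm p js (f s) x \<partial>M)"
    proof (rule nn_integral_mono)
      fix s assume s: "s \<in> space M"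
      have "iint js (\<lambda>x. f s x * g x) x \<le> mnorm p js (f s) x * mnorm q js g x"
        by (rule mnorm_pairing[OF js(2) q]) (use s in auto)
      also have "\<dots> \<le> mnorm p js (f s) x * 1" by (intro mult_left_mono g1) auto
      finally show "iint js (\<lambda>x. f s x * g x) x \<le> mnorm p js (f s) x" by simp
    qed
    finally show "iint js (\<lambda>x. (\<integral>\<^sup>+ s. f s x \<partial>M) * g x) x \<le> (\<integral>\<^sup>+ s. mnorm p js (f s) x \<partial>M)" .
  qed auto
qed

text \<open>Minkowski's inequality for the counting measure on a set of two points.\<close>

lemma mnorm_add:
  fixes f g :: "real ^ 'n::finite \<Rightarrow> ennreal"
  assumes js: "distinct js" "\<And>j. j \<in> set js \<Longrightarrow> p j > 1"
    and f: "f \<in> borel_measurable borel" "g \<in> borel_measurable borel"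
  shows "mnorm p js (\<lambda>x. f x + g x) x \<le> mnorm p js f x + mnorm p js g x"
proof -
  define F where "F s = (if s then f else g)" for s
  have "mnorm p js (\<lambda>x. \<integral>\<^sup>+ s. F s x \<partial>count_space UNIV) x \<le> (\<integral>\<^sup>+ s. mnorm p js (F s) x \<partial>count_space UNIV)"
  proof (rule mnorm_Minkowski[OF _ js])
    show "sigma_finite_measure (count_space (UNIV :: bool set))"
      by (rule sigma_finite_measure_count_space_finite) simp
    show "case_prod F \<in> borel_measurable (count_space UNIV \<Otimes>\<^sub>M borel)"
      by (rule measurable_pair_measure_countable1) (use f in \<open>auto simp: F_def\<close>)
  qed
  then show ?thesis by (simp add: nn_integral_count_space_finite UNIV_bool F_def add.commute)
qed

section \<open>Stopping at the first level\<close>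

definition first_at :: "nat \<Rightarrow> (nat \<Rightarrow> 'a \<Rightarrow> bool) \<Rightarrow> nat \<Rightarrow> 'a set" where
  "first_at k B i = {x. B i x \<and> (\<forall>j\<in>{k<..<i}. \<not> B j x)}"

lemma ex_first_at:
  assumes "\<exists>i\<in>{k<..K}. B i y"
  obtains i where "i \<in> {k<..K}" "y \<in> first_at k B i"
proof -
  define i where "i = (LEAST i. i \<in> {k<..K} \<and> B i y)"
  have ex: "\<exists>i. i \<in> {k<..K} \<and> B i y" using assms by auto
  have i: "i \<in> {k<..K} \<and> B i y" unfolding i_def using LeastI_ex[OF ex] .
  have "\<not> B j y" if "j \<in> {k<..<i}" for j
    using not_less_Least[of j "\<lambda>i. i \<in> {k<..K} \<and> B i y"] that i unfolding i_def[symmetric] by auto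
  with i that show ?thesis by (auto simp: first_at_def)
qed

lemma sum_indicator_first_at:
  "(\<Sum>i\<in>{k<..K}. indicator (first_at k B i) y) = (indicator {y. \<exists>i\<in>{k<..K}. B i y} y :: ennreal)"
proof (cases "\<exists>i\<in>{k<..K}. B i y")
  case True
  then obtain i where i: "i \<in> {k<..K}" "y \<in> first_at k B i" by (rule ex_first_at)
  have "indicator (first_at k B j) y = (if j = i then 1 else 0 :: ennreal)" if "j \<in> {k<..K}" for j
    using i that by (auto simp: first_at_def indicator_def)
      (metis greaterThanLessThan_iff linorder_neqE_nat)+
  then have "(\<Sum>j\<in>{k<..K}. indicator (first_at k B j) y) = (\<Sum>j\<in>{k<..K}. if j = i then 1 else 0 :: ennreal)"
    by (intro sum.cong) auto
  then show ?thesis using True i by simp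
next
  case False
  then have "indicator (first_at k B j) y = (0 :: ennreal)" if "j \<in> {k<..K}" for j
    using that by (auto simp: first_at_def)
  then show ?thesis using False by simp
qed

lemma first_at_measurable [measurable]:
  assumes [measurable]: "\<And>i. Measurable.pred M (B i)"
  shows "Measurable.pred M (\<lambda>x. x \<in> first_at k B i)"
  unfolding first_at_def mem_Collect_eq by measurable

section \<open>Conditional means along a nested family of cells\<close>

text \<open>An abstract dyadic grid: the cells of level k partition the space and share the volume
  \<open>v k\<close>, which is at most D times that of the next level. The same locale serves the
  real line, for one coordinate at a time, and the whole space. Membership is assumed measurable
  jointly in both points, so that cell means are measurable functions.\<close>

locale filtration =
  fixes cell :: "nat \<Rightarrow> 'a::euclidean_space \<Rightarrow> 'a set" and v :: "nat \<Rightarrow> real" and D :: real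
  assumes cell_self [simp]: "x \<in> cell k x"
    and cell_eq: "y \<in> cell k x \<Longrightarrow> cell k y = cell k x"
    and cell_Suc: "cell (Suc k) x \<subseteq> cell k x"
    and cell_measurable: "{z. snd z \<in> cell k (fst z)} \<in> sets (borel \<Otimes>\<^sub>M borel)"
    and emeasure_cell: "emeasure lborel (cell k x) = ennreal (v k)"
    and v_pos [simp]: "0 < v k"
    and v_doubling: "v k \<le> D * v (Suc k)"
begin

lemma cell_antimono: "k \<le> i \<Longrightarrow> cell i x \<subseteq> cell k x"
  by (induction rule: dec_induct) (use cell_Suc in auto)

lemma cell_sym: "y \<in> cell k x \<longleftrightarrow> x \<in> cell k y"
  using cell_eq cell_self by metis

text \<open>Conditional expectation is written with a symmetric kernel, so that self-adjointness of
  \<open>E\<close> is Tonelli's theorem; the tower rule follows from it.\<close>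

definition ker :: "nat \<Rightarrow> 'a \<Rightarrow> 'a \<Rightarrow> ennreal" where
  "ker k x y = ennreal (1 / v k) * indicator (cell k x) y"

definition E :: "nat \<Rightarrow> ('a \<Rightarrow> ennreal) \<Rightarrow> 'a \<Rightarrow> ennreal" where
  "E k f x = (\<integral>\<^sup>+ y. ker k x y * f y \<partial>lborel)"

text \<open>Constancy on the cells of level k. Measurability is kept apart, so that the notion also
  covers stopping conditions and function-valued maps.\<close>

definition adapted :: "nat \<Rightarrow> ('a \<Rightarrow> 'b) \<Rightarrow> bool" where
  "adapted k h \<longleftrightarrow> (\<forall>x y. y \<in> cell k x \<longrightarrow> h y = h x)"

lemma adaptedD: "adapted k h \<Longrightarrow> y \<in> cell k x \<Longrightarrow> h y = h x"
  by (simp add: adapted_def)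

lemma adapted_mono: "adapted k h \<Longrightarrow> k \<le> i \<Longrightarrow> adapted i h"
  unfolding adapted_def using cell_antimono by blast

lemma adapted_compose: "adapted k h \<Longrightarrow> adapted k (\<lambda>x. \<phi> (h x))"
  by (simp add: adapted_def)

lemma adapted_compose2: "adapted k h \<Longrightarrow> adapted k h' \<Longrightarrow> adapted k (\<lambda>x. \<phi> (h x) (h' x))"
  unfolding adapted_def by metis

lemma adapted_all: "(\<And>i. i \<in> I \<Longrightarrow> adapted k (h i)) \<Longrightarrow> adapted k (\<lambda>x. \<forall>i\<in>I. h i x)"
  unfolding adapted_def by metis

lemma adapted_SUP: "(\<And>i. i \<in> I \<Longrightarrow> adapted k (h i)) \<Longrightarrow> adapted k (\<lambda>x. SUP i\<in>I. h i x :: ennreal)"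
  unfolding adapted_def by (auto intro!: SUP_cong)

lemma adapted_indicator: "adapted k (\<lambda>x. x \<in> S) \<Longrightarrow> adapted k (indicator S :: 'a \<Rightarrow> ennreal)"
  unfolding adapted_def by (auto simp: indicator_def)

lemma ker_measurable: "(\<lambda>(x, y). ker k x y) \<in> borel_measurable (borel \<Otimes>\<^sub>M borel)"
proof -
  note [measurable] = cell_measurable
  have "(\<lambda>(x, y). ker k x y) = (\<lambda>z. ennreal (1 / v k) * indicator {z. snd z \<in> cell k (fst z)} z)"
    by (auto simp: ker_def fun_eq_iff indicator_def)
  also have "\<dots> \<in> borel_measurable (borel \<Otimes>\<^sub>M borel)" by measurable
  finally show ?thesis .
qed

lemma ker_measurable_raw [measurable (raw)]:
  assumes [measurable]: "f \<in> borel_measurable M" "g \<in> borel_measurable M"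
  shows "(\<lambda>x. ker k (f x) (g x)) \<in> borel_measurable M"
  using measurable_compose[OF _ ker_measurable, of "\<lambda>x. (f x, g x)" M] by simp

lemma E_measurable [measurable]:
  assumes [measurable]: "f \<in> borel_measurable borel"
  shows "E k f \<in> borel_measurable borel"
  unfolding E_def by measurable

lemma E_measurable_param:
  assumes [measurable]: "case_prod f \<in> borel_measurable (M \<Otimes>\<^sub>M borel)"
  shows "(\<lambda>(s, x). E k (f s) x) \<in> borel_measurable (M \<Otimes>\<^sub>M borel)"
  unfolding E_def by measurable

lemma ker_eq_0: "y \<notin> cell k x \<Longrightarrow> ker k x y = 0"
  by (simp add: ker_def)

lemma ker_sym: "ker k x y = ker k y x"
  using cell_sym[of y k x] by (simp add: ker_def indicator_def)

lemma ker_adapted: "k \<le> i \<Longrightarrow> adapted i (ker k x)"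
proof -
  assume "k \<le> i"
  have "y \<in> cell k x \<longleftrightarrow> z \<in> cell k x" if "z \<in> cell i y" for y z
    using that cell_antimono[OF \<open>k \<le> i\<close>] cell_eq cell_self by (metis subsetD)
  then show ?thesis by (auto simp: adapted_def ker_def indicator_def)
qed

lemma E_cong: "(\<And>y. y \<in> cell k x \<Longrightarrow> f y = g y) \<Longrightarrow> E k f x = E k g x"
  unfolding E_def by (intro nn_integral_cong) (metis ker_eq_0 mult_zero_left)

lemma E_mono: "(\<And>y. y \<in> cell k x \<Longrightarrow> f y \<le> g y) \<Longrightarrow> E k f x \<le> E k g x"
  unfolding E_def by (intro nn_integral_mono) (metis ker_eq_0 mult_left_mono mult_zero_left order_refl zero_le)

lemma E_add:
  assumes [measurable]: "f \<in> borel_measurable borel" "g \<in> borel_measurable borel"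
  shows "E k (\<lambda>y. f y + g y) x = E k f x + E k g x"
  unfolding E_def by (simp add: distrib_left nn_integral_add)

lemma E_cmult:
  assumes [measurable]: "f \<in> borel_measurable borel"
  shows "E k (\<lambda>y. c * f y) x = c * E k f x"
  unfolding E_def by (subst nn_integral_cmult[symmetric]) (auto simp: ac_simps)

lemma E_zero [simp]: "E k (\<lambda>y. 0) x = 0"
  by (simp add: E_def)

lemma E_sum:
  assumes "finite I" "\<And>i. i \<in> I \<Longrightarrow> f i \<in> borel_measurable borel"
  shows "E k (\<lambda>y. \<Sum>i\<in>I. f i y) x = (\<Sum>i\<in>I. E k (f i) x)"
  using assms by (induction I rule: finite_induct) (auto simp: E_add)

lemma E_add_sum:
  assumes "finite I" "\<And>i. i \<in> I \<Longrightarrow> f i \<in> borel_measurable borel" "a \<in> borel_measurable borel"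
  shows "E k (\<lambda>y. a y + (\<Sum>i\<in>I. f i y)) x = E k a x + (\<Sum>i\<in>I. E k (f i) x)"
  using E_add[of a "\<lambda>y. \<Sum>i\<in>I. f i y" k x] E_sum[of I f k x] assms by simp

lemma E_1 [simp]: "E k (\<lambda>y. 1) x = 1"
proof -
  have "cell k x \<in> sets borel"
    using emeasure_cell[of k x] v_pos[of k] emeasure_notin_sets[of "cell k x" lborel] by fastforce
  then show ?thesis
    unfolding E_def ker_def
    by (simp add: nn_integral_cmult emeasure_cell ennreal_mult'[symmetric] less_imp_le order_less_imp_not_eq2)
qed

lemma E_pull:
  assumes "adapted k h" and [measurable]: "f \<in> borel_measurable borel"
  shows "E k (\<lambda>y. h y * f y) x = h x * E k f x"
proof -
  have "E k (\<lambda>y. h y * f y) x = E k (\<lambda>y. h x * f y) x"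
    by (rule E_cong) (use adaptedD[OF assms(1)] in auto)
  then show ?thesis by (simp add: E_cmult)
qed

lemma E_adapted_eq: "adapted k h \<Longrightarrow> E k h x = h x"
  using E_pull[of k h "\<lambda>_. 1"] by simp

lemma E_const [simp]: "E k (\<lambda>y. c) x = c"
  by (rule E_adapted_eq) (simp add: adapted_def)

lemma E_adapted: "adapted k (E k f)"
proof -
  have "ker k y = ker k x" if "y \<in> cell k x" for x y
    using cell_eq[OF that] by (simp add: ker_def fun_eq_iff)
  then show ?thesis by (auto simp: adapted_def E_def)
qed

lemma E_selfadjoint:
  assumes [measurable]: "f \<in> borel_measurable borel" "g \<in> borel_measurable borel"
  shows "(\<integral>\<^sup>+ x. E k f x * g x \<partial>lborel) = (\<integral>\<^sup>+ x. f x * E k g x \<partial>lborel)"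
proof -
  have "(\<integral>\<^sup>+ x. E k f x * g x \<partial>lborel) = (\<integral>\<^sup>+ x. \<integral>\<^sup>+ y. ker k x y * f y * g x \<partial>lborel \<partial>lborel)"
    by (simp add: E_def nn_integral_multc)
  also have "\<dots> = (\<integral>\<^sup>+ y. \<integral>\<^sup>+ x. ker k x y * f y * g x \<partial>lborel \<partial>lborel)"
    by (rule lborel_pair.Fubini') measurable
  also have "\<dots> = (\<integral>\<^sup>+ y. \<integral>\<^sup>+ x. f y * (ker k y x * g x) \<partial>lborel \<partial>lborel)"
    by (simp add: ker_sym ac_simps)
  also have "\<dots> = (\<integral>\<^sup>+ y. f y * E k g y \<partial>lborel)"
    by (simp add: E_def nn_integral_cmult)
  finally show ?thesis .
qed

lemma nn_integral_E:
  assumes [measurable]: "f \<in> borel_measurable borel"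
  shows "(\<integral>\<^sup>+ x. E k f x \<partial>lborel) = (\<integral>\<^sup>+ x. f x \<partial>lborel)"
  using E_selfadjoint[of f "\<lambda>_. 1" k] by simp

lemma nn_integral_E_adapted:
  assumes [measurable]: "f \<in> borel_measurable borel" "h \<in> borel_measurable borel" and "adapted k h"
  shows "(\<integral>\<^sup>+ x. h x * E k f x \<partial>lborel) = (\<integral>\<^sup>+ x. h x * f x \<partial>lborel)"
  using E_selfadjoint[of h f k] by (simp add: E_adapted_eq[OF assms(3)])

lemma E_tower:
  assumes "j \<le> k" and [measurable]: "f \<in> borel_measurable borel"
  shows "E j (E k f) x = E j f x"
  unfolding E_def[of j] by (rule nn_integral_E_adapted) (use ker_adapted[OF assms(1)] in auto)

lemma E_pull_tower:
  assumes "j \<le> k" "adapted k h"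
    and [measurable]: "f \<in> borel_measurable borel" "h \<in> borel_measurable borel"
  shows "E j (\<lambda>y. h y * E k f y) x = E j (\<lambda>y. h y * f y) x"
proof -
  have "E j (\<lambda>y. h y * E k f y) x = E j (E k (\<lambda>y. h y * f y)) x"
    by (rule E_cong) (simp add: E_pull[OF assms(2)])
  then show ?thesis by (simp add: E_tower[OF assms(1)])
qed

lemma D_ge_1: "D \<ge> 1"
proof -
  have "cell 0 undefined \<in> sets lborel"
    using emeasure_cell[of 0 undefined] v_pos[of 0] emeasure_notin_sets[of "cell 0 undefined" lborel] by fastforce
  then have "ennreal (v (Suc 0)) \<le> ennreal (v 0)"
    unfolding emeasure_cell[symmetric, where x=undefined] by (intro emeasure_mono cell_Suc)
  then have "1 * v (Suc 0) \<le> D * v (Suc 0)" using v_doubling[of 0] ennreal_le_iff[OF less_imp_le[OF v_pos[of 0]], of "v (Suc 0)"] by linarith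
  then show ?thesis by (rule mult_right_le_imp_le) simp
qed

lemma E_Suc_le: "f \<in> borel_measurable borel \<Longrightarrow> E (Suc k) f x \<le> ennreal D * E k f x"
proof -
  assume [measurable]: "f \<in> borel_measurable borel"
  have D: "1 / v (Suc k) \<le> D * (1 / v k)"
    using v_doubling[of k] v_pos[of k] v_pos[of "Suc k"] by (simp add: field_simps)
  have "ker (Suc k) x y \<le> ennreal D * ker k x y" for y
  proof (cases "y \<in> cell (Suc k) x")
    case True
    then have "y \<in> cell k x" using cell_Suc by auto
    then show ?thesis using True D D_ge_1
      by (simp add: ker_def ennreal_mult'[symmetric] less_imp_le)
  qed (simp add: ker_def)
  then have "E (Suc k) f x \<le> (\<integral>\<^sup>+ y. ennreal D * (ker k x y * f y) \<partial>lborel)"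
    unfolding E_def mult.assoc[symmetric] by (intro nn_integral_mono mult_right_mono) auto
  then show ?thesis by (simp add: E_def nn_integral_cmult)
qed

lemma E_eq_0_mono:
  assumes "k \<le> i" "f \<in> borel_measurable borel" "E k f x = 0"
  shows "E i f x = 0"
  using assms(1)
proof (induction rule: dec_induct)
  case (step n)
  then show ?case using E_Suc_le[OF assms(2), of n x] by simp
qed (use assms in auto)

text \<open>Hoelder's inequality with the kernel split as ker^(1/r) ker^(1/q); the second factor
  disappears because the kernel has mass 1.\<close>

lemma E_Jensen:
  assumes "r > 1" and [measurable]: "f \<in> borel_measurable borel"
  shows "E k f x powe r \<le> E k (\<lambda>y. f y powe r) x"
proof -
  define q where "q = r / (r - 1)"
  have q: "1 / r + 1 / q = 1" "q > 0" using assms(1) by (auto simp: q_def field_simps)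
  have k: "ker k x y = ker k x y powe (1 / r) * ker k x y powe (1 / q)" for y
    by (simp add: powe_add[symmetric] q)
  have "E k f x = (\<integral>\<^sup>+ y. (ker k x y powe (1 / r) * f y) * ker k x y powe (1 / q) \<partial>lborel)"
    unfolding E_def by (subst k) (simp add: ac_simps)
  also have "\<dots> \<le> (\<integral>\<^sup>+ y. (ker k x y powe (1 / r) * f y) powe r \<partial>lborel) powe (1 / r) *
      (\<integral>\<^sup>+ y. (ker k x y powe (1 / q)) powe q \<partial>lborel) powe (1 / q)"
    by (rule nn_integral_Holder) (use assms q in auto)
  also have "\<dots> = E k (\<lambda>y. f y powe r) x powe (1 / r)"
  proof -
    have "(\<integral>\<^sup>+ y. ker k x y \<partial>lborel) = 1" using E_1[of k x] unfolding E_def by simp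
    then show ?thesis using q assms(1) by (simp add: E_def powe_mult powe_powe)
  qed
  finally show ?thesis using assms(1) by (simp add: powe_le_swap)
qed

lemma adapted_first_at:
  assumes "\<And>i. k < i \<Longrightarrow> adapted i (B i)" "k < i"
  shows "adapted i (indicator (first_at k B i) :: _ \<Rightarrow> ennreal)"
proof (rule adapted_indicator)
  have "adapted i (\<lambda>x. \<forall>j\<in>{k<..<i}. \<not> B j x)"
    by (rule adapted_all, rule adapted_compose, rule adapted_mono[OF assms(1)]) auto
  then show "adapted i (\<lambda>x. x \<in> first_at k B i)"
    unfolding first_at_def mem_Collect_eq using adapted_compose2[OF assms(1)[OF assms(2)], of _ "(\<and>)"] by auto
qed

text \<open>A stopping time argument: \<open>B k i\<close> is the stopping condition at level \<open>i\<close> for the process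
  started at level \<open>k\<close>.\<close>

lemma stopping_principle:
  fixes u a c :: "nat \<Rightarrow> 'a \<Rightarrow> ennreal"
  assumes um [measurable]: "\<And>k. u k \<in> borel_measurable borel"
    and am [measurable]: "\<And>k. a k \<in> borel_measurable borel"
    and cm [measurable]: "\<And>k. c k \<in> borel_measurable borel"
    and Bm [measurable]: "\<And>k i. Measurable.pred borel (B k i)"
    and Ba: "\<And>k i. k < i \<Longrightarrow> adapted i (B k i)"
    and ca: "\<And>k. adapted k (c k)"
    and small: "\<And>k x. k \<le> K \<Longrightarrow> E k (indicator {x. \<exists>i\<in>{k<..K}. B k i x}) x \<le> ennreal (1/2)"
    and none: "\<And>k x. k \<le> K \<Longrightarrow> (\<And>i. i \<in> {k<..K} \<Longrightarrow> \<not> B k i x) \<Longrightarrow> u k x \<le> a k x"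
    and first: "\<And>k i x. k < i \<Longrightarrow> i \<le> K \<Longrightarrow> B k i x \<Longrightarrow> (\<And>j. j \<in> {k<..<i} \<Longrightarrow> \<not> B k j x) \<Longrightarrow>
      u k x \<le> a k x + u i x"
    and ac: "\<And>k x. k \<le> K \<Longrightarrow> E k (a k) x \<le> c k x"
    and "k \<le> K"
  shows "E k (u k) x \<le> 2 * E k (\<lambda>x. SUP i\<in>{k..K}. c i x) x"
  using \<open>k \<le> K\<close>
proof (induction "K - k" arbitrary: k x rule: less_induct)
  case less
  define C where "C k x = (SUP i\<in>{k..K}. c i x)" for k x
  have [measurable]: "C k \<in> borel_measurable borel" for k
    unfolding C_def by measurable
  define S where "S i = first_at k (B k) i" for i
  have Sm [measurable]: "S i \<in> sets borel" for i
    using first_at_measurable[where M=borel and B="B k" and k=k and i=i] Bm by (simp add: S_def pred_def)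
  have Sa: "adapted i (indicator (S i) :: _ \<Rightarrow> ennreal)" if "i > k" for i
    unfolding S_def by (rule adapted_first_at[OF Ba that])
  define P where "P = {x. \<exists>i\<in>{k<..K}. B k i x}"
  have Pm [measurable]: "P \<in> sets borel" unfolding P_def by measurable
  have part: "indicator (- P) y + (\<Sum>i\<in>{k<..K}. indicator (S i) y) = (1 :: ennreal)" for y
    unfolding S_def sum_indicator_first_at P_def[symmetric] by (simp add: indicator_def)
  have uS: "u k y \<le> a k y + (\<Sum>i\<in>{k<..K}. indicator (S i) y * u i y)" for y
  proof (cases "y \<in> P")
    case True
    then obtain i where i: "i \<in> {k<..K}" "y \<in> S i"
      unfolding P_def S_def mem_Collect_eq by (rule ex_first_at)
    have "u k y \<le> a k y + u i y" by (rule first) (use i in \<open>auto simp: S_def first_at_def\<close>)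
    also have "u i y = indicator (S i) y * u i y" using i by simp
    also have "\<dots> \<le> (\<Sum>i\<in>{k<..K}. indicator (S i) y * u i y)"
      using i by (intro member_le_sum) auto
    finally show ?thesis by (simp add: add_left_mono)
  next
    case False
    then have "u k y \<le> a k y" by (intro none[OF less.prems]) (auto simp: P_def)
    then show ?thesis by (simp add: add_increasing2)
  qed
  have "E k (u k) x \<le> E k (\<lambda>y. a k y + (\<Sum>i\<in>{k<..K}. indicator (S i) y * u i y)) x"
    by (intro E_mono uS)
  also have "\<dots> = E k (a k) x + (\<Sum>i\<in>{k<..K}. E k (\<lambda>y. indicator (S i) y * u i y) x)"
    by (rule E_add_sum) auto
  \<comment> \<open>The factor 2 does not accumulate over the recursion. The cost \<open>a k\<close>
    is charged to the unstopped set \<open>- P\<close>, which fills at least half of the cell by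
    \<open>small\<close>, while \<open>c k\<close> is constant on the cell. The process restarted at
    level i is charged, by the induction hypothesis, to its own set \<open>S i\<close>. These sets
    are disjoint and cover the space, so the charges add up to a single copy of
    \<open>C k\<close>.\<close>
  also have "\<dots> \<le> 2 * E k (\<lambda>y. C k y * indicator (- P) y) x +
      (\<Sum>i\<in>{k<..K}. 2 * E k (\<lambda>y. indicator (S i) y * C k y) x)"
  proof (intro add_mono sum_mono)
    have "E k (indicator P) x + E k (indicator (- P)) x = E k (\<lambda>y. indicator P y + indicator (- P) y) x"
      by (rule E_add[symmetric]) auto
    also have "\<dots> = E k (\<lambda>y. 1) x" by (rule E_cong) (auto simp: indicator_def)
    finally have "1 = E k (indicator P) x + E k (indicator (- P)) x" by simp
    also have "\<dots> \<le> ennreal (1/2) + E k (indicator (- P)) x"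
      using small[OF less.prems, of x] by (auto simp: P_def intro: add_right_mono)
    finally have "1 \<le> ennreal (1/2) + E k (indicator (- P)) x" .
    moreover have "ennreal (1/2) + ennreal (1/2) = 1" by (subst ennreal_plus[symmetric]) auto
    ultimately have "ennreal (1/2) + ennreal (1/2) \<le> ennreal (1/2) + E k (indicator (- P)) x" by (simp only:)
    then have "ennreal (1/2) \<le> E k (indicator (- P)) x"
      by (subst (asm) ennreal_add_left_cancel_le) auto
    then have half: "2 * ennreal (1/2) \<le> 2 * E k (indicator (- P)) x" by (intro mult_left_mono) auto
    have "2 * ennreal (1/2) = 1"
      by (metis ennreal_1 ennreal_mult' ennreal_numeral mult.commute nonzero_mult_div_cancel_left times_divide_eq_right zero_le_numeral zero_neq_numeral mult_1)
    with half have half: "1 \<le> 2 * E k (indicator (- P)) x" by simp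
    have "E k (a k) x \<le> c k x * 1" using ac[OF less.prems] by simp
    also have "\<dots> \<le> c k x * (2 * E k (indicator (- P)) x)" by (intro mult_left_mono half) auto
    also have "\<dots> = 2 * E k (\<lambda>y. c k y * indicator (- P) y) x"
      by (simp add: E_pull[OF ca] ac_simps)
    also have "\<dots> \<le> 2 * E k (\<lambda>y. C k y * indicator (- P) y) x"
      unfolding C_def using less.prems by (intro mult_left_mono E_mono mult_right_mono SUP_upper) auto
    finally show "E k (a k) x \<le> 2 * E k (\<lambda>y. C k y * indicator (- P) y) x" .
  next
    fix i assume i: "i \<in> {k<..K}"
    then have ki: "k \<le> i" "k < i" by auto
    have "E k (\<lambda>y. indicator (S i) y * u i y) x = E k (\<lambda>y. indicator (S i) y * E i (u i) y) x"
      by (rule E_pull_tower[symmetric]) (use ki Sa in auto)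
    also have "\<dots> \<le> E k (\<lambda>y. indicator (S i) y * (2 * E i (C i) y)) x"
      unfolding C_def using i ki by (intro E_mono mult_left_mono less.hyps) auto
    also have "\<dots> = 2 * E k (\<lambda>y. indicator (S i) y * E i (C i) y) x"
      by (subst E_cmult[symmetric]) (auto simp: ac_simps)
    also have "\<dots> = 2 * E k (\<lambda>y. indicator (S i) y * C i y) x"
      by (subst E_pull_tower) (use ki Sa in auto)
    also have "\<dots> \<le> 2 * E k (\<lambda>y. indicator (S i) y * C k y) x"
      unfolding C_def using i by (intro mult_left_mono E_mono SUP_subset_mono) auto
    finally show "E k (\<lambda>y. indicator (S i) y * u i y) x \<le> 2 * E k (\<lambda>y. indicator (S i) y * C k y) x" .
  qed
  also have "\<dots> = 2 * E k (\<lambda>y. C k y * indicator (- P) y + (\<Sum>i\<in>{k<..K}. indicator (S i) y * C k y)) x"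
  proof -
    have "E k (\<lambda>y. C k y * indicator (- P) y + (\<Sum>i\<in>{k<..K}. indicator (S i) y * C k y)) x =
      E k (\<lambda>y. C k y * indicator (- P) y) x + (\<Sum>i\<in>{k<..K}. E k (\<lambda>y. indicator (S i) y * C k y) x)"
      by (rule E_add_sum) auto
    then show ?thesis by (simp only: sum_distrib_left distrib_left)
  qed
  also have "(\<lambda>y. C k y * indicator (- P) y + (\<Sum>i\<in>{k<..K}. indicator (S i) y * C k y)) =
      (\<lambda>y. C k y * (indicator (- P) y + (\<Sum>i\<in>{k<..K}. indicator (S i) y)))"
    by (simp add: distrib_left sum_distrib_left mult.commute)
  also have "\<dots> = C k" by (simp add: part)
  finally show ?case by (simp add: C_def[abs_def])
qed

section \<open>The maximal function of a filtration\<close>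

definition Mx :: "nat \<Rightarrow> nat \<Rightarrow> ('a \<Rightarrow> ennreal) \<Rightarrow> 'a \<Rightarrow> ennreal" where
  "Mx k K f x = (SUP i\<in>{k..K}. E i f x)"

lemma Mx_measurable [measurable]: "f \<in> borel_measurable borel \<Longrightarrow> Mx k K f \<in> borel_measurable borel"
  unfolding Mx_def by measurable

lemma Mx_upper: "k \<le> i \<Longrightarrow> i \<le> K \<Longrightarrow> E i f x \<le> Mx k K f x"
  unfolding Mx_def by (intro SUP_upper) auto

lemma Mx_adapted: "adapted K (Mx k K f)"
  unfolding Mx_def by (rule adapted_SUP, rule adapted_mono[OF E_adapted]) auto

text \<open>Chebyshev's inequality at the first passage: on \<open>S i\<close>, where level i is the
  first to exceed the threshold, the mean \<open>E i F\<close> can be traded for F because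
  \<open>S i\<close> is a union of cells of level i, and the disjoint sets \<open>S i\<close> carry
  at most the whole integral of F.\<close>

lemma maximal_weak_type:
  assumes [measurable]: "F \<in> borel_measurable borel" and a: "a > 0"
  shows "E k (indicator {y. \<exists>i\<in>{k<..K}. E i F y > ennreal a * E k F y}) x \<le> ennreal (1 / a)"
proof -
  define L where "L = E k F x"
  define B where "B i y \<longleftrightarrow> E i F y > ennreal a * E k F y" for i y
  have Bm [measurable]: "Measurable.pred borel (B i)" for i unfolding B_def by measurable
  have Ba: "adapted i (B i)" if "k < i" for i
    unfolding B_def by (rule adapted_compose2[OF E_adapted adapted_mono[OF E_adapted]]) (use that in auto)
  define P where "P = {y. \<exists>i\<in>{k<..K}. B i y}"
  have [measurable]: "P \<in> sets borel" unfolding P_def by measurable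
  define S where "S i = first_at k B i" for i
  have [measurable]: "S i \<in> sets borel" for i
    using first_at_measurable[where M=borel and B=B and k=k and i=i] Bm by (simp add: S_def pred_def)
  have Sa: "adapted i (indicator (S i) :: _ \<Rightarrow> ennreal)" if "i > k" for i
    unfolding S_def by (rule adapted_first_at[OF Ba that])
  have Sdis: "(\<Sum>i\<in>{k<..K}. indicator (S i) y) = (indicator P y :: ennreal)" for y
    by (simp add: S_def P_def sum_indicator_first_at)
  have EkL: "E k F y = L" if "y \<in> cell k x" for y
    using adaptedD[OF E_adapted that] by (simp add: L_def)
  have main: "ennreal a * L * E k (indicator P) x \<le> L"
  proof -
    have "ennreal a * L * E k (indicator P) x = E k (\<lambda>y. ennreal a * L * indicator P y) x"
      by (simp add: E_cmult)
    also have "\<dots> = E k (\<lambda>y. \<Sum>i\<in>{k<..K}. indicator (S i) y * (ennreal a * L)) x"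
      unfolding Sdis[symmetric] by (simp only: sum_distrib_left mult.commute)
    also have "\<dots> \<le> E k (\<lambda>y. \<Sum>i\<in>{k<..K}. indicator (S i) y * E i F y) x"
      by (intro E_mono sum_mono) (auto simp: S_def first_at_def B_def indicator_def EkL)
    also have "\<dots> = (\<Sum>i\<in>{k<..K}. E k (\<lambda>y. indicator (S i) y * F y) x)"
    proof -
      have "E k (\<lambda>y. \<Sum>i\<in>{k<..K}. indicator (S i) y * E i F y) x =
        (\<Sum>i\<in>{k<..K}. E k (\<lambda>y. indicator (S i) y * E i F y) x)" by (rule E_sum) auto
      also have "\<dots> = (\<Sum>i\<in>{k<..K}. E k (\<lambda>y. indicator (S i) y * F y) x)"
        by (intro sum.cong refl E_pull_tower) (use Sa in auto)
      finally show ?thesis .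
    qed
    also have "\<dots> = E k (\<lambda>y. \<Sum>i\<in>{k<..K}. indicator (S i) y * F y) x"
      by (rule E_sum[symmetric]) auto
    also have "\<dots> \<le> E k F x"
      by (intro E_mono) (simp only: sum_distrib_right[symmetric] Sdis, simp add: indicator_def)
    finally show ?thesis by (simp add: L_def)
  qed
  have "E k (indicator P) x \<le> ennreal (1 / a)"
  \<comment> \<open>Cancelling L requires 0 < L < top. In the two exceptional cases no point of the
    cell stops: the later means vanish too, or the threshold is infinite.\<close>
  proof (cases "L = 0 \<or> L = top")
    case True
    have "\<not> B i y" if "y \<in> cell k x" "i > k" for i y
      using True
    proof
      assume "L = 0"
      then have "E i F y = 0" using E_eq_0_mono[of k i F y] that EkL[OF that(1)] by simp
      then show ?thesis by (simp add: B_def)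
    next
      assume "L = top"
      then show ?thesis using a that by (simp add: B_def EkL ennreal_mult_top)
    qed
    then have "E k (indicator P) x = E k (\<lambda>y. 0) x"
      by (intro E_cong) (auto simp: P_def indicator_def)
    then show ?thesis by simp
  next
    case False
    have "L * (ennreal a * E k (indicator P) x) \<le> L * 1" using main by (simp add: ac_simps)
    then have "ennreal a * E k (indicator P) x \<le> 1"
      using False by (subst (asm) ennreal_mult_le_mult_iff) auto
    then have "ennreal (1 / a) * (ennreal a * E k (indicator P) x) \<le> ennreal (1 / a) * 1"
      by (intro mult_left_mono) auto
    then show ?thesis using a by (simp add: mult.assoc[symmetric] ennreal_mult'[symmetric])
  qed
  then show ?thesis by (simp add: P_def B_def)
qed

end

section \<open>Doob's maximal inequality\<close>

lemma powe_absorb: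
  assumes "r > 1" "Y < top" "Y \<le> c * Z * Y powe (1 - 1 / r)"
  shows "Y powe (1 / r) \<le> c * Z"
proof (cases "Y = 0")
  case False
  have "Y powe (1 - 1 / r) * Y powe (1 / r) = Y" by (simp add: powe_add[symmetric])
  with assms have "Y powe (1 - 1 / r) * Y powe (1 / r) \<le> Y powe (1 - 1 / r) * (c * Z)"
    by (simp add: ac_simps)
  then show ?thesis using False assms(2)
    by (subst (asm) ennreal_mult_le_mult_iff) auto
qed simp

text \<open>The one-step inequality behind Doob's theorem, with a the maximum so far, e the next
  mean, b the new maximum and r' = r / (r - 1): b^r - a^r is at most r' (b^(r-1) - a^(r-1)) e,
  written without subtraction. If e exceeds a, then b = e and it is Young's inequality for a^(r-1)
  b.\<close>

lemma powe_max_Young: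
  assumes r: "r > 1" and b: "b = max a e"
  shows "b powe r + ennreal (r / (r - 1)) * (a powe (r - 1) * e)
    \<le> a powe r + ennreal (r / (r - 1)) * (b powe (r - 1) * e)"
proof (cases "e \<le> a")
  case True then show ?thesis using b by (simp add: max_absorb1)
next
  case False
  then have be: "b = e" using b by (simp add: max_absorb2)
  define r' where "r' = r / (r - 1)"
  have r': "r' > 1" "1 / r' + 1 / r = 1" "(r - 1) * r' = r" "r' / r = r' - 1"
    using r by (auto simp: r'_def field_simps)
  have "ennreal r' * (a powe (r - 1) * b) \<le>
      ennreal r' * ((a powe (r - 1)) powe r' * ennreal (1 / r') + b powe r * ennreal (1 / r))"
    by (intro mult_left_mono ennreal_Young r') auto
  also have "\<dots> = a powe r * (ennreal r' * ennreal (1 / r')) + b powe r * (ennreal r' * ennreal (1 / r))"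
    unfolding powe_powe r'(3) by (simp only: distrib_left mult.assoc mult.left_commute mult.commute)
  also have "\<dots> = a powe r + b powe r * ennreal (r' - 1)"
    using r' r by (simp add: ennreal_mult'[symmetric])
  finally have "b powe r + ennreal r' * (a powe (r - 1) * b) \<le>
      b powe r + (a powe r + b powe r * ennreal (r' - 1))" by (intro add_left_mono)
  also have "\<dots> = a powe r + b powe r * (1 + ennreal (r' - 1))" by (simp add: distrib_left ac_simps)
  also have "1 + ennreal (r' - 1) = ennreal r'" using r' by (subst ennreal_1[symmetric], subst ennreal_plus[symmetric]) auto
  also have "b powe r * ennreal r' = ennreal r' * (b powe (r - 1) * b)"
    using powe_add[of b "r - 1" 1] by (simp add: mult.commute)
  finally show ?thesis by (simp add: be r'_def)
qed

lemma SUP_le_sum_ennreal: "finite I \<Longrightarrow> (SUP i\<in>I. f i) \<le> (\<Sum>i\<in>I. f i :: ennreal)"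
  by (intro SUP_least member_le_sum) auto

context filtration
begin

lemma Mx_self [simp]: "Mx k k F = E k F"
  by (simp add: Mx_def fun_eq_iff)

lemma Mx_Suc: "k \<le> n \<Longrightarrow> Mx k (Suc n) F x = max (Mx k n F x) (E (Suc n) F x)"
  by (simp add: Mx_def atLeastAtMostSuc_conv sup_max max.commute)

lemma Mx_mono: "(\<And>y. F y \<le> G y) \<Longrightarrow> Mx k K F x \<le> Mx k K G x"
  unfolding Mx_def by (intro SUP_mono') (auto intro: E_mono)

lemma Mx_level_mono: "k \<le> k' \<Longrightarrow> K' \<le> K \<Longrightarrow> Mx k' K' F x \<le> Mx k K F x"
  unfolding Mx_def by (intro SUP_subset_mono) auto

text \<open>A crude bound by the sum over the finitely many levels. Only finiteness matters: it
  permits the cancellations in \<open>Doob_maximal\<close> and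
  \<open>lattice_maximal\<close>.\<close>

lemma nn_integral_Mx_finite:
  assumes r: "r > 1" and [measurable]: "F \<in> borel_measurable borel"
    and fin: "(\<integral>\<^sup>+ x. F x powe r \<partial>lborel) < top"
  shows "(\<integral>\<^sup>+ x. Mx k K F x powe r \<partial>lborel) < top"
proof -
  have "(\<integral>\<^sup>+ x. Mx k K F x powe r \<partial>lborel) \<le> (\<integral>\<^sup>+ x. (\<Sum>i\<in>{k..K}. E i (\<lambda>y. F y powe r) x) \<partial>lborel)"
  proof (rule nn_integral_mono)
    fix x
    have "Mx k K F x powe r = (SUP i\<in>{k..K}. E i F x powe r)"
      unfolding Mx_def using r by (intro powe_SUP) auto
    also have "\<dots> \<le> (SUP i\<in>{k..K}. E i (\<lambda>y. F y powe r) x)"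
      by (intro SUP_mono' E_Jensen r) auto
    also have "\<dots> \<le> (\<Sum>i\<in>{k..K}. E i (\<lambda>y. F y powe r) x)" by (rule SUP_le_sum_ennreal) auto
    finally show "Mx k K F x powe r \<le> (\<Sum>i\<in>{k..K}. E i (\<lambda>y. F y powe r) x)" .
  qed
  also have "\<dots> = (\<Sum>i\<in>{k..K}. \<integral>\<^sup>+ x. F x powe r \<partial>lborel)"
    by (subst nn_integral_sum) (auto simp: nn_integral_E)
  also have "\<dots> < top" using fin by (simp add: ennreal_mult_less_top of_nat_less_top)
  finally show ?thesis .
qed

text \<open>Summing \<open>powe_max_Young\<close> over the levels bounds the integral of (MF)^r by r
  / (r - 1) times the integral of (MF)^(r-1) F. In each step the next mean can be replaced by F,
  since the powers of both maxima are constant on the cells of that level. Hoelder's inequality then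
  lets the left side absorb the power of itself on the right.\<close>

lemma Doob_maximal:
  assumes r: "r > 1" and [measurable]: "F \<in> borel_measurable borel"
  shows "(\<integral>\<^sup>+ x. Mx k K F x powe r \<partial>lborel) powe (1 / r)
    \<le> ennreal (r / (r - 1)) * (\<integral>\<^sup>+ x. F x powe r \<partial>lborel) powe (1 / r)"
proof (cases "(\<integral>\<^sup>+ x. F x powe r \<partial>lborel) = top \<or> K < k")
  case True
  then show ?thesis
  proof
    assume "K < k" then show ?thesis by (simp add: Mx_def bot_ennreal)
  next
    have "ennreal (r / (r - 1)) \<noteq> 0" using r by simp
    moreover assume "(\<integral>\<^sup>+ x. F x powe r \<partial>lborel) = top"
    ultimately show ?thesis by (simp add: ennreal_mult_top)
  qed
next
  case False
  then have fin: "(\<integral>\<^sup>+ x. F x powe r \<partial>lborel) < top" and kK: "k \<le> K" by (auto simp: less_top[symmetric])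
  define c where "c = ennreal (r / (r - 1))"
  define I where "I n = (\<integral>\<^sup>+ x. Mx k n F x powe r \<partial>lborel)" for n
  define J where "J n = (\<integral>\<^sup>+ x. Mx k n F x powe (r - 1) * F x \<partial>lborel)" for n
  have I_fin: "I n < top" for n unfolding I_def by (rule nn_integral_Mx_finite) (use r fin in auto)
  have q: "1 / r + 1 / (r / (r - 1)) = 1" "(r - 1) * (r / (r - 1)) = r" "1 / (r / (r - 1)) = 1 - 1 / r"
    using r by (auto simp: field_simps)
  have J_le: "J n \<le> (\<integral>\<^sup>+ x. F x powe r \<partial>lborel) powe (1 / r) * I n powe (1 - 1 / r)" for n
  proof -
    have "J n = (\<integral>\<^sup>+ x. F x * Mx k n F x powe (r - 1) \<partial>lborel)" by (simp add: J_def mult.commute)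
    also have "\<dots> \<le> (\<integral>\<^sup>+ x. F x powe r \<partial>lborel) powe (1 / r) *
       (\<integral>\<^sup>+ x. (Mx k n F x powe (r - 1)) powe (r / (r - 1)) \<partial>lborel) powe (1 / (r / (r - 1)))"
      by (rule nn_integral_Holder) (use r q in auto)
    also have "\<dots> = (\<integral>\<^sup>+ x. F x powe r \<partial>lborel) powe (1 / r) * I n powe (1 - 1 / r)"
      unfolding powe_powe q by (simp add: I_def)
    finally show ?thesis .
  qed
  have ad: "adapted i (\<lambda>x. Mx k n F x powe s)" if "n \<le> i" for n i s
    by (rule adapted_compose[where \<phi>="\<lambda>a. a powe s"]) (rule adapted_mono[OF Mx_adapted that])
  have "I K \<le> c * J K" using kK
  proof (induction rule: dec_induct)
    case base
    have "I k = (\<integral>\<^sup>+ x. Mx k k F x powe (r - 1) * E k F x \<partial>lborel)"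
      using powe_add[of _ "r - 1" 1] by (simp add: I_def)
    also have "\<dots> = J k" unfolding J_def by (rule nn_integral_E_adapted) (use ad[of k k "r - 1"] in auto)
    also have "\<dots> \<le> c * J k" using mult_right_mono[of 1 c "J k"] r by (simp add: c_def)
    finally show ?case .
  next
    case (step n)
    have J1: "(\<integral>\<^sup>+ x. Mx k n F x powe (r - 1) * E (Suc n) F x \<partial>lborel) = J n"
      unfolding J_def by (rule nn_integral_E_adapted) (use ad in auto)
    have J2: "(\<integral>\<^sup>+ x. Mx k (Suc n) F x powe (r - 1) * E (Suc n) F x \<partial>lborel) = J (Suc n)"
      unfolding J_def by (rule nn_integral_E_adapted) (use ad in auto)
    have "c * J n + I (Suc n) = (\<integral>\<^sup>+ x. Mx k (Suc n) F x powe r + c * (Mx k n F x powe (r - 1) * E (Suc n) F x) \<partial>lborel)"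
      by (simp add: nn_integral_add nn_integral_cmult J1 I_def add.commute)
    also have "\<dots> \<le> (\<integral>\<^sup>+ x. Mx k n F x powe r + c * (Mx k (Suc n) F x powe (r - 1) * E (Suc n) F x) \<partial>lborel)"
      unfolding c_def using step(1) r by (intro nn_integral_mono powe_max_Young Mx_Suc) auto
    also have "\<dots> = I n + c * J (Suc n)"
      by (simp add: nn_integral_add nn_integral_cmult J2 I_def)
    also have "\<dots> \<le> c * J n + c * J (Suc n)" by (intro add_right_mono step)
    finally have "c * J n + I (Suc n) \<le> c * J n + c * J (Suc n)" .
    moreover have "c * J n < top"
      using le_less_trans[OF J_le[of n]] fin I_fin[of n] by (simp add: c_def ennreal_mult_less_top)
    ultimately show ?case by (auto simp: ennreal_add_left_cancel_le)
  qed
  also have "\<dots> \<le> c * ((\<integral>\<^sup>+ x. F x powe r \<partial>lborel) powe (1 / r) * I K powe (1 - 1 / r))"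
    by (intro mult_left_mono J_le) auto
  finally show ?thesis
    using powe_absorb[OF r I_fin[of K], of c "(\<integral>\<^sup>+ x. F x powe r \<partial>lborel) powe (1 / r)"]
    by (simp add: I_def c_def mult.assoc)
qed

end

section \<open>Vector-valued maximal functions\<close>

text \<open>\<open>\<rho>\<close> plays the role of the norm of a lattice of functions on \<open>'y\<close>; if the lattice maximal function
  is bounded for one exponent \<open>r0\<close>, it is bounded for every exponent.\<close>

locale lattice_filtration = filtration cell v D
  for cell :: "nat \<Rightarrow> 'a::euclidean_space \<Rightarrow> 'a set" and v D +
  fixes \<rho> :: "('y::topological_space \<Rightarrow> ennreal) \<Rightarrow> ennreal" and r0 C0 :: real
  assumes rho_mono: "\<And>u w. (\<And>y. u y \<le> w y) \<Longrightarrow> \<rho> u \<le> \<rho> w"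
    and rho_add: "\<And>u w. u \<in> borel_measurable borel \<Longrightarrow> w \<in> borel_measurable borel \<Longrightarrow>
      \<rho> (\<lambda>y. u y + w y) \<le> \<rho> u + \<rho> w"
    and rho_zero: "\<rho> (\<lambda>y. 0) = 0"
    and rho_measurable: "\<And>f :: 'a \<Rightarrow> 'y \<Rightarrow> ennreal. case_prod f \<in> borel_measurable (borel \<Otimes>\<^sub>M borel) \<Longrightarrow>
      (\<lambda>t. \<rho> (f t)) \<in> borel_measurable borel"
    and rho_E: "\<And>f k x. case_prod f \<in> borel_measurable (borel \<Otimes>\<^sub>M borel) \<Longrightarrow>
      \<rho> (\<lambda>y. E k (\<lambda>t. f t y) x) \<le> E k (\<lambda>t. \<rho> (f t)) x"
    and r0: "r0 > 1" and C0: "C0 \<ge> 1"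
    and base: "\<And>f k K. case_prod f \<in> borel_measurable (borel \<Otimes>\<^sub>M borel) \<Longrightarrow>
      (\<integral>\<^sup>+ x. \<rho> (\<lambda>y. Mx k K (\<lambda>t. f t y) x) powe r0 \<partial>lborel) \<le> ennreal C0 * (\<integral>\<^sup>+ x. \<rho> (f x) powe r0 \<partial>lborel)"
begin

abbreviation MM :: "nat \<Rightarrow> nat \<Rightarrow> ('a \<Rightarrow> 'y \<Rightarrow> ennreal) \<Rightarrow> 'a \<Rightarrow> 'y \<Rightarrow> ennreal" where
  "MM k K f x \<equiv> \<lambda>y. Mx k K (\<lambda>t. f t y) x"

abbreviation jm :: "('a \<Rightarrow> 'y \<Rightarrow> ennreal) \<Rightarrow> bool" where
  "jm f \<equiv> case_prod f \<in> borel_measurable (borel \<Otimes>\<^sub>M borel)"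

lemma jm_section: "jm f \<Longrightarrow> (\<lambda>t. f t y) \<in> borel_measurable borel"
  using measurable_compose[OF _ , of "\<lambda>t. (t, y)" borel "borel \<Otimes>\<^sub>M borel" "case_prod f"] by simp

lemma jm_section2: "jm f \<Longrightarrow> f t \<in> borel_measurable borel"
  using measurable_compose[OF _ , of "\<lambda>y. (t, y)" borel "borel \<Otimes>\<^sub>M borel" "case_prod f"] by simp

lemma jm_E: 
  assumes "jm f" shows "jm (\<lambda>x y. E k (\<lambda>t. f t y) x)"
proof -
  have "(\<lambda>(y, t). f t y) \<in> borel_measurable (borel \<Otimes>\<^sub>M borel)"
    using measurable_compose[OF measurable_pair_swap' assms] by (simp add: split_def)
  from measurable_compose[OF measurable_pair_swap' E_measurable_param[OF this, of k]]
  show ?thesis by (simp add: split_def)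
qed

lemma jm_MM: "jm f \<Longrightarrow> jm (MM k K f)"
  using jm_E[of f] unfolding Mx_def split_def by (intro borel_measurable_SUP) auto

lemma rho_sum:
  "finite I \<Longrightarrow> (\<And>i. i \<in> I \<Longrightarrow> u i \<in> borel_measurable borel) \<Longrightarrow> \<rho> (\<lambda>y. \<Sum>i\<in>I. u i y) \<le> (\<Sum>i\<in>I. \<rho> (u i))"
proof (induction I rule: finite_induct)
  case (insert i I)
  have "\<rho> (\<lambda>y. u i y + (\<Sum>i\<in>I. u i y)) \<le> \<rho> (u i) + \<rho> (\<lambda>y. \<Sum>i\<in>I. u i y)"
    by (rule rho_add) (use insert in auto)
  also have "\<dots> \<le> \<rho> (u i) + (\<Sum>i\<in>I. \<rho> (u i))" by (intro add_left_mono insert) (use insert in auto)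
  finally show ?case using insert by simp
qed (simp add: rho_zero)

lemma rho_MM_le_sum:
  assumes "jm f"
  shows "\<rho> (MM k K f x) \<le> (\<Sum>i\<in>{k..K}. E i (\<lambda>t. \<rho> (f t)) x)"
proof -
  have "\<rho> (MM k K f x) \<le> \<rho> (\<lambda>y. \<Sum>i\<in>{k..K}. E i (\<lambda>t. f t y) x)"
    unfolding Mx_def by (intro rho_mono SUP_le_sum_ennreal) auto
  also have "\<dots> \<le> (\<Sum>i\<in>{k..K}. \<rho> (\<lambda>y. E i (\<lambda>t. f t y) x))"
    by (rule rho_sum) (use jm_section2[OF jm_E[OF assms]] in auto)
  also have "\<dots> \<le> (\<Sum>i\<in>{k..K}. E i (\<lambda>t. \<rho> (f t)) x)"
    by (intro sum_mono rho_E assms)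
  finally show ?thesis .
qed

text \<open>Cutting f off outside the cell changes nothing inside, because only levels from k on
  enter; the global bound \<open>base\<close> thus becomes a bound on each cell.\<close>

lemma base_local:
  assumes f: "jm f"
  shows "E k (\<lambda>x. \<rho> (MM k K f x) powe r0) z \<le> ennreal C0 * E k (\<lambda>x. \<rho> (f x) powe r0) z"
proof -
  have ind_m: "(\<lambda>t. indicator (cell k z) t :: ennreal) \<in> borel_measurable borel"
  proof -
    have "cell k z \<in> sets borel"
      using emeasure_cell[of k z] v_pos[of k] emeasure_notin_sets[of "cell k z" lborel] by fastforce
    then show ?thesis by simp
  qed
  note [measurable] = ind_m
  define f' where "f' t y = indicator (cell k z) t * f t y" for t y
  have f': "jm f'" unfolding f'_def split_def
    by (intro borel_measurable_times_ennreal measurable_compose[OF measurable_fst ind_m])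
      (use f in \<open>simp add: split_def\<close>)
  have [measurable]: "(\<lambda>x. \<rho> (f x)) \<in> borel_measurable borel" "(\<lambda>x. \<rho> (MM k K f x)) \<in> borel_measurable borel"
    using rho_measurable f jm_MM by auto
  have *: "MM k K f' x = MM k K f x" if "x \<in> cell k z" for x
  proof (rule ext)
    fix y
    have "E i (\<lambda>t. f' t y) x = E i (\<lambda>t. f t y) x" if "i \<in> {k..K}" for i
    proof (rule E_cong)
      fix t assume "t \<in> cell i x"
      then have "t \<in> cell k x" using that cell_antimono[of k i x] by auto
      then have "t \<in> cell k z" using \<open>x \<in> cell k z\<close> cell_eq by auto
      then show "f' t y = f t y" by (simp add: f'_def)
    qed
    then show "MM k K f' x y = MM k K f x y" by (simp add: Mx_def)
  qed
  have "E k (\<lambda>x. \<rho> (MM k K f x) powe r0) z = ennreal (1 / v k) *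
      (\<integral>\<^sup>+ x. indicator (cell k z) x * \<rho> (MM k K f x) powe r0 \<partial>lborel)"
    by (simp add: E_def ker_def mult.assoc nn_integral_cmult)
  also have "\<dots> \<le> ennreal (1 / v k) * (\<integral>\<^sup>+ x. \<rho> (MM k K f' x) powe r0 \<partial>lborel)"
    by (intro mult_left_mono nn_integral_mono) (auto simp: indicator_def *)
  also have "\<dots> \<le> ennreal (1 / v k) * (ennreal C0 * (\<integral>\<^sup>+ x. \<rho> (f' x) powe r0 \<partial>lborel))"
    by (intro mult_left_mono base f') auto
  also have "(\<integral>\<^sup>+ x. \<rho> (f' x) powe r0 \<partial>lborel) = (\<integral>\<^sup>+ x. indicator (cell k z) x * \<rho> (f x) powe r0 \<partial>lborel)"
    by (intro nn_integral_cong) (auto simp: f'_def[abs_def] indicator_def rho_zero)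
  also have "ennreal (1 / v k) * (ennreal C0 * \<dots>) = ennreal C0 * E k (\<lambda>x. \<rho> (f x) powe r0) z"
    by (simp add: E_def ker_def mult.assoc nn_integral_cmult mult.left_commute)
  finally show ?thesis .
qed

text \<open>Chosen so that its power r0 equals (4 D)^r0 * 4 C0: the averaged function is bounded by
  4 D times the initial mean, and Chebyshev's inequality with the constant \<open>C0\<close> then
  leaves a quarter of the cell.\<close>

definition weak_const :: real where "weak_const = 4 * D * (4 * C0) powr (1 / r0)"

lemma weak_const_ge_1: "weak_const \<ge> 1"
proof -
  have "1 \<le> (4 * C0) powr (1 / r0)" using C0 r0 by (intro ge_one_powr_ge_zero) auto
  then have "1 * 1 \<le> (4 * D) * (4 * C0) powr (1 / r0)" using D_ge_1 by (intro mult_mono) auto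
  then show ?thesis by (simp add: weak_const_def)
qed

text \<open>Calderon--Zygmund decomposition: \<open>f~\<close> is \<open>f\<close> averaged over the cells at which the means of
  \<open>F\<close> first exceed four times the initial mean.\<close>

lemma lattice_weak_type:
  assumes f: "jm f" and kK: "k \<le> K"
  shows "E k (indicator {x. \<rho> (MM k K f x) > ennreal weak_const * E k (\<lambda>t. \<rho> (f t)) x}) z \<le> ennreal (1/2)"
proof -
  define F where "F t = \<rho> (f t)" for t
  have Fm [measurable]: "F \<in> borel_measurable borel" unfolding F_def by (rule rho_measurable[OF f])
  have fm [measurable]: "(\<lambda>t. f t y) \<in> borel_measurable borel" for y by (rule jm_section[OF f])
  define B where "B i y \<longleftrightarrow> E i F y > ennreal 4 * E k F y" for i y
  have Bm [measurable]: "Measurable.pred borel (B i)" for i unfolding B_def by measurable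
  have Ba: "adapted i (B i)" if "k < i" for i
    unfolding B_def by (rule adapted_compose2[OF E_adapted adapted_mono[OF E_adapted]]) (use that in auto)
  define P where "P = {y. \<exists>i\<in>{k<..K}. B i y}"
  have [measurable]: "P \<in> sets borel" unfolding P_def by measurable
  have Pa: "adapted K (indicator (- P) :: _ \<Rightarrow> ennreal)"
  proof (rule adapted_indicator)
    have "adapted K (\<lambda>x. \<forall>i\<in>{k<..K}. \<not> B i x)"
      by (rule adapted_all, rule adapted_compose, rule adapted_mono[OF Ba]) auto
    then show "adapted K (\<lambda>x. x \<in> - P)" by (simp add: P_def)
  qed
  define S where "S i = first_at k B i" for i
  have [measurable]: "S i \<in> sets borel" for i
    using first_at_measurable[where M=borel and B=B and k=k and i=i] Bm by (simp add: S_def pred_def)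
  have Sa: "adapted i (indicator (S i) :: _ \<Rightarrow> ennreal)" if "i > k" for i
    unfolding S_def by (rule adapted_first_at[OF Ba that])
  have part: "indicator (- P) y + (\<Sum>i\<in>{k<..K}. indicator (S i) y) = (1 :: ennreal)" for y
    unfolding S_def sum_indicator_first_at P_def[symmetric] by (simp add: indicator_def)
  define g where "g x y = indicator (- P) x * E K (\<lambda>t. f t y) x + (\<Sum>i\<in>{k<..K}. indicator (S i) x * E i (\<lambda>t. f t y) x)" for x y
  have gm: "jm g"
  proof -
    have "(\<lambda>z. indicator X (fst z) * E i (\<lambda>t. f t (snd z)) (fst z)) \<in> borel_measurable (borel \<Otimes>\<^sub>M borel)"
      if "X \<in> sets borel" for X i
      using jm_E[OF f, of i] that by (intro borel_measurable_times_ennreal) (auto simp: split_def intro: measurable_compose[OF measurable_fst])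
    then show ?thesis unfolding g_def split_def
      by (intro borel_measurable_add borel_measurable_sum) auto
  qed
  \<comment> \<open>Averaging over stopped cells is invisible outside \<open>P\<close>. The cell of
    level i around x contains every stopped cell of level at least i that it meets, so the mean over
    it is unchanged; it misses the stopped cells of lower level because x lies in none of them.
    Hence no bad part remains off \<open>P\<close>.\<close>
  have gE: "E i (\<lambda>t. g t y) x = E i (\<lambda>t. f t y) x" if "x \<notin> P" "i \<in> {k..K}" for i x y
  proof -
    let ?f = "\<lambda>t. f t y"
    have 1: "E i (\<lambda>t. indicator (S j) t * E j ?f t) x = E i (\<lambda>t. indicator (S j) t * ?f t) x" if j: "j \<in> {k<..K}" for j
    proof (cases "i \<le> j")
      case True
      then show ?thesis by (rule E_pull_tower) (use Sa j in auto)
    next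
      case False
      have "x \<notin> S j" using \<open>x \<notin> P\<close> j by (auto simp: P_def S_def first_at_def)
      moreover have "adapted i (indicator (S j) :: _ \<Rightarrow> ennreal)"
        by (rule adapted_mono[OF Sa]) (use False j in auto)
      ultimately show ?thesis by (simp add: E_pull)
    qed
    have "E i (\<lambda>t. g t y) x = E i (\<lambda>t. indicator (- P) t * E K ?f t) x +
        (\<Sum>j\<in>{k<..K}. E i (\<lambda>t. indicator (S j) t * E j ?f t) x)"
      unfolding g_def by (rule E_add_sum) auto
    also have "\<dots> = E i (\<lambda>t. indicator (- P) t * ?f t) x + (\<Sum>j\<in>{k<..K}. E i (\<lambda>t. indicator (S j) t * ?f t) x)"
      using that(2) by (intro arg_cong2[of _ _ _ _ "(+)"] sum.cong refl 1 E_pull_tower[OF _ Pa]) auto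
    also have "\<dots> = E i (\<lambda>t. indicator (- P) t * ?f t + (\<Sum>j\<in>{k<..K}. indicator (S j) t * ?f t)) x"
      by (rule E_add_sum[symmetric]) auto
    also have "(\<lambda>t. indicator (- P) t * ?f t + (\<Sum>j\<in>{k<..K}. indicator (S j) t * ?f t)) =
        (\<lambda>t. (indicator (- P) t + (\<Sum>j\<in>{k<..K}. indicator (S j) t)) * ?f t)"
      by (simp only: distrib_right sum_distrib_right)
    finally show ?thesis by (simp only: part mult_1)
  qed
  have rho_EF: "\<rho> (\<lambda>y. E i (\<lambda>t. f t y) x) \<le> E i F x" for i x
    unfolding F_def by (rule rho_E[OF f])
  \<comment> \<open>The parent of a stopped cell is unstopped or the initial cell, so its mean of F
    is at most four times the initial mean; passing to the stopped cell costs D.\<close>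
  have g_bd: "\<rho> (g x) \<le> ennreal (4 * D) * E k F x" for x
  proof (cases "x \<in> P")
    case True
    then obtain i where i: "i \<in> {k<..K}" "x \<in> S i"
      unfolding P_def S_def mem_Collect_eq by (rule ex_first_at)
    have ind: "indicator (S j) x = (if j = i then 1 else 0 :: ennreal)" if "j \<in> {k<..K}" for j
    proof (cases "j = i")
      case False
      have "(\<Sum>l\<in>{i, j}. indicator (S l) x) \<le> (\<Sum>l\<in>{k<..K}. indicator (S l) x :: ennreal)"
        by (rule sum_mono2) (use i that in auto)
      also have "\<dots> \<le> 1" using part[of x] by (metis add.commute le_iff_add)
      finally show ?thesis using False i by (auto simp: indicator_def split: if_splits)
    qed (use i in simp)
    have z: "indicator (- P) x = (0 :: ennreal)" using True by simp
    have "g x y = (\<Sum>j\<in>{k<..K}. indicator (S j) x * E j (\<lambda>t. f t y) x)" for y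
      by (simp only: g_def z mult_zero_left add_0)
    also have "\<dots> y = (\<Sum>j\<in>{k<..K}. if j = i then E i (\<lambda>t. f t y) x else 0)" for y
      by (rule sum.cong[OF refl], simp only: ind, auto)
    finally have "g x y = (\<Sum>j\<in>{k<..K}. if j = i then E i (\<lambda>t. f t y) x else 0)" for y .
    then have "g x = (\<lambda>y. E i (\<lambda>t. f t y) x)" using i by (auto simp: fun_eq_iff)
    then have "\<rho> (g x) \<le> E i F x" using rho_EF by simp
    also obtain j where j: "i = Suc j" "k \<le> j" using i by (cases i) auto
    have "E i F x \<le> ennreal D * E j F x" unfolding j by (rule E_Suc_le) auto
    also have "E j F x \<le> ennreal 4 * E k F x"
    proof (cases "j = k")
      case False
      then have "\<not> B j x" using i j by (auto simp: S_def first_at_def)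
      then show ?thesis by (simp add: B_def not_less)
    next
      case True
      have "1 * E k F x \<le> ennreal 4 * E k F x" by (intro mult_right_mono) auto
      then show ?thesis using True by simp
    qed
    also have "ennreal D * (ennreal 4 * E k F x) = ennreal (4 * D) * E k F x"
      using D_ge_1 by (simp add: ennreal_mult ac_simps)
    finally show ?thesis by (simp add: mult_left_mono)
  next
    case False
    then have "x \<notin> S j" if "j \<in> {k<..K}" for j
      using that by (auto simp: P_def S_def first_at_def)
    then have "g x = (\<lambda>y. E K (\<lambda>t. f t y) x)" using False by (simp add: g_def fun_eq_iff)
    then have "\<rho> (g x) \<le> E K F x" using rho_EF by simp
    also have "\<dots> \<le> ennreal 4 * E k F x"
    proof (cases "K = k")
      case False
      then have "\<not> B K x" using \<open>x \<notin> P\<close> kK by (auto simp: P_def)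
      then show ?thesis by (simp add: B_def not_less)
    next
      case True
      have "1 * E k F x \<le> ennreal 4 * E k F x" by (intro mult_right_mono) auto
      then show ?thesis using True by simp
    qed
    also have "\<dots> \<le> ennreal (4 * D) * E k F x"
      using D_ge_1 by (intro mult_right_mono ennreal_leI) auto
    finally show ?thesis .
  qed
  define L where "L = E k F z"
  have EkL: "E k F y = L" if "y \<in> cell k z" for y
    using adaptedD[OF E_adapted that] by (simp add: L_def)
  define Q where "Q = {x. \<rho> (MM k K g x) > ennreal weak_const * E k F x}"
  have [measurable]: "(\<lambda>x. \<rho> (MM k K g x)) \<in> borel_measurable borel" "(\<lambda>x. \<rho> (MM k K f x)) \<in> borel_measurable borel"
    "(\<lambda>x. \<rho> (g x)) \<in> borel_measurable borel"
    using rho_measurable f gm jm_MM by auto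
  have [measurable]: "Q \<in> sets borel" unfolding Q_def by measurable
  show ?thesis
  proof (cases "L = 0 \<or> L = top")
    case True
    have "\<not> \<rho> (MM k K f x) > ennreal weak_const * E k (\<lambda>t. \<rho> (f t)) x" if x: "x \<in> cell k z" for x
      using True
    proof
      assume "L = 0"
      then have "E i F x = 0" if "i \<ge> k" for i using E_eq_0_mono[of k i F x] that EkL[OF x] by simp
      then have "\<rho> (MM k K f x) \<le> 0" using rho_MM_le_sum[OF f, of k K x] by (simp add: F_def[abs_def])
      then show ?thesis by simp
    next
      assume "L = top"
      then show ?thesis using weak_const_ge_1 EkL[OF x] by (simp add: F_def[abs_def] ennreal_mult_top)
    qed
    then have "E k (indicator {x. \<rho> (MM k K f x) > ennreal weak_const * E k (\<lambda>t. \<rho> (f t)) x}) z = E k (\<lambda>y. 0) z"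
      by (intro E_cong) (auto simp: indicator_def)
    then show ?thesis by simp
  next
    case False
    have "(ennreal weak_const * L) powe r0 * E k (indicator Q) z = E k (\<lambda>x. (ennreal weak_const * L) powe r0 * indicator Q x) z"
      by (simp add: E_cmult)
    also have "\<dots> \<le> E k (\<lambda>x. \<rho> (MM k K g x) powe r0) z"
    proof (rule E_mono)
      fix x assume "x \<in> cell k z"
      then show "(ennreal weak_const * L) powe r0 * indicator Q x \<le> \<rho> (MM k K g x) powe r0"
        using r0 EkL by (auto simp: indicator_def Q_def intro!: powe_mono)
    qed
    also have "\<dots> \<le> ennreal C0 * E k (\<lambda>x. \<rho> (g x) powe r0) z" by (rule base_local[OF gm])
    also have "\<dots> \<le> ennreal C0 * E k (\<lambda>x. (ennreal (4 * D) * L) powe r0) z"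
    proof (intro mult_left_mono E_mono powe_mono)
      show "\<rho> (g x) \<le> ennreal (4 * D) * L" if "x \<in> cell k z" for x
        using g_bd[of x] EkL[OF that] by simp
    qed (use r0 in auto)
    also have "\<dots> = ennreal C0 * ennreal ((4 * D) powr r0) * L powe r0"
      using D_ge_1 by (simp add: powe_mult powe_ennreal mult.assoc)
    finally have 1: "(ennreal weak_const * L) powe r0 * E k (indicator Q) z \<le> ennreal C0 * ennreal ((4 * D) powr r0) * L powe r0" .
    have Ar: "weak_const powr r0 = (4 * D) powr r0 * (4 * C0)"
      using C0 D_ge_1 r0 by (simp add: weak_const_def powr_mult powr_powr)
    have "ennreal (C0 * (4 * D) powr r0) * L powe r0 * (4 * E k (indicator Q) z) =
        (ennreal weak_const * L) powe r0 * E k (indicator Q) z"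
      using weak_const_ge_1 C0 by (simp add: powe_mult powe_ennreal Ar ennreal_mult ac_simps)
    also have "\<dots> \<le> ennreal (C0 * (4 * D) powr r0) * L powe r0 * 1"
      using 1 C0 by (simp add: ennreal_mult ac_simps)
    finally have "4 * E k (indicator Q) z \<le> 1"
      using False C0 D_ge_1
      by (subst (asm) ennreal_mult_le_mult_iff) (auto simp: ennreal_mult_eq_top_iff)
    then have "ennreal (1/4) * (4 * E k (indicator Q) z) \<le> ennreal (1/4) * 1" by (intro mult_left_mono) auto
    moreover have "ennreal (1/4) * 4 = 1"
      using ennreal_mult'[of 4 "1/4"] by (simp add: mult.commute)
    ultimately have Q4: "E k (indicator Q) z \<le> ennreal (1/4)" by (simp add: mult.assoc[symmetric])
    \<comment> \<open>The threshold 4 leaves a quarter for the stopped set and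
      \<open>weak_const\<close> a quarter for the averaged function; together they give the half
      that \<open>stopping_principle\<close> demands.\<close>
    have P4: "E k (indicator P) z \<le> ennreal (1/4)"
      unfolding P_def B_def by (rule maximal_weak_type) auto
    have "E k (indicator {x. \<rho> (MM k K f x) > ennreal weak_const * E k (\<lambda>t. \<rho> (f t)) x}) z \<le> E k (\<lambda>x. indicator P x + indicator Q x) z"
    proof (rule E_mono)
      fix x
      have "MM k K g x = MM k K f x" if "x \<notin> P"
        using gE[OF that] by (simp add: Mx_def fun_eq_iff)
      then show "indicator {x. \<rho> (MM k K f x) > ennreal weak_const * E k (\<lambda>t. \<rho> (f t)) x} x \<le> (indicator P x + indicator Q x :: ennreal)"
        by (cases "x \<in> P") (auto simp: indicator_def Q_def F_def[abs_def])
    qed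
    also have "\<dots> = E k (indicator P) z + E k (indicator Q) z" by (simp add: E_add)
    also have "\<dots> \<le> ennreal (1/4) + ennreal (1/4)" by (intro add_mono P4 Q4)
    also have "\<dots> = ennreal (1/2)" by (simp add: ennreal_plus[symmetric] del: ennreal_plus)
    finally show ?thesis .
  qed
qed

text \<open>The process stops when the lattice norm of the maximal function over levels k to i
  exceeds \<open>weak_const\<close> times the initial mean of F; by \<open>lattice_weak_type\<close>
  at most half of a cell stops. Before the stop the norm is controlled by that mean, from the stop
  on the process starts afresh, and subadditivity of \<rho> joins the two. What remains is a
  supremum of products of means of F and g, bounded by the product of their maximal
  functions.\<close>

lemma lattice_sparse_bound:
  assumes f: "jm f" and kK: "k \<le> K" and [measurable]: "g \<in> borel_measurable borel"
  shows "(\<integral>\<^sup>+ x. \<rho> (MM k K f x) * g x \<partial>lborel)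
    \<le> ennreal (2 * weak_const) * (\<integral>\<^sup>+ x. Mx k K (\<lambda>t. \<rho> (f t)) x * Mx k K g x \<partial>lborel)"
proof -
  define F where "F t = \<rho> (f t)" for t
  have Fm [measurable]: "F \<in> borel_measurable borel" unfolding F_def by (rule rho_measurable[OF f])
  have rm [measurable]: "(\<lambda>x. \<rho> (MM k K f x)) \<in> borel_measurable borel" for k K
    by (rule rho_measurable[OF jm_MM[OF f]])
  define u where "u k x = \<rho> (MM k K f x) * g x" for k x
  define c where "c k x = ennreal weak_const * E k F x * E k g x" for k x
  define a where "a k x = ennreal weak_const * E k F x * g x" for k x
  define B where "B k i x \<longleftrightarrow> \<rho> (MM k i f x) > ennreal weak_const * E k F x" for k i x
  have [measurable]: "u k \<in> borel_measurable borel" "c k \<in> borel_measurable borel" "a k \<in> borel_measurable borel" for k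
    unfolding u_def c_def a_def by measurable
  have EA: "adapted k (\<lambda>x. ennreal weak_const * E k F x)" for k by (rule adapted_compose[OF E_adapted])
  have rho_EF: "\<rho> (\<lambda>y. E i (\<lambda>t. f t y) x) \<le> E i F x" for i x
    unfolding F_def by (rule rho_E[OF f])
  have main: "E k (u k) x \<le> 2 * E k (\<lambda>x. SUP i\<in>{k..K}. c i x) x" for x
  proof (rule stopping_principle[OF _ _ _ _ _ _ _ _ _ _ kK, where a=a and B=B])
    show "Measurable.pred borel (B k i)" for k i unfolding B_def by measurable
    show "adapted i (B k i)" if "k < i" for k i
    proof -
      have "adapted i (\<lambda>x. MM k i f x)"
        unfolding adapted_def fun_eq_iff using adaptedD[OF Mx_adapted] by blast
      then have "adapted i (\<lambda>x. \<rho> (MM k i f x))" by (rule adapted_compose)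
      moreover have "adapted i (\<lambda>x. ennreal weak_const * E k F x)" by (rule adapted_mono[OF EA]) (use that in auto)
      ultimately show ?thesis unfolding B_def by (rule adapted_compose2)
    qed
    show "adapted k (c k)" for k
      unfolding c_def by (rule adapted_compose2[OF EA E_adapted])
    show "E k (a k) x \<le> c k x" for k x
      unfolding a_def c_def by (simp add: E_pull[OF EA])
    show "E k (indicator {x. \<exists>i\<in>{k<..K}. B k i x}) x \<le> ennreal (1/2)" if "k \<le> K" for k x
    proof -
      have mono: "\<rho> (MM k i f y) \<le> \<rho> (MM k K f y)" if "i \<le> K" for i y
        by (intro rho_mono Mx_level_mono) (use that in auto)
      have "E k (indicator {x. \<exists>i\<in>{k<..K}. B k i x}) x \<le>
          E k (indicator {x. \<rho> (MM k K f x) > ennreal weak_const * E k (\<lambda>t. \<rho> (f t)) x}) x"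
        using mono by (intro E_mono) (auto simp: B_def F_def[abs_def] indicator_def intro: less_le_trans)
      also have "\<dots> \<le> ennreal (1/2)" by (rule lattice_weak_type[OF f that])
      finally show ?thesis .
    qed
    have below: "\<rho> (MM k i f x) \<le> ennreal weak_const * E k F x" if "k \<le> i" "i > k \<Longrightarrow> \<not> B k i x" for k i x
    proof (cases "i = k")
      case True
      have "\<rho> (MM k k f x) \<le> 1 * E k F x" using rho_EF by simp
      also have "\<dots> \<le> ennreal weak_const * E k F x" using weak_const_ge_1 by (intro mult_right_mono) auto
      finally show ?thesis using True by simp
    next
      case False
      then show ?thesis using that by (auto simp: B_def not_less)
    qed
    show "u k x \<le> a k x" if "k \<le> K" "\<And>i. i \<in> {k<..K} \<Longrightarrow> \<not> B k i x" for k x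
      unfolding u_def a_def by (intro mult_right_mono below) (use that in auto)
    show "u k x \<le> a k x + u i x" if i: "k < i" "i \<le> K" "B k i x" "\<And>j. j \<in> {k<..<i} \<Longrightarrow> \<not> B k j x" for k i x
    proof -
      \<comment> \<open>Level i belongs to the restarted process, so the part before the stop ends
        at its predecessor j, where the threshold is not yet exceeded.\<close>
      obtain j where j: "i = Suc j" "k \<le> j" using i by (cases i) auto
      have "MM k K f x y \<le> MM k j f x y + MM i K f x y" for y
        unfolding Mx_def
      proof (rule SUP_least)
        fix l assume l: "l \<in> {k..K}"
        show "E l (\<lambda>t. f t y) x \<le> (SUP i\<in>{k..j}. E i (\<lambda>t. f t y) x) + (SUP i\<in>{i..K}. E i (\<lambda>t. f t y) x)"
        proof (cases "l \<le> j")
          case True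
          then show ?thesis using l by (intro add_increasing2 SUP_upper) auto
        next
          case False
          then show ?thesis using l j by (intro add_increasing SUP_upper) auto
        qed
      qed
      then have "\<rho> (MM k K f x) \<le> \<rho> (\<lambda>y. MM k j f x y + MM i K f x y)" by (rule rho_mono)
      also have "\<dots> \<le> \<rho> (MM k j f x) + \<rho> (MM i K f x)"
        by (rule rho_add; rule jm_section2[OF jm_MM[OF f]])
      also have "\<dots> \<le> ennreal weak_const * E k F x + \<rho> (MM i K f x)"
        by (intro add_right_mono below) (use i j in auto)
      finally have "u k x \<le> (ennreal weak_const * E k F x + \<rho> (MM i K f x)) * g x"
        unfolding u_def by (intro mult_right_mono) auto
      then show ?thesis by (simp add: u_def a_def distrib_right)
    qed
  qed auto
  have "(\<integral>\<^sup>+ x. u k x \<partial>lborel) = (\<integral>\<^sup>+ x. E k (u k) x \<partial>lborel)" by (simp add: nn_integral_E)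
  also have "\<dots> \<le> (\<integral>\<^sup>+ x. 2 * E k (\<lambda>x. SUP i\<in>{k..K}. c i x) x \<partial>lborel)"
    by (intro nn_integral_mono main)
  also have "\<dots> = 2 * (\<integral>\<^sup>+ x. (SUP i\<in>{k..K}. c i x) \<partial>lborel)"
    by (simp add: nn_integral_cmult nn_integral_E)
  also have "\<dots> \<le> 2 * (\<integral>\<^sup>+ x. ennreal weak_const * (Mx k K F x * Mx k K g x) \<partial>lborel)"
  proof (intro mult_left_mono nn_integral_mono SUP_least)
    fix x i assume "i \<in> {k..K}"
    then show "c i x \<le> ennreal weak_const * (Mx k K F x * Mx k K g x)"
      unfolding c_def mult.assoc by (intro mult_left_mono mult_mono Mx_upper) auto
  qed auto
  also have "\<dots> = ennreal (2 * weak_const) * (\<integral>\<^sup>+ x. Mx k K F x * Mx k K g x \<partial>lborel)"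
    using weak_const_ge_1 by (simp add: nn_integral_cmult ennreal_mult mult.assoc)
  finally show ?thesis by (simp add: u_def F_def[abs_def])
qed

text \<open>Let h be the norm of the maximal function. Testing the sparse bound on g = h^(r-1) turns
  its left side into the integral of h^r. Doob's inequality for r and for the conjugate exponent
  contributes the factors r / (r - 1) and r, and the remaining power of the integral is
  absorbed.\<close>

theorem lattice_maximal:
  assumes f: "jm f" and r: "r > 1"
  shows "(\<integral>\<^sup>+ x. \<rho> (MM k K f x) powe r \<partial>lborel) powe (1 / r)
    \<le> ennreal (2 * weak_const * (r / (r - 1)) * r) * (\<integral>\<^sup>+ x. \<rho> (f x) powe r \<partial>lborel) powe (1 / r)"
proof (cases "(\<integral>\<^sup>+ x. \<rho> (f x) powe r \<partial>lborel) = top \<or> K < k")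
  case True
  then show ?thesis
  proof
    assume "K < k" then show ?thesis by (simp add: Mx_def bot_ennreal rho_zero)
  next
    have "2 * weak_const * (r / (r - 1)) * r > 0" using r weak_const_ge_1 by simp
    moreover assume "(\<integral>\<^sup>+ x. \<rho> (f x) powe r \<partial>lborel) = top"
    ultimately show ?thesis using r weak_const_ge_1 by (simp add: ennreal_mult_top)
  qed
next
  case False
  define F where "F t = \<rho> (f t)" for t
  have Fm [measurable]: "F \<in> borel_measurable borel" unfolding F_def by (rule rho_measurable[OF f])
  have fin: "(\<integral>\<^sup>+ x. F x powe r \<partial>lborel) < top" and kK: "k \<le> K"
    using False by (auto simp: less_top[symmetric] F_def)
  define h where "h x = \<rho> (MM k K f x)" for x
  have hm [measurable]: "h \<in> borel_measurable borel"
    unfolding h_def by (rule rho_measurable[OF jm_MM[OF f]])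
  define Y where "Y = (\<integral>\<^sup>+ x. h x powe r \<partial>lborel)"
  have Y_fin: "Y < top"
  proof -
    have "Y \<le> (\<integral>\<^sup>+ x. (of_nat (Suc K - k) * Mx k K F x) powe r \<partial>lborel)"
      unfolding Y_def
    proof (intro nn_integral_mono powe_mono)
      fix x
      have "h x \<le> (\<Sum>i\<in>{k..K}. E i F x)"
        unfolding h_def F_def by (rule rho_MM_le_sum[OF f])
      also have "\<dots> \<le> (\<Sum>i\<in>{k..K}. Mx k K F x)" by (intro sum_mono Mx_upper) auto
      finally show "h x \<le> of_nat (Suc K - k) * Mx k K F x" by simp
    qed (use r in simp)
    also have "\<dots> = (of_nat (Suc K - k)) powe r * (\<integral>\<^sup>+ x. Mx k K F x powe r \<partial>lborel)"
      by (simp add: powe_mult nn_integral_cmult)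
    also have "\<dots> < top" using nn_integral_Mx_finite[OF r Fm fin, of k K]
      by (simp add: ennreal_mult_less_top of_nat_less_top)
    finally show ?thesis .
  qed
  define q where "q = r / (r - 1)"
  have q: "q > 1" "1 / r + 1 / q = 1" "(r - 1) * q = r" "1 / q = 1 - 1 / r" "q / (q - 1) = r"
    using r by (auto simp: q_def field_simps)
  define g where "g x = h x powe (r - 1)" for x
  have [measurable]: "g \<in> borel_measurable borel" unfolding g_def by measurable
  have "Y = (\<integral>\<^sup>+ x. h x * g x \<partial>lborel)"
    unfolding Y_def g_def using powe_add[of _ "r - 1" 1] by (simp add: mult.commute)
  also have "\<dots> \<le> ennreal (2 * weak_const) * (\<integral>\<^sup>+ x. Mx k K F x * Mx k K g x \<partial>lborel)"
    unfolding h_def F_def[abs_def] by (rule lattice_sparse_bound[OF f kK]) simp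
  also have "\<dots> \<le> ennreal (2 * weak_const) * ((\<integral>\<^sup>+ x. Mx k K F x powe r \<partial>lborel) powe (1 / r) *
      (\<integral>\<^sup>+ x. Mx k K g x powe q \<partial>lborel) powe (1 / q))"
    by (intro mult_left_mono nn_integral_Holder) (use r q in auto)
  also have "\<dots> \<le> ennreal (2 * weak_const) * ((ennreal q * (\<integral>\<^sup>+ x. F x powe r \<partial>lborel) powe (1 / r)) *
      (ennreal r * (\<integral>\<^sup>+ x. g x powe q \<partial>lborel) powe (1 / q)))"
    using Doob_maximal[OF r Fm, of k K] Doob_maximal[of q g k K] q
    by (intro mult_left_mono mult_mono) (auto simp: q_def)
  also have "(\<integral>\<^sup>+ x. g x powe q \<partial>lborel) = Y"
    by (simp add: g_def powe_powe q Y_def)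
  also have "ennreal (2 * weak_const) * ((ennreal q * (\<integral>\<^sup>+ x. F x powe r \<partial>lborel) powe (1 / r)) * (ennreal r * Y powe (1 / q)))
    = ennreal (2 * weak_const * q * r) * (\<integral>\<^sup>+ x. F x powe r \<partial>lborel) powe (1 / r) * Y powe (1 - 1 / r)"
    using weak_const_ge_1 q r by (simp add: ennreal_mult ac_simps)
  finally have "Y powe (1 / r) \<le> ennreal (2 * weak_const * q * r) * (\<integral>\<^sup>+ x. F x powe r \<partial>lborel) powe (1 / r)"
    by (rule powe_absorb[OF r Y_fin])
  then show ?thesis by (simp add: Y_def h_def F_def q_def)
qed

end

section \<open>Dyadic grids\<close>

declare DIM_real [simp del] DIM_cart [simp del] Basis_real_def [simp del]

text \<open>Half-open cubes of side l / 2^k of the grid through \<tau>, encoded by equality of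
  integer parts.\<close>

definition gcell :: "'a::euclidean_space \<Rightarrow> real \<Rightarrow> nat \<Rightarrow> 'a \<Rightarrow> 'a set" where
  "gcell \<tau> l k x = {y. \<forall>b\<in>Basis. \<lfloor>(y \<bullet> b - \<tau> \<bullet> b) * 2 ^ k / l\<rfloor> = \<lfloor>(x \<bullet> b - \<tau> \<bullet> b) * 2 ^ k / l\<rfloor>}"

definition gvol :: "nat \<Rightarrow> real \<Rightarrow> nat \<Rightarrow> real" where
  "gvol d l k = (l / 2 ^ k) ^ d"

lemma floor_double: "\<lfloor>2 * w\<rfloor> div 2 = \<lfloor>w :: real\<rfloor>"
proof -
  have "\<lfloor>2 * w\<rfloor> = 2 * \<lfloor>w\<rfloor> \<or> \<lfloor>2 * w\<rfloor> = 2 * \<lfloor>w\<rfloor> + 1" by linarith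
  then show ?thesis by auto
qed

lemma gcell_filtration:
  fixes \<tau> :: "'a::euclidean_space"
  assumes "l > 0"
  shows "filtration (gcell \<tau> l) (gvol DIM('a) l) (2 ^ DIM('a))"
proof
  fix x y :: 'a and k
  show "x \<in> gcell \<tau> l k x" by (simp add: gcell_def)
  show "gcell \<tau> l k y = gcell \<tau> l k x" if "y \<in> gcell \<tau> l k x" using that by (simp add: gcell_def)
  show "gcell \<tau> l (Suc k) x \<subseteq> gcell \<tau> l k x"
  proof
    fix y assume y: "y \<in> gcell \<tau> l (Suc k) x"
    have "\<lfloor>(y \<bullet> b - \<tau> \<bullet> b) * 2 ^ k / l\<rfloor> = \<lfloor>(x \<bullet> b - \<tau> \<bullet> b) * 2 ^ k / l\<rfloor>" if "b \<in> Basis" for b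
    proof -
      have "\<lfloor>2 * ((y \<bullet> b - \<tau> \<bullet> b) * 2 ^ k / l)\<rfloor> = \<lfloor>2 * ((x \<bullet> b - \<tau> \<bullet> b) * 2 ^ k / l)\<rfloor>"
        using y that by (simp add: gcell_def algebra_simps)
      then show ?thesis using floor_double by metis
    qed
    then show "y \<in> gcell \<tau> l k x" by (simp add: gcell_def)
  qed
  show "{z. snd z \<in> gcell \<tau> l k (fst z)} \<in> sets (borel \<Otimes>\<^sub>M borel)"
  proof -
    have "Measurable.pred (borel \<Otimes>\<^sub>M borel) (\<lambda>z :: 'a \<times> 'a. \<forall>b\<in>Basis.
        \<lfloor>(snd z \<bullet> b - \<tau> \<bullet> b) * 2 ^ k / l\<rfloor> = \<lfloor>(fst z \<bullet> b - \<tau> \<bullet> b) * 2 ^ k / l\<rfloor>)"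
      by measurable
    then show ?thesis by (simp add: gcell_def pred_def space_pair_measure)
  qed
  define s where "s = l / 2 ^ k"
  have s: "s > 0" using assms by (simp add: s_def)
  define lo where "lo = (\<Sum>b\<in>Basis. (\<tau> \<bullet> b + s * of_int \<lfloor>(x \<bullet> b - \<tau> \<bullet> b) / s\<rfloor>) *\<^sub>R b)"
  define hi where "hi = (\<Sum>b\<in>Basis. (\<tau> \<bullet> b + s * of_int \<lfloor>(x \<bullet> b - \<tau> \<bullet> b) / s\<rfloor> + s) *\<^sub>R b)"
  have lo: "lo \<bullet> b = \<tau> \<bullet> b + s * of_int \<lfloor>(x \<bullet> b - \<tau> \<bullet> b) / s\<rfloor>"
    and hi: "hi \<bullet> b = lo \<bullet> b + s" if "b \<in> Basis" for b
    using that by (simp_all add: lo_def hi_def)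
  have mem: "y \<in> gcell \<tau> l k x \<longleftrightarrow> (\<forall>b\<in>Basis. lo \<bullet> b \<le> y \<bullet> b \<and> y \<bullet> b < hi \<bullet> b)" for y
  proof -
    have "\<lfloor>(y \<bullet> b - \<tau> \<bullet> b) * 2 ^ k / l\<rfloor> = \<lfloor>(x \<bullet> b - \<tau> \<bullet> b) * 2 ^ k / l\<rfloor> \<longleftrightarrow>
       lo \<bullet> b \<le> y \<bullet> b \<and> y \<bullet> b < hi \<bullet> b" if "b \<in> Basis" for b
    proof -
      have e: "z * 2 ^ k / l = z / s" for z by (simp add: s_def)
      define n where "n = \<lfloor>(x \<bullet> b - \<tau> \<bullet> b) / s\<rfloor>"
      have "\<lfloor>(y \<bullet> b - \<tau> \<bullet> b) / s\<rfloor> = n \<longleftrightarrow> of_int n \<le> (y \<bullet> b - \<tau> \<bullet> b) / s \<and> (y \<bullet> b - \<tau> \<bullet> b) / s < of_int n + 1"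
        by (rule floor_eq_iff)
      also have "\<dots> \<longleftrightarrow> lo \<bullet> b \<le> y \<bullet> b \<and> y \<bullet> b < hi \<bullet> b"
        using s by (simp add: lo hi that n_def[symmetric] pos_le_divide_eq pos_divide_less_eq algebra_simps)
      finally show ?thesis unfolding e n_def .
    qed
    then show ?thesis by (simp add: gcell_def)
  qed
  have vol: "(\<Prod>b\<in>Basis. (hi - lo) \<bullet> b) = gvol DIM('a) l k"
    using hi by (simp add: inner_diff_left gvol_def s_def)
  have meas: "gcell \<tau> l k x \<in> sets borel"
  proof -
    have "gcell \<tau> l k x = {y \<in> space borel. \<forall>b\<in>Basis. lo \<bullet> b \<le> y \<bullet> b \<and> y \<bullet> b < hi \<bullet> b}"
      using mem by auto
    also have "\<dots> \<in> sets borel" by measurable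
    finally show ?thesis .
  qed
  have le: "lo \<bullet> b \<le> hi \<bullet> b" if "b \<in> Basis" for b using hi[OF that] s by simp
  show "emeasure lborel (gcell \<tau> l k x) = ennreal (gvol DIM('a) l k)"
  proof (rule antisym)
    have "emeasure lborel (gcell \<tau> l k x) \<le> emeasure lborel (cbox lo hi)"
      by (rule emeasure_mono) (auto simp: mem mem_box less_imp_le)
    also have "\<dots> = ennreal (gvol DIM('a) l k)" using le by (simp add: emeasure_lborel_cbox vol)
    finally show "emeasure lborel (gcell \<tau> l k x) \<le> ennreal (gvol DIM('a) l k)" .
    have "ennreal (gvol DIM('a) l k) = emeasure lborel (box lo hi)"
      using le by (simp add: emeasure_lborel_box vol)
    also have "\<dots> \<le> emeasure lborel (gcell \<tau> l k x)"
      by (rule emeasure_mono) (use meas in \<open>auto simp: mem mem_box less_imp_le\<close>)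
    finally show "ennreal (gvol DIM('a) l k) \<le> emeasure lborel (gcell \<tau> l k x)" .
  qed
  show "0 < gvol DIM('a) l k" using assms by (simp add: gvol_def)
  show "gvol DIM('a) l k \<le> 2 ^ DIM('a) * gvol DIM('a) l (Suc k)"
    by (simp add: gvol_def power_mult_distrib[symmetric])
qed

abbreviation gE :: "'a::euclidean_space \<Rightarrow> real \<Rightarrow> nat \<Rightarrow> ('a \<Rightarrow> ennreal) \<Rightarrow> 'a \<Rightarrow> ennreal" where
  "gE \<tau> l \<equiv> filtration.E (gcell \<tau> l) (gvol DIM('a) l)"

abbreviation gMx :: "'a::euclidean_space \<Rightarrow> real \<Rightarrow> nat \<Rightarrow> nat \<Rightarrow> ('a \<Rightarrow> ennreal) \<Rightarrow> 'a \<Rightarrow> ennreal" where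
  "gMx \<tau> l \<equiv> filtration.Mx (gcell \<tau> l) (gvol DIM('a) l)"

section \<open>Maximal functions in one coordinate\<close>

definition Mc :: "real \<Rightarrow> real \<Rightarrow> nat \<Rightarrow> nat \<Rightarrow> 'n \<Rightarrow> (real ^ 'n \<Rightarrow> ennreal) \<Rightarrow> real ^ 'n \<Rightarrow> ennreal" where
  "Mc \<tau> l k K j f x = gMx \<tau> l k K (\<lambda>t. f (upd_coord x j t)) (x $ j)"

definition Ec :: "real \<Rightarrow> real \<Rightarrow> nat \<Rightarrow> 'n \<Rightarrow> (real ^ 'n \<Rightarrow> ennreal) \<Rightarrow> real ^ 'n \<Rightarrow> ennreal" where
  "Ec \<tau> l k j f x = gE \<tau> l k (\<lambda>t. f (upd_coord x j t)) (x $ j)"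

lemma Ec_measurable:
  fixes f :: "real ^ 'n::finite \<Rightarrow> ennreal"
  assumes l: "l > 0" and [measurable]: "f \<in> borel_measurable borel"
  shows "Ec \<tau> l k j f \<in> borel_measurable borel"
proof -
  interpret filtration "gcell \<tau> l" "gvol DIM(real) l" "2 ^ DIM(real)" by (rule gcell_filtration[OF l])
  have "(\<lambda>(x, s). E k (\<lambda>t. f (upd_coord x j t)) s) \<in> borel_measurable (borel \<Otimes>\<^sub>M borel)"
    by (rule E_measurable_param) measurable
  then have "(\<lambda>x. (\<lambda>(x, s). E k (\<lambda>t. f (upd_coord x j t)) s) (x, x $ j)) \<in> borel_measurable borel"
    by (rule measurable_compose[rotated]) measurable
  then show ?thesis by (simp add: Ec_def[abs_def])
qed

lemma Mc_measurable:
  fixes f :: "real ^ 'n::finite \<Rightarrow> ennreal"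
  assumes l: "l > 0" and f: "f \<in> borel_measurable borel"
  shows "Mc \<tau> l k K j f \<in> borel_measurable borel"
proof -
  have "Mc \<tau> l k K j f = (\<lambda>x. SUP i\<in>{k..K}. Ec \<tau> l i j f x)"
    unfolding Mc_def[abs_def] Ec_def filtration.Mx_def[OF gcell_filtration[OF l]] ..
  also have "\<dots> \<in> borel_measurable borel"
    using Ec_measurable[OF l f] by (intro borel_measurable_SUP) auto
  finally show ?thesis .
qed

lemma mnorm_upd:
  assumes "j \<notin> set js"
  shows "mnorm p js g (upd_coord z j t) = mnorm p js (\<lambda>y. g (upd_coord y j t)) z"
proof -
  have "mnorm p js (\<lambda>y. g (upd_coord y j t)) z = mnorm p js (\<lambda>y. g (upd_coord y j t)) (upd_coord z j t)"
    by (rule mnorm_indep_aux[symmetric]) (use assms in auto)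
  also have "\<dots> = mnorm p js g (upd_coord z j t)"
  proof (rule mnorm_cong_at)
    fix y assume "\<And>i. i \<notin> set js \<Longrightarrow> y $ i = upd_coord z j t $ i"
    from this[OF assms] have "y $ j = t" by simp
    then have "upd_coord y j t = y" using upd_coord_id[of y j] by simp
    then show "g (upd_coord y j t) = g y" by simp
  qed
  finally show ?thesis by simp
qed

text \<open>Here \<rho> is the mixed norm over the coordinates \<open>js @ [i]\<close>, with
  coordinate j frozen at 0 because it is the variable of the filtration. At the exponent r0 = p i
  the root of the outermost norm disappears, so Tonelli's theorem exchanges the integrals over
  coordinates i and j, and \<open>base\<close> reduces to the inequality for the shorter list
  \<open>js\<close>.\<close>

lemma lattice_filtration_mnorm:
  fixes x :: "real ^ 'n::finite"
  assumes l: "l > 0" and js: "distinct (js @ [i])" "j \<notin> set (js @ [i])" "\<And>a. a \<in> set (js @ [i]) \<Longrightarrow> p a > 1"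
    and C0: "C0 \<ge> 1"
    and bd: "\<And>k K f x. f \<in> borel_measurable borel \<Longrightarrow>
      (\<integral>\<^sup>+ t. mnorm p js (Mc \<tau> l k K j f) (upd_coord x j t) powe p i \<partial>lborel)
        \<le> ennreal C0 * (\<integral>\<^sup>+ t. mnorm p js f (upd_coord x j t) powe p i \<partial>lborel)"
  shows "lattice_filtration (gcell \<tau> l) (gvol DIM(real) l) (2 ^ DIM(real))
    (\<lambda>h. mnorm p (js @ [i]) (\<lambda>y. h (upd_coord y j 0)) x) (p i) C0"
proof -
  interpret filtration "gcell \<tau> l" "gvol DIM(real) l" "2 ^ DIM(real)" by (rule gcell_filtration[OF l])
  have p0: "\<And>a. a \<in> set (js @ [i]) \<Longrightarrow> p a > 0" using js(3) by force
  have jm: "(\<lambda>(t, y). f t (upd_coord y j 0)) \<in> borel_measurable (borel \<Otimes>\<^sub>M borel)"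
    if "case_prod f \<in> borel_measurable (borel \<Otimes>\<^sub>M borel)" for f :: "real \<Rightarrow> real ^ 'n \<Rightarrow> ennreal"
    using that by measurable
  show ?thesis
  proof (unfold_locales, goal_cases)
    case (1 u w)
    then show ?case by (intro mnorm_mono p0) auto
  next
    case (2 u w)
    note [measurable] = 2
    show ?case by (intro mnorm_add js) measurable
  next
    case 3
    show ?case by simp
  next
    case (4 f)
    have "(\<lambda>(t, y). mnorm p (js @ [i]) (\<lambda>y. f t (upd_coord y j 0)) y) \<in> borel_measurable (borel \<Otimes>\<^sub>M borel)"
      by (rule mnorm_measurable_param[OF jm[OF 4]])
    then have "(\<lambda>t. (\<lambda>(t, y). mnorm p (js @ [i]) (\<lambda>y. f t (upd_coord y j 0)) y) (t, x)) \<in> borel_measurable borel"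
      by (rule measurable_compose[rotated]) measurable
    then show ?case by simp
  next
    case (5 f k s)
    note [measurable] = jm[OF 5]
    have "mnorm p (js @ [i]) (\<lambda>y. \<integral>\<^sup>+ t. ker k s t * f t (upd_coord y j 0) \<partial>lborel) x
      \<le> (\<integral>\<^sup>+ t. mnorm p (js @ [i]) (\<lambda>y. ker k s t * f t (upd_coord y j 0)) x \<partial>lborel)"
      by (rule mnorm_Minkowski[OF _ js(1,3)]) (auto intro: lborel.sigma_finite_measure_axioms)
    also have "\<dots> = (\<integral>\<^sup>+ t. ker k s t * mnorm p (js @ [i]) (\<lambda>y. f t (upd_coord y j 0)) x \<partial>lborel)"
    proof (intro nn_integral_cong mnorm_cmult p0)
      fix t
      show "(\<lambda>y. f t (upd_coord y j 0)) \<in> borel_measurable borel"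
        using measurable_compose[OF _ jm[OF 5], of "\<lambda>y. (t, y)" borel] by simp
    qed
    finally show ?case by (simp only: E_def)
  next
    case 6
    show ?case using js(3) by simp
  next
    case 7
    show ?case by fact
  next
    case (8 f k K)
    \<comment> \<open>Glues the family f into one function on the whole space by reading its
      parameter off coordinate j.\<close>
    define g where "g y = f (y $ j) (upd_coord y j 0)" for y
    have gm [measurable]: "g \<in> borel_measurable borel"
      unfolding g_def using measurable_compose[OF _ jm[OF 8], of "\<lambda>y. (y $ j, y)" borel] by simp
    have g1: "g (upd_coord y j t) = f t (upd_coord y j 0)" for y t by (simp add: g_def)
    have g2: "Mc \<tau> l k K j g (upd_coord y j t) = Mx k K (\<lambda>s. f s (upd_coord y j 0)) t" for y t
      by (simp add: Mc_def g1)
    have ji: "j \<notin> set js" "i \<noteq> j" using js by auto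
    have expand: "mnorm p (js @ [i]) h x powe p i = (\<integral>\<^sup>+ s. mnorm p js h (upd_coord x i s) powe p i \<partial>lborel)" for h
      using js(3)[of i] by (simp add: mnorm_append cnorm_def powe_powe)
    have [measurable]: "Mc \<tau> l k K j g \<in> borel_measurable borel" by (rule Mc_measurable[OF l gm])
    have "(\<integral>\<^sup>+ t. mnorm p (js @ [i]) (\<lambda>y. Mx k K (\<lambda>s. f s (upd_coord y j 0)) t) x powe p i \<partial>lborel) =
        (\<integral>\<^sup>+ t. \<integral>\<^sup>+ s. mnorm p js (Mc \<tau> l k K j g) (upd_coord (upd_coord x i s) j t) powe p i \<partial>lborel \<partial>lborel)"
      unfolding expand mnorm_upd[OF ji(1)] g2 ..
    also have "\<dots> = (\<integral>\<^sup>+ s. \<integral>\<^sup>+ t. mnorm p js (Mc \<tau> l k K j g) (upd_coord (upd_coord x i s) j t) powe p i \<partial>lborel \<partial>lborel)"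
      by (rule lborel_pair.Fubini'[symmetric]) measurable
    also have "\<dots> \<le> (\<integral>\<^sup>+ s. ennreal C0 * (\<integral>\<^sup>+ t. mnorm p js g (upd_coord (upd_coord x i s) j t) powe p i \<partial>lborel) \<partial>lborel)"
      by (intro nn_integral_mono bd gm)
    also have "\<dots> = ennreal C0 * (\<integral>\<^sup>+ s. \<integral>\<^sup>+ t. mnorm p js g (upd_coord (upd_coord x i s) j t) powe p i \<partial>lborel \<partial>lborel)"
      by (rule nn_integral_cmult) measurable
    also have "(\<integral>\<^sup>+ s. \<integral>\<^sup>+ t. mnorm p js g (upd_coord (upd_coord x i s) j t) powe p i \<partial>lborel \<partial>lborel) =
       (\<integral>\<^sup>+ t. \<integral>\<^sup>+ s. mnorm p js g (upd_coord (upd_coord x i s) j t) powe p i \<partial>lborel \<partial>lborel)"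
      by (rule lborel_pair.Fubini') measurable
    also have "\<dots> = (\<integral>\<^sup>+ t. mnorm p (js @ [i]) (\<lambda>y. f t (upd_coord y j 0)) x powe p i \<partial>lborel)"
      unfolding expand mnorm_upd[OF ji(1)] g1 ..
    finally show ?case .
  qed
qed

text \<open>Induction from the inner coordinates outwards, with the exponent r in coordinate j kept
  general: the hypothesis is used at r = p i to feed \<open>lattice_filtration_mnorm\<close>, and
  \<open>lattice_maximal\<close> carries the result to every r. The empty list is Doob's
  inequality.\<close>

lemma coordinate_maximal_aux:
  fixes js :: "'n::finite list"
  assumes "distinct js" "j \<notin> set js" "\<And>a. a \<in> set js \<Longrightarrow> p a > 1" "r > 1"
  shows "\<exists>C\<ge>1. \<forall>\<tau> l k K f (x :: real ^ 'n). l > 0 \<longrightarrow> f \<in> borel_measurable borel \<longrightarrow>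
      (\<integral>\<^sup>+ t. mnorm p js (Mc \<tau> l k K j f) (upd_coord x j t) powe r \<partial>lborel)
        \<le> ennreal C * (\<integral>\<^sup>+ t. mnorm p js f (upd_coord x j t) powe r \<partial>lborel)"
  using assms
proof (induction js arbitrary: r rule: rev_induct)
  case Nil
  define C where "C = max 1 ((r / (r - 1)) powr r)"
  show ?case
  proof (intro exI[of _ C] conjI allI impI)
    fix \<tau> l :: real and k K and f :: "real ^ 'n \<Rightarrow> ennreal" and x :: "real ^ 'n"
    assume l: "l > 0" and [measurable]: "f \<in> borel_measurable borel"
    interpret filtration "gcell \<tau> l" "gvol DIM(real) l" "2 ^ DIM(real)" by (rule gcell_filtration[OF l])
    define F where "F t = f (upd_coord x j t)" for t
    have [measurable]: "F \<in> borel_measurable borel" unfolding F_def by measurable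
    have "(\<integral>\<^sup>+ t. Mx k K F t powe r \<partial>lborel) \<le> (ennreal (r / (r - 1)) * (\<integral>\<^sup>+ x. F x powe r \<partial>lborel) powe (1 / r)) powe r"
      using Doob_maximal[of r F k K] \<open>r > 1\<close> by (simp add: powe_le_swap')
    also have "\<dots> = ennreal ((r / (r - 1)) powr r) * (\<integral>\<^sup>+ x. F x powe r \<partial>lborel)"
      using \<open>r > 1\<close> by (simp add: powe_mult powe_powe powe_ennreal)
    also have "\<dots> \<le> ennreal C * (\<integral>\<^sup>+ x. F x powe r \<partial>lborel)"
      by (intro mult_right_mono ennreal_leI) (auto simp: C_def)
    finally show "(\<integral>\<^sup>+ t. mnorm p [] (Mc \<tau> l k K j f) (upd_coord x j t) powe r \<partial>lborel)
        \<le> ennreal C * (\<integral>\<^sup>+ t. mnorm p [] f (upd_coord x j t) powe r \<partial>lborel)"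
      by (simp add: Mc_def F_def[abs_def])
  qed (simp add: C_def)
next
  case (snoc i js)
  obtain C0 where C0: "C0 \<ge> 1" "\<And>\<tau> l k K f (x :: real ^ 'n). l > 0 \<Longrightarrow> f \<in> borel_measurable borel \<Longrightarrow>
      (\<integral>\<^sup>+ t. mnorm p js (Mc \<tau> l k K j f) (upd_coord x j t) powe p i \<partial>lborel)
        \<le> ennreal C0 * (\<integral>\<^sup>+ t. mnorm p js f (upd_coord x j t) powe p i \<partial>lborel)"
    using snoc.IH[of "p i"] snoc.prems by auto
  define c where "c = lattice_filtration.weak_const (2 ^ DIM(real)) (p i) C0"
  define C where "C = max 1 ((2 * c * (r / (r - 1)) * r) powr r)"
  show ?case
  proof (intro exI[of _ C] conjI allI impI)
    fix \<tau> l :: real and k K and f :: "real ^ 'n \<Rightarrow> ennreal" and x :: "real ^ 'n"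
    assume l: "l > 0" and [measurable]: "f \<in> borel_measurable borel"
    interpret lattice_filtration "gcell \<tau> l" "gvol DIM(real) l" "2 ^ DIM(real)"
      "\<lambda>h. mnorm p (js @ [i]) (\<lambda>y. h (upd_coord y j 0)) x" "p i" C0
      by (rule lattice_filtration_mnorm[OF l snoc.prems(1-3) C0(1)]) (use C0(2)[OF l] in auto)
    have c: "c \<ge> 1" unfolding c_def by (rule weak_const_ge_1)
    define F where "F t y = f (upd_coord y j t)" for t y
    have Fm: "case_prod F \<in> borel_measurable (borel \<Otimes>\<^sub>M borel)" unfolding F_def by measurable
    have 1: "mnorm p (js @ [i]) (Mc \<tau> l k K j f) (upd_coord x j t) =
        mnorm p (js @ [i]) (\<lambda>y. Mx k K (\<lambda>s. F s (upd_coord y j 0)) t) x" for t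
      unfolding mnorm_upd[OF snoc.prems(2)] by (simp add: Mc_def F_def)
    have 2: "mnorm p (js @ [i]) f (upd_coord x j t) = mnorm p (js @ [i]) (\<lambda>y. F t (upd_coord y j 0)) x" for t
      unfolding mnorm_upd[OF snoc.prems(2)] by (simp add: F_def)
    have "(\<integral>\<^sup>+ t. mnorm p (js @ [i]) (Mc \<tau> l k K j f) (upd_coord x j t) powe r \<partial>lborel) powe (1 / r)
      \<le> ennreal (2 * c * (r / (r - 1)) * r) *
        (\<integral>\<^sup>+ t. mnorm p (js @ [i]) f (upd_coord x j t) powe r \<partial>lborel) powe (1 / r)"
      unfolding 1 2 c_def by (rule lattice_maximal[OF Fm snoc.prems(4)])
    then have "(\<integral>\<^sup>+ t. mnorm p (js @ [i]) (Mc \<tau> l k K j f) (upd_coord x j t) powe r \<partial>lborel)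
      \<le> (ennreal (2 * c * (r / (r - 1)) * r) *
        (\<integral>\<^sup>+ t. mnorm p (js @ [i]) f (upd_coord x j t) powe r \<partial>lborel) powe (1 / r)) powe r"
      using \<open>r > 1\<close> by (subst (asm) powe_le_swap') auto
    also have "\<dots> = ennreal ((2 * c * (r / (r - 1)) * r) powr r) *
        (\<integral>\<^sup>+ t. mnorm p (js @ [i]) f (upd_coord x j t) powe r \<partial>lborel)"
      using \<open>r > 1\<close> c by (simp add: powe_mult powe_powe powe_ennreal)
    also have "\<dots> \<le> ennreal C * (\<integral>\<^sup>+ t. mnorm p (js @ [i]) f (upd_coord x j t) powe r \<partial>lborel)"
      by (intro mult_right_mono ennreal_leI) (auto simp: C_def)
    finally show "(\<integral>\<^sup>+ t. mnorm p (js @ [i]) (Mc \<tau> l k K j f) (upd_coord x j t) powe r \<partial>lborel)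
      \<le> ennreal C * (\<integral>\<^sup>+ t. mnorm p (js @ [i]) f (upd_coord x j t) powe r \<partial>lborel)" .
  qed (simp add: C_def)
qed

text \<open>The coordinates integrated before j are handled by \<open>coordinate_maximal_aux\<close>
  with r = p j; those integrated after j see a pointwise inequality and enter by
  monotonicity.\<close>

lemma coordinate_maximal:
  fixes js :: "'n::finite list"
  assumes js: "distinct js" "j \<in> set js" "\<And>a. a \<in> set js \<Longrightarrow> p a > 1"
  shows "\<exists>C\<ge>1. \<forall>\<tau> l k K f (x :: real ^ 'n). l > 0 \<longrightarrow> f \<in> borel_measurable borel \<longrightarrow>
      mnorm p js (Mc \<tau> l k K j f) x \<le> ennreal C * mnorm p js f x"
proof -
  obtain js1 js2 where split: "js = js1 @ j # js2" using split_list[OF js(2)] by blast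
  obtain C where C: "C \<ge> 1" "\<And>\<tau> l k K f (x :: real ^ 'n). l > 0 \<Longrightarrow> f \<in> borel_measurable borel \<Longrightarrow>
      (\<integral>\<^sup>+ t. mnorm p js1 (Mc \<tau> l k K j f) (upd_coord x j t) powe p j \<partial>lborel)
        \<le> ennreal C * (\<integral>\<^sup>+ t. mnorm p js1 f (upd_coord x j t) powe p j \<partial>lborel)"
    using coordinate_maximal_aux[of js1 j p "p j"] js unfolding split by auto
  have pj: "p j > 1" using js by simp
  define C' where "C' = C powr (1 / p j)"
  show ?thesis
  proof (intro exI[of _ C'] conjI allI impI)
    show "1 \<le> C'" unfolding C'_def using C pj by (intro ge_one_powr_ge_zero) auto
    fix \<tau> l :: real and k K and f :: "real ^ 'n \<Rightarrow> ennreal" and x :: "real ^ 'n"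
    assume l: "l > 0" and [measurable]: "f \<in> borel_measurable borel"
    have "cnorm p j (mnorm p js1 (Mc \<tau> l k K j f)) y \<le> ennreal C' * cnorm p j (mnorm p js1 f) y" for y
    proof -
      have "cnorm p j (mnorm p js1 (Mc \<tau> l k K j f)) y \<le>
        (ennreal C * (\<integral>\<^sup>+ t. mnorm p js1 f (upd_coord y j t) powe p j \<partial>lborel)) powe (1 / p j)"
        unfolding cnorm_def using pj by (intro powe_mono C l) auto
      also have "\<dots> = ennreal C' * cnorm p j (mnorm p js1 f) y"
        using C by (simp add: powe_mult powe_ennreal C'_def cnorm_def)
      finally show ?thesis .
    qed
    then have "mnorm p js2 (cnorm p j (mnorm p js1 (Mc \<tau> l k K j f))) x
      \<le> mnorm p js2 (\<lambda>y. ennreal C' * cnorm p j (mnorm p js1 f) y) x"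
      using js(3) unfolding split by (intro mnorm_mono) force+
    also have "\<dots> = ennreal C' * mnorm p js2 (cnorm p j (mnorm p js1 f)) x"
      using js(3) unfolding split by (intro mnorm_cmult) force+
    finally show "mnorm p js (Mc \<tau> l k K j f) x \<le> ennreal C' * mnorm p js f x"
      unfolding split by (simp add: mnorm_append)
  qed
qed

section \<open>The dyadic maximal function on mixed-norm spaces\<close>

text \<open>Composition of one-coordinate maximal functions. Over all coordinates it dominates the
  dyadic maximal function over cubes, because the mean over a cube is an iterated mean.\<close>

primrec Mlist :: "real ^ 'n \<Rightarrow> real \<Rightarrow> nat \<Rightarrow> 'n list \<Rightarrow> (real ^ 'n \<Rightarrow> ennreal) \<Rightarrow> real ^ 'n \<Rightarrow> ennreal" where
  "Mlist \<tau> l K [] f = f"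
| "Mlist \<tau> l K (j # js) f = Mlist \<tau> l K js (Mc (\<tau> $ j) l 0 K j f)"

primrec Elist :: "real ^ 'n \<Rightarrow> real \<Rightarrow> nat \<Rightarrow> 'n list \<Rightarrow> (real ^ 'n \<Rightarrow> ennreal) \<Rightarrow> real ^ 'n \<Rightarrow> ennreal" where
  "Elist \<tau> l k [] f = f"
| "Elist \<tau> l k (j # js) f = Elist \<tau> l k js (Ec (\<tau> $ j) l k j f)"

lemma Elist_le_Mlist:
  assumes l: "l > 0" and "k \<le> K" "\<And>x. f x \<le> g x"
  shows "Elist \<tau> l k js f x \<le> Mlist \<tau> l K js g x"
  using assms(3)
proof (induction js arbitrary: f g)
  case (Cons j js)
  interpret filtration "gcell (\<tau> $ j) l" "gvol DIM(real) l" "2 ^ DIM(real)" by (rule gcell_filtration[OF l])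
  have "Ec (\<tau> $ j) l k j f y \<le> Mc (\<tau> $ j) l 0 K j g y" for y
  proof -
    have "Ec (\<tau> $ j) l k j f y \<le> E k (\<lambda>t. g (upd_coord y j t)) (y $ j)"
      unfolding Ec_def by (intro E_mono Cons.prems)
    also have "\<dots> \<le> Mc (\<tau> $ j) l 0 K j g y"
      unfolding Mc_def using assms(2) by (intro Mx_upper) auto
    finally show ?thesis .
  qed
  then show ?case using Cons.IH by simp
qed simp

lemma Mlist_bounded:
  fixes all :: "'n::finite list"
  assumes all: "distinct all" "\<And>a. a \<in> set all \<Longrightarrow> p a > 1" and "set js \<subseteq> set all"
  shows "\<exists>C\<ge>1. \<forall>\<tau> l K f (x :: real ^ 'n). l > 0 \<longrightarrow> f \<in> borel_measurable borel \<longrightarrow>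
    mnorm p all (Mlist \<tau> l K js f) x \<le> ennreal C * mnorm p all f x"
  using assms(3)
proof (induction js)
  case Nil
  show ?case by (intro exI[of _ 1]) simp
next
  case (Cons j js)
  obtain C where C: "C \<ge> 1" "\<And>\<tau> l K f (x :: real ^ 'n). l > 0 \<Longrightarrow> f \<in> borel_measurable borel \<Longrightarrow>
    mnorm p all (Mlist \<tau> l K js f) x \<le> ennreal C * mnorm p all f x"
    using Cons by auto
  obtain C' where C': "C' \<ge> 1" "\<And>\<tau> l k K f (x :: real ^ 'n). l > 0 \<Longrightarrow> f \<in> borel_measurable borel \<Longrightarrow>
      mnorm p all (Mc \<tau> l k K j f) x \<le> ennreal C' * mnorm p all f x"
    using coordinate_maximal[where js=all and j=j and p=p] all Cons.prems by auto
  show ?case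
  proof (intro exI[of _ "C * C'"] conjI allI impI)
    show "1 \<le> C * C'" using C(1) C'(1) mult_mono[of 1 C 1 C'] by simp
    fix \<tau> :: "real ^ 'n" and l :: real and K and f :: "real ^ 'n \<Rightarrow> ennreal" and x :: "real ^ 'n"
    assume l: "l > 0" and f: "f \<in> borel_measurable borel"
    have "mnorm p all (Mlist \<tau> l K js (Mc (\<tau> $ j) l 0 K j f)) x \<le> ennreal C * mnorm p all (Mc (\<tau> $ j) l 0 K j f) x"
      by (rule C(2)[OF l Mc_measurable[OF l f]])
    also have "\<dots> \<le> ennreal C * (ennreal C' * mnorm p all f x)"
      by (intro mult_left_mono C'(2) l f) auto
    finally show "mnorm p all (Mlist \<tau> l K (j # js) f) x \<le> ennreal (C * C') * mnorm p all f x"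
      using C(1) C'(1) by (simp add: ennreal_mult mult.assoc)
  qed
qed

abbreviation cker :: "real \<Rightarrow> real \<Rightarrow> nat \<Rightarrow> real \<Rightarrow> real \<Rightarrow> ennreal" where
  "cker \<tau> l \<equiv> filtration.ker (gcell \<tau> l) (gvol DIM(real) l)"

lemma Elist_eq_iint:
  fixes f :: "real ^ 'n::finite \<Rightarrow> ennreal"
  assumes l: "l > 0" and "distinct js" and "f \<in> borel_measurable borel"
  shows "Elist \<tau> l k js f x = iint js (\<lambda>y. (\<Prod>i\<in>set js. cker (\<tau> $ i) l k (x $ i) (y $ i)) * f y) x"
  using assms(2,3)
proof (induction js arbitrary: f)
  case (Cons j js)
  note [measurable] = Cons.prems(2)
  interpret filtration "gcell (\<tau> $ j) l" "gvol DIM(real) l" "2 ^ DIM(real)" by (rule gcell_filtration[OF l])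
  have "Elist \<tau> l k (j # js) f x =
      iint js (\<lambda>y. (\<Prod>i\<in>set js. cker (\<tau> $ i) l k (x $ i) (y $ i)) * Ec (\<tau> $ j) l k j f y) x"
    using Cons.IH[OF _ Ec_measurable[OF l Cons.prems(2)]] Cons.prems by simp
  also have "\<dots> = iint js (cnorm (\<lambda>_. 1) j (\<lambda>y. (\<Prod>i\<in>set (j # js). cker (\<tau> $ i) l k (x $ i) (y $ i)) * f y)) x"
  proof (rule mnorm_cong_at)
    fix y assume "\<And>i. i \<notin> set js \<Longrightarrow> y $ i = x $ i"
    then have yj: "y $ j = x $ j" using Cons.prems(1) by simp
    have *: "(\<Prod>i\<in>set js. cker (\<tau> $ i) l k (x $ i) (upd_coord y j t $ i)) =
        (\<Prod>i\<in>set js. cker (\<tau> $ i) l k (x $ i) (y $ i))" for t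
      using Cons.prems(1) by (intro prod.cong) (auto simp: upd_coord_nth)
    have "cnorm (\<lambda>_. 1) j (\<lambda>y. (\<Prod>i\<in>set (j # js). cker (\<tau> $ i) l k (x $ i) (y $ i)) * f y) y =
      (\<integral>\<^sup>+ t. (\<Prod>i\<in>set js. cker (\<tau> $ i) l k (x $ i) (y $ i)) * (ker k (x $ j) t * f (upd_coord y j t)) \<partial>lborel)"
      using Cons.prems(1) by (simp add: cnorm_1 * ac_simps)
    also have "\<dots> = (\<Prod>i\<in>set js. cker (\<tau> $ i) l k (x $ i) (y $ i)) * Ec (\<tau> $ j) l k j f y"
      by (subst nn_integral_cmult) (auto simp: Ec_def E_def yj)
    finally show "(\<Prod>i\<in>set js. cker (\<tau> $ i) l k (x $ i) (y $ i)) * Ec (\<tau> $ j) l k j f y =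
      cnorm (\<lambda>_. 1) j (\<lambda>y. (\<Prod>i\<in>set (j # js). cker (\<tau> $ i) l k (x $ i) (y $ i)) * f y) y" by simp
  qed
  finally show ?case by simp
qed simp

lemma gcell_vec: "y \<in> gcell \<tau> l k x \<longleftrightarrow> (\<forall>i. y $ i \<in> gcell (\<tau> $ i) l k (x $ i))"
  for x y \<tau> :: "real ^ 'n::finite"
proof -
  have B: "(Basis :: (real ^ 'n) set) = range (\<lambda>i. axis i 1)" by (auto simp: Basis_vec_def Basis_real_def)
  show ?thesis unfolding gcell_def B by (simp add: inner_axis Basis_real_def)
qed

text \<open>The kernel of a cube is the product of the kernels of its sides, so this is Tonelli's
  theorem in the form of \<open>iint_eq_lborel\<close>.\<close>

lemma gE_eq_Elist:
  fixes f :: "real ^ 'n::finite \<Rightarrow> ennreal"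
  assumes l: "l > 0" and js: "distinct js" "set js = UNIV" and [measurable]: "f \<in> borel_measurable borel"
  shows "gE \<tau> l k f x = Elist \<tau> l k js f x"
proof -
  interpret filtration "gcell \<tau> l" "gvol DIM(real ^ 'n) l" "2 ^ DIM(real ^ 'n)" by (rule gcell_filtration[OF l])
  have ck: "cker t l k a b = ennreal (2 ^ k / l) * indicator (gcell t l k a) b" for t a b
    using filtration.ker_def[OF gcell_filtration[OF l, of t], of k a b] by (simp add: gvol_def DIM_real)
  have "ker k x y = (\<Prod>i\<in>set js. cker (\<tau> $ i) l k (x $ i) (y $ i))" for y
  proof -
    have "(\<Prod>i\<in>(UNIV :: 'n set). indicator (gcell (\<tau> $ i) l k (x $ i)) (y $ i)) = (indicator (gcell \<tau> l k x) y :: ennreal)"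
    proof (cases "y \<in> gcell \<tau> l k x")
      case True
      then show ?thesis by (simp add: gcell_vec)
    next
      case False
      then obtain i where "y $ i \<notin> gcell (\<tau> $ i) l k (x $ i)" by (auto simp: gcell_vec)
      then have "(\<Prod>i\<in>(UNIV :: 'n set). indicator (gcell (\<tau> $ i) l k (x $ i)) (y $ i)) = (0 :: ennreal)"
        by (intro prod_zero bexI[of _ i]) auto
      then show ?thesis using False by simp
    qed
    then have "(\<Prod>i\<in>set js. cker (\<tau> $ i) l k (x $ i) (y $ i)) = ennreal (2 ^ k / l) ^ CARD('n) * indicator (gcell \<tau> l k x) y"
      unfolding ck js(2) prod.distrib by simp
    also have "ennreal (2 ^ k / l) ^ CARD('n) = ennreal ((2 ^ k / l) ^ CARD('n))"
      using l by (simp add: ennreal_power)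
    also have "(2 ^ k / l) ^ CARD('n) = 1 / gvol DIM(real ^ 'n) l k"
      by (simp add: gvol_def power_divide DIM_real DIM_cart)
    finally show ?thesis by (simp add: ker_def)
  qed
  then have "gE \<tau> l k f x = (\<integral>\<^sup>+ y. (\<Prod>i\<in>set js. cker (\<tau> $ i) l k (x $ i) (y $ i)) * f y \<partial>lborel)"
    by (simp add: E_def)
  also have "\<dots> = iint js (\<lambda>y. (\<Prod>i\<in>set js. cker (\<tau> $ i) l k (x $ i) (y $ i)) * f y) x"
  proof (rule iint_eq_lborel[OF js, symmetric])
    have [measurable]: "(\<lambda>y :: real ^ 'n. cker (\<tau> $ i) l k (x $ i) (y $ i)) \<in> borel_measurable borel" for i
      by (rule filtration.ker_measurable_raw[OF gcell_filtration[OF l]]) auto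
    show "(\<lambda>y. (\<Prod>i\<in>set js. cker (\<tau> $ i) l k (x $ i) (y $ i)) * f y) \<in> borel_measurable borel" by measurable
  qed
  also have "\<dots> = Elist \<tau> l k js f x" by (rule Elist_eq_iint[symmetric]) (use l js in auto)
  finally show ?thesis .
qed

text \<open>The constant is uniform in the grid and in the levels, so that the truncation K and the
  top scale l can later tend to infinity.\<close>

theorem dyadic_maximal_bounded:
  fixes p :: "'n::{finite,linorder} \<Rightarrow> real"
  assumes "\<And>a. p a > 1"
  shows "\<exists>C\<ge>1. \<forall>(\<tau> :: real ^ 'n::{finite,linorder}) l k K f x. l > 0 \<longrightarrow> f \<in> borel_measurable borel \<longrightarrow>
    mnorm p coords (gMx \<tau> l k K f) x \<le> ennreal C * mnorm p coords f x"
proof -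
  obtain C where C: "C \<ge> 1" "\<And>\<tau> l K f (x :: real ^ 'n::{finite,linorder}). l > 0 \<Longrightarrow> f \<in> borel_measurable borel \<Longrightarrow>
    mnorm p coords (Mlist \<tau> l K coords f) x \<le> ennreal C * mnorm p coords f x"
    using Mlist_bounded[of coords p coords] assms by auto
  show ?thesis
  proof (intro exI[of _ C] conjI allI impI)
    fix \<tau> x :: "real ^ 'n::{finite,linorder}" and l :: real and k K and f :: "real ^ 'n::{finite,linorder} \<Rightarrow> ennreal"
    assume l: "l > 0" and f: "f \<in> borel_measurable borel"
    have "gMx \<tau> l k K f y \<le> Mlist \<tau> l K coords f y" for y
      unfolding filtration.Mx_def[OF gcell_filtration[OF l]]
    proof (rule SUP_least)
      fix i assume "i \<in> {k..K}"
      then have "Elist \<tau> l i coords f y \<le> Mlist \<tau> l K coords f y"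
        by (intro Elist_le_Mlist l) auto
      then show "gE \<tau> l i f y \<le> Mlist \<tau> l K coords f y"
        by (subst gE_eq_Elist[OF l _ _ f, of coords]) auto
    qed
    then have "mnorm p coords (gMx \<tau> l k K f) x \<le> mnorm p coords (Mlist \<tau> l K coords f) x"
      using assms by (intro mnorm_mono) (auto intro: less_trans[OF zero_less_one])
    also have "\<dots> \<le> ennreal C * mnorm p coords f x" by (rule C(2)[OF l f])
    finally show "mnorm p coords (gMx \<tau> l k K f) x \<le> ennreal C * mnorm p coords f x" .
  qed (use C in auto)
qed

section \<open>Convergence of the means of an integrable function\<close>

text \<open>Equality fails in general: if l = 0 and c = top, the left side is 0 while all products
  on the right may be top.\<close>

lemma Liminf_ennreal_mult_ge:
  fixes a :: "nat \<Rightarrow> ennreal"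
  assumes "a \<longlonglongrightarrow> l"
  shows "l * c \<le> liminf (\<lambda>n. a n * c)"
proof (cases "c = top")
  case False
  then have "(\<lambda>n. a n * c) \<longlonglongrightarrow> l * c"
    using ennreal_tendsto_cmult[OF _ assms, of c] by (simp add: mult.commute less_top)
  then show ?thesis by (simp add: lim_imp_Liminf)
next
  case c: True
  show ?thesis
  proof (cases "l = 0")
    case False
    then have "\<forall>\<^sub>F n in sequentially. a n > 0"
      using order_tendstoD(1)[OF assms, of 0] by (simp add: zero_less_iff_neq_zero)
    then have "\<forall>\<^sub>F n in sequentially. top \<le> a n * c"
      by eventually_elim (simp add: c ennreal_mult_top)
    then have "top \<le> liminf (\<lambda>n. a n * c)" by (rule Liminf_bounded)
    then show ?thesis by (simp add: top_unique)
  qed simp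
qed

context filtration
begin

lemma cell_sets [measurable]: "cell k x \<in> sets borel"
  using emeasure_cell[of k x] v_pos[of k] emeasure_notin_sets[of "cell k x" lborel] by fastforce

text \<open>An L^1 modulus of continuity with respect to the grid. It dominates the L^1 distance
  between f and its cell means and behaves well under approximation.\<close>

definition osc_int :: "nat \<Rightarrow> ('a \<Rightarrow> complex) \<Rightarrow> ennreal" where
  "osc_int k f = (\<integral>\<^sup>+ x. E k (\<lambda>y. ennreal (norm (f x - f y))) x \<partial>lborel)"

lemma osc_int_measurable:
  assumes [measurable]: "f \<in> borel_measurable borel"
  shows "(\<lambda>x. E k (\<lambda>y. ennreal (norm (f x - f y :: complex))) x) \<in> borel_measurable borel"
proof -
  have "(\<lambda>(s, x). E k (\<lambda>y. ennreal (norm (f s - f y))) x) \<in> borel_measurable (borel \<Otimes>\<^sub>M borel)"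
    by (rule E_measurable_param) measurable
  then have "(\<lambda>x. (\<lambda>(s, x). E k (\<lambda>y. ennreal (norm (f s - f y))) x) (x, x)) \<in> borel_measurable borel"
    by (rule measurable_compose[rotated]) measurable
  then show ?thesis by simp
qed

lemma osc_int_triangle:
  assumes [measurable]: "f \<in> borel_measurable borel" "g \<in> borel_measurable borel"
  shows "osc_int k f \<le> osc_int k g + 2 * (\<integral>\<^sup>+ x. ennreal (norm (f x - g x)) \<partial>lborel)"
proof -
  define w where "w x = ennreal (norm (f x - g x))" for x
  have [measurable]: "w \<in> borel_measurable borel" unfolding w_def by measurable
  have "osc_int k f \<le> (\<integral>\<^sup>+ x. E k (\<lambda>y. ennreal (norm (g x - g y))) x + (w x + E k w x) \<partial>lborel)"
    unfolding osc_int_def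
  proof (rule nn_integral_mono)
    fix x
    have "E k (\<lambda>y. ennreal (norm (f x - f y))) x \<le> E k (\<lambda>y. ennreal (norm (g x - g y)) + (w x + w y)) x"
    proof (rule E_mono)
      fix y
      have "norm (f x - f y) \<le> norm (g x - g y) + (norm (f x - g x) + norm (f y - g y))"
        using norm_triangle_ineq[of "g x - g y" "(f x - g x) - (f y - g y)"]
          norm_triangle_ineq4[of "f x - g x" "f y - g y"] by simp
      then have "ennreal (norm (f x - f y)) \<le> ennreal (norm (g x - g y) + (norm (f x - g x) + norm (f y - g y)))"
        by (rule ennreal_leI)
      then show "ennreal (norm (f x - f y)) \<le> ennreal (norm (g x - g y)) + (w x + w y)"
        by (simp add: w_def)
    qed
    also have "\<dots> = E k (\<lambda>y. ennreal (norm (g x - g y))) x + (w x + E k w x)"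
      by (simp add: E_add)
    finally show "E k (\<lambda>y. ennreal (norm (f x - f y))) x \<le> E k (\<lambda>y. ennreal (norm (g x - g y))) x + (w x + E k w x)" .
  qed
  also have "\<dots> = osc_int k g + (\<integral>\<^sup>+ x. w x \<partial>lborel) + (\<integral>\<^sup>+ x. w x \<partial>lborel)"
    using osc_int_measurable[OF assms(2)]
    by (subst nn_integral_add) (auto simp: nn_integral_add nn_integral_E osc_int_def add.assoc)
  finally show ?thesis by (simp add: w_def mult_2 add.assoc)
qed

text \<open>A point of U has its small cells inside U, so dominated convergence disposes of the
  points of U. The contribution of the complement equals that of U by self-adjointness, so boundary
  points of U call for no separate treatment.\<close>

lemma osc_int_open:
  assumes shrink: "\<And>x S. open S \<Longrightarrow> x \<in> S \<Longrightarrow> \<exists>k. cell k x \<subseteq> S"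
    and U: "open U" "emeasure lborel U < top"
  shows "(\<lambda>k. osc_int k (\<lambda>x. indicator U x *\<^sub>R c)) \<longlonglongrightarrow> 0"
proof -
  have [measurable]: "U \<in> sets borel" using U by simp
  define W where "W = (\<lambda>k. \<integral>\<^sup>+ x. indicator U x * E k (indicator (- U)) x \<partial>lborel)"
  have "W \<longlonglongrightarrow> (\<integral>\<^sup>+ (x :: 'a). 0 \<partial>lborel)"
    unfolding W_def
  proof (rule nn_integral_dominated_convergence[where w="indicator U"])
    show "(\<integral>\<^sup>+ x. indicator U x \<partial>lborel) < \<infinity>" using U by simp
    show "AE x in lborel. indicator U x * E j (indicator (- U)) x \<le> indicator U x" for j
    proof (intro AE_I2)
      fix x
      have "E j (indicator (- U)) x \<le> E j (\<lambda>y. 1) x" by (rule E_mono) (simp add: indicator_def)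
      then have "indicator U x * E j (indicator (- U)) x \<le> indicator U x * 1" by (intro mult_left_mono) auto
      then show "indicator U x * E j (indicator (- U)) x \<le> indicator U x" by simp
    qed
    show "AE x in lborel. (\<lambda>j. indicator U x * E j (indicator (- U)) x) \<longlonglongrightarrow> 0"
    proof (intro AE_I2)
      fix x
      show "(\<lambda>j. indicator U x * E j (indicator (- U)) x) \<longlonglongrightarrow> 0"
      proof (cases "x \<in> U")
        case True
        then obtain k where k: "cell k x \<subseteq> U" using shrink[OF U(1)] by blast
        have "E j (indicator (- U)) x = 0" if "j \<ge> k" for j
        proof -
          have "E j (indicator (- U)) x = E j (\<lambda>y. 0) x"
            using cell_antimono[OF that, of x] k by (intro E_cong) auto
          then show ?thesis by simp
        qed
        then have "\<forall>\<^sub>F j in sequentially. indicator U x * E j (indicator (- U)) x = 0"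
          by (intro eventually_sequentiallyI[of k]) simp
        then show ?thesis by (rule tendsto_eventually)
      qed simp
    qed
  qed auto
  then have W0: "W \<longlonglongrightarrow> 0" by simp
  have le: "osc_int k (\<lambda>x. indicator U x *\<^sub>R c) \<le> ennreal (2 * norm c) * W k" for k
  proof -
    have "osc_int k (\<lambda>x. indicator U x *\<^sub>R c) \<le> (\<integral>\<^sup>+ x. ennreal (norm c) *
       (indicator U x * E k (indicator (- U)) x + indicator (- U) x * E k (indicator U) x) \<partial>lborel)"
      unfolding osc_int_def
    proof (rule nn_integral_mono)
      fix x
      have "E k (\<lambda>y. ennreal (norm (indicator U x *\<^sub>R c - indicator U y *\<^sub>R c))) x
        \<le> E k (\<lambda>y. ennreal (norm c) * (indicator U x * indicator (- U) y + indicator (- U) x * indicator U y)) x"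
        by (rule E_mono) (auto simp: indicator_def)
      also have "\<dots> = ennreal (norm c) *
       (indicator U x * E k (indicator (- U)) x + indicator (- U) x * E k (indicator U) x)"
        by (subst E_cmult, measurable, subst E_add, measurable) (simp add: E_cmult)
      finally show "E k (\<lambda>y. ennreal (norm (indicator U x *\<^sub>R c - indicator U y *\<^sub>R c))) x \<le> ennreal (norm c) *
       (indicator U x * E k (indicator (- U)) x + indicator (- U) x * E k (indicator U) x)" .
    qed
    also have "\<dots> = ennreal (norm c) * (W k + (\<integral>\<^sup>+ x. indicator (- U) x * E k (indicator U) x \<partial>lborel))"
      by (subst nn_integral_cmult, measurable, subst nn_integral_add) (auto simp: W_def)
    also have "(\<integral>\<^sup>+ x. indicator (- U) x * E k (indicator U) x \<partial>lborel) = W k"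
      using E_selfadjoint[of "indicator (- U)" "indicator U" k] by (simp add: W_def mult.commute)
    also have "ennreal (norm c) * (W k + W k) = ennreal (2 * norm c) * W k"
      by (simp add: ennreal_mult mult_2[symmetric] ac_simps)
    finally show ?thesis .
  qed
  have "(\<lambda>k. ennreal (2 * norm c) * W k) \<longlonglongrightarrow> ennreal (2 * norm c) * 0"
    by (intro ennreal_tendsto_cmult W0) simp
  then have lim: "(\<lambda>k. ennreal (2 * norm c) * W k) \<longlonglongrightarrow> 0" by simp
  show ?thesis
    by (rule tendsto_sandwich[OF _ _ tendsto_const lim]) (simp_all add: le)
qed

text \<open>A density argument: the property is stable under L^1 approximation
  (\<open>approx\<close>). Indicators are approximated by open sets through outer regularity, and
  general integrable functions by dominated convergence.\<close>

lemma osc_int_tendsto_0: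
  assumes shrink: "\<And>x S. open S \<Longrightarrow> x \<in> S \<Longrightarrow> \<exists>k. cell k x \<subseteq> S"
    and "integrable lborel f"
  shows "(\<lambda>k. osc_int k f) \<longlonglongrightarrow> 0"
proof -
  have approx: "(\<lambda>k. osc_int k f) \<longlonglongrightarrow> 0" if [measurable]: "f \<in> borel_measurable borel"
    and ap: "\<And>e. e > 0 \<Longrightarrow> \<exists>g\<in>borel_measurable borel. (\<lambda>k. osc_int k g) \<longlonglongrightarrow> 0 \<and>
      (\<integral>\<^sup>+ x. ennreal (norm (f x - g x)) \<partial>lborel) < ennreal e" for f :: "'a \<Rightarrow> complex"
  proof (rule order_tendstoI)
    \<comment> \<open>In \<open>osc_int_triangle\<close> an error e of the approximation counts
      twice; with e for the approximant itself this makes 3 e.\<close>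
    fix a :: ennreal assume "0 < a"
    then obtain e where e: "0 < e" "ennreal (3 * e) \<le> a"
    proof (cases a)
      case (real r)
      then show ?thesis using that[of "r / 3"] \<open>0 < a\<close> by simp
    next
      case top then show ?thesis using that[of 1] by simp
    qed
    obtain g where [measurable]: "g \<in> borel_measurable borel" and g: "(\<lambda>k. osc_int k g) \<longlonglongrightarrow> 0"
      "(\<integral>\<^sup>+ x. ennreal (norm (f x - g x)) \<partial>lborel) < ennreal e" using ap[OF e(1)] by blast
    have "\<forall>\<^sub>F k in sequentially. osc_int k g < ennreal e"
      using order_tendstoD(2)[OF g(1), of "ennreal e"] e by simp
    then show "\<forall>\<^sub>F k in sequentially. osc_int k f < a"
    proof eventually_elim
      case (elim k)
      have "osc_int k f \<le> osc_int k g + 2 * (\<integral>\<^sup>+ x. ennreal (norm (f x - g x)) \<partial>lborel)"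
        by (rule osc_int_triangle) auto
      also have "\<dots> \<le> osc_int k g + 2 * ennreal e"
        using g(2) by (intro add_left_mono mult_left_mono) auto
      also have "\<dots> < ennreal e + 2 * ennreal e"
        using elim e by (simp add: ennreal_mult_eq_top_iff)
      also have "\<dots> = ennreal (3 * e)"
      proof -
        have "2 * ennreal e = ennreal (2 * e)" using e by (simp add: ennreal_mult)
        then show ?thesis using e by (simp add: ennreal_plus[symmetric] del: ennreal_plus)
      qed
      finally show ?case using e by simp
    qed
  qed simp
  show ?thesis using assms(2)
  proof (induction rule: integrable_induct)
    case (base A c)
    show ?case
    proof (rule approx)
      show "(\<lambda>x. indicator A x *\<^sub>R c) \<in> borel_measurable borel" using base by simp
      fix e :: real assume e: "e > 0"
      define e' where "e' = e / (1 + norm c)"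
      have nc: "1 + norm c > 0" by (simp add: add_pos_nonneg)
      have e': "e' > 0" "norm c * e' < e" using e nc by (auto simp: e'_def field_simps)
      obtain U where U: "open U" "A \<subseteq> U" "emeasure lebesgue (U - A) < ennreal e'"
      proof -
        have "A \<in> sets lebesgue" using base by (simp add: sets_completionI_sets)
        then show ?thesis using sets_lebesgue_outer_open[of A e'] e'(1) that by metis
      qed
      have [measurable]: "U \<in> sets borel" "A \<in> sets borel" using U base by auto
      have UA: "emeasure lborel (U - A) < ennreal e'" using U(3) by (simp add: emeasure_completion)
      have "emeasure lborel U \<le> emeasure lborel A + emeasure lborel (U - A)"
        using emeasure_subadditive[of A lborel "U - A"] U(2) by (simp add: Un_absorb1)
      also have "\<dots> < top" using base UA by (auto simp: less_top[symmetric] top_unique)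
      finally have Ufin: "emeasure lborel U < top" .
      have "(\<integral>\<^sup>+ x. ennreal (norm (indicator A x *\<^sub>R c - indicator U x *\<^sub>R c)) \<partial>lborel)
        \<le> (\<integral>\<^sup>+ x. ennreal (norm c) * indicator (U - A) x \<partial>lborel)"
        using U(2) by (intro nn_integral_mono) (auto simp: indicator_def)
      also have "\<dots> = ennreal (norm c) * emeasure lborel (U - A)"
        by (simp add: nn_integral_cmult)
      also have "\<dots> \<le> ennreal (norm c) * ennreal e'" using UA by (intro mult_left_mono) auto
      also have "\<dots> < ennreal e" using e' e by (simp add: ennreal_mult'[symmetric] ennreal_lessI)
      finally show "\<exists>g\<in>borel_measurable borel. (\<lambda>k. osc_int k g) \<longlonglongrightarrow> 0 \<and>
         (\<integral>\<^sup>+ x. ennreal (norm (indicator A x *\<^sub>R c - g x)) \<partial>lborel) < ennreal e"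
        by (intro bexI[of _ "\<lambda>x. indicator U x *\<^sub>R c"] conjI osc_int_open[OF shrink U(1) Ufin]) auto
    qed
  next
    case (add f g)
    have [measurable]: "f \<in> borel_measurable borel" "g \<in> borel_measurable borel"
      using add(1,2) by auto
    have le: "osc_int k (\<lambda>x. f x + g x) \<le> osc_int k f + osc_int k g" for k
    proof -
      have "osc_int k (\<lambda>x. f x + g x) \<le> (\<integral>\<^sup>+ x. E k (\<lambda>y. ennreal (norm (f x - f y))) x + E k (\<lambda>y. ennreal (norm (g x - g y))) x \<partial>lborel)"
        unfolding osc_int_def
      proof (rule nn_integral_mono)
        fix x
        have "E k (\<lambda>y. ennreal (norm (f x + g x - (f y + g y)))) x \<le>
           E k (\<lambda>y. ennreal (norm (f x - f y)) + ennreal (norm (g x - g y))) x"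
          by (rule E_mono) (auto simp: ennreal_plus[symmetric] add_diff_add simp del: ennreal_plus
            intro!: ennreal_leI norm_triangle_ineq)
        then show "E k (\<lambda>y. ennreal (norm (f x + g x - (f y + g y)))) x \<le>
           E k (\<lambda>y. ennreal (norm (f x - f y))) x + E k (\<lambda>y. ennreal (norm (g x - g y))) x"
          by (simp add: E_add)
      qed
      also have "\<dots> = osc_int k f + osc_int k g"
        unfolding osc_int_def by (rule nn_integral_add) (use osc_int_measurable in auto)
      finally show ?thesis .
    qed
    have "(\<lambda>k. osc_int k f + osc_int k g) \<longlonglongrightarrow> 0 + 0" by (intro tendsto_add add.IH)
    then have lim: "(\<lambda>k. osc_int k f + osc_int k g) \<longlonglongrightarrow> 0" by simp
    show ?case
      by (rule tendsto_sandwich[OF _ _ tendsto_const lim]) (simp_all add: le)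
  next
    case (lim f s)
    have [measurable]: "f \<in> borel_measurable borel" "\<And>i. s i \<in> borel_measurable borel"
      using lim(1,4) by auto
    show ?case
    proof (rule approx)
      fix e :: real assume e: "e > 0"
      have "(\<lambda>i. \<integral>\<^sup>+ x. ennreal (norm (f x - s i x)) \<partial>lborel) \<longlonglongrightarrow> (\<integral>\<^sup>+ (x :: 'a). 0 \<partial>lborel)"
      proof (rule nn_integral_dominated_convergence[where w="\<lambda>x. ennreal (3 * norm (f x))"])
        show "AE x in lborel. ennreal (norm (f x - s j x)) \<le> ennreal (3 * norm (f x))" for j
        proof (intro AE_I2 ennreal_leI)
          fix x
          have "norm (s j x) \<le> 2 * norm (f x)" using lim(3) by simp
          then show "norm (f x - s j x) \<le> 3 * norm (f x)" using norm_triangle_ineq4[of "f x" "s j x"] by linarith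
        qed
        have "integrable lborel (\<lambda>x. 3 * norm (f x))" using lim(4) by auto
        then show "(\<integral>\<^sup>+ x. ennreal (3 * norm (f x)) \<partial>lborel) < \<infinity>"
          by (subst nn_integral_eq_integral) auto
        show "AE x in lborel. (\<lambda>j. ennreal (norm (f x - s j x))) \<longlonglongrightarrow> 0"
        proof (intro AE_I2)
          fix x
          have "(\<lambda>j. norm (f x - s j x)) \<longlonglongrightarrow> norm (f x - f x)"
            by (intro tendsto_intros lim(2)) simp
          then show "(\<lambda>j. ennreal (norm (f x - s j x))) \<longlonglongrightarrow> 0"
            using tendsto_ennrealI by fastforce
        qed
      qed auto
      then have "\<forall>\<^sub>F i in sequentially. (\<integral>\<^sup>+ x. ennreal (norm (f x - s i x)) \<partial>lborel) < ennreal e"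
        using order_tendstoD(2)[of _ 0 sequentially "ennreal e"] e by simp
      then obtain i where "(\<integral>\<^sup>+ x. ennreal (norm (f x - s i x)) \<partial>lborel) < ennreal e"
        by (auto simp: eventually_sequentially)
      then show "\<exists>g\<in>borel_measurable borel. (\<lambda>k. osc_int k g) \<longlonglongrightarrow> 0 \<and>
         (\<integral>\<^sup>+ x. ennreal (norm (f x - g x)) \<partial>lborel) < ennreal e"
        by (intro bexI[of _ "s i"] conjI lim.IH) auto
    qed auto
  qed
qed

section \<open>Complex cell means and their convergence almost everywhere\<close>

definition cell_mean :: "('a \<Rightarrow> complex) \<Rightarrow> nat \<Rightarrow> 'a \<Rightarrow> complex" where
  "cell_mean b k x = (LINT y|lborel. indicator (cell k x) y *\<^sub>R b y) /\<^sub>R v k"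

lemma cell_mean_adapted: "adapted k (cell_mean b k)"
  unfolding adapted_def cell_mean_def using cell_eq by metis

lemma cell_mean_measurable [measurable]:
  assumes [measurable]: "b \<in> borel_measurable borel"
  shows "cell_mean b k \<in> borel_measurable borel"
proof -
  note [measurable] = cell_measurable
  have "(\<lambda>(x, y). indicator (cell k x) y *\<^sub>R b y) = (\<lambda>z. indicator {z. snd z \<in> cell k (fst z)} z *\<^sub>R b (snd z))"
    by (auto simp: fun_eq_iff indicator_def)
  also have "\<dots> \<in> borel_measurable (borel \<Otimes>\<^sub>M lborel)" by measurable
  finally have "(\<lambda>x. LINT y|lborel. indicator (cell k x) y *\<^sub>R b y) \<in> borel_measurable borel"
    by (rule lborel.borel_measurable_lebesgue_integral)
  then show ?thesis unfolding cell_mean_def by measurable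
qed

lemma cell_mean_diff_le:
  assumes "integrable lborel (\<lambda>y. indicator (cell k x) y *\<^sub>R b y)"
  shows "ennreal (norm (cell_mean b k x - c)) \<le> E k (\<lambda>y. ennreal (norm (b y - c))) x"
proof -
  have ic: "integrable lborel (\<lambda>y. indicator (cell k x) y *\<^sub>R c)"
    using emeasure_cell[of k x] by (intro integrable_scaleR_left) (auto simp: integrable_indicator_iff)
  have "measure lborel (cell k x) = v k" using emeasure_cell[of k x] v_pos[of k] by (simp add: measure_def)
  then have "(LINT y|lborel. indicator (cell k x) y *\<^sub>R c) = v k *\<^sub>R c"
    using emeasure_cell[of k x] by (subst integral_scaleR_left) (auto simp: integrable_indicator_iff)
  then have c: "c = (LINT y|lborel. indicator (cell k x) y *\<^sub>R c) /\<^sub>R v k"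
    using less_imp_neq[OF v_pos[of k], symmetric] by simp
  have "cell_mean b k x - c = (LINT y|lborel. indicator (cell k x) y *\<^sub>R b y - indicator (cell k x) y *\<^sub>R c) /\<^sub>R v k"
    by (subst c) (simp add: cell_mean_def Bochner_Integration.integral_diff[OF assms ic] scaleR_diff_right)
  also have "(\<lambda>y. indicator (cell k x) y *\<^sub>R b y - indicator (cell k x) y *\<^sub>R c) = (\<lambda>y. indicator (cell k x) y *\<^sub>R (b y - c))"
    by (simp add: scaleR_diff_right)
  finally have eq: "cell_mean b k x - c = (LINT y|lborel. indicator (cell k x) y *\<^sub>R (b y - c)) /\<^sub>R v k" .
  have "integrable lborel (\<lambda>y. indicator (cell k x) y *\<^sub>R (b y - c))"
    using Bochner_Integration.integrable_diff[OF assms ic] by (simp add: scaleR_diff_right)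
  from integral_norm_bound_ennreal[OF this]
  have n: "ennreal (norm (LINT y|lborel. indicator (cell k x) y *\<^sub>R (b y - c))) \<le>
      (\<integral>\<^sup>+ y. ennreal (norm (indicator (cell k x) y *\<^sub>R (b y - c))) \<partial>lborel)" .
  have "ennreal (norm (cell_mean b k x - c)) = ennreal (1 / v k) * ennreal (norm (LINT y|lborel. indicator (cell k x) y *\<^sub>R (b y - c)))"
    unfolding eq by (simp add: divide_inverse abs_of_pos, subst ennreal_mult) (auto simp: less_imp_le)
  also have "\<dots> \<le> ennreal (1 / v k) * (\<integral>\<^sup>+ y. ennreal (norm (indicator (cell k x) y *\<^sub>R (b y - c))) \<partial>lborel)"
    by (intro mult_left_mono n) auto
  also have "\<dots> = (\<integral>\<^sup>+ y. ennreal (1 / v k) * ennreal (norm (indicator (cell k x) y *\<^sub>R (b y - c))) \<partial>lborel)"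
  proof (rule nn_integral_cmult[symmetric])
    have [measurable]: "(\<lambda>y. indicator (cell k x) y *\<^sub>R (b y - c)) \<in> borel_measurable lborel"
      by (rule borel_measurable_integrable) fact
    show "(\<lambda>y. ennreal (norm (indicator (cell k x) y *\<^sub>R (b y - c)))) \<in> borel_measurable lborel"
      by measurable
  qed
  also have "\<dots> = E k (\<lambda>y. ennreal (norm (b y - c))) x"
    unfolding E_def ker_def by (intro nn_integral_cong) (simp add: indicator_def)
  finally show ?thesis .
qed

text \<open>A substitute for Lebesgue differentiation: the cell means converge in L^1, hence almost
  everywhere along a subsequence. As b is only locally integrable, this is done on one top cell, and
  the subsequence depends on that cell.\<close>

lemma cell_mean_AE_subseq:
  assumes shrink: "\<And>x S. open S \<Longrightarrow> x \<in> S \<Longrightarrow> \<exists>k. cell k x \<subseteq> S"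
    and [measurable]: "b \<in> borel_measurable borel"
    and int: "\<And>k x. integrable lborel (\<lambda>y. indicator (cell k x) y *\<^sub>R b y)"
  shows "\<exists>r :: nat \<Rightarrow> nat. strict_mono r \<and> (AE x in lborel. x \<in> cell 0 z \<longrightarrow> (\<lambda>n. cell_mean b (r n) x) \<longlonglongrightarrow> b x)"
proof -
  define f where "f y = indicator (cell 0 z) y *\<^sub>R b y" for y
  have [measurable]: "f \<in> borel_measurable borel" unfolding f_def by measurable
  have intf: "integrable lborel (\<lambda>y. indicator (cell k x) y *\<^sub>R f y)" for k x
  proof -
    have "integrable lborel (\<lambda>y. indicator (cell k x) y *\<^sub>R (indicator (cell 0 z) y *\<^sub>R b y))"
      by (rule integrable_mult_indicator) (use int in auto)
    then show ?thesis by (simp add: f_def)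
  qed
  have cell_mean_f: "cell_mean b k x = cell_mean f k x" if "x \<in> cell 0 z" for k x
  proof -
    have "cell k x \<subseteq> cell 0 z" using cell_antimono[of 0 k x] cell_eq[OF that] by auto
    then have "(\<lambda>y. indicator (cell k x) y *\<^sub>R f y) = (\<lambda>y. indicator (cell k x) y *\<^sub>R b y)"
      by (auto simp: f_def indicator_def fun_eq_iff)
    then show ?thesis by (simp add: cell_mean_def)
  qed
  have le: "(\<integral>\<^sup>+ x. ennreal (norm (cell_mean f k x - f x)) \<partial>lborel) \<le> osc_int k f" for k
    unfolding osc_int_def
  proof (rule nn_integral_mono)
    fix x
    have "ennreal (norm (cell_mean f k x - f x)) \<le> E k (\<lambda>y. ennreal (norm (f y - f x))) x"
      by (rule cell_mean_diff_le[OF intf])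
    then show "ennreal (norm (cell_mean f k x - f x)) \<le> E k (\<lambda>y. ennreal (norm (f x - f y))) x"
      by (simp add: norm_minus_commute)
  qed
  have "integrable lborel f" using int[of 0 z] by (simp add: f_def[abs_def])
  from osc_int_tendsto_0[OF shrink this]
  have O0: "(\<lambda>k. osc_int k f) \<longlonglongrightarrow> 0" .
  then have "\<forall>\<^sub>F k in sequentially. osc_int k f < 1" using order_tendstoD(2)[OF O0, of 1] by simp
  \<comment> \<open>From level N on the oscillation is below 1, which makes every \<open>u n\<close>
    integrable.\<close>
  then obtain N where N: "\<And>k. k \<ge> N \<Longrightarrow> osc_int k f < 1" by (auto simp: eventually_sequentially)
  define u where "u n x = cell_mean f (n + N) x - f x" for n x
  have iu: "integrable lborel (u n)" for n
  proof (rule integrableI_bounded)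
    show "u n \<in> borel_measurable lborel" unfolding u_def by measurable
    have "(\<integral>\<^sup>+ x. ennreal (norm (u n x)) \<partial>lborel) \<le> osc_int (n + N) f" unfolding u_def by (rule le)
    also have "\<dots> < 1" by (rule N) simp
    also have "(1 :: ennreal) < \<infinity>" by simp
    finally show "(\<integral>\<^sup>+ x. ennreal (norm (u n x)) \<partial>lborel) < \<infinity>" .
  qed
  have "(\<lambda>n. \<integral>\<^sup>+ x. ennreal (norm (u n x)) \<partial>lborel) \<longlonglongrightarrow> 0"
  proof (rule tendsto_sandwich[OF _ _ tendsto_const])
    show "(\<lambda>n. osc_int (n + N) f) \<longlonglongrightarrow> 0" using O0 by (rule LIMSEQ_ignore_initial_segment)
    show "\<forall>\<^sub>F n in sequentially. (\<integral>\<^sup>+ x. ennreal (norm (u n x)) \<partial>lborel) \<le> osc_int (n + N) f"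
      unfolding u_def using le by simp
  qed simp
  moreover have "(\<integral>\<^sup>+ x. ennreal (norm (u n x)) \<partial>lborel) = ennreal (\<integral> x. norm (u n x) \<partial>lborel)" for n
    using iu[of n] by (intro nn_integral_eq_integral) auto
  ultimately have "(\<lambda>n. ennreal (\<integral> x. norm (u n x) \<partial>lborel)) \<longlonglongrightarrow> ennreal 0" by simp
  then have "(\<lambda>n. (\<integral> x. norm (u n x) \<partial>lborel)) \<longlonglongrightarrow> 0"
    by (subst (asm) tendsto_ennreal_iff) auto
  from tendsto_L1_AE_subseq[OF iu this]
  obtain r :: "nat \<Rightarrow> nat" where r: "strict_mono r" "AE x in lborel. (\<lambda>n. u (r n) x) \<longlonglongrightarrow> 0" by blast
  have "AE x in lborel. x \<in> cell 0 z \<longrightarrow> (\<lambda>n. cell_mean b (r n + N) x) \<longlonglongrightarrow> b x"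
    using r(2)
  proof eventually_elim
    case (elim x)
    show ?case
    proof
      assume x: "x \<in> cell 0 z"
      have "(\<lambda>n. u (r n) x + f x) \<longlonglongrightarrow> 0 + f x" by (intro tendsto_add elim tendsto_const)
      then show "(\<lambda>n. cell_mean b (r n + N) x) \<longlonglongrightarrow> b x"
        using x by (simp add: u_def cell_mean_f) (simp add: f_def)
    qed
  qed
  moreover have "strict_mono (\<lambda>n. r n + N)" using r(1) by (simp add: strict_mono_def)
  ultimately show ?thesis by (intro exI[of _ "\<lambda>n. r n + N"]) auto
qed

end

section \<open>Functions of bounded mean oscillation on a filtration\<close>

text \<open>Here \<Theta> bounds the mean oscillation over the cells, and \<open>shrink\<close>
  ensures that the cell means recover b almost everywhere along a subsequence.\<close>

locale bmo_filtration = filtration cell v D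
  for cell :: "nat \<Rightarrow> 'a::euclidean_space \<Rightarrow> 'a set" and v D +
  fixes b :: "'a \<Rightarrow> complex" and \<Theta> :: real
  assumes b_measurable [measurable]: "b \<in> borel_measurable borel"
    and b_integrable: "\<And>k x. integrable lborel (\<lambda>y. indicator (cell k x) y *\<^sub>R b y)"
    and \<Theta>_pos: "\<Theta> > 0"
    and b_osc: "\<And>k x. E k (\<lambda>y. ennreal (norm (b y - cell_mean b k y))) x \<le> ennreal \<Theta>"
    and shrink: "\<And>x S. open S \<Longrightarrow> x \<in> S \<Longrightarrow> \<exists>k. cell k x \<subseteq> S"
begin

definition osc :: "nat \<Rightarrow> 'a \<Rightarrow> ennreal" where
  "osc k y = ennreal (norm (b y - cell_mean b k y))"

text \<open>Stand-in for \<open>osc k\<close> at finite depth: b is replaced by its mean at level K,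
  so that stopping arguments run over finitely many levels. \<open>subseq_limit\<close> recovers
  \<open>osc k\<close>.\<close>

definition mean_diff :: "nat \<Rightarrow> nat \<Rightarrow> 'a \<Rightarrow> ennreal" where
  "mean_diff K k y = ennreal (norm (cell_mean b K y - cell_mean b k y))"

lemma osc_measurable [measurable]: "osc k \<in> borel_measurable borel"
  unfolding osc_def by measurable

lemma mean_diff_measurable [measurable]: "mean_diff K k \<in> borel_measurable borel"
  unfolding mean_diff_def by measurable

lemma E_osc: "E k (osc k) x \<le> ennreal \<Theta>"
  using b_osc[of k x] by (simp add: osc_def[abs_def])

lemma mean_diff_self [simp]: "mean_diff k k y = 0"
  by (simp add: mean_diff_def)

lemma mean_diff_triangle: "mean_diff K k y \<le> mean_diff K i y + mean_diff i k y"
  unfolding mean_diff_def by (simp add: ennreal_plus[symmetric] norm_triangle_ineq[of "cell_mean b K y - cell_mean b i y" "cell_mean b i y - cell_mean b k y", simplified] ennreal_leI del: ennreal_plus)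

lemma mean_diff_le_E_osc:
  assumes "k \<le> i" shows "mean_diff i k x \<le> E i (osc k) x"
proof -
  have "mean_diff i k x \<le> E i (\<lambda>y. ennreal (norm (b y - cell_mean b k x))) x"
    unfolding mean_diff_def by (rule cell_mean_diff_le[OF b_integrable])
  also have "\<dots> = E i (osc k) x"
  proof (rule E_cong)
    fix y assume "y \<in> cell i x"
    then have "y \<in> cell k x" using cell_antimono[OF assms] by auto
    then show "ennreal (norm (b y - cell_mean b k x)) = osc k y"
      using adaptedD[OF cell_mean_adapted] by (simp add: osc_def)
  qed
  finally show ?thesis .
qed

lemma osc_stop_small:
  "E k (indicator {x. \<exists>i\<in>{k<..K}. E i (osc k) x > ennreal (4 * \<Theta>)}) x \<le> ennreal (1/4)"
proof -
  have "ennreal 4 * E k (osc k) y \<le> ennreal (4 * \<Theta>)" for y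
    using mult_left_mono[OF E_osc, of "ennreal 4" k y] \<Theta>_pos by (simp add: ennreal_mult)
  then have "E k (indicator {x. \<exists>i\<in>{k<..K}. E i (osc k) x > ennreal (4 * \<Theta>)}) x \<le>
      E k (indicator {x. \<exists>i\<in>{k<..K}. E i (osc k) x > ennreal 4 * E k (osc k) x}) x"
    by (intro E_mono) (auto simp: indicator_def intro: le_less_trans)
  also have "\<dots> \<le> ennreal (1/4)" by (rule maximal_weak_type) auto
  finally show ?thesis .
qed

text \<open>At the level before i the mean of \<open>osc k\<close> is still at most 4 \<Theta>;
  descending one level costs D, and the mean of \<open>osc k\<close> over a cell dominates the
  change of the cell mean of b.\<close>

lemma mean_diff_stop:
  assumes i: "k < i" and no: "\<And>j. j \<in> {k<..<i} \<Longrightarrow> \<not> E j (osc k) x > ennreal (4 * \<Theta>)"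
  shows "mean_diff i k x \<le> ennreal (4 * D * \<Theta>)"
proof -
  obtain j where j: "i = Suc j" "k \<le> j" using i by (cases i) auto
  have "mean_diff i k x \<le> E i (osc k) x" by (rule mean_diff_le_E_osc) (use i in auto)
  also have "\<dots> \<le> ennreal D * E j (osc k) x" unfolding j by (rule E_Suc_le) auto
  also have "E j (osc k) x \<le> ennreal (4 * \<Theta>)"
  proof (cases "j = k")
    case True
    have "E k (osc k) x \<le> ennreal \<Theta>" by (rule E_osc)
    also have "\<dots> \<le> ennreal (4 * \<Theta>)" using \<Theta>_pos by (intro ennreal_leI) auto
    finally show ?thesis using True by simp
  next
    case False
    then show ?thesis using no[of j] j by auto
  qed
  also have "ennreal D * ennreal (4 * \<Theta>) = ennreal (4 * D * \<Theta>)"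
    using D_ge_1 \<Theta>_pos by (simp add: ennreal_mult'[symmetric] ac_simps)
  finally show ?thesis by (simp add: mult_left_mono)
qed

lemma \<Theta>_le_D: "ennreal (4 * \<Theta>) \<le> ennreal (4 * D * \<Theta>)"
  using D_ge_1 \<Theta>_pos by (intro ennreal_leI) simp

text \<open>A bilinear form of exponential integrability. The process stops when the mean of
  \<open>osc k\<close> exceeds 4 \<Theta>, which by the weak type bound happens on at most a quarter
  of the cell. Up to the stop the cell mean of b moves by at most 4 D \<Theta>, and the triangle
  inequality hands the remainder to the restarted process; \<open>stopping_principle\<close> doubles
  the constant.\<close>

lemma John_Nirenberg:
  assumes [measurable]: "g \<in> borel_measurable borel" and kK: "k \<le> K"
  shows "E k (\<lambda>y. mean_diff K k y * g y) x \<le> ennreal (8 * D * \<Theta>) * E k (Mx k K g) x"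
proof -
  define a where "a k y = ennreal (4 * D * \<Theta>) * g y" for k :: nat and y
  define c where "c k y = ennreal (4 * D * \<Theta>) * E k g y" for k y
  define B where "B k i x \<longleftrightarrow> E i (osc k) x > ennreal (4 * \<Theta>)" for k i x
  have [measurable]: "a k \<in> borel_measurable borel" "c k \<in> borel_measurable borel" for k
    unfolding a_def c_def by measurable
  have "E k (\<lambda>y. mean_diff K k y * g y) x \<le> 2 * E k (\<lambda>x. SUP i\<in>{k..K}. c i x) x"
  proof (rule stopping_principle[OF _ _ _ _ _ _ _ _ _ _ kK, where u="\<lambda>k y. mean_diff K k y * g y" and a=a and B=B])
    show "Measurable.pred borel (B k i)" for k i unfolding B_def by measurable
    show "adapted i (B k i)" for k i unfolding B_def by (rule adapted_compose[OF E_adapted])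
    show "adapted k (c k)" for k unfolding c_def by (rule adapted_compose[OF E_adapted])
    show "E k (indicator {x. \<exists>i\<in>{k<..K}. B k i x}) x \<le> ennreal (1/2)" for k x
      using osc_stop_small[of k K x] unfolding B_def by (rule order_trans) (rule ennreal_leI, simp)
    show "E k (a k) x \<le> c k x" for k x by (simp add: a_def[abs_def] c_def E_cmult)
    show "mean_diff K k x * g x \<le> a k x" if "k \<le> K" "\<And>i. i \<in> {k<..K} \<Longrightarrow> \<not> B k i x" for k x
    proof (cases "k = K")
      case False
      have "mean_diff K k x \<le> E K (osc k) x" by (rule mean_diff_le_E_osc[OF that(1)])
      also have "\<dots> \<le> ennreal (4 * \<Theta>)" using that(2)[of K] that(1) False by (auto simp: B_def)
      also note \<Theta>_le_D
      finally show ?thesis unfolding a_def by (intro mult_right_mono) auto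
    qed (simp add: a_def)
    show "mean_diff K k x * g x \<le> a k x + mean_diff K i x * g x"
      if i: "k < i" "i \<le> K" "B k i x" "\<And>j. j \<in> {k<..<i} \<Longrightarrow> \<not> B k j x" for k i x
    proof -
      have "mean_diff K k x \<le> mean_diff K i x + ennreal (4 * D * \<Theta>)"
        using mean_diff_triangle[of K k x i] mean_diff_stop[OF i(1), of x] i(4) by (auto simp: B_def intro: order_trans add_left_mono)
      then have "mean_diff K k x * g x \<le> (mean_diff K i x + ennreal (4 * D * \<Theta>)) * g x" by (intro mult_right_mono) auto
      then show ?thesis by (simp add: a_def distrib_right add.commute)
    qed
  qed auto
  also have "\<dots> \<le> 2 * E k (\<lambda>x. ennreal (4 * D * \<Theta>) * Mx k K g x) x"
    unfolding c_def by (intro mult_left_mono E_mono SUP_least) (auto intro: mult_left_mono Mx_upper)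
  also have "\<dots> = ennreal (8 * D * \<Theta>) * E k (Mx k K g) x"
  proof -
    have "2 * ennreal (4 * D * \<Theta>) = ennreal (8 * D * \<Theta>)"
      using D_ge_1 \<Theta>_pos ennreal_mult'[of 2 "4 * D * \<Theta>"] by (simp add: mult.assoc)
    then show ?thesis by (simp add: E_cmult mult.assoc[symmetric])
  qed
  finally show ?thesis .
qed

definition comm_max :: "nat \<Rightarrow> ('a \<Rightarrow> ennreal) \<Rightarrow> nat \<Rightarrow> 'a \<Rightarrow> ennreal" where
  "comm_max K f k y = (SUP i\<in>{k..K}. mean_diff K i y * E i f y)"

lemma comm_max_measurable [measurable]: "f \<in> borel_measurable borel \<Longrightarrow> comm_max K f k \<in> borel_measurable borel"
  unfolding comm_max_def by measurable

text \<open>Two stopping rules, each triggered on at most a quarter of the cell: large oscillation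
  of b, and growth of the mean of f by the factor 4. Before the stop every term of the supremum is
  at most 4 E_k f (|b_K - b_k| + 4 \<Theta>), and \<open>John_Nirenberg\<close> integrates the
  bracket against g. The constant is 2 * 4 * (8 + 4) D \<Theta>. The inner maximal function of g
  comes from \<open>John_Nirenberg\<close>, the outer one from the supremum over the levels.\<close>

lemma commutator_local:
  assumes [measurable]: "f \<in> borel_measurable borel" "g \<in> borel_measurable borel" and kK: "k \<le> K"
  shows "E k (\<lambda>y. comm_max K f k y * g y) x \<le> ennreal (96 * D * \<Theta>) * E k (\<lambda>y. Mx k K f y * Mx k K (Mx k K g) y) x"
proof -
  define a where "a k y = (4 * E k f y) * ((mean_diff K k y + ennreal (4 * \<Theta>)) * g y)" for k y
  define c where "c k y = ennreal (48 * D * \<Theta>) * E k f y * E k (Mx k K g) y" for k y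
  define B where "B k i x \<longleftrightarrow> E i (osc k) x > ennreal (4 * \<Theta>) \<or> E i f x > ennreal 4 * E k f x" for k i x
  have [measurable]: "a k \<in> borel_measurable borel" "c k \<in> borel_measurable borel" for k
    unfolding a_def c_def by measurable
  have "E k (\<lambda>y. comm_max K f k y * g y) x \<le> 2 * E k (\<lambda>x. SUP i\<in>{k..K}. c i x) x"
  proof (rule stopping_principle[OF _ _ _ _ _ _ _ _ _ _ kK, where u="\<lambda>k y. comm_max K f k y * g y" and a=a and B=B])
    show "Measurable.pred borel (B k i)" for k i unfolding B_def by measurable
    show "adapted i (B k i)" if "k < i" for k i
    proof -
      have "adapted i (\<lambda>x. E i (osc k) x > ennreal (4 * \<Theta>))" by (rule adapted_compose[OF E_adapted])
      moreover have "adapted i (\<lambda>x. E i f x > ennreal 4 * E k f x)"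
        by (rule adapted_compose2[OF E_adapted adapted_mono[OF E_adapted]]) (use that in auto)
      ultimately show ?thesis unfolding B_def by (rule adapted_compose2)
    qed
    show "adapted k (c k)" for k unfolding c_def
      by (rule adapted_compose2[OF adapted_compose[OF E_adapted] E_adapted])
    show "E k (indicator {x. \<exists>i\<in>{k<..K}. B k i x}) x \<le> ennreal (1/2)" for k x
    proof -
      let ?P = "{x. \<exists>i\<in>{k<..K}. E i (osc k) x > ennreal (4 * \<Theta>)}"
      let ?Q = "{x. \<exists>i\<in>{k<..K}. E i f x > ennreal 4 * E k f x}"
      have "E k (indicator {x. \<exists>i\<in>{k<..K}. B k i x}) x \<le> E k (\<lambda>x. indicator ?P x + indicator ?Q x) x"
        by (rule E_mono) (auto simp: B_def indicator_def)
      also have "\<dots> = E k (indicator ?P) x + E k (indicator ?Q) x" by (rule E_add) measurable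
      also have "\<dots> \<le> ennreal (1/4) + ennreal (1/4)"
        by (intro add_mono osc_stop_small maximal_weak_type) auto
      also have "\<dots> = ennreal (1/2)" by (subst ennreal_plus[symmetric]) auto
      finally show ?thesis .
    qed
    show "E k (a k) x \<le> c k x" if kK: "k \<le> K" for k x
    proof -
      have "E k (a k) x = (4 * E k f x) * E k (\<lambda>y. mean_diff K k y * g y + ennreal (4 * \<Theta>) * g y) x"
        unfolding a_def by (subst E_pull[OF adapted_compose[OF E_adapted]]) (auto simp: distrib_right)
      also have "\<dots> \<le> (4 * E k f x) * (ennreal (12 * D * \<Theta>) * E k (Mx k K g) x)"
      proof (rule mult_left_mono)
        have "E k g x = E k (E k g) x" by (simp add: E_tower)
        also have "\<dots> \<le> E k (Mx k K g) x" by (intro E_mono Mx_upper) (use kK in auto)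
        finally have g: "E k g x \<le> E k (Mx k K g) x" .
        have "E k (\<lambda>y. mean_diff K k y * g y + ennreal (4 * \<Theta>) * g y) x =
            E k (\<lambda>y. mean_diff K k y * g y) x + ennreal (4 * \<Theta>) * E k g x"
          by (simp add: E_add E_cmult)
        also have "\<dots> \<le> ennreal (8 * D * \<Theta>) * E k (Mx k K g) x + ennreal (4 * D * \<Theta>) * E k (Mx k K g) x"
          by (intro add_mono mult_mono John_Nirenberg kK \<Theta>_le_D g) auto
        also have "\<dots> = ennreal (12 * D * \<Theta>) * E k (Mx k K g) x"
          using D_ge_1 \<Theta>_pos by (simp add: distrib_right[symmetric] ennreal_plus[symmetric] del: ennreal_plus)
        finally show "E k (\<lambda>y. mean_diff K k y * g y + ennreal (4 * \<Theta>) * g y) x \<le> ennreal (12 * D * \<Theta>) * E k (Mx k K g) x" .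
      qed simp
      also have "\<dots> = (4 * ennreal (12 * D * \<Theta>)) * E k f x * E k (Mx k K g) x"
        by (simp add: ac_simps)
      also have "4 * ennreal (12 * D * \<Theta>) = ennreal (48 * D * \<Theta>)"
        using D_ge_1 \<Theta>_pos ennreal_mult'[of 4 "12 * D * \<Theta>"] by (simp add: mult.assoc)
      finally show ?thesis by (simp add: c_def)
    qed
    have tm: "mean_diff K j x * E j f x \<le> (4 * E k f x) * (mean_diff K k x + ennreal (4 * \<Theta>))"
      if "k \<le> j" "j > k \<Longrightarrow> \<not> B k j x" for k j x
    proof (cases "j = k")
      case True
      have "mean_diff K k x * E k f x \<le> (mean_diff K k x + ennreal (4 * \<Theta>)) * (4 * E k f x)"
      proof (intro mult_mono)
        have "1 * E k f x \<le> 4 * E k f x" by (intro mult_right_mono) auto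
        then show "E k f x \<le> 4 * E k f x" by simp
      qed (auto intro: add_increasing2)
      then show ?thesis using True by (simp add: mult.commute)
    next
      case False
      have "mean_diff k j x \<le> ennreal (4 * \<Theta>)"
        using mean_diff_le_E_osc[OF that(1), of x] that False
        by (auto simp: B_def mean_diff_def norm_minus_commute not_less intro: order_trans)
      then have "mean_diff K j x \<le> mean_diff K k x + ennreal (4 * \<Theta>)"
        using mean_diff_triangle[of K j x k] by (auto intro: order_trans add_left_mono)
      moreover have "E j f x \<le> 4 * E k f x" using that False by (auto simp: B_def not_less)
      ultimately have "mean_diff K j x * E j f x \<le> (mean_diff K k x + ennreal (4 * \<Theta>)) * (4 * E k f x)"
        by (intro mult_mono) auto
      then show ?thesis by (simp add: mult.commute)
    qed
    show "comm_max K f k x * g x \<le> a k x" if "k \<le> K" "\<And>i. i \<in> {k<..K} \<Longrightarrow> \<not> B k i x" for k x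
    proof -
      have "comm_max K f k x \<le> (4 * E k f x) * (mean_diff K k x + ennreal (4 * \<Theta>))"
        unfolding comm_max_def by (intro SUP_least tm) (use that in auto)
      then have "comm_max K f k x * g x \<le> (4 * E k f x) * (mean_diff K k x + ennreal (4 * \<Theta>)) * g x"
        by (intro mult_right_mono) auto
      then show ?thesis by (simp add: a_def mult.assoc)
    qed
    show "comm_max K f k x * g x \<le> a k x + comm_max K f i x * g x"
      if i: "k < i" "i \<le> K" "B k i x" "\<And>j. j \<in> {k<..<i} \<Longrightarrow> \<not> B k j x" for k i x
    proof -
      have "comm_max K f k x \<le> (4 * E k f x) * (mean_diff K k x + ennreal (4 * \<Theta>)) + comm_max K f i x"
        unfolding comm_max_def[of K f k]
      proof (rule SUP_least)
        fix j assume j: "j \<in> {k..K}"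
        show "mean_diff K j x * E j f x \<le> (4 * E k f x) * (mean_diff K k x + ennreal (4 * \<Theta>)) + comm_max K f i x"
        proof (cases "j < i")
          case True
          have "mean_diff K j x * E j f x \<le> (4 * E k f x) * (mean_diff K k x + ennreal (4 * \<Theta>))"
            by (rule tm) (use j i True in auto)
          then show ?thesis by (rule add_increasing2[OF zero_le])
        next
          case False
          have "mean_diff K j x * E j f x \<le> comm_max K f i x"
            unfolding comm_max_def by (rule SUP_upper) (use j False in auto)
          then show ?thesis by (rule add_increasing[OF zero_le])
        qed
      qed
      then have "comm_max K f k x * g x \<le> ((4 * E k f x) * (mean_diff K k x + ennreal (4 * \<Theta>)) + comm_max K f i x) * g x"
        by (intro mult_right_mono) auto
      then show ?thesis by (simp add: a_def distrib_right mult.assoc)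
    qed
  qed auto
  also have "\<dots> \<le> 2 * E k (\<lambda>x. ennreal (48 * D * \<Theta>) * (Mx k K f x * Mx k K (Mx k K g) x)) x"
  proof (intro mult_left_mono E_mono SUP_least)
    fix y i assume i: "i \<in> {k..K}"
    have "E i (Mx i K g) y \<le> E i (Mx k K g) y" by (intro E_mono Mx_level_mono) (use i in auto)
    also have "\<dots> \<le> Mx k K (Mx k K g) y" by (rule Mx_upper) (use i in auto)
    finally show "c i y \<le> ennreal (48 * D * \<Theta>) * (Mx k K f y * Mx k K (Mx k K g) y)"
      unfolding c_def mult.assoc using i by (intro mult_left_mono mult_mono Mx_upper) auto
  qed auto
  also have "\<dots> = ennreal (96 * D * \<Theta>) * E k (\<lambda>y. Mx k K f y * Mx k K (Mx k K g) y) x"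
  proof -
    have "2 * ennreal (48 * D * \<Theta>) = ennreal (96 * D * \<Theta>)"
      using D_ge_1 \<Theta>_pos ennreal_mult'[of 2 "48 * D * \<Theta>"] by (simp add: mult.assoc)
    then show ?thesis by (subst E_cmult, measurable) (simp only: mult.assoc[symmetric])
  qed
  finally show ?thesis .
qed

end

section \<open>Dyadic operators over all levels\<close>

context filtration
begin

definition dyadic_max :: "('a \<Rightarrow> ennreal) \<Rightarrow> 'a \<Rightarrow> ennreal" where
  "dyadic_max f x = (SUP K. Mx 0 K f x)"

definition dyadic_comm :: "('a \<Rightarrow> complex) \<Rightarrow> ('a \<Rightarrow> ennreal) \<Rightarrow> 'a \<Rightarrow> ennreal" where
  "dyadic_comm b f x = (SUP i. ennreal (norm (b x - cell_mean b i x)) * E i f x)"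

lemma dyadic_max_measurable [measurable]: "f \<in> borel_measurable borel \<Longrightarrow> dyadic_max f \<in> borel_measurable borel"
  unfolding dyadic_max_def by measurable

lemma dyadic_comm_measurable [measurable]:
  assumes [measurable]: "b \<in> borel_measurable borel" "f \<in> borel_measurable borel"
  shows "dyadic_comm b f \<in> borel_measurable borel"
  unfolding dyadic_comm_def by measurable

lemma Mx_le_dyadic_max: "Mx k K f x \<le> dyadic_max f x"
  unfolding dyadic_max_def by (rule SUP_upper2[of K]) (auto intro: Mx_level_mono)

lemma E_le_dyadic_max: "E k f x \<le> dyadic_max f x"
  using Mx_upper[of 0 k k f x] Mx_le_dyadic_max[of 0 k f x] by auto

lemma Mx_le_dyadic_max_dyadic_max: "Mx k K (Mx k K f) x \<le> dyadic_max (dyadic_max f) x"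
  by (rule order_trans[OF Mx_mono Mx_le_dyadic_max]) (rule Mx_le_dyadic_max)

end

context bmo_filtration
begin

lemma subseq_limit:
  "\<exists>r :: nat \<Rightarrow> nat. (\<forall>n. n \<le> r n) \<and>
    (AE y in lborel. y \<in> cell 0 z \<longrightarrow> (\<forall>i. (\<lambda>n. mean_diff (r n) i y) \<longlonglongrightarrow> osc i y))"
proof -
  obtain r :: "nat \<Rightarrow> nat" where r: "strict_mono r"
    "AE y in lborel. y \<in> cell 0 z \<longrightarrow> (\<lambda>n. cell_mean b (r n) y) \<longlonglongrightarrow> b y"
    using cell_mean_AE_subseq[OF shrink b_measurable b_integrable, of z] by blast
  have "AE y in lborel. y \<in> cell 0 z \<longrightarrow> (\<forall>i. (\<lambda>n. mean_diff (r n) i y) \<longlonglongrightarrow> osc i y)"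
    using r(2)
  proof eventually_elim
    case (elim y)
    show ?case unfolding mean_diff_def osc_def
      by (intro impI allI tendsto_ennrealI tendsto_norm tendsto_diff tendsto_const) (use elim in auto)
  qed
  then show ?thesis using seq_suble[OF r(1)] by blast
qed

lemma liminf_le_const:
  fixes u :: "nat \<Rightarrow> ennreal"
  assumes "\<And>n. n \<ge> n0 \<Longrightarrow> u n \<le> C" shows "liminf u \<le> C"
proof -
  have "limsup u \<le> C"
    by (rule Limsup_bounded) (use assms in \<open>auto simp: eventually_sequentially\<close>)
  then show ?thesis using Liminf_le_Limsup[of sequentially u] by (auto intro: order_trans)
qed

text \<open>Fatou's lemma along the subsequence of \<open>subseq_limit\<close> removes the
  truncation from \<open>John_Nirenberg\<close>.\<close>

lemma osc_bound:
  assumes [measurable]: "f \<in> borel_measurable borel"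
  shows "E i (\<lambda>y. osc i y * f y) x \<le> ennreal (8 * D * \<Theta>) * E i (dyadic_max f) x"
proof -
  obtain r :: "nat \<Rightarrow> nat" where r: "\<And>n. r n \<ge> n"
    "AE y in lborel. y \<in> cell 0 x \<longrightarrow> (\<forall>i. (\<lambda>n. mean_diff (r n) i y) \<longlonglongrightarrow> osc i y)"
    using subseq_limit[of x] by blast
  have "E i (\<lambda>y. osc i y * f y) x \<le> (\<integral>\<^sup>+ y. liminf (\<lambda>n. ker i x y * (mean_diff (r n) i y * f y)) \<partial>lborel)"
    unfolding E_def
  proof (rule nn_integral_mono_AE)
    show "AE y in lborel. ker i x y * (osc i y * f y) \<le> liminf (\<lambda>n. ker i x y * (mean_diff (r n) i y * f y))"
      using r(2)
    proof eventually_elim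
      case (elim y)
      show ?case
      proof (cases "y \<in> cell i x")
        case True
        then have "y \<in> cell 0 x" using cell_antimono[of 0 i x] by auto
        then have "(\<lambda>n. mean_diff (r n) i y) \<longlonglongrightarrow> osc i y" using elim by auto
        from Liminf_ennreal_mult_ge[OF this, of "ker i x y * f y"] show ?thesis by (simp add: ac_simps)
      qed (simp add: ker_eq_0)
    qed
  qed
  also have "\<dots> \<le> liminf (\<lambda>n. E i (\<lambda>y. mean_diff (r n) i y * f y) x)"
    unfolding E_def by (rule nn_integral_liminf) measurable
  also have "\<dots> \<le> ennreal (8 * D * \<Theta>) * E i (dyadic_max f) x"
  proof (rule liminf_le_const[of i])
    fix n assume n: "i \<le> n"
    have "E i (\<lambda>y. mean_diff (r n) i y * f y) x \<le> ennreal (8 * D * \<Theta>) * E i (Mx i (r n) f) x"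
      by (rule John_Nirenberg) (use n r(1)[of n] in auto)
    also have "\<dots> \<le> ennreal (8 * D * \<Theta>) * E i (dyadic_max f) x"
      by (intro mult_left_mono E_mono Mx_le_dyadic_max) auto
    finally show "E i (\<lambda>y. mean_diff (r n) i y * f y) x \<le> ennreal (8 * D * \<Theta>) * E i (dyadic_max f) x" .
  qed
  finally show ?thesis .
qed

text \<open>Fatou's lemma is applied in one top cell at a time, because the subsequence of
  \<open>subseq_limit\<close> depends on the cell; integrating the local bounds over all points
  gives the global one.\<close>

lemma commutator_bilinear:
  assumes [measurable]: "f \<in> borel_measurable borel" "g \<in> borel_measurable borel"
  shows "(\<integral>\<^sup>+ y. dyadic_comm b f y * g y \<partial>lborel) \<le> ennreal (96 * D * \<Theta>) * (\<integral>\<^sup>+ y. dyadic_max f y * dyadic_max (dyadic_max g) y \<partial>lborel)"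
proof -
  have local: "E 0 (\<lambda>y. dyadic_comm b f y * g y) x \<le> ennreal (96 * D * \<Theta>) * E 0 (\<lambda>y. dyadic_max f y * dyadic_max (dyadic_max g) y) x" for x
  proof -
    obtain r :: "nat \<Rightarrow> nat" where r: "\<And>n. r n \<ge> n"
      "AE y in lborel. y \<in> cell 0 x \<longrightarrow> (\<forall>i. (\<lambda>n. mean_diff (r n) i y) \<longlonglongrightarrow> osc i y)"
      using subseq_limit[of x] by blast
    have "E 0 (\<lambda>y. dyadic_comm b f y * g y) x \<le> (\<integral>\<^sup>+ y. liminf (\<lambda>n. ker 0 x y * (comm_max (r n) f 0 y * g y)) \<partial>lborel)"
      unfolding E_def
    proof (rule nn_integral_mono_AE)
      show "AE y in lborel. ker 0 x y * (dyadic_comm b f y * g y) \<le> liminf (\<lambda>n. ker 0 x y * (comm_max (r n) f 0 y * g y))"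
        using r(2)
      proof eventually_elim
        case (elim y)
        show ?case
        proof (cases "y \<in> cell 0 x")
          case True
          have "ker 0 x y * (dyadic_comm b f y * g y) = (SUP i. osc i y * (E i f y * (ker 0 x y * g y)))"
            unfolding dyadic_comm_def osc_def[symmetric]
            by (simp add: SUP_mult_right_ennreal SUP_mult_left_ennreal ac_simps)
          also have "\<dots> \<le> liminf (\<lambda>n. ker 0 x y * (comm_max (r n) f 0 y * g y))"
          proof (rule SUP_least)
            fix i
            have "(\<lambda>n. mean_diff (r n) i y) \<longlonglongrightarrow> osc i y" using elim True by auto
            then have "osc i y * (E i f y * (ker 0 x y * g y)) \<le> liminf (\<lambda>n. mean_diff (r n) i y * (E i f y * (ker 0 x y * g y)))"
              by (rule Liminf_ennreal_mult_ge)
            also have "\<dots> \<le> liminf (\<lambda>n. ker 0 x y * (comm_max (r n) f 0 y * g y))"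
            proof (rule Liminf_mono, rule eventually_sequentiallyI[of i])
              fix n assume n: "i \<le> n"
              then have "i \<le> r n" using r(1)[of n] by simp
              then have "mean_diff (r n) i y * E i f y \<le> comm_max (r n) f 0 y" unfolding comm_max_def by (intro SUP_upper) auto
              then have "ker 0 x y * ((mean_diff (r n) i y * E i f y) * g y) \<le> ker 0 x y * (comm_max (r n) f 0 y * g y)"
                by (intro mult_left_mono mult_right_mono) auto
              then show "mean_diff (r n) i y * (E i f y * (ker 0 x y * g y)) \<le> ker 0 x y * (comm_max (r n) f 0 y * g y)"
                by (simp add: ac_simps)
            qed
            finally show "osc i y * (E i f y * (ker 0 x y * g y)) \<le> liminf (\<lambda>n. ker 0 x y * (comm_max (r n) f 0 y * g y))" .
          qed
          finally show ?thesis .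
        qed (simp add: ker_eq_0)
      qed
    qed
    also have "\<dots> \<le> liminf (\<lambda>n. E 0 (\<lambda>y. comm_max (r n) f 0 y * g y) x)"
      unfolding E_def by (rule nn_integral_liminf) measurable
    also have "\<dots> \<le> ennreal (96 * D * \<Theta>) * E 0 (\<lambda>y. dyadic_max f y * dyadic_max (dyadic_max g) y) x"
    proof (rule liminf_le_const[of 0])
      fix n :: nat
      have "E 0 (\<lambda>y. comm_max (r n) f 0 y * g y) x \<le> ennreal (96 * D * \<Theta>) * E 0 (\<lambda>y. Mx 0 (r n) f y * Mx 0 (r n) (Mx 0 (r n) g) y) x"
        by (rule commutator_local) auto
      also have "\<dots> \<le> ennreal (96 * D * \<Theta>) * E 0 (\<lambda>y. dyadic_max f y * dyadic_max (dyadic_max g) y) x"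
        by (intro mult_left_mono E_mono mult_mono Mx_le_dyadic_max Mx_le_dyadic_max_dyadic_max) auto
      finally show "E 0 (\<lambda>y. comm_max (r n) f 0 y * g y) x \<le> ennreal (96 * D * \<Theta>) * E 0 (\<lambda>y. dyadic_max f y * dyadic_max (dyadic_max g) y) x" .
    qed
    finally show ?thesis .
  qed
  have "(\<integral>\<^sup>+ y. dyadic_comm b f y * g y \<partial>lborel) = (\<integral>\<^sup>+ x. E 0 (\<lambda>y. dyadic_comm b f y * g y) x \<partial>lborel)"
    by (simp add: nn_integral_E)
  also have "\<dots> \<le> (\<integral>\<^sup>+ x. ennreal (96 * D * \<Theta>) * E 0 (\<lambda>y. dyadic_max f y * dyadic_max (dyadic_max g) y) x \<partial>lborel)"
    by (intro nn_integral_mono local)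
  also have "\<dots> = ennreal (96 * D * \<Theta>) * (\<integral>\<^sup>+ y. dyadic_max f y * dyadic_max (dyadic_max g) y \<partial>lborel)"
    by (simp add: nn_integral_cmult nn_integral_E)
  finally show ?thesis .
qed

end

section \<open>Dyadic maximal commutators on mixed-norm spaces\<close>

abbreviation gdyadic_max :: "'a::euclidean_space \<Rightarrow> real \<Rightarrow> ('a \<Rightarrow> ennreal) \<Rightarrow> 'a \<Rightarrow> ennreal" where
  "gdyadic_max \<tau> l \<equiv> filtration.dyadic_max (gcell \<tau> l) (gvol DIM('a) l)"

abbreviation gdyadic_comm :: "'a::euclidean_space \<Rightarrow> real \<Rightarrow> ('a \<Rightarrow> complex) \<Rightarrow> ('a \<Rightarrow> ennreal) \<Rightarrow> 'a \<Rightarrow> ennreal" where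
  "gdyadic_comm \<tau> l \<equiv> filtration.dyadic_comm (gcell \<tau> l) (gvol DIM('a) l)"

abbreviation gcell_mean :: "'a::euclidean_space \<Rightarrow> real \<Rightarrow> ('a \<Rightarrow> complex) \<Rightarrow> nat \<Rightarrow> 'a \<Rightarrow> complex" where
  "gcell_mean \<tau> l \<equiv> filtration.cell_mean (gcell \<tau> l) (gvol DIM('a) l)"

abbreviation gbmo :: "'a::euclidean_space \<Rightarrow> real \<Rightarrow> ('a \<Rightarrow> complex) \<Rightarrow> real \<Rightarrow> bool" where
  "gbmo \<tau> l \<equiv> bmo_filtration (gcell \<tau> l) (gvol DIM('a) l) (2 ^ DIM('a))"

theorem dyadic_dyadic_max_bounded:
  fixes p :: "'n::{finite,linorder} \<Rightarrow> real"
  assumes p: "\<And>a. p a > 1"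
  shows "\<exists>C\<ge>1. \<forall>(\<tau> :: real ^ 'n::{finite,linorder}) l f x. l > 0 \<longrightarrow> f \<in> borel_measurable borel \<longrightarrow>
    mnorm p coords (gdyadic_max \<tau> l f) x \<le> ennreal C * mnorm p coords f x"
proof -
  obtain C where C: "C \<ge> 1" "\<And>(\<tau> :: real ^ 'n::{finite,linorder}) l k K f x. l > 0 \<Longrightarrow> f \<in> borel_measurable borel \<Longrightarrow>
    mnorm p coords (gMx \<tau> l k K f) x \<le> ennreal C * mnorm p coords f x"
    using dyadic_maximal_bounded[where p=p, OF p] by blast
  show ?thesis
  proof (intro exI[of _ C] conjI allI impI)
    fix \<tau> x :: "real ^ 'n::{finite,linorder}" and l :: real and f :: "real ^ 'n::{finite,linorder} \<Rightarrow> ennreal"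
    assume l: "l > 0" and f: "f \<in> borel_measurable borel"
    interpret filtration "gcell \<tau> l" "gvol DIM(real ^ 'n::{finite,linorder}) l" "2 ^ DIM(real ^ 'n::{finite,linorder})"
      by (rule gcell_filtration[OF l])
    have "mnorm p coords (\<lambda>x. SUP K. Mx 0 K f x) x = (SUP K. mnorm p coords (Mx 0 K f) x)"
    proof (rule mnorm_SUP)
      show "incseq (\<lambda>K. Mx 0 K f)" by (auto simp: incseq_def le_fun_def intro: Mx_level_mono)
    qed (use f less_trans[OF zero_less_one p] in auto)
    also have "\<dots> \<le> ennreal C * mnorm p coords f x"
      by (intro SUP_least C(2) l f)
    finally show "mnorm p coords (gdyadic_max \<tau> l f) x \<le> ennreal C * mnorm p coords f x"
      by (simp add: dyadic_max_def[abs_def])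
  qed (use C in auto)
qed

text \<open>By duality and \<open>commutator_bilinear\<close>, the maximal function of f is
  estimated with the exponents p and the twofold maximal function of g with the conjugate ones. The
  constant is linear in \<Theta> and independent of the grid.\<close>

theorem dyadic_commutator_bounded:
  fixes p :: "'n::{finite,linorder} \<Rightarrow> real"
  assumes p: "\<And>a. p a > 1"
  shows "\<exists>C\<ge>1. \<forall>(\<tau> :: real ^ 'n::{finite,linorder}) l b \<Theta> f x. l > 0 \<longrightarrow> gbmo \<tau> l b \<Theta> \<longrightarrow> f \<in> borel_measurable borel \<longrightarrow>
    mnorm p coords (gdyadic_comm \<tau> l b f) x \<le> ennreal (C * \<Theta>) * mnorm p coords f x"
proof -
  define q where "q a = p a / (p a - 1)" for a
  have q: "1 / p a + 1 / q a = 1" for a using p[of a] by (simp add: q_def field_simps)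
  have q1: "q a > 1" for a by (rule conj_exponent(1)[OF p q])
  obtain C where C: "C \<ge> 1" "\<And>(\<tau> :: real ^ 'n::{finite,linorder}) l f x. l > 0 \<Longrightarrow> f \<in> borel_measurable borel \<Longrightarrow>
    mnorm p coords (gdyadic_max \<tau> l f) x \<le> ennreal C * mnorm p coords f x"
    using dyadic_dyadic_max_bounded[where p=p, OF p] by blast
  obtain C' where C': "C' \<ge> 1" "\<And>(\<tau> :: real ^ 'n::{finite,linorder}) l f x. l > 0 \<Longrightarrow> f \<in> borel_measurable borel \<Longrightarrow>
    mnorm q coords (gdyadic_max \<tau> l f) x \<le> ennreal C' * mnorm q coords f x"
    using dyadic_dyadic_max_bounded[where p=q, OF q1] by blast
  define D where "D = (2 :: real) ^ DIM(real ^ 'n::{finite,linorder})"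
  have D1: "D \<ge> 1" by (simp add: D_def)
  define c where "c = 96 * D * C * C' * C'"
  have c: "c \<ge> 1"
  proof -
    have "1 * 1 * 1 * 1 * 1 \<le> 96 * D * C * C' * C'"
      using D1 C(1) C'(1) by (intro mult_mono) auto
    then show ?thesis by (simp add: c_def)
  qed
  show ?thesis
  proof (intro exI[of _ c] conjI allI impI c)
    fix \<tau> x :: "real ^ 'n::{finite,linorder}" and l :: real and b \<Theta>
      and f :: "real ^ 'n::{finite,linorder} \<Rightarrow> ennreal"
    assume l: "l > 0" and "gbmo \<tau> l b \<Theta>" and f [measurable]: "f \<in> borel_measurable borel"
    interpret bmo_filtration "gcell \<tau> l" "gvol DIM(real ^ 'n::{finite,linorder}) l" D b \<Theta>
      unfolding D_def by fact
    show "mnorm p coords (gdyadic_comm \<tau> l b f) x \<le> ennreal (c * \<Theta>) * mnorm p coords f x"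
    proof (rule mnorm_le_dual[OF _ p q])
      fix g :: "real ^ 'n::{finite,linorder} \<Rightarrow> ennreal"
      assume g [measurable]: "g \<in> borel_measurable borel" and g1: "\<And>y. mnorm q coords g y \<le> 1"
      have "iint coords (\<lambda>x. dyadic_comm b f x * g x) x = (\<integral>\<^sup>+ y. dyadic_comm b f y * g y \<partial>lborel)"
        by (rule iint_eq_lborel) auto
      also have "\<dots> \<le> ennreal (96 * D * \<Theta>) * (\<integral>\<^sup>+ y. dyadic_max f y * dyadic_max (dyadic_max g) y \<partial>lborel)"
        by (rule commutator_bilinear) auto
      also have "(\<integral>\<^sup>+ y. dyadic_max f y * dyadic_max (dyadic_max g) y \<partial>lborel) = iint coords (\<lambda>y. dyadic_max f y * dyadic_max (dyadic_max g) y) x"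
        by (rule iint_eq_lborel[symmetric]) auto
      also have "\<dots> \<le> mnorm p coords (dyadic_max f) x * mnorm q coords (dyadic_max (dyadic_max g)) x"
        by (rule mnorm_pairing[OF p q]) auto
      also have "\<dots> \<le> (ennreal C * mnorm p coords f x) * (ennreal C' * (ennreal C' * 1))"
      proof (intro mult_mono C(2) l f)
        have "mnorm q coords (dyadic_max (dyadic_max g)) x \<le> ennreal C' * mnorm q coords (dyadic_max g) x" by (intro C'(2) l) measurable
        also have "\<dots> \<le> ennreal C' * (ennreal C' * mnorm q coords g x)" by (intro mult_left_mono C'(2) l g) auto
        also have "\<dots> \<le> ennreal C' * (ennreal C' * 1)" by (intro mult_left_mono g1) auto
        finally show "mnorm q coords (dyadic_max (dyadic_max g)) x \<le> ennreal C' * (ennreal C' * 1)" .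
      qed auto
      also have "ennreal (96 * D * \<Theta>) * ((ennreal C * mnorm p coords f x) * (ennreal C' * (ennreal C' * 1))) =
          (ennreal (96 * D * \<Theta>) * ennreal C * ennreal C' * ennreal C') * mnorm p coords f x"
        by (simp add: ac_simps)
      also have "ennreal (96 * D * \<Theta>) * ennreal C * ennreal C' * ennreal C' = ennreal (c * \<Theta>)"
        using D1 C(1) C'(1) \<Theta>_pos by (simp add: ennreal_mult[symmetric] c_def ac_simps)
      finally show "iint coords (\<lambda>x. dyadic_comm b f x * g x) x \<le> ennreal (c * \<Theta>) * mnorm p coords f x"
        by (simp add: mult_left_mono)
    qed auto
  qed
qed

section \<open>Balls and shifted grids\<close>

text \<open>Fatou's lemma for mixed norms. It leads from grids of finite top scale, which see only
  balls of bounded radius, to all balls.\<close>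

lemma mnorm_liminf_le:
  fixes W :: "nat \<Rightarrow> real ^ 'n::finite \<Rightarrow> ennreal"
  assumes p: "\<And>j. j \<in> set js \<Longrightarrow> p j > 0" and [measurable]: "\<And>n. W n \<in> borel_measurable borel"
    and le: "\<And>y. G y \<le> liminf (\<lambda>n. W n y)" and bd: "\<And>n. mnorm p js (W n) x \<le> C"
  shows "mnorm p js G x \<le> C"
proof -
  have "mnorm p js G x \<le> mnorm p js (\<lambda>y. SUP N. INF n\<in>{N..}. W n y) x"
    by (intro mnorm_mono p le[unfolded liminf_SUP_INF])
  also have "\<dots> = (SUP N. mnorm p js (\<lambda>y. INF n\<in>{N..}. W n y) x)"
  proof (rule mnorm_SUP[OF p])
    show "incseq (\<lambda>N y. INF n\<in>{N..}. W n y)"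
      by (auto simp: incseq_def le_fun_def intro!: INF_superset_mono)
  qed measurable
  also have "\<dots> \<le> C"
  proof (rule SUP_least)
    fix N
    have "mnorm p js (\<lambda>y. INF n\<in>{N..}. W n y) x \<le> mnorm p js (W N) x"
      by (intro mnorm_mono p INF_lower) auto
    then show "mnorm p js (\<lambda>y. INF n\<in>{N..}. W n y) x \<le> C" using bd by (rule order_trans)
  qed
  finally show ?thesis .
qed

text \<open>Grid points of two grids shifted by a third of the top scale stay at a distance of at least a third
  of the mesh at every level, because no power of two is divisible by three.\<close>

lemma floor_shifted_eq:
  fixes x r l :: real
  assumes l: "l > 0" and r: "6 * r \<le> l / 2 ^ k"
  shows "(\<forall>y. \<bar>y - x\<bar> < r \<longrightarrow> \<lfloor>(y - 0) * 2 ^ k / l\<rfloor> = \<lfloor>(x - 0) * 2 ^ k / l\<rfloor>) \<or>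
    (\<forall>y. \<bar>y - x\<bar> < r \<longrightarrow> \<lfloor>(y - l / 3) * 2 ^ k / l\<rfloor> = \<lfloor>(x - l / 3) * 2 ^ k / l\<rfloor>)"
proof (rule ccontr)
  define L where "L = l / 2 ^ k"
  have L: "L > 0" "z * 2 ^ k / l = z / L" for z using l by (auto simp: L_def)
  \<comment> \<open>Different integer parts mean that a point of the grid shifted by t lies between
    x and y, hence within r of x.\<close>
  have near: "\<exists>m :: int. \<bar>of_int m * L + t - x\<bar> < r"
    if yt: "\<bar>y - x\<bar> < r" "\<lfloor>(y - t) / L\<rfloor> \<noteq> \<lfloor>(x - t) / L\<rfloor>" for y t
  proof -
    have up: "a < of_int \<lfloor>(z - t) / L\<rfloor> * L + t \<and> of_int \<lfloor>(z - t) / L\<rfloor> * L + t \<le> z"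
      if "\<lfloor>(a - t) / L\<rfloor> < \<lfloor>(z - t) / L\<rfloor>" for a z
    proof -
      obtain m where m: "\<lfloor>(z - t) / L\<rfloor> = m" "of_int m \<le> (z - t) / L" by (metis of_int_floor_le)
      have "(a - t) / L < of_int m" using that m(1) by (simp add: floor_less_iff)
      then have "a - t < of_int m * L" using L(1) by (simp add: pos_divide_less_eq)
      moreover have "of_int m * L \<le> z - t" using m(2) L(1) by (simp add: pos_le_divide_eq)
      ultimately show ?thesis unfolding m(1) by linarith
    qed
    consider "\<lfloor>(y - t) / L\<rfloor> < \<lfloor>(x - t) / L\<rfloor>" | "\<lfloor>(x - t) / L\<rfloor> < \<lfloor>(y - t) / L\<rfloor>" using yt(2) by linarith
    then show ?thesis
    proof cases
      case 1
      from up[OF this] yt(1) show ?thesis by (intro exI[of _ "\<lfloor>(x - t) / L\<rfloor>"]) linarith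
    next
      case 2
      from up[OF this] yt(1) show ?thesis by (intro exI[of _ "\<lfloor>(y - t) / L\<rfloor>"]) linarith
    qed
  qed
  assume "\<not> ?thesis"
  then obtain y1 y2 where y: "\<bar>y1 - x\<bar> < r" "\<lfloor>(y1 - 0) / L\<rfloor> \<noteq> \<lfloor>(x - 0) / L\<rfloor>"
    "\<bar>y2 - x\<bar> < r" "\<lfloor>(y2 - l / 3) / L\<rfloor> \<noteq> \<lfloor>(x - l / 3) / L\<rfloor>" unfolding L(2) by blast
  obtain m where m: "\<bar>of_int m * L + 0 - x\<bar> < r" using near[OF y(1,2)] by blast
  obtain m' where m': "\<bar>of_int m' * L + l / 3 - x\<bar> < r" using near[OF y(3,4)] by blast
  have "l = 2 ^ k * L" using l by (simp add: L_def)
  \<comment> \<open>If both grids had a point within r of x, the integer 3 (m - m') - 2^k would be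
    smaller than 1 in absolute value, hence zero.\<close>
  then have eq: "(of_int (3 * (m - m') - 2 ^ k) :: real) * L = 3 * ((of_int m * L + 0 - x) - (of_int m' * L + l / 3 - x))"
    by (simp add: algebra_simps)
  then have "\<bar>of_int (3 * (m - m') - 2 ^ k) * L\<bar> = 3 * \<bar>(of_int m * L + 0 - x) - (of_int m' * L + l / 3 - x)\<bar>"
    unfolding eq by (simp only: abs_mult abs_numeral)
  also have "\<dots> < 3 * (2 * r)"
    using m m' abs_triangle_ineq4[of "of_int m * L + 0 - x" "of_int m' * L + l / 3 - x"]
    by (smt (verit, ccfv_threshold))
  also have "\<dots> \<le> L" using r by (simp add: L_def)
  finally have "\<bar>of_int (3 * (m - m') - 2 ^ k) :: real\<bar> * L < 1 * L" using L(1) by (simp add: abs_mult)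
  then have "\<bar>of_int (3 * (m - m') - 2 ^ k) :: real\<bar> < 1" using L(1) by (simp only: mult_less_cancel_right_pos)
  then have "3 * (m - m') = (2 ^ k :: int)" by linarith
  then have "(3 :: int) dvd 2 ^ k" by (metis dvd_triv_left)
  moreover have "\<not> (3 :: int) dvd 2 ^ k"
  proof (induction k)
    case (Suc k)
    have "3 dvd x" if "3 dvd 2 * x" for x :: int using that by presburger
    from this[of "2 ^ k"] Suc show ?case unfolding power_Suc by blast
  qed simp
  ultimately show False by simp
qed

text \<open>The choice between the two grids is made in each coordinate separately, which gives 2^d
  grids in dimension d.\<close>

definition shift :: "('n::finite \<Rightarrow> bool) \<Rightarrow> real \<Rightarrow> real ^ 'n" where
  "shift \<alpha> l = (\<chi> i. if \<alpha> i then l / 3 else 0)"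

text \<open>The level k is the last one whose mesh is at least 6 r, so the mesh is below 12 r;
  \<open>floor_shifted_eq\<close> selects the shift in each coordinate.\<close>

lemma ball_subset_gcell:
  fixes x :: "real ^ 'n::finite"
  assumes r: "r > 0" "6 * r \<le> l"
  obtains k \<alpha> where "ball x r \<subseteq> gcell (shift \<alpha> l) l k x" "l / 2 ^ k \<le> 12 * r"
proof -
  have l: "l > 0" using r by linarith
  obtain n where "l / (6 * r) < 2 ^ n" using real_arch_pow[of 2 "l / (6 * r)"] by auto
  then have "l < 2 ^ n * (6 * r)" using r by (simp add: pos_divide_less_eq)
  also have "\<dots> \<le> 2 ^ Suc n * (6 * r)" using r by (intro mult_right_mono) auto
  finally have "l / 2 ^ Suc n < 6 * r" by (simp add: pos_divide_less_eq mult.commute)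
  then have ex: "\<exists>n. l / 2 ^ Suc n < 6 * r" by blast
  define k where "k = (LEAST n. l / 2 ^ Suc n < 6 * r)"
  have k1: "l / 2 ^ Suc k < 6 * r" unfolding k_def by (rule LeastI_ex[OF ex])
  have k2: "6 * r \<le> l / 2 ^ k"
  proof (cases k)
    case (Suc j)
    then show ?thesis using not_less_Least[of j "\<lambda>n. l / 2 ^ Suc n < 6 * r"] by (simp add: k_def[symmetric] del: power_Suc)
  qed (use r in simp)
  define \<alpha> where "\<alpha> i \<longleftrightarrow> \<not> (\<forall>y. \<bar>y - x $ i\<bar> < r \<longrightarrow> \<lfloor>(y - 0) * 2 ^ k / l\<rfloor> = \<lfloor>(x $ i - 0) * 2 ^ k / l\<rfloor>)" for i
  have "ball x r \<subseteq> gcell (shift \<alpha> l) l k x"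
  proof
    fix y assume "y \<in> ball x r"
    then have "norm (y - x) < r" by (simp add: dist_norm norm_minus_commute)
    then have yi: "\<bar>y $ i - x $ i\<bar> < r" for i
      using component_le_norm_cart[of "y - x" i] by simp
    have "y $ i \<in> gcell (shift \<alpha> l $ i) l k (x $ i)" for i
    proof (cases "\<alpha> i")
      case True
      then have "\<lfloor>(y $ i - l / 3) * 2 ^ k / l\<rfloor> = \<lfloor>(x $ i - l / 3) * 2 ^ k / l\<rfloor>"
        using floor_shifted_eq[OF l k2, of "x $ i"] yi[of i] unfolding \<alpha>_def by blast
      then show ?thesis unfolding gcell_def shift_def by (simp add: Basis_real_def True)
    next
      case False
      then have "\<lfloor>(y $ i - 0) * 2 ^ k / l\<rfloor> = \<lfloor>(x $ i - 0) * 2 ^ k / l\<rfloor>"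
        using yi[of i] unfolding \<alpha>_def by blast
      then show ?thesis unfolding gcell_def shift_def by (simp add: Basis_real_def False)
    qed
    then show "y \<in> gcell (shift \<alpha> l) l k x" by (simp add: gcell_vec)
  qed
  moreover have "l / 2 ^ k \<le> 12 * r" using k1 by (simp add: field_simps)
  ultimately show ?thesis using that by blast
qed

section \<open>Averages over balls\<close>

lemma emeasure_ball_vec:
  fixes x :: "real ^ 'n::finite"
  assumes "r \<ge> 0"
  shows "emeasure lborel (ball x r) = ennreal (unit_ball_vol (real CARD('n)) * r ^ CARD('n))"
  using emeasure_ball[OF assms, of x] by (simp add: DIM_real DIM_cart)

definition avg :: "(real ^ 'n \<Rightarrow> ennreal) \<Rightarrow> real ^ 'n \<Rightarrow> real \<Rightarrow> ennreal" where
  "avg f x r = (\<integral>\<^sup>+ y\<in>ball x r. f y \<partial>lborel) / emeasure lborel (ball x r)"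

lemma avg_alt:
  fixes x :: "real ^ 'n::finite"
  assumes "r > 0"
  shows "avg f x r = ennreal (1 / (unit_ball_vol (real CARD('n)) * r ^ CARD('n))) * (\<integral>\<^sup>+ y\<in>ball x r. f y \<partial>lborel)"
proof -
  have "unit_ball_vol (real CARD('n)) * r ^ CARD('n) > 0" using assms by simp
  then show ?thesis using assms
    by (simp add: avg_def emeasure_ball_vec divide_ennreal_def inverse_ennreal inverse_eq_divide mult.commute)
qed

text \<open>The cell from \<open>ball_subset_gcell\<close> has volume at most (12 r)^d in dimension
  d. It depends on the ball and on l and is chosen before g.\<close>

lemma ball_avg_le:
  fixes x :: "real ^ 'n::finite"
  assumes r: "r > 0" "6 * r \<le> l"
  shows "\<exists>\<alpha> k. \<forall>g\<in>borel_measurable borel.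
    avg g x r \<le> ennreal (12 ^ CARD('n) / unit_ball_vol (real CARD('n))) * gE (shift \<alpha> l) l k g x"
proof -
  obtain k \<alpha> where k: "ball x r \<subseteq> gcell (shift \<alpha> l) l k x" "l / 2 ^ k \<le> 12 * r"
    by (rule ball_subset_gcell[OF r])
  have l: "l > 0" using r by linarith
  interpret filtration "gcell (shift \<alpha> l) l" "gvol DIM(real ^ 'n) l" "2 ^ DIM(real ^ 'n)"
    by (rule gcell_filtration[OF l])
  define w where "w = unit_ball_vol (real CARD('n))"
  have w: "w > 0" by (simp add: w_def)
  define V where "V = gvol DIM(real ^ 'n) l k"
  have V: "0 < V" "V \<le> 12 ^ CARD('n) * r ^ CARD('n)"
  proof -
    have "V = (l / 2 ^ k) ^ CARD('n)" by (simp add: V_def gvol_def DIM_cart DIM_real)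
    also have "\<dots> \<le> (12 * r) ^ CARD('n)" using l k(2) by (intro power_mono) auto
    finally show "V \<le> 12 ^ CARD('n) * r ^ CARD('n)" by (simp add: power_mult_distrib)
    show "V > 0" unfolding V_def by simp
  qed
  have c: "1 / (w * r ^ CARD('n)) \<le> (12 ^ CARD('n) / w) * (1 / V)"
  proof -
    have "1 / r ^ CARD('n) \<le> 12 ^ CARD('n) / V"
      using V r by (simp add: pos_le_divide_eq pos_divide_le_eq mult.commute)
    then have "(1 / r ^ CARD('n)) / w \<le> (12 ^ CARD('n) / V) / w" using w by (intro divide_right_mono) auto
    then show ?thesis by (simp add: mult.commute)
  qed
  have "avg g x r \<le> ennreal (12 ^ CARD('n) / w) * E k g x" if [measurable]: "g \<in> borel_measurable borel" for g
  proof -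
    have "avg g x r \<le> ennreal ((12 ^ CARD('n) / w) * (1 / V)) * (\<integral>\<^sup>+ y. indicator (gcell (shift \<alpha> l) l k x) y * g y \<partial>lborel)"
      unfolding avg_alt[OF r(1)] w_def[symmetric]
      by (rule mult_mono[OF ennreal_leI[OF c] nn_integral_mono]) (use k(1) in \<open>auto simp: indicator_def\<close>)
    also have "\<dots> = ennreal (12 ^ CARD('n) / w) * E k g x"
      using w V by (simp add: E_def ker_def V_def[symmetric] nn_integral_cmult mult.assoc ennreal_mult' del: times_divide_eq_right times_divide_eq_left)
    finally show ?thesis .
  qed
  then show ?thesis unfolding w_def by blast
qed

definition HL_max :: "(real ^ 'n \<Rightarrow> ennreal) \<Rightarrow> real ^ 'n \<Rightarrow> ennreal" where
  "HL_max f x = (SUP r\<in>{0<..}. avg f x r)"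

definition max_commutator :: "(real ^ 'n \<Rightarrow> complex) \<Rightarrow> (real ^ 'n \<Rightarrow> ennreal) \<Rightarrow> real ^ 'n \<Rightarrow> ennreal" where
  "max_commutator b f x = (SUP r\<in>{0<..}. avg (\<lambda>y. ennreal (norm (b x - b y)) * f y) x r)"

text \<open>Bounded mean oscillation of a Borel function over balls. The values m x r are arbitrary
  constants attached to the balls, so that the means of the original function can be kept when it is
  replaced by a Borel representative.\<close>

definition ball_bmo :: "(real ^ 'n \<Rightarrow> complex) \<Rightarrow> (real ^ 'n \<Rightarrow> real \<Rightarrow> complex) \<Rightarrow> real \<Rightarrow> bool" where
  "ball_bmo b m T \<longleftrightarrow> b \<in> borel_measurable borel \<and> T > 0 \<and>
    (\<forall>x r. integrable lborel (\<lambda>y. indicator (ball x r) y *\<^sub>R b y)) \<and>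
    (\<forall>x r. r > 0 \<longrightarrow> (\<integral>\<^sup>+ y\<in>ball x r. ennreal (norm (b y - m x r)) \<partial>lborel) \<le> ennreal (T * r ^ CARD('n)))"

lemma gcell_subset_ball:
  fixes x :: "real ^ 'n::finite"
  assumes "l > 0"
  shows "gcell \<tau> l k x \<subseteq> ball x (real CARD('n) * (l / 2 ^ k))"
proof
  fix y assume y: "y \<in> gcell \<tau> l k x"
  define L where "L = l / 2 ^ k"
  have L: "L > 0" using assms by (simp add: L_def)
  have "\<bar>y $ i - x $ i\<bar> < L" for i
  proof -
    have "y $ i \<in> gcell (\<tau> $ i) l k (x $ i)" using y by (simp add: gcell_vec)
    then have "\<lfloor>(y $ i - \<tau> $ i) / L\<rfloor> = \<lfloor>(x $ i - \<tau> $ i) / L\<rfloor>"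
      by (simp add: gcell_def Basis_real_def L_def)
    then have "\<bar>(y $ i - \<tau> $ i) / L - (x $ i - \<tau> $ i) / L\<bar> < 1" by linarith
    also have "(y $ i - \<tau> $ i) / L - (x $ i - \<tau> $ i) / L = (y $ i - x $ i) / L" by (simp add: diff_divide_distrib)
    finally show ?thesis using L by (simp add: pos_divide_less_eq)
  qed
  then have "(\<Sum>i\<in>UNIV. \<bar>(y - x) $ i\<bar>) < (\<Sum>i\<in>(UNIV :: 'n set). L)" by (intro sum_strict_mono) auto
  then have "norm (y - x) < real CARD('n) * L" using norm_le_l1_cart[of "y - x"] by simp
  then show "y \<in> ball x (real CARD('n) * (l / 2 ^ k))" by (simp add: dist_norm norm_minus_commute L_def)
qed

text \<open>In dimension d a cell of side L lies in the ball of radius d L about each of its points,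
  whence the factor d^d; the factor 2 is the price of replacing the constant of that ball by the
  cell mean.\<close>

lemma ball_bmo_gbmo:
  fixes b :: "real ^ 'n::finite \<Rightarrow> complex"
  assumes b: "ball_bmo b m T" and l: "l > 0"
  shows "gbmo \<tau> l b (2 * T * real CARD('n) ^ CARD('n))"
proof -
  interpret filtration "gcell \<tau> l" "gvol DIM(real ^ 'n) l" "2 ^ DIM(real ^ 'n)" by (rule gcell_filtration[OF l])
  have bm [measurable]: "b \<in> borel_measurable borel" and T: "T > 0"
    and int: "\<And>x r. integrable lborel (\<lambda>y. indicator (ball x r) y *\<^sub>R b y)"
    and osc: "\<And>x r. r > 0 \<Longrightarrow> (\<integral>\<^sup>+ y\<in>ball x r. ennreal (norm (b y - m x r)) \<partial>lborel) \<le> ennreal (T * r ^ CARD('n))"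
    using b by (auto simp: ball_bmo_def)
  have intc: "integrable lborel (\<lambda>y. indicator (gcell \<tau> l k x) y *\<^sub>R b y)" for k x
  proof -
    let ?B = "ball x (real CARD('n) * (l / 2 ^ k))"
    have "integrable lborel (\<lambda>y. indicator (gcell \<tau> l k x) y *\<^sub>R (indicator ?B y *\<^sub>R b y))"
      by (rule integrable_mult_indicator) (use int in auto)
    moreover have "(\<lambda>y. indicator (gcell \<tau> l k x) y *\<^sub>R (indicator ?B y *\<^sub>R b y)) = (\<lambda>y. indicator (gcell \<tau> l k x) y *\<^sub>R b y)"
      using gcell_subset_ball[OF l, of \<tau> k x] by (auto simp: indicator_def fun_eq_iff)
    ultimately show ?thesis by simp
  qed
  show ?thesis
  proof
    fix k and x :: "real ^ 'n"
    show "0 < 2 * T * real CARD('n) ^ CARD('n)" using T by simp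
    show "integrable lborel (\<lambda>y. indicator (gcell \<tau> l k x) y *\<^sub>R b y)" by (rule intc)
    define L where "L = l / 2 ^ k"
    define R where "R = real CARD('n) * L"
    define c where "c = m x R"
    have L: "L > 0" "R > 0" using l by (auto simp: L_def R_def)
    have V: "gvol DIM(real ^ 'n) l k = L ^ CARD('n)" by (simp add: gvol_def L_def DIM_cart DIM_real)
    have 1: "E k (\<lambda>y. ennreal (norm (b y - c))) x \<le> ennreal (T * real CARD('n) ^ CARD('n))"
    proof -
      have "E k (\<lambda>y. ennreal (norm (b y - c))) x = ennreal (1 / L ^ CARD('n)) *
          (\<integral>\<^sup>+ y. indicator (gcell \<tau> l k x) y * ennreal (norm (b y - c)) \<partial>lborel)"
        by (simp add: E_def ker_def V nn_integral_cmult mult.assoc)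
      also have "\<dots> \<le> ennreal (1 / L ^ CARD('n)) * (\<integral>\<^sup>+ y\<in>ball x R. ennreal (norm (b y - c)) \<partial>lborel)"
        using gcell_subset_ball[OF l, of \<tau> k x] by (intro mult_left_mono nn_integral_mono) (auto simp: indicator_def R_def L_def)
      also have "\<dots> \<le> ennreal (1 / L ^ CARD('n)) * ennreal (T * R ^ CARD('n))"
        unfolding c_def by (intro mult_left_mono osc L) auto
      also have "\<dots> = ennreal (1 / L ^ CARD('n) * (T * R ^ CARD('n)))"
        using L by (subst ennreal_mult') auto
      also have "1 / L ^ CARD('n) * (T * R ^ CARD('n)) = T * real CARD('n) ^ CARD('n)"
        using L by (simp add: R_def power_mult_distrib)
      finally show ?thesis .
    qed
    have "E k (\<lambda>y. ennreal (norm (b y - cell_mean b k y))) x \<le>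
        E k (\<lambda>y. ennreal (norm (b y - c)) + ennreal (norm (cell_mean b k x - c))) x"
    proof (rule E_mono)
      fix y assume "y \<in> gcell \<tau> l k x"
      then have "cell_mean b k y = cell_mean b k x" by (rule adaptedD[OF cell_mean_adapted])
      then show "ennreal (norm (b y - cell_mean b k y)) \<le> ennreal (norm (b y - c)) + ennreal (norm (cell_mean b k x - c))"
        using norm_triangle_ineq4[of "b y - c" "cell_mean b k x - c"]
        by (simp add: ennreal_plus[symmetric] ennreal_leI del: ennreal_plus)
    qed
    also have "\<dots> = E k (\<lambda>y. ennreal (norm (b y - c))) x + ennreal (norm (cell_mean b k x - c))"
      by (simp add: E_add)
    also have "\<dots> \<le> ennreal (T * real CARD('n) ^ CARD('n)) + ennreal (T * real CARD('n) ^ CARD('n))"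
      by (intro add_mono 1 order_trans[OF cell_mean_diff_le[OF intc] 1])
    also have "\<dots> = ennreal (2 * T * real CARD('n) ^ CARD('n))"
      using T by (subst ennreal_plus[symmetric]) auto
    finally show "E k (\<lambda>y. ennreal (norm (b y - cell_mean b k y))) x \<le> ennreal (2 * T * real CARD('n) ^ CARD('n))" .
  next
    fix x :: "real ^ 'n" and S assume "open S" "x \<in> S"
    then obtain e where e: "e > 0" "ball x e \<subseteq> S" using openE by blast
    obtain k where "real CARD('n) * l / e < 2 ^ k" using real_arch_pow[of 2 "real CARD('n) * l / e"] by auto
    then have "real CARD('n) * (l / 2 ^ k) < e" using e by (simp add: pos_divide_less_eq mult.commute)
    then have "ball x (real CARD('n) * (l / 2 ^ k)) \<subseteq> ball x e" by auto
    then show "\<exists>k. gcell \<tau> l k x \<subseteq> S" using gcell_subset_ball[OF l, of \<tau> k x] e by blast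
  qed auto
qed

section \<open>Maximal operators over balls on mixed-norm spaces\<close>

definition nrm :: "('n::{finite,linorder} \<Rightarrow> real) \<Rightarrow> (real ^ 'n::{finite,linorder} \<Rightarrow> ennreal) \<Rightarrow> ennreal" where
  "nrm p f = mnorm p coords f 0"

lemma nrm_mono: "(\<And>a. p a > 0) \<Longrightarrow> (\<And>y. f y \<le> g y) \<Longrightarrow> nrm p f \<le> nrm p g"
  unfolding nrm_def by (rule mnorm_mono)

lemma nrm_cmult: "(\<And>a. p a > 0) \<Longrightarrow> f \<in> borel_measurable borel \<Longrightarrow> nrm p (\<lambda>x. c * f x) = c * nrm p f"
  unfolding nrm_def by (rule mnorm_cmult)

lemma nrm_zero [simp]: "nrm p (\<lambda>x. 0) = 0"
  by (simp add: nrm_def)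

lemma nrm_add:
  "(\<And>a. p a > 1) \<Longrightarrow> f \<in> borel_measurable borel \<Longrightarrow> g \<in> borel_measurable borel \<Longrightarrow>
    nrm p (\<lambda>x. f x + g x) \<le> nrm p f + nrm p g"
  unfolding nrm_def by (rule mnorm_add) auto

lemma nrm_sum:
  assumes "finite I" "\<And>a. p a > 1" "\<And>i. i \<in> I \<Longrightarrow> f i \<in> borel_measurable borel"
  shows "nrm p (\<lambda>x. \<Sum>i\<in>I. f i x) \<le> (\<Sum>i\<in>I. nrm p (f i))"
  using assms(1,3)
proof (induction I rule: finite_induct)
  case (insert i I)
  have "nrm p (\<lambda>x. f i x + (\<Sum>i\<in>I. f i x)) \<le> nrm p (f i) + nrm p (\<lambda>x. \<Sum>i\<in>I. f i x)"
    by (rule nrm_add[OF assms(2)]) (use insert in auto)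
  also have "\<dots> \<le> nrm p (f i) + (\<Sum>i\<in>I. nrm p (f i))" by (intro add_left_mono insert) (use insert in auto)
  finally show ?case using insert by simp
qed simp

lemma nrm_pairing:
  fixes f g :: "real ^ 'n::{finite,linorder} \<Rightarrow> ennreal"
  assumes "\<And>a. p a > 1" "\<And>a. 1 / p a + 1 / q a = 1"
    and [measurable]: "f \<in> borel_measurable borel" "g \<in> borel_measurable borel"
  shows "(\<integral>\<^sup>+ x. f x * g x \<partial>lborel) \<le> nrm p f * nrm q g"
proof -
  have "(\<integral>\<^sup>+ x. f x * g x \<partial>lborel) = iint coords (\<lambda>x. f x * g x) 0"
    by (rule iint_eq_lborel[symmetric]) auto
  also have "\<dots> \<le> nrm p f * nrm q g"
    unfolding nrm_def by (rule mnorm_pairing) (use assms in auto)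
  finally show ?thesis .
qed

lemma nrm_liminf_le:
  fixes W :: "nat \<Rightarrow> real ^ 'n::{finite,linorder} \<Rightarrow> ennreal"
  assumes "\<And>a. p a > 0" "\<And>n. W n \<in> borel_measurable borel"
    "\<And>y. G y \<le> liminf (\<lambda>n. W n y)" "\<And>n. nrm p (W n) \<le> C"
  shows "nrm p G \<le> C"
  unfolding nrm_def by (rule mnorm_liminf_le[of coords p W]) (use assms in \<open>auto simp: nrm_def\<close>)

text \<open>If the top scale is at least 6 r, an average over a ball of radius r is dominated by the
  dyadic maximal function of one of the shifted grids, hence by the sum \<open>W n\<close> over all
  shifts. Every r becomes admissible for large n, and the bounds do not depend on n.\<close>

theorem HL_max_bounded:
  fixes p :: "'n::{finite,linorder} \<Rightarrow> real"
  assumes p: "\<And>a. p a > 1"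
  shows "\<exists>C\<ge>1. \<forall>f\<in>borel_measurable borel. nrm p (HL_max f) \<le> ennreal C * nrm p f"
proof -
  have p0: "p a > 0" for a using p[of a] by simp
  obtain C where C: "C \<ge> 1" "\<And>(\<tau> :: real ^ 'n::{finite,linorder}) l f x. l > 0 \<Longrightarrow> f \<in> borel_measurable borel \<Longrightarrow>
    mnorm p coords (gdyadic_max \<tau> l f) x \<le> ennreal C * mnorm p coords f x"
    using dyadic_dyadic_max_bounded[where p=p, OF p] by blast
  define c1 where "c1 = (12 :: real) ^ CARD('n) / unit_ball_vol (real CARD('n))"
  have c1: "c1 > 0" by (simp add: c1_def)
  define N where "N = real (card (UNIV :: ('n \<Rightarrow> bool) set))"
  have N: "N \<ge> 0" by (simp add: N_def)
  define C' where "C' = max 1 (c1 * (N * C))"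
  show ?thesis
  proof (intro exI[of _ C'] conjI ballI)
    fix f :: "real ^ 'n::{finite,linorder} \<Rightarrow> ennreal" assume f [measurable]: "f \<in> borel_measurable borel"
    define ll where "ll n = real (Suc n)" for n
    have ll: "ll n > 0" for n by (simp add: ll_def)
    define W where "W n y = ennreal c1 * (\<Sum>\<alpha>\<in>UNIV. gdyadic_max (shift \<alpha> (ll n)) (ll n) f y)" for n y
    have Mm [measurable]: "gdyadic_max (shift \<alpha> (ll n)) (ll n) f \<in> borel_measurable borel" for n \<alpha>
      by (rule filtration.dyadic_max_measurable[OF gcell_filtration[OF ll]]) auto
    show "nrm p (HL_max f) \<le> ennreal C' * nrm p f"
    proof (rule nrm_liminf_le[OF p0, of W])
      show "W n \<in> borel_measurable borel" for n unfolding W_def by measurable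
      show "HL_max f y \<le> liminf (\<lambda>n. W n y)" for y
        unfolding HL_max_def
      proof (rule SUP_least)
        fix r :: real assume "r \<in> {0<..}"
        then have r: "r > 0" by simp
        obtain n0 :: nat where n0: "6 * r \<le> real n0" using real_arch_simple by blast
        show "avg f y r \<le> liminf (\<lambda>n. W n y)"
        proof (rule Liminf_bounded, rule eventually_sequentiallyI[of n0])
          fix n assume "n0 \<le> n"
          then have "6 * r \<le> ll n" using n0 by (simp add: ll_def)
          from ball_avg_le[OF r this, of y] obtain \<alpha> k where
            "avg f y r \<le> ennreal c1 * gE (shift \<alpha> (ll n)) (ll n) k f y"
            using f unfolding c1_def by blast
          also have "\<dots> \<le> ennreal c1 * gdyadic_max (shift \<alpha> (ll n)) (ll n) f y"
            by (intro mult_left_mono filtration.E_le_dyadic_max[OF gcell_filtration[OF ll]]) auto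
          also have "\<dots> \<le> W n y" unfolding W_def
            by (intro mult_left_mono member_le_sum) auto
          finally show "avg f y r \<le> W n y" .
        qed
      qed
      show "nrm p (W n) \<le> ennreal C' * nrm p f" for n
      proof -
        have "nrm p (W n) = ennreal c1 * nrm p (\<lambda>y. \<Sum>\<alpha>\<in>UNIV. gdyadic_max (shift \<alpha> (ll n)) (ll n) f y)"
          unfolding W_def by (rule nrm_cmult[OF p0]) measurable
        also have "\<dots> \<le> ennreal c1 * (\<Sum>(\<alpha> :: 'n \<Rightarrow> bool)\<in>UNIV. ennreal C * nrm p f)"
        proof (rule mult_left_mono)
          have "nrm p (\<lambda>y. \<Sum>\<alpha>\<in>UNIV. gdyadic_max (shift \<alpha> (ll n)) (ll n) f y)
            \<le> (\<Sum>\<alpha>\<in>UNIV. nrm p (gdyadic_max (shift \<alpha> (ll n)) (ll n) f))"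
            by (rule nrm_sum[OF _ p]) auto
          also have "\<dots> \<le> (\<Sum>(\<alpha> :: 'n \<Rightarrow> bool)\<in>UNIV. ennreal C * nrm p f)"
            unfolding nrm_def by (intro sum_mono C(2) f ll)
          finally show "nrm p (\<lambda>y. \<Sum>\<alpha>\<in>UNIV. gdyadic_max (shift \<alpha> (ll n)) (ll n) f y)
            \<le> (\<Sum>(\<alpha> :: 'n \<Rightarrow> bool)\<in>UNIV. ennreal C * nrm p f)" .
        qed simp
        also have "\<dots> = ennreal (c1 * (N * C)) * nrm p f"
          using C(1) c1 N by (simp add: N_def ennreal_mult ennreal_of_nat_eq_real_of_nat mult.assoc)
        also have "\<dots> \<le> ennreal C' * nrm p f"
          by (intro mult_right_mono ennreal_leI) (auto simp: C'_def)
        finally show ?thesis .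
      qed
    qed
  qed (simp add: C'_def)
qed

text \<open>On the cell Q containing the ball, |b(y) - b(u)| is at most |b(y) - b_Q| plus the
  oscillation of b at u, where b_Q is the cell mean. The first term leads to the dyadic commutator,
  the second, through \<open>osc_bound\<close>, to the twofold dyadic maximal function with e = 8 D
  \<Theta>.\<close>

theorem max_commutator_bounded:
  fixes p :: "'n::{finite,linorder} \<Rightarrow> real" and b :: "real ^ 'n::{finite,linorder} \<Rightarrow> complex"
  assumes p: "\<And>a. p a > 1" and b: "ball_bmo b m T"
  shows "\<exists>C\<ge>1. \<forall>f\<in>borel_measurable borel. nrm p (max_commutator b f) \<le> ennreal C * nrm p f"
proof -
  have p0: "p a > 0" for a using p[of a] by simp
  have T: "T > 0" and bm [measurable]: "b \<in> borel_measurable borel" using b by (auto simp: ball_bmo_def)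
  obtain C where C: "C \<ge> 1" "\<And>(\<tau> :: real ^ 'n::{finite,linorder}) l f x. l > 0 \<Longrightarrow> f \<in> borel_measurable borel \<Longrightarrow>
    mnorm p coords (gdyadic_max \<tau> l f) x \<le> ennreal C * mnorm p coords f x"
    using dyadic_dyadic_max_bounded[where p=p, OF p] by blast
  obtain H where H: "H \<ge> 1" "\<And>(\<tau> :: real ^ 'n::{finite,linorder}) l b \<Theta> f x. l > 0 \<Longrightarrow> gbmo \<tau> l b \<Theta> \<Longrightarrow> f \<in> borel_measurable borel \<Longrightarrow>
    mnorm p coords (gdyadic_comm \<tau> l b f) x \<le> ennreal (H * \<Theta>) * mnorm p coords f x"
    using dyadic_commutator_bounded[where p=p, OF p] by blast
  define \<Theta> where "\<Theta> = 2 * T * real CARD('n) ^ CARD('n)"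
  have \<Theta>: "\<Theta> > 0" using T by (simp add: \<Theta>_def)
  have gb: "gbmo \<tau> l b \<Theta>" if "l > 0" for \<tau> l
    unfolding \<Theta>_def by (rule ball_bmo_gbmo[OF b that])
  define c1 where "c1 = (12 :: real) ^ CARD('n) / unit_ball_vol (real CARD('n))"
  have c1: "c1 > 0" by (simp add: c1_def)
  define D where "D = (2 :: real) ^ DIM(real ^ 'n::{finite,linorder})"
  have D: "D > 0" by (simp add: D_def)
  define e where "e = 8 * D * \<Theta>"
  have e: "e > 0" using D \<Theta> by (simp add: e_def)
  define N where "N = real (card (UNIV :: ('n \<Rightarrow> bool) set))"
  have N: "N \<ge> 0" by (simp add: N_def)
  define C' where "C' = max 1 (c1 * (N * (H * \<Theta> + e * (C * C))))"
  show ?thesis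
  proof (intro exI[of _ C'] conjI ballI)
    fix f :: "real ^ 'n::{finite,linorder} \<Rightarrow> ennreal" assume f [measurable]: "f \<in> borel_measurable borel"
    define ll where "ll n = real (Suc n)" for n
    have ll: "ll n > 0" for n by (simp add: ll_def)
    define U where "U n \<alpha> y = gdyadic_comm (shift \<alpha> (ll n)) (ll n) b f y +
      ennreal e * gdyadic_max (shift \<alpha> (ll n)) (ll n) (gdyadic_max (shift \<alpha> (ll n)) (ll n) f) y" for n \<alpha> y
    define W where "W n y = ennreal c1 * (\<Sum>\<alpha>\<in>UNIV. U n \<alpha> y)" for n y
    have Mm [measurable]: "gdyadic_max (shift \<alpha> (ll n)) (ll n) h \<in> borel_measurable borel"
      if "h \<in> borel_measurable borel" for n \<alpha> h
      by (rule filtration.dyadic_max_measurable[OF gcell_filtration[OF ll]]) (use that in auto)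
    have Hm [measurable]: "gdyadic_comm (shift \<alpha> (ll n)) (ll n) b f \<in> borel_measurable borel" for n \<alpha>
      by (rule filtration.dyadic_comm_measurable[OF gcell_filtration[OF ll]]) auto
    have Um [measurable]: "U n \<alpha> \<in> borel_measurable borel" for n \<alpha> unfolding U_def by measurable
    show "nrm p (max_commutator b f) \<le> ennreal C' * nrm p f"
    proof (rule nrm_liminf_le[OF p0, of W])
      show "W n \<in> borel_measurable borel" for n unfolding W_def by measurable
      show "max_commutator b f y \<le> liminf (\<lambda>n. W n y)" for y
        unfolding max_commutator_def
      proof (rule SUP_least)
        fix r :: real assume "r \<in> {0<..}"
        then have r: "r > 0" by simp
        define g where "g u = ennreal (norm (b y - b u)) * f u" for u
        have gm: "g \<in> borel_measurable borel" unfolding g_def by measurable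
        obtain n0 :: nat where n0: "6 * r \<le> real n0" using real_arch_simple by blast
        have "avg g y r \<le> liminf (\<lambda>n. W n y)"
        proof (rule Liminf_bounded, rule eventually_sequentiallyI[of n0])
          fix n assume "n0 \<le> n"
          then have "6 * r \<le> ll n" using n0 by (simp add: ll_def)
          from ball_avg_le[OF r this, of y] obtain \<alpha> k where
            le: "avg g y r \<le> ennreal c1 * gE (shift \<alpha> (ll n)) (ll n) k g y"
            using gm unfolding c1_def by blast
          interpret bmo_filtration "gcell (shift \<alpha> (ll n)) (ll n)"
            "gvol DIM(real ^ 'n::{finite,linorder}) (ll n)" D b \<Theta>
            unfolding D_def by (rule gb[OF ll])
          have "E k g y \<le> E k (\<lambda>u. ennreal (norm (b y - cell_mean b k y)) * f u + osc k u * f u) y"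
          proof (rule E_mono)
            fix u assume "u \<in> gcell (shift \<alpha> (ll n)) (ll n) k y"
            then have "cell_mean b k u = cell_mean b k y" by (rule adaptedD[OF cell_mean_adapted])
            then have "ennreal (norm (b y - b u)) \<le> ennreal (norm (b y - cell_mean b k y)) + osc k u"
              using norm_triangle_ineq4[of "b y - cell_mean b k y" "b u - cell_mean b k y"] unfolding osc_def
              by (simp add: ennreal_plus[symmetric] ennreal_leI del: ennreal_plus)
            then show "g u \<le> ennreal (norm (b y - cell_mean b k y)) * f u + osc k u * f u"
              unfolding g_def by (metis distrib_right mult_right_mono zero_le)
          qed
          also have "\<dots> = ennreal (norm (b y - cell_mean b k y)) * E k f y + E k (\<lambda>u. osc k u * f u) y"
            by (simp add: E_add E_cmult)
          also have "\<dots> \<le> dyadic_comm b f y + ennreal e * dyadic_max (dyadic_max f) y"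
          proof (rule add_mono)
            show "ennreal (norm (b y - cell_mean b k y)) * E k f y \<le> dyadic_comm b f y"
              unfolding dyadic_comm_def by (rule SUP_upper) auto
            have "E k (\<lambda>u. osc k u * f u) y \<le> ennreal e * E k (dyadic_max f) y"
              unfolding e_def by (rule osc_bound) auto
            also have "\<dots> \<le> ennreal e * dyadic_max (dyadic_max f) y" by (intro mult_left_mono E_le_dyadic_max) auto
            finally show "E k (\<lambda>u. osc k u * f u) y \<le> ennreal e * dyadic_max (dyadic_max f) y" .
          qed
          also have "\<dots> = U n \<alpha> y" by (simp add: U_def)
          finally have "avg g y r \<le> ennreal c1 * U n \<alpha> y" using le by (meson mult_left_mono order_trans zero_le)
          also have "\<dots> \<le> W n y" unfolding W_def by (intro mult_left_mono member_le_sum) auto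
          finally show "avg g y r \<le> W n y" .
        qed
        then show "avg (\<lambda>u. ennreal (norm (b y - b u)) * f u) y r \<le> liminf (\<lambda>n. W n y)"
          by (simp add: g_def[abs_def])
      qed
      show "nrm p (W n) \<le> ennreal C' * nrm p f" for n
      proof -
        have Ub: "nrm p (U n \<alpha>) \<le> ennreal (H * \<Theta> + e * (C * C)) * nrm p f" for \<alpha>
        proof -
          let ?M = "gdyadic_max (shift \<alpha> (ll n)) (ll n)"
          have "nrm p (U n \<alpha>) \<le> nrm p (gdyadic_comm (shift \<alpha> (ll n)) (ll n) b f) + nrm p (\<lambda>y. ennreal e * ?M (?M f) y)"
            unfolding U_def by (rule nrm_add[OF p]) measurable
          also have "nrm p (\<lambda>y. ennreal e * ?M (?M f) y) = ennreal e * nrm p (?M (?M f))"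
            by (rule nrm_cmult[OF p0]) measurable
          also have "nrm p (gdyadic_comm (shift \<alpha> (ll n)) (ll n) b f) + ennreal e * nrm p (?M (?M f)) \<le>
              ennreal (H * \<Theta>) * nrm p f + ennreal e * (ennreal C * (ennreal C * nrm p f))"
          proof (intro add_mono mult_left_mono)
            show "nrm p (gdyadic_comm (shift \<alpha> (ll n)) (ll n) b f) \<le> ennreal (H * \<Theta>) * nrm p f"
              unfolding nrm_def by (rule H(2)[OF ll gb[OF ll] f])
            have "nrm p (?M (?M f)) \<le> ennreal C * nrm p (?M f)"
              unfolding nrm_def by (rule C(2)[OF ll]) auto
            also have "\<dots> \<le> ennreal C * (ennreal C * nrm p f)"
              unfolding nrm_def by (intro mult_left_mono C(2) f ll) auto
            finally show "nrm p (?M (?M f)) \<le> ennreal C * (ennreal C * nrm p f)" .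
          qed simp
          also have "\<dots> = ennreal (H * \<Theta> + e * (C * C)) * nrm p f"
            using H(1) \<Theta> e C(1) by (simp add: ennreal_mult distrib_right mult.assoc)
          finally show ?thesis .
        qed
        have "nrm p (W n) = ennreal c1 * nrm p (\<lambda>y. \<Sum>\<alpha>\<in>UNIV. U n \<alpha> y)"
          unfolding W_def by (rule nrm_cmult[OF p0]) measurable
        also have "\<dots> \<le> ennreal c1 * (\<Sum>(\<alpha> :: 'n \<Rightarrow> bool)\<in>UNIV. ennreal (H * \<Theta> + e * (C * C)) * nrm p f)"
        proof (rule mult_left_mono)
          have "nrm p (\<lambda>y. \<Sum>\<alpha>\<in>UNIV. U n \<alpha> y) \<le> (\<Sum>\<alpha>\<in>UNIV. nrm p (U n \<alpha>))"
            by (rule nrm_sum[OF _ p]) auto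
          also have "\<dots> \<le> (\<Sum>(\<alpha> :: 'n \<Rightarrow> bool)\<in>UNIV. ennreal (H * \<Theta> + e * (C * C)) * nrm p f)"
            by (intro sum_mono Ub)
          finally show "nrm p (\<lambda>y. \<Sum>\<alpha>\<in>UNIV. U n \<alpha> y)
            \<le> (\<Sum>(\<alpha> :: 'n \<Rightarrow> bool)\<in>UNIV. ennreal (H * \<Theta> + e * (C * C)) * nrm p f)" .
        qed simp
        also have "\<dots> = ennreal c1 * (ennreal N * (ennreal (H * \<Theta> + e * (C * C)) * nrm p f))"
          by (simp add: N_def ennreal_of_nat_eq_real_of_nat)
        also have "\<dots> = ennreal (c1 * (N * (H * \<Theta> + e * (C * C)))) * nrm p f"
          using C(1) c1 N H(1) \<Theta> e by (simp add: ennreal_mult mult.assoc del: ennreal_plus)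
        also have "\<dots> \<le> ennreal C' * nrm p f"
          by (intro mult_right_mono ennreal_leI) (auto simp: C'_def)
        finally show ?thesis .
      qed
    qed
  qed (simp add: C'_def)
qed

section \<open>Measurability of maximal functions\<close>

lemma ball_sets_borel [measurable]: "ball x r \<in> sets borel"
  by simp

lemma ennreal_SUP_prod_incseq:
  fixes a :: "'k \<Rightarrow> nat \<Rightarrow> ennreal"
  assumes "finite I" "\<And>k. k \<in> I \<Longrightarrow> incseq (a k)"
  shows "(SUP n. \<Prod>k\<in>I. a k n) = (\<Prod>k\<in>I. SUP n. a k n)"
  using assms
proof (induction I rule: finite_induct)
  case (insert k I)
  have "incseq (\<lambda>n. \<Prod>k\<in>I. a k n)"
    unfolding incseq_def
  proof (intro allI impI prod_mono_ennreal)
    fix m n :: nat and i assume "m \<le> n" "i \<in> I"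
    then show "a i m \<le> a i n" using insert.prems[of i] by (auto dest: incseqD)
  qed
  then have "(SUP n. a k n * (\<Prod>k\<in>I. a k n)) = (SUP n. a k n) * (SUP n. \<Prod>k\<in>I. a k n)"
    by (intro ennreal_SUP_mult_incseq) (use insert.prems in auto)
  then show ?case using insert by simp
qed simp

text \<open>The radii start at r / 2, so they are positive, and increase to r; because the ball is
  open, the smaller balls exhaust it.\<close>

lemma nn_integral_ball_SUP:
  fixes x :: "real ^ 'n::finite"
  assumes [measurable]: "h \<in> borel_measurable borel" and r: "r > 0"
  shows "(\<integral>\<^sup>+ y\<in>ball x r. h y \<partial>lborel) = (SUP j. \<integral>\<^sup>+ y\<in>ball x (r * (1 - 1 / real (j + 2))). h y \<partial>lborel)"
proof -
  have mono: "1 - 1 / real (i + 2) \<le> 1 - 1 / real (j + 2)" if "i \<le> j" for i j :: nat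
    using that by (simp add: frac_le)
  have "(SUP j. h y * indicator (ball x (r * (1 - 1 / real (j + 2)))) y) = h y * indicator (ball x r) y" for y
  proof (cases "y \<in> ball x r")
    case True
    then have "0 < 1 - dist x y / r" using r by simp
    then obtain j where j: "inverse (real (Suc j)) < 1 - dist x y / r" using reals_Archimedean by blast
    have "1 / real (j + 2) \<le> inverse (real (Suc j))" by (simp add: inverse_eq_divide frac_le)
    with j have "dist x y / r < 1 - 1 / real (j + 2)" by linarith
    then have "dist x y < r * (1 - 1 / real (j + 2))" using r by (simp add: pos_divide_less_eq mult.commute)
    then have "h y \<le> (SUP j. h y * indicator (ball x (r * (1 - 1 / real (j + 2)))) y)"
      by (intro SUP_upper2[of j]) auto
    moreover have "(SUP j. h y * indicator (ball x (r * (1 - 1 / real (j + 2)))) y) \<le> h y"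
      by (rule SUP_least) (auto simp: indicator_def)
    ultimately show ?thesis using True by simp
  next
    case False
    have "r * (1 - 1 / real (j + 2)) \<le> r" for j using r by (simp add: mult_le_cancel_left1)
    then have "y \<notin> ball x (r * (1 - 1 / real (j + 2)))" for j using False by (meson mem_ball not_less order_trans)
    then show ?thesis using False by simp
  qed
  then have "(\<integral>\<^sup>+ y\<in>ball x r. h y \<partial>lborel) = (\<integral>\<^sup>+ y. (SUP j. h y * indicator (ball x (r * (1 - 1 / real (j + 2)))) y) \<partial>lborel)"
    by simp
  also have "\<dots> = (SUP j. \<integral>\<^sup>+ y\<in>ball x (r * (1 - 1 / real (j + 2))). h y \<partial>lborel)"
  proof (rule nn_integral_monotone_convergence_SUP)
    show "incseq (\<lambda>j y. h y * indicator (ball x (r * (1 - 1 / real (j + 2)))) y)"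
      unfolding incseq_def le_fun_def
    proof (intro allI impI mult_left_mono)
      fix i j :: nat and y assume "i \<le> j"
      then have "r * (1 - 1 / real (i + 2)) \<le> r * (1 - 1 / real (j + 2))" using mono r by (intro mult_left_mono) auto
      then have "ball x (r * (1 - 1 / real (i + 2))) \<subseteq> ball x (r * (1 - 1 / real (j + 2)))" by (rule subset_ball)
      then show "(indicator (ball x (r * (1 - 1 / real (i + 2)))) y :: ennreal) \<le> indicator (ball x (r * (1 - 1 / real (j + 2)))) y"
        by (auto simp: indicator_def)
    qed simp
  qed measurable
  finally show ?thesis .
qed

text \<open>The uncountable supremum reduces to rational radii: the integrals over smaller balls
  increase to the one over the ball of radius r, while the normalising factor only grows as the
  radius shrinks. The functions h k may depend on the centre, as they do for the commutator.\<close>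

lemma SUP_prod_avg_measurable:
  fixes h :: "'k \<Rightarrow> real ^ 'n::finite \<Rightarrow> real ^ 'n \<Rightarrow> ennreal"
  assumes I: "finite I" and h: "\<And>k. k \<in> I \<Longrightarrow> case_prod (h k) \<in> borel_measurable (borel \<Otimes>\<^sub>M borel)"
  shows "(\<lambda>x. SUP r\<in>{0<..}. \<Prod>k\<in>I. avg (h k x) x r) \<in> borel_measurable borel"
proof -
  have hx: "h k x \<in> borel_measurable borel" if "k \<in> I" for k x
    using measurable_compose[OF _ h[OF that], of "\<lambda>y. (x, y)" borel] by simp
  have am: "(\<lambda>x. avg (h k x) x r) \<in> borel_measurable borel" if k: "k \<in> I" and r: "r > 0" for k r
  proof -
    note [measurable] = h[OF k]
    have "Measurable.pred (borel \<Otimes>\<^sub>M borel) (\<lambda>z :: (real ^ 'n) \<times> (real ^ 'n). dist (fst z) (snd z) < r)" by measurable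
    then have b: "{z :: (real ^ 'n) \<times> (real ^ 'n). dist (fst z) (snd z) < r} \<in> sets (borel \<Otimes>\<^sub>M borel)"
      by (simp add: pred_def space_pair_measure)
    note [measurable] = b
    have "(\<lambda>(x, y). h k x y * indicator (ball x r) y) = (\<lambda>z. case_prod (h k) z * indicator {z. dist (fst z) (snd z) < r} z)"
      by (auto simp: fun_eq_iff indicator_def)
    also have "\<dots> \<in> borel_measurable (borel \<Otimes>\<^sub>M lborel)" by measurable
    finally have "(\<lambda>x. \<integral>\<^sup>+ y\<in>ball x r. h k x y \<partial>lborel) \<in> borel_measurable borel"
      by (rule lborel.borel_measurable_nn_integral)
    then show ?thesis unfolding avg_alt[OF r] by measurable
  qed
  have "(SUP r\<in>{0<..}. \<Prod>k\<in>I. avg (h k x) x r) = (SUP r\<in>{0<..} \<inter> \<rat>. \<Prod>k\<in>I. avg (h k x) x r)" for x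
  proof (rule antisym)
    show "(SUP r\<in>{0<..}. \<Prod>k\<in>I. avg (h k x) x r) \<le> (SUP r\<in>{0<..} \<inter> \<rat>. \<Prod>k\<in>I. avg (h k x) x r)"
    proof (rule SUP_least)
      fix r :: real assume "r \<in> {0<..}"
      then have r: "r > 0" by simp
      define a where "a k s = (\<integral>\<^sup>+ y\<in>ball x s. h k x y \<partial>lborel)" for k s
      define s where "s j = r * (1 - 1 / real (j + 2))" for j :: nat
      define c where "c t = ennreal (1 / (unit_ball_vol (real CARD('n)) * t ^ CARD('n)))" for t
      have s: "0 < s j" "s j < r" for j using r by (auto simp: s_def mult_less_cancel_left1)
      have a_mono: "a k t \<le> a k t'" if "t \<le> t'" for k t t'
      proof -
        have "ball x t \<subseteq> ball x t'" using that by (rule subset_ball)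
        then show ?thesis unfolding a_def by (intro nn_integral_mono) (auto simp: indicator_def)
      qed
      have s_mono: "incseq s"
        unfolding incseq_def s_def using r by (auto intro!: mult_left_mono simp: frac_le)
      have av: "avg (h k x) x t = c t * a k t" if "t > 0" for k t
        using avg_alt[OF that] by (simp add: c_def a_def)
      have c_anti: "c r \<le> c t" if "0 < t" "t \<le> r" for t
        unfolding c_def using that r by (intro ennreal_leI divide_left_mono mult_left_mono power_mono mult_pos_pos) auto
      have "(\<Prod>k\<in>I. avg (h k x) x r) = (\<Prod>k\<in>I. SUP j. c r * a k (s j))"
        unfolding av[OF r]
        by (intro prod.cong refl) (simp add: SUP_mult_left_ennreal[symmetric] a_def s_def nn_integral_ball_SUP[OF hx r])
      also have "\<dots> = (SUP j. \<Prod>k\<in>I. c r * a k (s j))"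
        by (rule ennreal_SUP_prod_incseq[symmetric, OF I])
          (auto simp: incseq_def intro!: mult_left_mono a_mono incseqD[OF s_mono])
      also have "\<dots> \<le> (SUP r\<in>{0<..} \<inter> \<rat>. \<Prod>k\<in>I. avg (h k x) x r)"
      proof (rule SUP_least)
        fix j
        obtain t where t: "t \<in> \<rat>" "s j < t" "t < r" using Rats_dense_in_real[OF s(2)[of j]] by blast
        have t0: "t > 0" using t s(1)[of j] by linarith
        have "(\<Prod>k\<in>I. c r * a k (s j)) \<le> (\<Prod>k\<in>I. avg (h k x) x t)"
          unfolding av[OF t0] using t t0 by (intro prod_mono_ennreal mult_mono c_anti a_mono) auto
        also have "\<dots> \<le> (SUP r\<in>{0<..} \<inter> \<rat>. \<Prod>k\<in>I. avg (h k x) x r)"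
          by (rule SUP_upper) (use t t0 in auto)
        finally show "(\<Prod>k\<in>I. c r * a k (s j)) \<le> (SUP r\<in>{0<..} \<inter> \<rat>. \<Prod>k\<in>I. avg (h k x) x r)" .
      qed
      finally show "(\<Prod>k\<in>I. avg (h k x) x r) \<le> (SUP r\<in>{0<..} \<inter> \<rat>. \<Prod>k\<in>I. avg (h k x) x r)" .
    qed
  qed (intro SUP_subset_mono, auto)
  then have "(\<lambda>x. SUP r\<in>{0<..}. \<Prod>k\<in>I. avg (h k x) x r) = (\<lambda>x. SUP r\<in>{0<..} \<inter> \<rat>. \<Prod>k\<in>I. avg (h k x) x r)" by auto
  also have "\<dots> \<in> borel_measurable borel"
  proof (rule borel_measurable_SUP)
    show "countable ({0<..} \<inter> \<rat> :: real set)" using countable_rat by (rule countable_subset[rotated]) auto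
    show "(\<lambda>x. \<Prod>k\<in>I. avg (h k x) x r) \<in> borel_measurable borel" if "r \<in> {0<..} \<inter> \<rat>" for r
      using am that by (intro borel_measurable_prod_ennreal) auto
  qed
  finally show ?thesis .
qed

lemma HL_max_measurable [measurable]:
  fixes f :: "real ^ 'n::finite \<Rightarrow> ennreal"
  assumes [measurable]: "f \<in> borel_measurable borel"
  shows "HL_max f \<in> borel_measurable borel"
  using SUP_prod_avg_measurable[of "{()}" "\<lambda>_ _. f"] by (simp add: HL_max_def[abs_def])

lemma max_commutator_measurable [measurable]:
  fixes f :: "real ^ 'n::finite \<Rightarrow> ennreal"
  assumes [measurable]: "f \<in> borel_measurable borel" "b \<in> borel_measurable borel"
  shows "max_commutator b f \<in> borel_measurable borel"
  using SUP_prod_avg_measurable[of "{()}" "\<lambda>_ x y. ennreal (norm (b x - b y)) * f y"] by (simp add: max_commutator_def[abs_def])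

section \<open>Norms of balls\<close>

text \<open>The homogeneity degree of the mixed norm: the indicator of a ball of radius r has norm
  comparable to r to this power.\<close>

definition sig :: "('n::finite \<Rightarrow> real) \<Rightarrow> real" where
  "sig p = (\<Sum>a\<in>UNIV. 1 / p a)"

lemma nrm_cube:
  fixes z :: "real ^ 'n::{finite,linorder}"
  assumes p: "\<And>a. p a > 0" and s: "s > 0"
  shows "nrm p (indicator {y. \<forall>i. \<bar>y $ i - z $ i\<bar> < s}) = ennreal ((2 * s) powr sig p)"
proof -
  have eq: "(indicator {y. \<forall>i. \<bar>y $ i - z $ i\<bar> < s} :: _ \<Rightarrow> ennreal) =
      (\<lambda>y. \<Prod>i\<in>set coords. indicator {z $ i - s<..<z $ i + s} (y $ i))"
  proof
    fix y :: "real ^ 'n::{finite,linorder}"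
    show "indicator {y. \<forall>i. \<bar>y $ i - z $ i\<bar> < s} y = (\<Prod>i\<in>set coords. indicator {z $ i - s<..<z $ i + s} (y $ i) :: ennreal)"
    proof (cases "\<forall>i. \<bar>y $ i - z $ i\<bar> < s")
      case True
      have "y $ i \<in> {z $ i - s<..<z $ i + s}" for i using True[rule_format, of i] by (auto simp: abs_less_iff)
      then show ?thesis using True by simp
    next
      case False
      then obtain i where "\<not> \<bar>y $ i - z $ i\<bar> < s" by blast
      then have "y $ i \<notin> {z $ i - s<..<z $ i + s}" by (auto simp: abs_less_iff)
      then have "(\<Prod>i\<in>set coords. indicator {z $ i - s<..<z $ i + s} (y $ i) :: ennreal) = 0"
        by (intro prod_zero bexI[of _ i]) auto
      then show ?thesis using False by simp
    qed
  qed
  have ind: "(indicator A t :: ennreal) powe e = indicator A t" for A e and t :: real by (simp add: indicator_def)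
  have "nrm p (indicator {y. \<forall>i. \<bar>y $ i - z $ i\<bar> < s}) =
    (\<Prod>i\<in>set coords. (\<integral>\<^sup>+ t. indicator {z $ i - s<..<z $ i + s} t powe p i \<partial>lborel) powe (1 / p i))"
    unfolding eq nrm_def by (rule mnorm_prod) (use p in auto)
  also have "\<dots> = (\<Prod>i\<in>UNIV. ennreal ((2 * s) powr (1 / p i)))"
    using s by (simp add: ind powe_ennreal)
  also have "\<dots> = ennreal (\<Prod>i\<in>UNIV. (2 * s) powr (1 / p i))" by (intro prod_ennreal) auto
  also have "(\<Prod>i\<in>UNIV. (2 * s) powr (1 / p i)) = (2 * s) powr sig p"
    unfolding sig_def using s by (intro powr_sum[symmetric]) auto
  finally show ?thesis .
qed

lemma nrm_ball_le:
  fixes z :: "real ^ 'n::{finite,linorder}"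
  assumes p: "\<And>a. p a > 0" and r: "r > 0"
  shows "nrm p (indicator (ball z r)) \<le> ennreal ((2 * r) powr sig p)"
  unfolding nrm_cube[where p=p and z=z, OF p r, symmetric]
proof (rule nrm_mono[OF p])
  fix y :: "real ^ 'n::{finite,linorder}"
  have "\<bar>y $ i - z $ i\<bar> < r" if "y \<in> ball z r" for i
    using component_le_norm_cart[of "y - z" i] that by (simp add: dist_norm norm_minus_commute)
  then show "(indicator (ball z r) y :: ennreal) \<le> indicator {y. \<forall>i. \<bar>y $ i - z $ i\<bar> < r} y"
    by (auto simp: indicator_def)
qed

lemma nrm_ball_ge:
  fixes z :: "real ^ 'n::{finite,linorder}"
  assumes p: "\<And>a. p a > 0" and r: "r > 0"
  shows "ennreal ((2 * (r / real CARD('n))) powr sig p) \<le> nrm p (indicator (ball z r))"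
proof -
  have s: "r / real CARD('n) > 0" using r by simp
  show ?thesis unfolding nrm_cube[where p=p and z=z, OF p s, symmetric]
  proof (rule nrm_mono[OF p])
    fix y :: "real ^ 'n::{finite,linorder}"
    have "y \<in> ball z r" if "\<forall>i. \<bar>y $ i - z $ i\<bar> < r / real CARD('n)"
    proof -
      have "(\<Sum>i\<in>UNIV. \<bar>(y - z) $ i\<bar>) < (\<Sum>i\<in>(UNIV :: 'n set). r / real CARD('n))"
        using that by (intro sum_strict_mono) auto
      then have "norm (y - z) < r" using norm_le_l1_cart[of "y - z"] by simp
      then show ?thesis by (simp add: dist_norm norm_minus_commute)
    qed
    then show "(indicator {y. \<forall>i. \<bar>y $ i - z $ i\<bar> < r / real CARD('n)} y :: ennreal) \<le> indicator (ball z r) y"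
      by (auto simp: indicator_def)
  qed
qed

text \<open>The norm on a ball, normalised by the power of T to which the norm of the indicator is
  comparable; this keeps the dependence on T explicit.\<close>

definition ball_norm :: "('n::{finite,linorder} \<Rightarrow> real) \<Rightarrow> (real ^ 'n::{finite,linorder} \<Rightarrow> ennreal) \<Rightarrow> real ^ 'n::{finite,linorder} \<Rightarrow> real \<Rightarrow> ennreal" where
  "ball_norm p f z T = nrm p (\<lambda>y. f y * indicator (ball z T) y) * ennreal (T powr - sig p)"

lemma nrm_eq_ball_norm: "T > 0 \<Longrightarrow> nrm p (\<lambda>y. f y * indicator (ball z T) y) = ennreal (T powr sig p) * ball_norm p f z T"
proof -
  assume T: "T > 0"
  have "ennreal (T powr sig p) * ennreal (T powr - sig p) = 1"
    using T by (simp add: ennreal_mult[symmetric] powr_add[symmetric])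
  moreover have "ennreal (T powr sig p) * (X * ennreal (T powr - sig p)) = X * (ennreal (T powr sig p) * ennreal (T powr - sig p))" for X
    by (simp only: mult.left_commute)
  ultimately show ?thesis unfolding ball_norm_def by simp
qed

lemma ball_norm_measurable:
  fixes f :: "real ^ 'n::{finite,linorder} \<Rightarrow> ennreal"
  assumes [measurable]: "f \<in> borel_measurable borel"
  shows "ball_norm p f z \<in> borel_measurable borel"
proof -
  have "Measurable.pred (borel \<Otimes>\<^sub>M borel) (\<lambda>w :: real \<times> (real ^ 'n::{finite,linorder}). dist z (snd w) < fst w)" by measurable
  then have b: "{w :: real \<times> (real ^ 'n::{finite,linorder}). dist z (snd w) < fst w} \<in> sets (borel \<Otimes>\<^sub>M borel)"
    by (simp add: pred_def space_pair_measure)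
  note [measurable] = b
  have "(\<lambda>(T, y). f y * indicator (ball z T) y) = (\<lambda>w. f (snd w) * indicator {w. dist z (snd w) < fst w} w)"
    by (auto simp: fun_eq_iff indicator_def)
  also have "\<dots> \<in> borel_measurable (borel \<Otimes>\<^sub>M borel)" by measurable
  finally have "(\<lambda>(T, x). mnorm p coords (\<lambda>y. f y * indicator (ball z T) y) x) \<in> borel_measurable (borel \<Otimes>\<^sub>M borel)"
    by (rule mnorm_measurable_param)
  then have "(\<lambda>T. (\<lambda>(T, x). mnorm p coords (\<lambda>y. f y * indicator (ball z T) y) x) (T, 0)) \<in> borel_measurable borel"
    by (rule measurable_compose[rotated]) measurable
  then have "(\<lambda>T. nrm p (\<lambda>y. f y * indicator (ball z T) y)) \<in> borel_measurable borel" by (simp add: nrm_def)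
  then show ?thesis unfolding ball_norm_def[abs_def] by measurable
qed

lemma sig_conj:
  fixes p q :: "'n::finite \<Rightarrow> real"
  shows "(\<And>a. 1 / p a + 1 / q a = 1) \<Longrightarrow> sig p + sig q = real CARD('n)"
  by (simp add: sig_def sum.distrib[symmetric])

lemma nn_integral_pair_ball_norm:
  fixes f g :: "real ^ 'n::{finite,linorder} \<Rightarrow> ennreal"
  assumes p: "\<And>a. p a > 1" "\<And>a. 1 / p a + 1 / q a = 1" and T: "T > 0" and c: "c \<ge> 0"
    and [measurable]: "f \<in> borel_measurable borel" "g \<in> borel_measurable borel"
    and g: "nrm q (\<lambda>y. g y * indicator (ball z T) y) \<le> ennreal (c * T powr sig q)"
  shows "(\<integral>\<^sup>+ y\<in>ball z T. g y * f y \<partial>lborel) \<le> ennreal (c * T ^ CARD('n)) * ball_norm p f z T"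
proof -
  have "(\<integral>\<^sup>+ y\<in>ball z T. g y * f y \<partial>lborel) =
      (\<integral>\<^sup>+ y. (f y * indicator (ball z T) y) * (g y * indicator (ball z T) y) \<partial>lborel)"
    by (intro nn_integral_cong) (auto simp: indicator_def mult.commute)
  also have "\<dots> \<le> nrm p (\<lambda>y. f y * indicator (ball z T) y) * nrm q (\<lambda>y. g y * indicator (ball z T) y)"
    by (rule nrm_pairing[OF p]) measurable
  also have "\<dots> \<le> (ennreal (T powr sig p) * ball_norm p f z T) * ennreal (c * T powr sig q)"
    unfolding nrm_eq_ball_norm[OF T, symmetric] by (intro mult_left_mono g) auto
  also have "\<dots> = ennreal (T powr sig p * (c * T powr sig q)) * ball_norm p f z T"
    using c by (simp add: ennreal_mult ac_simps)
  also have "T powr sig p * (c * T powr sig q) = c * T powr (sig p + sig q)" by (simp add: powr_add)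
  also have "T powr (sig p + sig q) = T ^ CARD('n)" using T by (simp add: sig_conj[OF p(2)] powr_realpow)
  finally show ?thesis .
qed

lemma nn_integral_ball_ball_norm:
  fixes f :: "real ^ 'n::{finite,linorder} \<Rightarrow> ennreal"
  assumes p: "\<And>a. p a > 1" "\<And>a. 1 / p a + 1 / q a = 1" and T: "T > 0"
    and [measurable]: "f \<in> borel_measurable borel"
  shows "(\<integral>\<^sup>+ y\<in>ball z T. f y \<partial>lborel) \<le> ennreal (2 powr sig q * T ^ CARD('n)) * ball_norm p f z T"
proof -
  have q0: "q a > 0" for a using conj_exponent(1)[OF p(1,2)[of a]] by simp
  have "nrm q (\<lambda>y. 1 * indicator (ball z T) y) \<le> ennreal ((2 * T) powr sig q)"
    using nrm_ball_le[where p=q and z=z, OF q0 T] by simp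
  also have "(2 * T) powr sig q = 2 powr sig q * T powr sig q" using T by (simp add: powr_mult)
  finally show ?thesis using nn_integral_pair_ball_norm[where p=p and q=q and c="2 powr sig q" and f=f and g="\<lambda>_. 1" and z=z, OF p T] by simp
qed

section \<open>Mean oscillation over balls\<close>

text \<open>Comes from the commutator applied to an indicator. Averaging the triangle inequality
  over u in B = ball z T bounds |b(y) - m z T| by the mean of |b(y) - b(u)| plus a constant, and
  since B lies in ball y (2 T), that mean is at most 2^d times the commutator of the indicator of B
  at y, with d the dimension. Its boundedness thus stands in for a mixed-norm John-Nirenberg
  inequality.\<close>

lemma ball_bmo_nrm:
  fixes b :: "real ^ 'n::{finite,linorder} \<Rightarrow> complex"
  assumes p: "\<And>a. p a > 1" and b: "ball_bmo b m \<Theta>"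
  shows "\<exists>C>0. \<forall>z T. T > 0 \<longrightarrow> nrm p (\<lambda>y. ennreal (norm (b y - m z T)) * indicator (ball z T) y) \<le> ennreal (C * T powr sig p)"
proof -
  have p0: "p a > 0" for a using p[of a] by simp
  have bm [measurable]: "b \<in> borel_measurable borel" and \<Theta>: "\<Theta> > 0"
    and osc: "\<And>x r. r > 0 \<Longrightarrow> (\<integral>\<^sup>+ y\<in>ball x r. ennreal (norm (b y - m x r)) \<partial>lborel) \<le> ennreal (\<Theta> * r ^ CARD('n))"
    using b by (auto simp: ball_bmo_def)
  obtain C where C: "C \<ge> 1" "\<And>f. f \<in> borel_measurable borel \<Longrightarrow> nrm p (max_commutator b f) \<le> ennreal C * nrm p f"
    using max_commutator_bounded[where p=p, OF p b] by blast
  define w where "w = unit_ball_vol (real CARD('n))"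
  have w: "w > 0" by (simp add: w_def)
  define C' where "C' = (2 ^ CARD('n) * C + \<Theta> / w) * 2 powr sig p"
  show ?thesis
  proof (intro exI[of _ C'] conjI allI impI)
    show "C' > 0" unfolding C'_def using C(1) \<Theta> w by (intro mult_pos_pos add_pos_pos) auto
    fix z :: "real ^ 'n::{finite,linorder}" and T :: real assume T: "T > 0"
    define ch where "ch = (indicator (ball z T) :: real ^ 'n::{finite,linorder} \<Rightarrow> ennreal)"
    have chm [measurable]: "ch \<in> borel_measurable borel" by (simp add: ch_def)
    define V where "V = w * T ^ CARD('n)"
    have V: "V > 0" using w T by (simp add: V_def)
    have pw: "ennreal (norm (b y - m z T)) * ch y \<le> ennreal (2 ^ CARD('n)) * max_commutator b ch y + ennreal (\<Theta> / w) * ch y" for y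
    proof (cases "y \<in> ball z T")
      case True
      have sub: "ball z T \<subseteq> ball y (2 * T)"
      proof
        fix u assume "u \<in> ball z T"
        then show "u \<in> ball y (2 * T)" using True dist_triangle2[of y u z] by (simp add: dist_commute)
      qed
      have "ennreal (norm (b y - m z T)) * ennreal V = (\<integral>\<^sup>+ u\<in>ball z T. ennreal (norm (b y - m z T)) \<partial>lborel)"
        using T by (simp add: nn_integral_cmult_indicator emeasure_ball_vec V_def w_def)
      also have "\<dots> \<le> (\<integral>\<^sup>+ u. ennreal (norm (b y - b u)) * ch u + ennreal (norm (b u - m z T)) * ch u \<partial>lborel)"
        using norm_triangle_ineq[of "b y - b u" "b u - m z T" for u]
        by (intro nn_integral_mono) (auto simp: ch_def indicator_def ennreal_plus[symmetric] ennreal_leI simp del: ennreal_plus)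
      also have "\<dots> = (\<integral>\<^sup>+ u. ennreal (norm (b y - b u)) * ch u \<partial>lborel) + (\<integral>\<^sup>+ u\<in>ball z T. ennreal (norm (b u - m z T)) \<partial>lborel)"
        by (simp add: nn_integral_add ch_def)
      also have "\<dots> \<le> ennreal (2 ^ CARD('n) * V) * max_commutator b ch y + ennreal (\<Theta> * T ^ CARD('n))"
      proof (intro add_mono osc T)
        have "avg (\<lambda>u. ennreal (norm (b y - b u)) * ch u) y (2 * T) \<le> max_commutator b ch y"
          unfolding max_commutator_def by (rule SUP_upper) (use T in auto)
        moreover have "avg (\<lambda>u. ennreal (norm (b y - b u)) * ch u) y (2 * T) =
            ennreal (1 / (2 ^ CARD('n) * V)) * (\<integral>\<^sup>+ u. ennreal (norm (b y - b u)) * ch u \<partial>lborel)"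
        proof -
          have "(\<integral>\<^sup>+ u\<in>ball y (2 * T). ennreal (norm (b y - b u)) * ch u \<partial>lborel) = (\<integral>\<^sup>+ u. ennreal (norm (b y - b u)) * ch u \<partial>lborel)"
            using sub by (intro nn_integral_cong) (auto simp: ch_def indicator_def)
          then show ?thesis using T by (subst avg_alt) (auto simp: V_def w_def power_mult_distrib ac_simps)
        qed
        ultimately have "ennreal (2 ^ CARD('n) * V) * (ennreal (1 / (2 ^ CARD('n) * V)) * (\<integral>\<^sup>+ u. ennreal (norm (b y - b u)) * ch u \<partial>lborel))
          \<le> ennreal (2 ^ CARD('n) * V) * max_commutator b ch y" by (intro mult_left_mono) auto
        moreover have "ennreal (2 ^ CARD('n) * V) * ennreal (1 / (2 ^ CARD('n) * V)) = 1"
          using V by (subst ennreal_mult[symmetric]) auto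
        ultimately show "(\<integral>\<^sup>+ u. ennreal (norm (b y - b u)) * ch u \<partial>lborel) \<le> ennreal (2 ^ CARD('n) * V) * max_commutator b ch y"
          by (simp add: mult.assoc[symmetric])
      qed
      finally have "ennreal (norm (b y - m z T)) * ennreal V \<le> ennreal (2 ^ CARD('n) * V) * max_commutator b ch y + ennreal (\<Theta> * T ^ CARD('n))" .
      then have "ennreal (1 / V) * (ennreal (norm (b y - m z T)) * ennreal V) \<le>
          ennreal (1 / V) * (ennreal (2 ^ CARD('n) * V) * max_commutator b ch y + ennreal (\<Theta> * T ^ CARD('n)))"
        by (intro mult_left_mono) auto
      moreover have "ennreal (1 / V) * (ennreal (norm (b y - m z T)) * ennreal V) = ennreal (norm (b y - m z T))"
        using V by (simp add: ennreal_mult[symmetric])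
      moreover have "ennreal (1 / V) * (ennreal (2 ^ CARD('n) * V) * max_commutator b ch y + ennreal (\<Theta> * T ^ CARD('n))) =
          ennreal (2 ^ CARD('n)) * max_commutator b ch y + ennreal (\<Theta> / w)"
      proof -
        have "1 / V * (2 ^ CARD('n) * V) = 2 ^ CARD('n)" "1 / V * (\<Theta> * T ^ CARD('n)) = \<Theta> / w"
          using V T w by (auto simp: V_def field_simps)
        then show ?thesis using V \<Theta> T
          by (simp only: distrib_left mult.assoc[symmetric] ennreal_mult[symmetric] less_imp_le zero_le_divide_iff zero_le_one
              mult_nonneg_nonneg zero_le_power zero_le_numeral simp_thms)
      qed
      ultimately show ?thesis using True by (simp add: ch_def)
    qed (simp add: ch_def)
    have "nrm p (\<lambda>y. ennreal (norm (b y - m z T)) * ch y) \<le> nrm p (\<lambda>y. ennreal (2 ^ CARD('n)) * max_commutator b ch y + ennreal (\<Theta> / w) * ch y)"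
      by (rule nrm_mono[OF p0 pw])
    also have "\<dots> \<le> nrm p (\<lambda>y. ennreal (2 ^ CARD('n)) * max_commutator b ch y) + nrm p (\<lambda>y. ennreal (\<Theta> / w) * ch y)"
      by (rule nrm_add[OF p]) measurable
    also have "\<dots> = ennreal (2 ^ CARD('n)) * nrm p (max_commutator b ch) + ennreal (\<Theta> / w) * nrm p ch"
      by (subst (1 2) nrm_cmult[OF p0]) measurable
    also have "\<dots> \<le> ennreal (2 ^ CARD('n)) * (ennreal C * nrm p ch) + ennreal (\<Theta> / w) * nrm p ch"
      by (intro add_right_mono mult_left_mono C(2)) auto
    also have "\<dots> = ennreal (2 ^ CARD('n) * C + \<Theta> / w) * nrm p ch"
      using C(1) \<Theta> w by (simp add: ennreal_mult distrib_right mult.assoc)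
    also have "\<dots> \<le> ennreal (2 ^ CARD('n) * C + \<Theta> / w) * ennreal ((2 * T) powr sig p)"
      unfolding ch_def by (intro mult_left_mono nrm_ball_le p0 T) auto
    also have "\<dots> = ennreal (C' * T powr sig p)"
      using C(1) \<Theta> w T by (simp add: C'_def powr_mult ennreal_mult[symmetric] mult.assoc del: ennreal_plus)
    finally show "nrm p (\<lambda>y. ennreal (norm (b y - m z T)) * indicator (ball z T) y) \<le> ennreal (C' * T powr sig p)"
      by (simp add: ch_def)
  qed
qed

text \<open>Enlarging the radius by a factor of at most 2 moves the constant of the ball by at most
  c, and ln (T / r) counts the doublings; since ln 2 is at least 1/2, the constant 2 c pays for each
  of them.\<close>

lemma ball_bmo_mean_log:
  fixes b :: "real ^ 'n::finite \<Rightarrow> complex"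
  assumes b: "ball_bmo b m \<Theta>"
  shows "\<exists>c>0. \<forall>z r T. 0 < r \<longrightarrow> r \<le> T \<longrightarrow> norm (m z T - m z r) \<le> c * (1 + ln (T / r))"
proof -
  have bm [measurable]: "b \<in> borel_measurable borel" and \<Theta>: "\<Theta> > 0"
    and osc: "\<And>x r. r > 0 \<Longrightarrow> (\<integral>\<^sup>+ y\<in>ball x r. ennreal (norm (b y - m x r)) \<partial>lborel) \<le> ennreal (\<Theta> * r ^ CARD('n))"
    using b by (auto simp: ball_bmo_def)
  define w where "w = unit_ball_vol (real CARD('n))"
  have w: "w > 0" by (simp add: w_def)
  define c where "c = \<Theta> * (2 ^ CARD('n) + 1) / w"
  have c: "c > 0" using \<Theta> w by (simp add: c_def add_pos_pos)
  have step: "norm (m z s - m z r) \<le> c" if r: "0 < r" "r \<le> s" "s \<le> 2 * r" for z r s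
  proof -
    have "ennreal (norm (m z s - m z r) * (w * r ^ CARD('n))) = (\<integral>\<^sup>+ u\<in>ball z r. ennreal (norm (m z s - m z r)) \<partial>lborel)"
      using r w by (simp add: nn_integral_cmult_indicator emeasure_ball_vec w_def ennreal_mult)
    also have "\<dots> \<le> (\<integral>\<^sup>+ u. ennreal (norm (b u - m z s)) * indicator (ball z s) u + ennreal (norm (b u - m z r)) * indicator (ball z r) u \<partial>lborel)"
    proof (rule nn_integral_mono)
      fix u
      have "norm (m z s - m z r) \<le> norm (b u - m z s) + norm (b u - m z r)"
        using norm_triangle_ineq4[of "b u - m z r" "b u - m z s"] by simp
      then have "ennreal (norm (m z s - m z r)) \<le> ennreal (norm (b u - m z s)) + ennreal (norm (b u - m z r))"
        by (simp add: ennreal_plus[symmetric] ennreal_leI del: ennreal_plus)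
      then show "ennreal (norm (m z s - m z r)) * indicator (ball z r) u
        \<le> ennreal (norm (b u - m z s)) * indicator (ball z s) u + ennreal (norm (b u - m z r)) * indicator (ball z r) u"
        using r by (auto simp: indicator_def)
    qed
    also have "\<dots> = (\<integral>\<^sup>+ u\<in>ball z s. ennreal (norm (b u - m z s)) \<partial>lborel) + (\<integral>\<^sup>+ u\<in>ball z r. ennreal (norm (b u - m z r)) \<partial>lborel)"
      by (rule nn_integral_add) measurable
    also have "\<dots> \<le> ennreal (\<Theta> * s ^ CARD('n)) + ennreal (\<Theta> * r ^ CARD('n))"
      using r by (intro add_mono osc) auto
    also have "\<dots> = ennreal (\<Theta> * s ^ CARD('n) + \<Theta> * r ^ CARD('n))" using r \<Theta> by simp
    finally have "norm (m z s - m z r) * (w * r ^ CARD('n)) \<le> \<Theta> * s ^ CARD('n) + \<Theta> * r ^ CARD('n)"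
      using r \<Theta> by (subst (asm) ennreal_le_iff) auto
    also have "\<dots> \<le> \<Theta> * (2 * r) ^ CARD('n) + \<Theta> * r ^ CARD('n)"
      using r \<Theta> by (intro add_right_mono mult_left_mono power_mono) auto
    also have "\<dots> = (\<Theta> * (2 ^ CARD('n) + 1)) * r ^ CARD('n)" by (simp add: power_mult_distrib algebra_simps)
    also have "\<Theta> * (2 ^ CARD('n) + 1) = c * w" using w by (simp add: c_def)
    also have "c * w * r ^ CARD('n) = c * (w * r ^ CARD('n))" by simp
    finally show ?thesis by (rule mult_right_le_imp_le) (use w r in simp)
  qed
  have ln2: "ln 2 \<ge> (1/2 :: real)"
    using ln_le_minus_one[of "1/2 :: real"] by (simp add: ln_div)
  have main: "norm (m z T - m z r) \<le> 2 * c * (1 + ln (T / r))" if "0 < r" "r \<le> T" "T \<le> 2 ^ j * r" for z r T and j :: nat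
    using that
  proof (induction j arbitrary: T)
    case 0
    then show ?case using c by simp
  next
    case (Suc j)
    have ln0: "ln (T / r) \<ge> 0" using Suc.prems by simp
    show ?case
    proof (cases "T \<le> 2 * r")
      case True
      have "norm (m z T - m z r) \<le> c * 1" using step[of r T z] Suc.prems True by simp
      also have "\<dots> \<le> c * (2 * (1 + ln (T / r)))" using c ln0 by (intro mult_left_mono) auto
      also have "\<dots> = 2 * c * (1 + ln (T / r))" by (simp only: mult.assoc mult.left_commute)
      finally show ?thesis .
    next
      case False
      have ih: "norm (m z (T / 2) - m z r) \<le> 2 * c * (1 + ln (T / 2 / r))"
        by (rule Suc.IH) (use Suc.prems False in auto)
      have st: "norm (m z T - m z (T / 2)) \<le> c" by (rule step) (use Suc.prems in auto)
      have "ln (T / 2 / r) = ln (T / r) - ln 2"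
        using Suc.prems by (simp add: ln_div ln_mult)
      then have "norm (m z T - m z r) \<le> c + 2 * c * (1 + (ln (T / r) - ln 2))"
        using norm_triangle_ineq[of "m z T - m z (T / 2)" "m z (T / 2) - m z r"] ih st by simp
      also have "\<dots> = 2 * c * (1 + ln (T / r)) + c * (1 - 2 * ln 2)" by (simp add: algebra_simps)
      also have "c * (1 - 2 * ln 2) \<le> 0" using c ln2 by (intro mult_nonneg_nonpos) auto
      finally show ?thesis by simp
    qed
  qed
  show ?thesis
  proof (intro exI[of _ "2 * c"] conjI allI impI)
    fix z r T assume r: "0 < r" "r \<le> (T :: real)"
    obtain j where "T / r < 2 ^ j" using real_arch_pow[of 2 "T / r"] by auto
    then have "T \<le> 2 ^ j * r" using r by (simp add: pos_divide_less_eq)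
    with main r show "norm (m z T - m z r) \<le> 2 * c * (1 + ln (T / r))" by blast
  qed (use c in simp)
qed

section \<open>Local estimates\<close>

definition tail_norm :: "(real \<Rightarrow> real) \<Rightarrow> ('n::{finite,linorder} \<Rightarrow> real) \<Rightarrow> (real ^ 'n::{finite,linorder} \<Rightarrow> ennreal) \<Rightarrow>
    real ^ 'n::{finite,linorder} \<Rightarrow> real \<Rightarrow> ennreal" where
  "tail_norm \<omega> p f z r = (SUP T\<in>{2 * r..}. ennreal (\<omega> (T / r)) * ball_norm p f z T)"

text \<open>On [T, 2 T], an interval of length T inside (r, \<infinity>), neither the norm on the
  ball nor \<omega> decreases, while 1 / s and the normalising power lose at most the factors 2 and
  2^sig. So the term for a single T is already dominated by the integral.\<close>

lemma tail_norm_le_integral: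
  fixes f :: "real ^ 'n::{finite,linorder} \<Rightarrow> ennreal"
  assumes p: "\<And>a. p a > 0" and \<omega>: "\<And>s t. 1 \<le> s \<Longrightarrow> s \<le> t \<Longrightarrow> \<omega> s \<le> \<omega> t" "\<And>s. 1 \<le> s \<Longrightarrow> \<omega> s \<ge> 0"
    and r: "r > 0"
  shows "tail_norm \<omega> p f z r \<le> ennreal (2 * 2 powr sig p) * (\<integral>\<^sup>+ s\<in>{r<..}. ennreal (\<omega> (s / r) / s) * ball_norm p f z s \<partial>lborel)"
  unfolding tail_norm_def
proof (rule SUP_least)
  fix T assume "T \<in> {2 * r..}"
  then have T: "2 * r \<le> T" by simp
  have sg: "sig p \<ge> 0" unfolding sig_def using p by (intro sum_nonneg) (simp add: less_imp_le)
  define X where "X = ennreal (\<omega> (T / r) / (2 * T)) * (ennreal (2 powr - sig p) * ball_norm p f z T)"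
  have "ennreal T * X = (\<integral>\<^sup>+ s. X * indicator {T..2 * T} s \<partial>lborel)"
    using T r by (simp add: nn_integral_cmult_indicator mult.commute)
  also have "\<dots> \<le> (\<integral>\<^sup>+ s\<in>{r<..}. ennreal (\<omega> (s / r) / s) * ball_norm p f z s \<partial>lborel)"
  proof (rule nn_integral_mono)
    fix s
    show "X * indicator {T..2 * T} s \<le> ennreal (\<omega> (s / r) / s) * ball_norm p f z s * indicator {r<..} s"
    proof (cases "s \<in> {T..2 * T}")
      case True
      then have s: "T \<le> s" "s \<le> 2 * T" "r < s" "0 < s" using T r by auto
      have "X \<le> ennreal (\<omega> (s / r) / s) * ball_norm p f z s"
        unfolding X_def
      proof (rule mult_mono)
        have "\<omega> (T / r) \<le> \<omega> (s / r)" using s T r by (intro \<omega> divide_right_mono) (auto simp: pos_le_divide_eq)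
        moreover have "\<omega> (T / r) \<ge> 0" using T r by (intro \<omega>) (auto simp: pos_le_divide_eq)
        ultimately show "ennreal (\<omega> (T / r) / (2 * T)) \<le> ennreal (\<omega> (s / r) / s)"
          using s by (intro ennreal_leI frac_le) auto
        have "ball z T \<subseteq> ball z s" using s by (intro subset_ball) auto
        then have "nrm p (\<lambda>y. f y * indicator (ball z T) y) \<le> nrm p (\<lambda>y. f y * indicator (ball z s) y)"
          by (intro nrm_mono p mult_left_mono) (auto simp: indicator_def)
        moreover have "2 powr - sig p * T powr - sig p \<le> s powr - sig p"
        proof -
          have "2 powr - sig p * T powr - sig p = (2 * T) powr - sig p" using T r by (simp add: powr_mult)
          also have "\<dots> \<le> s powr - sig p" using s sg by (intro powr_mono2') auto
          finally show ?thesis .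
        qed
        ultimately have "nrm p (\<lambda>y. f y * indicator (ball z T) y) * ennreal (2 powr - sig p * T powr - sig p) \<le> ball_norm p f z s"
          unfolding ball_norm_def by (intro mult_mono ennreal_leI) auto
        then show "ennreal (2 powr - sig p) * ball_norm p f z T \<le> ball_norm p f z s"
          by (simp add: ball_norm_def ennreal_mult ac_simps)
      qed auto
      then show ?thesis using True s by simp
    qed simp
  qed
  finally have le: "ennreal T * X \<le> (\<integral>\<^sup>+ s\<in>{r<..}. ennreal (\<omega> (s / r) / s) * ball_norm p f z s \<partial>lborel)" .
  have w0: "\<omega> (T / r) \<ge> 0" using T r by (intro \<omega>) (auto simp: pos_le_divide_eq)
  have "ennreal (2 * 2 powr sig p) * (ennreal T * X) =
      ennreal ((2 * 2 powr sig p) * (T * (\<omega> (T / r) / (2 * T) * 2 powr - sig p))) * ball_norm p f z T"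
    using T r w0 unfolding X_def by (simp only: ennreal_mult mult.assoc mult_nonneg_nonneg zero_le_numeral powr_ge_zero
        divide_nonneg_nonneg order_trans[of 0 "2 * r" T])
  also have "(2 * 2 powr sig p) * (T * (\<omega> (T / r) / (2 * T) * 2 powr - sig p)) = \<omega> (T / r)"
  proof -
    have "2 powr sig p * 2 powr - sig p = (1 :: real)" by (simp add: powr_add[symmetric])
    then have "\<omega> (T / r) * (2 powr sig p * 2 powr - sig p) = \<omega> (T / r)" by simp
    then show ?thesis using T r by (simp add: ac_simps)
  qed
  finally have "ennreal (\<omega> (T / r)) * ball_norm p f z T = ennreal (2 * 2 powr sig p) * (ennreal T * X)" ..
  also have "\<dots> \<le> ennreal (2 * 2 powr sig p) * (\<integral>\<^sup>+ s\<in>{r<..}. ennreal (\<omega> (s / r) / s) * ball_norm p f z s \<partial>lborel)"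
    by (intro mult_left_mono le) auto
  finally show "ennreal (\<omega> (T / r)) * ball_norm p f z T \<le> ennreal (2 * 2 powr sig p) *
    (\<integral>\<^sup>+ s\<in>{r<..}. ennreal (\<omega> (s / r) / s) * ball_norm p f z s \<partial>lborel)" .
qed

text \<open>Radii t < r see only the part of f in ball z (2 r). For t at least r the ball lies in
  ball z T with T = 2 t, which is at least 2 r, and the change of normalisation costs 2^d in
  dimension d.\<close>

lemma avg_near_far:
  fixes f c :: "real ^ 'n::finite \<Rightarrow> ennreal"
  assumes [measurable]: "f \<in> borel_measurable borel" "c \<in> borel_measurable borel"
    and x: "x \<in> ball z r" and t: "t > 0"
  shows "avg (\<lambda>y. c y * f y) x t \<le> avg (\<lambda>y. c y * (f y * indicator (ball z (2 * r)) y)) x t +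
    (SUP T\<in>{2 * r..}. ennreal (2 ^ CARD('n) / (unit_ball_vol (real CARD('n)) * T ^ CARD('n))) * (\<integral>\<^sup>+ y\<in>ball z T. c y * f y \<partial>lborel))"
proof -
  define k where "k = ennreal (1 / (unit_ball_vol (real CARD('n)) * t ^ CARD('n)))"
  let ?g = "\<lambda>y. c y * (f y * indicator (ball z (2 * r)) y)"
  show ?thesis
  proof (cases "t < r")
    case True
    have "ball x t \<subseteq> ball z (2 * r)"
    proof
      fix y assume "y \<in> ball x t"
      then show "y \<in> ball z (2 * r)" using x True dist_triangle[of z y x] by simp
    qed
    then have "avg (\<lambda>y. c y * f y) x t \<le> avg ?g x t"
      unfolding avg_alt[OF t] by (intro mult_left_mono nn_integral_mono) (auto simp: indicator_def)
    then show ?thesis by (rule add_increasing2[OF zero_le])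
  next
    case False
    define T where "T = 2 * t"
    have sub: "ball x t \<subseteq> ball z T"
    proof
      fix y assume "y \<in> ball x t"
      then show "y \<in> ball z T" using x False dist_triangle[of z y x] by (simp add: T_def)
    qed
    have "avg (\<lambda>y. c y * f y) x t \<le> k * (\<integral>\<^sup>+ y\<in>ball z T. c y * f y \<partial>lborel)"
      unfolding avg_alt[OF t] k_def using sub by (intro mult_left_mono nn_integral_mono) (auto simp: indicator_def)
    also have "k = ennreal (2 ^ CARD('n) / (unit_ball_vol (real CARD('n)) * T ^ CARD('n)))"
      by (simp add: k_def T_def power_mult_distrib)
    also have "\<dots> * (\<integral>\<^sup>+ y\<in>ball z T. c y * f y \<partial>lborel) \<le>
      (SUP T\<in>{2 * r..}. ennreal (2 ^ CARD('n) / (unit_ball_vol (real CARD('n)) * T ^ CARD('n))) * (\<integral>\<^sup>+ y\<in>ball z T. c y * f y \<partial>lborel))"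
      by (rule SUP_upper) (use False in \<open>simp add: T_def\<close>)
    finally show ?thesis by (rule add_increasing[OF zero_le])
  qed
qed

lemma HL_max_pointwise:
  fixes p :: "'n::{finite,linorder} \<Rightarrow> real"
  assumes p: "\<And>a. p a > 1"
  shows "\<exists>K>0. \<forall>f\<in>borel_measurable borel. \<forall>z r. \<forall>x\<in>ball z r. r > 0 \<longrightarrow>
    HL_max f x \<le> HL_max (\<lambda>y. f y * indicator (ball z (2 * r)) y) x + ennreal K * tail_norm (\<lambda>_. 1) p f z r"
proof -
  define q where "q a = p a / (p a - 1)" for a
  have q: "1 / p a + 1 / q a = 1" for a using p[of a] by (simp add: q_def field_simps)
  define w where "w = unit_ball_vol (real CARD('n))"
  have w: "w > 0" by (simp add: w_def)
  define K where "K = 2 ^ CARD('n) / w * 2 powr sig q"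
  show ?thesis
  proof (intro exI[of _ K] conjI ballI allI impI)
    show "K > 0" using w by (simp add: K_def)
    fix f :: "real ^ 'n::{finite,linorder} \<Rightarrow> ennreal" and z x :: "real ^ 'n::{finite,linorder}" and r
    assume [measurable]: "f \<in> borel_measurable borel" and x: "x \<in> ball z r" and r: "r > 0"
    let ?g = "\<lambda>y. f y * indicator (ball z (2 * r)) y"
    show "HL_max f x \<le> HL_max ?g x + ennreal K * tail_norm (\<lambda>_. 1) p f z r"
      unfolding HL_max_def[of f]
    proof (rule SUP_least)
      fix t :: real assume "t \<in> {0<..}"
      then have t: "t > 0" by simp
      have "avg f x t \<le> avg ?g x t +
        (SUP T\<in>{2 * r..}. ennreal (2 ^ CARD('n) / (w * T ^ CARD('n))) * (\<integral>\<^sup>+ y\<in>ball z T. f y \<partial>lborel))"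
        using avg_near_far[where f=f and c="\<lambda>_. 1" and x=x and z=z and r=r and t=t] x t by (simp add: w_def)
      also have "\<dots> \<le> HL_max ?g x + ennreal K * tail_norm (\<lambda>_. 1) p f z r"
      proof (rule add_mono)
        show "avg ?g x t \<le> HL_max ?g x" unfolding HL_max_def by (rule SUP_upper) (use t in simp)
        show "(SUP T\<in>{2 * r..}. ennreal (2 ^ CARD('n) / (w * T ^ CARD('n))) * (\<integral>\<^sup>+ y\<in>ball z T. f y \<partial>lborel))
          \<le> ennreal K * tail_norm (\<lambda>_. 1) p f z r"
        proof (rule SUP_least)
          fix T assume "T \<in> {2 * r..}"
          then have T: "T > 0" "2 * r \<le> T" using r by auto
          have "ennreal (2 ^ CARD('n) / (w * T ^ CARD('n))) * (\<integral>\<^sup>+ y\<in>ball z T. f y \<partial>lborel) \<le>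
             ennreal (2 ^ CARD('n) / (w * T ^ CARD('n))) * (ennreal (2 powr sig q * T ^ CARD('n)) * ball_norm p f z T)"
            by (intro mult_left_mono nn_integral_ball_ball_norm p q T) auto
          also have "\<dots> = ennreal (2 ^ CARD('n) / (w * T ^ CARD('n)) * (2 powr sig q * T ^ CARD('n))) * ball_norm p f z T"
            using T w by (subst ennreal_mult') (auto simp: mult.assoc)
          also have "2 ^ CARD('n) / (w * T ^ CARD('n)) * (2 powr sig q * T ^ CARD('n)) = K"
            using T w by (simp add: K_def)
          also have "ball_norm p f z T \<le> tail_norm (\<lambda>_. 1) p f z r"
            unfolding tail_norm_def by (rule SUP_upper2[of T]) (use T in auto)
          finally show "ennreal (2 ^ CARD('n) / (w * T ^ CARD('n))) * (\<integral>\<^sup>+ y\<in>ball z T. f y \<partial>lborel) \<le> ennreal K * tail_norm (\<lambda>_. 1) p f z r"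
            by (simp add: mult_left_mono)
        qed
      qed
      finally show "avg f x t \<le> HL_max ?g x + ennreal K * tail_norm (\<lambda>_. 1) p f z r" .
    qed
  qed
qed

text \<open>In the far part |b(x) - b(y)| is split at the constants of ball z r and ball z T. The
  first difference depends on x only, the second grows logarithmically by
  \<open>ball_bmo_mean_log\<close>, and the third is paired with f through its norm in the conjugate
  exponents (\<open>ball_bmo_nrm\<close>). All three are absorbed into the product of 1 + |b(x) - m
  z r| and 1 + ln (T / r).\<close>

lemma max_commutator_pointwise:
  fixes p :: "'n::{finite,linorder} \<Rightarrow> real" and b :: "real ^ 'n::{finite,linorder} \<Rightarrow> complex"
  assumes p: "\<And>a. p a > 1" and b: "ball_bmo b m \<Theta>"
  shows "\<exists>K>0. \<forall>f\<in>borel_measurable borel. \<forall>z r. \<forall>x\<in>ball z r. r > 0 \<longrightarrow>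
    max_commutator b f x \<le> max_commutator b (\<lambda>y. f y * indicator (ball z (2 * r)) y) x +
      ennreal K * (1 + ennreal (norm (b x - m z r))) * tail_norm (\<lambda>u. 1 + ln u) p f z r"
proof -
  define q where "q a = p a / (p a - 1)" for a
  have q: "1 / p a + 1 / q a = 1" for a using p[of a] by (simp add: q_def field_simps)
  have q1: "q a > 1" for a by (rule conj_exponent(1)[OF p q])
  have bm [measurable]: "b \<in> borel_measurable borel" using b by (auto simp: ball_bmo_def)
  obtain Cq where Cq: "Cq > 0" "\<And>z T. T > 0 \<Longrightarrow> nrm q (\<lambda>y. ennreal (norm (b y - m z T)) * indicator (ball z T) y) \<le> ennreal (Cq * T powr sig q)"
    using ball_bmo_nrm[where p=q, OF q1 b] by blast
  obtain c where c: "c > 0" "\<And>z r T. 0 < r \<Longrightarrow> r \<le> T \<Longrightarrow> norm (m z T - m z r) \<le> c * (1 + ln (T / r))"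
    using ball_bmo_mean_log[OF b] by blast
  define w where "w = unit_ball_vol (real CARD('n))"
  have w: "w > 0" by (simp add: w_def)
  define C1 where "C1 = 2 powr sig q"
  have C1: "C1 > 0" by (simp add: C1_def)
  define K where "K = 2 ^ CARD('n) / w * (C1 * (1 + c) + Cq)"
  have K0: "K > 0" unfolding K_def using w C1 c(1) Cq(1) by (intro mult_pos_pos add_pos_pos) auto
  show ?thesis
  proof (intro exI[of _ K] conjI ballI allI impI K0)
    fix f :: "real ^ 'n::{finite,linorder} \<Rightarrow> ennreal" and z x :: "real ^ 'n::{finite,linorder}" and r
    assume f [measurable]: "f \<in> borel_measurable borel" and x: "x \<in> ball z r" and r: "r > 0"
    let ?g = "\<lambda>y. f y * indicator (ball z (2 * r)) y"
    let ?S = "tail_norm (\<lambda>u. 1 + ln u) p f z r"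
    define B where "B = norm (b x - m z r)"
    have B: "B \<ge> 0" by (simp add: B_def)
    show "max_commutator b f x \<le> max_commutator b ?g x + ennreal K * (1 + ennreal (norm (b x - m z r))) * ?S"
      unfolding max_commutator_def[of b f] B_def[symmetric]
    proof (rule SUP_least)
      fix t :: real assume "t \<in> {0<..}"
      then have t: "t > 0" by simp
      have "avg (\<lambda>y. ennreal (norm (b x - b y)) * f y) x t \<le> avg (\<lambda>y. ennreal (norm (b x - b y)) * ?g y) x t +
        (SUP T\<in>{2 * r..}. ennreal (2 ^ CARD('n) / (w * T ^ CARD('n))) * (\<integral>\<^sup>+ y\<in>ball z T. ennreal (norm (b x - b y)) * f y \<partial>lborel))"
        unfolding w_def by (rule avg_near_far) (use x t in auto)
      also have "\<dots> \<le> max_commutator b ?g x + ennreal K * (1 + ennreal B) * ?S"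
      proof (rule add_mono)
        show "avg (\<lambda>y. ennreal (norm (b x - b y)) * ?g y) x t \<le> max_commutator b ?g x"
          unfolding max_commutator_def by (rule SUP_upper) (use t in simp)
        show "(SUP T\<in>{2 * r..}. ennreal (2 ^ CARD('n) / (w * T ^ CARD('n))) * (\<integral>\<^sup>+ y\<in>ball z T. ennreal (norm (b x - b y)) * f y \<partial>lborel))
          \<le> ennreal K * (1 + ennreal B) * ?S"
        proof (rule SUP_least)
          fix T assume "T \<in> {2 * r..}"
          then have T: "T > 0" "2 * r \<le> T" "r \<le> T" using r by auto
          define l where "l = ln (T / r)"
          have l: "l \<ge> 0" using T r by (simp add: l_def)
          define A where "A = B + c * (1 + l)"
          have A: "A \<ge> 0" using B c(1) l by (simp add: A_def)
          have "(\<integral>\<^sup>+ y\<in>ball z T. ennreal (norm (b x - b y)) * f y \<partial>lborel) \<le>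
            (\<integral>\<^sup>+ y. ennreal A * (f y * indicator (ball z T) y) + ennreal (norm (b y - m z T)) * f y * indicator (ball z T) y \<partial>lborel)"
          proof (rule nn_integral_mono)
            fix y
            have "norm (b x - b y) \<le> norm (b x - m z r) + norm (m z T - m z r) + norm (b y - m z T)"
              using norm_triangle_ineq4[of "b x - m z r" "m z T - m z r"]
                norm_triangle_ineq4[of "(b x - m z r) - (m z T - m z r)" "b y - m z T"] by simp
            also have "\<dots> \<le> A + norm (b y - m z T)" using c(2)[OF r T(3), of z] by (simp add: A_def B_def l_def)
            finally have "ennreal (norm (b x - b y)) \<le> ennreal A + ennreal (norm (b y - m z T))"
              using A by (simp add: ennreal_plus[symmetric] ennreal_leI del: ennreal_plus)
            then have "ennreal (norm (b x - b y)) * (f y * indicator (ball z T) y) \<le>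
              (ennreal A + ennreal (norm (b y - m z T))) * (f y * indicator (ball z T) y)"
              by (intro mult_right_mono) auto
            then show "ennreal (norm (b x - b y)) * f y * indicator (ball z T) y \<le>
              ennreal A * (f y * indicator (ball z T) y) + ennreal (norm (b y - m z T)) * f y * indicator (ball z T) y"
              by (simp add: distrib_right mult.assoc)
          qed
          also have "\<dots> = ennreal A * (\<integral>\<^sup>+ y\<in>ball z T. f y \<partial>lborel) + (\<integral>\<^sup>+ y\<in>ball z T. ennreal (norm (b y - m z T)) * f y \<partial>lborel)"
            by (simp add: nn_integral_add nn_integral_cmult)
          also have "\<dots> \<le> ennreal A * (ennreal (C1 * T ^ CARD('n)) * ball_norm p f z T) + ennreal (Cq * T ^ CARD('n)) * ball_norm p f z T"
            unfolding C1_def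
            by (intro add_mono mult_left_mono nn_integral_ball_ball_norm p q T nn_integral_pair_ball_norm[where p=p and q=q] Cq(2)) (use Cq(1) in auto)
          also have "\<dots> = ennreal ((A * C1 + Cq) * T ^ CARD('n)) * ball_norm p f z T"
            using A C1 Cq(1) T(1) by (simp add: ennreal_mult distrib_right mult.assoc)
          also have "\<dots> \<le> ennreal ((C1 * (1 + c) + Cq) * (1 + B) * (1 + l) * T ^ CARD('n)) * ball_norm p f z T"
          proof (intro mult_right_mono ennreal_leI)
            have "A \<le> (1 + c) * ((1 + B) * (1 + l))"
            proof -
              have "0 \<le> B * l + c * (B * (1 + l)) + (1 + l)" using B c(1) l by (intro add_nonneg_nonneg mult_nonneg_nonneg) auto
              then show ?thesis by (simp add: A_def algebra_simps)
            qed
            then have "A * C1 \<le> (1 + c) * ((1 + B) * (1 + l)) * C1" using C1 by (intro mult_right_mono) auto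
            moreover have "Cq * 1 \<le> Cq * ((1 + B) * (1 + l))"
            proof (intro mult_left_mono)
              have "1 * 1 \<le> (1 + B) * (1 + l)" using B l by (intro mult_mono) auto
              then show "1 \<le> (1 + B) * (1 + l)" by simp
            qed (use Cq(1) in auto)
            ultimately have "A * C1 + Cq \<le> (1 + c) * ((1 + B) * (1 + l)) * C1 + Cq * ((1 + B) * (1 + l))"
              by linarith
            also have "\<dots> = (C1 * (1 + c) + Cq) * (1 + B) * (1 + l)" by (simp add: algebra_simps)
            finally show "A * C1 + Cq \<le> (C1 * (1 + c) + Cq) * (1 + B) * (1 + l)" .
          qed (use T in auto)
          finally have "ennreal (2 ^ CARD('n) / (w * T ^ CARD('n))) * (\<integral>\<^sup>+ y\<in>ball z T. ennreal (norm (b x - b y)) * f y \<partial>lborel) \<le>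
            ennreal (2 ^ CARD('n) / (w * T ^ CARD('n))) * (ennreal ((C1 * (1 + c) + Cq) * (1 + B) * (1 + l) * T ^ CARD('n)) * ball_norm p f z T)"
            by (intro mult_left_mono) auto
          also have "\<dots> = ennreal (2 ^ CARD('n) / (w * T ^ CARD('n)) * ((C1 * (1 + c) + Cq) * (1 + B) * (1 + l) * T ^ CARD('n))) * ball_norm p f z T"
            using T w by (subst ennreal_mult') (auto simp: mult.assoc)
          also have "2 ^ CARD('n) / (w * T ^ CARD('n)) * ((C1 * (1 + c) + Cq) * (1 + B) * (1 + l) * T ^ CARD('n)) = K * (1 + B) * (1 + l)"
            using T w by (simp add: K_def)
          also have "ennreal (K * (1 + B) * (1 + l)) * ball_norm p f z T = ennreal K * (1 + ennreal B) * (ennreal (1 + l) * ball_norm p f z T)"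
            using B l K0 by (simp add: ennreal_mult mult.assoc)
          also have "\<dots> \<le> ennreal K * (1 + ennreal B) * ?S"
            unfolding tail_norm_def l_def by (intro mult_left_mono SUP_upper) (use T in auto)
          finally show "ennreal (2 ^ CARD('n) / (w * T ^ CARD('n))) * (\<integral>\<^sup>+ y\<in>ball z T. ennreal (norm (b x - b y)) * f y \<partial>lborel) \<le> ennreal K * (1 + ennreal B) * ?S" .
        qed
      qed
      finally show "avg (\<lambda>y. ennreal (norm (b x - b y)) * f y) x t \<le> max_commutator b ?g x + ennreal K * (1 + ennreal B) * ?S" .
    qed
  qed
qed

text \<open>Common to both operators: the maximal function has \<omega> = 1 and e = 1, the
  commutator \<omega> = 1 + ln and e = 1 + |b - m z r|. Since \<open>tail_norm\<close> begins at T =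
  2 r and \<omega> is at least 1, it dominates the near part as well.\<close>

lemma local_estimate:
  fixes p :: "'n::{finite,linorder} \<Rightarrow> real"
    and Op :: "(real ^ 'n::{finite,linorder} \<Rightarrow> ennreal) \<Rightarrow> real ^ 'n::{finite,linorder} \<Rightarrow> ennreal"
  assumes p: "\<And>a. p a > 1"
    and \<omega>: "\<And>s t. 1 \<le> s \<Longrightarrow> s \<le> t \<Longrightarrow> \<omega> s \<le> \<omega> t" "\<And>s. 1 \<le> s \<Longrightarrow> \<omega> s \<ge> 1"
    and Opm: "\<And>g. g \<in> borel_measurable borel \<Longrightarrow> Op g \<in> borel_measurable borel"
    and bd: "\<And>g. g \<in> borel_measurable borel \<Longrightarrow> nrm p (Op g) \<le> ennreal C * nrm p g" and C: "C \<ge> 1"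
    and pt: "\<And>f z r x. f \<in> borel_measurable borel \<Longrightarrow> r > 0 \<Longrightarrow> x \<in> ball z r \<Longrightarrow>
      Op f x \<le> Op (\<lambda>y. f y * indicator (ball z (2 * r)) y) x + ennreal K * e z r x * tail_norm \<omega> p f z r" and K: "K > 0"
    and em: "\<And>z r. e z r \<in> borel_measurable borel"
    and en: "\<And>z r. r > 0 \<Longrightarrow> nrm p (\<lambda>x. e z r x * indicator (ball z r) x) \<le> ennreal (E * r powr sig p)" and E: "E > 0"
    and f: "f \<in> borel_measurable borel" and r: "r > 0"
  shows "nrm p (\<lambda>y. Op f y * indicator (ball z r) y) \<le>
    ennreal ((C * 2 powr sig p + K * E) * (2 * 2 powr sig p) * r powr sig p) *
      (\<integral>\<^sup>+ s\<in>{r<..}. ennreal (\<omega> (s / r) / s) * ball_norm p f z s \<partial>lborel)"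
proof -
  note [measurable] = f em
  have p0: "p a > 0" for a using p[of a] by simp
  define S where "S = tail_norm \<omega> p f z r"
  let ?g = "\<lambda>y. f y * indicator (ball z (2 * r)) y"
  have gm [measurable]: "?g \<in> borel_measurable borel" by measurable
  have [measurable]: "Op ?g \<in> borel_measurable borel" by (rule Opm[OF gm])
  have "nrm p (\<lambda>y. Op f y * indicator (ball z r) y) \<le>
     nrm p (\<lambda>y. Op ?g y + (ennreal K * S) * (e z r y * indicator (ball z r) y))"
  proof (rule nrm_mono[OF p0])
    fix y
    show "Op f y * indicator (ball z r) y \<le> Op ?g y + (ennreal K * S) * (e z r y * indicator (ball z r) y)"
      using pt[OF f r, of y z] by (cases "y \<in> ball z r") (auto simp: S_def ac_simps)
  qed
  also have "\<dots> \<le> nrm p (Op ?g) + nrm p (\<lambda>y. (ennreal K * S) * (e z r y * indicator (ball z r) y))"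
    by (rule nrm_add[OF p]) measurable
  also have "nrm p (\<lambda>y. (ennreal K * S) * (e z r y * indicator (ball z r) y)) =
      (ennreal K * S) * nrm p (\<lambda>y. e z r y * indicator (ball z r) y)"
    by (rule nrm_cmult[OF p0]) measurable
  also have "nrm p (Op ?g) + (ennreal K * S) * nrm p (\<lambda>y. e z r y * indicator (ball z r) y) \<le>
      ennreal C * (ennreal (2 powr sig p * r powr sig p) * S) + (ennreal K * S) * ennreal (E * r powr sig p)"
  proof (intro add_mono mult_left_mono en r)
    have "nrm p (Op ?g) \<le> ennreal C * nrm p ?g" by (rule bd[OF gm])
    also have "nrm p ?g = ennreal ((2 * r) powr sig p) * ball_norm p f z (2 * r)" by (rule nrm_eq_ball_norm) (use r in simp)
    also have "(2 * r) powr sig p = 2 powr sig p * r powr sig p" using r by (simp add: powr_mult)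
    also have "ball_norm p f z (2 * r) \<le> S"
    proof -
      have "1 \<le> ennreal (\<omega> (2 * r / r))" using \<omega>(2)[of 2] r by (simp flip: ennreal_1 add: ennreal_leI)
      then have "1 * ball_norm p f z (2 * r) \<le> ennreal (\<omega> (2 * r / r)) * ball_norm p f z (2 * r)" by (rule mult_right_mono) simp
      also have "\<dots> \<le> S" unfolding S_def tail_norm_def by (rule SUP_upper) simp
      finally show ?thesis by simp
    qed
    finally show "nrm p (Op ?g) \<le> ennreal C * (ennreal (2 powr sig p * r powr sig p) * S)"
      by (simp add: mult_left_mono)
  qed auto
  also have "\<dots> = ennreal ((C * 2 powr sig p + K * E) * r powr sig p) * S"
    using C K E r by (simp add: ennreal_mult distrib_right distrib_left ac_simps)
  also have "\<dots> \<le> ennreal ((C * 2 powr sig p + K * E) * r powr sig p) *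
      (ennreal (2 * 2 powr sig p) * (\<integral>\<^sup>+ s\<in>{r<..}. ennreal (\<omega> (s / r) / s) * ball_norm p f z s \<partial>lborel))"
    unfolding S_def
  proof (intro mult_left_mono tail_norm_le_integral p0 \<omega>(1) r)
    show "0 \<le> \<omega> s" if "1 \<le> s" for s using \<omega>(2)[OF that] by simp
  qed auto
  also have "\<dots> = ennreal ((C * 2 powr sig p + K * E) * (2 * 2 powr sig p) * r powr sig p) *
      (\<integral>\<^sup>+ s\<in>{r<..}. ennreal (\<omega> (s / r) / s) * ball_norm p f z s \<partial>lborel)"
  proof -
    have "C * 2 powr sig p + K * E \<ge> 0" using C K E by (intro add_nonneg_nonneg mult_nonneg_nonneg) auto
    then have "ennreal ((C * 2 powr sig p + K * E) * (2 * 2 powr sig p) * r powr sig p) =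
       ennreal ((C * 2 powr sig p + K * E) * r powr sig p) * ennreal (2 * 2 powr sig p)"
      by (subst ennreal_mult[symmetric]) (auto simp: ac_simps)
    then show ?thesis by (simp add: mult.assoc)
  qed
  finally show ?thesis .
qed

lemma HL_max_local:
  fixes p :: "'n::{finite,linorder} \<Rightarrow> real"
  assumes p: "\<And>a. p a > 1"
  shows "\<exists>C>0. \<forall>f\<in>borel_measurable borel. \<forall>z r. r > 0 \<longrightarrow>
    nrm p (\<lambda>y. HL_max f y * indicator (ball z r) y) \<le>
      ennreal (C * r powr sig p) * (\<integral>\<^sup>+ s\<in>{r<..}. ennreal (1 / s) * ball_norm p f z s \<partial>lborel)"
proof -
  have p0: "p a > 0" for a using p[of a] by simp
  obtain K where K: "K > 0" "\<And>f z r x. f \<in> borel_measurable borel \<Longrightarrow> r > 0 \<Longrightarrow> x \<in> ball z r \<Longrightarrow>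
    HL_max f x \<le> HL_max (\<lambda>y. f y * indicator (ball z (2 * r)) y) x + ennreal K * tail_norm (\<lambda>_. 1) p f z r"
    using HL_max_pointwise[where p=p, OF p] by blast
  obtain C where C: "C \<ge> 1" "\<And>f. f \<in> borel_measurable borel \<Longrightarrow> nrm p (HL_max f) \<le> ennreal C * nrm p f"
    using HL_max_bounded[where p=p, OF p] by blast
  define E :: real where "E = 2 powr sig p"
  have E: "E > 0" by (simp add: E_def)
  define C' where "C' = (C * 2 powr sig p + K * E) * (2 * 2 powr sig p)"
  have C': "C' > 0" unfolding C'_def using C(1) K(1) E by (intro mult_pos_pos add_pos_pos) auto
  have "nrm p (\<lambda>y. HL_max f y * indicator (ball z r) y) \<le>
      ennreal (C' * r powr sig p) * (\<integral>\<^sup>+ s\<in>{r<..}. ennreal (1 / s) * ball_norm p f z s \<partial>lborel)"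
    if "f \<in> borel_measurable borel" "r > 0" for f :: "real ^ 'n::{finite,linorder} \<Rightarrow> ennreal" and z r
    unfolding C'_def
  proof (rule local_estimate[where \<omega>="\<lambda>_. 1" and Op=HL_max and e="\<lambda>_ _ _. 1", OF p _ _ _ C(2,1) _ K(1) _ _ E that])
    show "HL_max f x \<le> HL_max (\<lambda>y. f y * indicator (ball z (2 * r)) y) x + ennreal K * 1 * tail_norm (\<lambda>_. 1) p f z r"
      if "f \<in> borel_measurable borel" "r > 0" "x \<in> ball z r" for f z r x
      using K(2)[OF that] by simp
    show "nrm p (\<lambda>x. 1 * indicator (ball z r) x) \<le> ennreal (E * r powr sig p)" if "r > 0"
      for z :: "real ^ 'n::{finite,linorder}" and r
      using nrm_ball_le[where p=p and z=z, OF p0 that] that by (simp add: E_def powr_mult)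
  qed auto
  with C' show ?thesis by blast
qed

lemma max_commutator_local:
  fixes p :: "'n::{finite,linorder} \<Rightarrow> real" and b :: "real ^ 'n::{finite,linorder} \<Rightarrow> complex"
  assumes p: "\<And>a. p a > 1" and b: "ball_bmo b m \<Theta>"
  shows "\<exists>C>0. \<forall>f\<in>borel_measurable borel. \<forall>z r. r > 0 \<longrightarrow>
    nrm p (\<lambda>y. max_commutator b f y * indicator (ball z r) y) \<le>
      ennreal (C * r powr sig p) * (\<integral>\<^sup>+ s\<in>{r<..}. ennreal ((1 + ln (s / r)) / s) * ball_norm p f z s \<partial>lborel)"
proof -
  have p0: "p a > 0" for a using p[of a] by simp
  have bm [measurable]: "b \<in> borel_measurable borel" using b by (auto simp: ball_bmo_def)
  obtain K where K: "K > 0" "\<And>f z r x. f \<in> borel_measurable borel \<Longrightarrow> r > 0 \<Longrightarrow> x \<in> ball z r \<Longrightarrow>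
    max_commutator b f x \<le> max_commutator b (\<lambda>y. f y * indicator (ball z (2 * r)) y) x +
      ennreal K * (1 + ennreal (norm (b x - m z r))) * tail_norm (\<lambda>u. 1 + ln u) p f z r"
    using max_commutator_pointwise[where p=p, OF p b] by blast
  obtain C where C: "C \<ge> 1" "\<And>f. f \<in> borel_measurable borel \<Longrightarrow> nrm p (max_commutator b f) \<le> ennreal C * nrm p f"
    using max_commutator_bounded[where p=p, OF p b] by blast
  obtain Cm where Cm: "Cm > 0" "\<And>z T. T > 0 \<Longrightarrow> nrm p (\<lambda>y. ennreal (norm (b y - m z T)) * indicator (ball z T) y) \<le> ennreal (Cm * T powr sig p)"
    using ball_bmo_nrm[where p=p, OF p b] by blast
  define E :: real where "E = 2 powr sig p + Cm"
  have E: "E > 0" using Cm(1) by (simp add: E_def add_pos_pos)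
  define C' where "C' = (C * 2 powr sig p + K * E) * (2 * 2 powr sig p)"
  have C': "C' > 0" unfolding C'_def using C(1) K(1) E by (intro mult_pos_pos add_pos_pos) auto
  have "nrm p (\<lambda>y. max_commutator b f y * indicator (ball z r) y) \<le>
      ennreal (C' * r powr sig p) * (\<integral>\<^sup>+ s\<in>{r<..}. ennreal ((1 + ln (s / r)) / s) * ball_norm p f z s \<partial>lborel)"
    if "f \<in> borel_measurable borel" "r > 0" for f :: "real ^ 'n::{finite,linorder} \<Rightarrow> ennreal" and z r
    unfolding C'_def
  proof (rule local_estimate[where \<omega>="\<lambda>u. 1 + ln u" and Op="max_commutator b" and e="\<lambda>z r x. 1 + ennreal (norm (b x - m z r))",
      OF p _ _ _ C(2,1) K(2) K(1) _ _ E that])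
    show "nrm p (\<lambda>x. (1 + ennreal (norm (b x - m z r))) * indicator (ball z r) x) \<le> ennreal (E * r powr sig p)"
      if r: "r > 0" for z :: "real ^ 'n::{finite,linorder}" and r
    proof -
      have "nrm p (\<lambda>x. (1 + ennreal (norm (b x - m z r))) * indicator (ball z r) x) \<le>
         nrm p (indicator (ball z r)) + nrm p (\<lambda>x. ennreal (norm (b x - m z r)) * indicator (ball z r) x)"
        unfolding distrib_right mult_1 by (rule nrm_add[OF p]) measurable
      also have "\<dots> \<le> ennreal ((2 * r) powr sig p) + ennreal (Cm * r powr sig p)"
        by (intro add_mono nrm_ball_le p0 Cm(2) r)
      also have "\<dots> = ennreal (E * r powr sig p)"
        using r Cm(1) by (simp add: E_def powr_mult ennreal_plus[symmetric] distrib_right del: ennreal_plus)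
      finally show ?thesis .
    qed
    show "(1 :: real) + ln s \<le> 1 + ln t" if "1 \<le> s" "s \<le> t" for s t :: real using that by simp
  qed auto
  with C' show ?thesis by blast
qed

section \<open>Morrey norms\<close>

lemma ball_norm_le_morrey:
  fixes F :: "real ^ 'n::{finite,linorder} \<Rightarrow> ennreal"
  assumes F [measurable]: "F \<in> borel_measurable borel" and q: "\<And>j. q $ j > 0" and \<phi>: "\<phi> (z, s) > 0" and s: "s > 0"
  shows "ball_norm (($) q) F z s \<le> ennreal (2 powr sig (($) q)) * morrey_norm \<phi> q F * ennreal (\<phi> (z, s))"
proof -
  define G where "G = nrm (($) q) (\<lambda>y. F y * indicator (ball z s) y)"
  define w where "w = nrm (($) q) (indicator (ball z s))"
  define a where "a = ennreal (\<phi> (z, s))"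
  have wu: "w \<le> ennreal ((2 * s) powr sig (($) q))" unfolding w_def by (rule nrm_ball_le[OF q s])
  have w0: "w \<noteq> 0"
  proof -
    have "ennreal ((2 * (s / real CARD('n))) powr sig (($) q)) \<le> w" unfolding w_def by (rule nrm_ball_ge[OF q s])
    moreover have "ennreal ((2 * (s / real CARD('n))) powr sig (($) q)) > 0" using s by simp
    ultimately show ?thesis by auto
  qed
  have wt: "w < top" using wu by (rule le_less_trans) simp
  have a0: "a \<noteq> 0" "a < top" using \<phi> by (auto simp: a_def)
  have "inverse a * inverse w * G \<le> morrey_norm \<phi> q F"
  proof -
    have 1: "G = mixed_norm q (\<lambda>y. F y * indicator (ball z s) y)"
      unfolding G_def nrm_def by (rule mixed_norm_eq_mnorm[symmetric]) (use q in auto)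
    have 2: "w = mixed_norm q (indicator (ball z s))"
      unfolding w_def nrm_def by (rule mixed_norm_eq_mnorm[symmetric]) (use q in auto)
    show ?thesis unfolding 1 2 a_def morrey_norm_def
      by (rule SUP_upper2[of z], simp, rule SUP_upper2[of s]) (use s in auto)
  qed
  then have "(a * w) * (inverse a * inverse w * G) \<le> (a * w) * morrey_norm \<phi> q F" by (rule mult_left_mono) simp
  moreover have "(a * w) * (inverse a * inverse w * G) = (a * inverse a) * (w * inverse w) * G" by (simp only: ac_simps)
  moreover have "a * inverse a = 1" "w * inverse w = 1"
    using a0 w0 wt by (auto simp: divide_ennreal_def[symmetric] ennreal_divide_self)
  ultimately have "G \<le> (a * w) * morrey_norm \<phi> q F" by simp
  also have "\<dots> \<le> (a * ennreal ((2 * s) powr sig (($) q))) * morrey_norm \<phi> q F"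
    by (intro mult_right_mono mult_left_mono wu) auto
  finally have "G * ennreal (s powr - sig (($) q)) \<le> ((a * ennreal ((2 * s) powr sig (($) q))) * morrey_norm \<phi> q F) * ennreal (s powr - sig (($) q))"
    by (rule mult_right_mono) simp
  also have "\<dots> = ennreal ((2 * s) powr sig (($) q)) * ennreal (s powr - sig (($) q)) * morrey_norm \<phi> q F * a"
    by (simp only: ac_simps)
  also have "ennreal ((2 * s) powr sig (($) q)) * ennreal (s powr - sig (($) q)) = ennreal (2 powr sig (($) q))"
  proof -
    have "s powr sig (($) q) * s powr - sig (($) q) = 1" using s by (simp add: powr_add[symmetric])
    then show ?thesis using s by (simp add: powr_mult ennreal_mult[symmetric] mult.assoc)
  qed
  finally show ?thesis by (simp add: ball_norm_def G_def a_def)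
qed

text \<open>The section of \<phi> may fail to be measurable, so no constant can be moved through the
  integral on the right. Instead the measurable integrand on the left is divided by c and the
  integrals are compared afterwards; c = 0 is treated apart.\<close>

lemma integral_ball_norm_le_morrey:
  fixes F :: "real ^ 'n::{finite,linorder} \<Rightarrow> ennreal"
  assumes F [measurable]: "F \<in> borel_measurable borel" and q: "\<And>j. q $ j > 0" and \<phi>: "\<And>s. s > 0 \<Longrightarrow> \<phi> (z, s) > 0"
    and r: "r > 0" and fin: "morrey_norm \<phi> q F < top"
    and \<omega> [measurable]: "\<omega> \<in> borel_measurable borel" and \<omega>1: "\<And>s. 1 \<le> s \<Longrightarrow> \<omega> s \<ge> 0"
  shows "(\<integral>\<^sup>+ s\<in>{r<..}. ennreal (\<omega> (s / r) / s) * ball_norm (($) q) F z s \<partial>lborel) \<le>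
    ennreal (2 powr sig (($) q)) * morrey_norm \<phi> q F * (\<integral>\<^sup>+ s\<in>{r<..}. ennreal (\<omega> (s / r) * (\<phi> (z, s) / s)) \<partial>lebesgue)"
proof -
  define c where "c = ennreal (2 powr sig (($) q)) * morrey_norm \<phi> q F"
  have c: "c < top" using fin by (simp add: c_def ennreal_mult_less_top)
  have GAm [measurable]: "ball_norm (($) q) F z \<in> borel_measurable borel" by (rule ball_norm_measurable[OF F])
  have le: "ball_norm (($) q) F z s \<le> c * ennreal (\<phi> (z, s))" if "s > r" for s
    unfolding c_def by (rule ball_norm_le_morrey[OF F q]) (use that r \<phi>[of s] in auto)
  show ?thesis
  proof (cases "c = 0")
    case True
    have "(\<integral>\<^sup>+ s\<in>{r<..}. ennreal (\<omega> (s / r) / s) * ball_norm (($) q) F z s \<partial>lborel) = (\<integral>\<^sup>+ (s :: real). 0 \<partial>lborel)"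
    proof (rule nn_integral_cong)
      fix s
      show "ennreal (\<omega> (s / r) / s) * ball_norm (($) q) F z s * indicator {r<..} s = 0"
      proof (cases "s > r")
        case s: True
        have "ball_norm (($) q) F z s = 0" using le[OF s] True by simp
        then show ?thesis by simp
      qed simp
    qed
    then show ?thesis by simp
  next
    case False
    have ic: "c * inverse c = 1" using False c by (simp add: divide_ennreal_def[symmetric] ennreal_divide_self)
    have "(\<integral>\<^sup>+ s\<in>{r<..}. ennreal (\<omega> (s / r) / s) * ball_norm (($) q) F z s \<partial>lborel) =
       (\<integral>\<^sup>+ s. c * (inverse c * (ennreal (\<omega> (s / r) / s) * ball_norm (($) q) F z s * indicator {r<..} s)) \<partial>lborel)"
      by (simp add: mult.assoc[symmetric] ic)
    also have "\<dots> = c * (\<integral>\<^sup>+ s. inverse c * (ennreal (\<omega> (s / r) / s) * ball_norm (($) q) F z s * indicator {r<..} s) \<partial>lborel)"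
      by (rule nn_integral_cmult) measurable
    also have "\<dots> \<le> c * (\<integral>\<^sup>+ s\<in>{r<..}. ennreal (\<omega> (s / r) * (\<phi> (z, s) / s)) \<partial>lborel)"
    proof (intro mult_left_mono nn_integral_mono)
      fix s
      show "inverse c * (ennreal (\<omega> (s / r) / s) * ball_norm (($) q) F z s * indicator {r<..} s) \<le>
        ennreal (\<omega> (s / r) * (\<phi> (z, s) / s)) * indicator {r<..} s"
      proof (cases "s > r")
        case s: True
        have "inverse c * (ennreal (\<omega> (s / r) / s) * ball_norm (($) q) F z s) \<le> inverse c * (ennreal (\<omega> (s / r) / s) * (c * ennreal (\<phi> (z, s))))"
          by (intro mult_left_mono le s) auto
        also have "\<dots> = (c * inverse c) * (ennreal (\<omega> (s / r) / s) * ennreal (\<phi> (z, s)))" by (simp only: ac_simps)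
        also have "\<dots> = ennreal (\<omega> (s / r) / s * \<phi> (z, s))"
          unfolding ic mult_1
        proof (rule ennreal_mult[symmetric])
          show "0 \<le> \<omega> (s / r) / s" using \<omega>1[of "s / r"] s r by simp
          show "0 \<le> \<phi> (z, s)" using \<phi>[of s] s r by simp
        qed
        also have "\<omega> (s / r) / s * \<phi> (z, s) = \<omega> (s / r) * (\<phi> (z, s) / s)" by simp
        finally show ?thesis using s by simp
      qed simp
    qed auto
    finally show ?thesis by (simp add: c_def nn_integral_completion)
  qed
qed

section \<open>Borel representatives\<close>

lemma complex_borel_representative:
  fixes f :: "real ^ 'n::finite \<Rightarrow> complex"
  assumes f [measurable]: "f \<in> borel_measurable lebesgue"
  shows "\<exists>g\<in>borel_measurable borel. \<exists>N\<in>null_sets lborel. \<forall>x. x \<notin> N \<longrightarrow> f x = g x"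
proof -
  have "(\<lambda>x. Re (f x)) \<in> borel_measurable lebesgue" "(\<lambda>x. Im (f x)) \<in> borel_measurable lebesgue" by measurable
  from this[THEN completion_ex_borel_measurable_real] obtain u w
    where [measurable]: "u \<in> borel_measurable lborel" "w \<in> borel_measurable lborel"
      and "AE x in lborel. Re (f x) = u x" "AE x in lborel. Im (f x) = w x" by blast
  then have "AE x in lborel. f x = Complex (u x) (w x)" by (auto simp: complex_eq_iff)
  then obtain N where "N \<in> null_sets lborel" "{x \<in> space lborel. \<not> f x = Complex (u x) (w x)} \<subseteq> N"
    by (auto simp: eventually_ae_filter)
  moreover have "(\<lambda>x. Complex (u x) (w x)) \<in> borel_measurable borel"
  proof -
    have "(\<lambda>x. complex_of_real (u x) + \<i> * complex_of_real (w x)) \<in> borel_measurable borel"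
      using \<open>u \<in> borel_measurable lborel\<close> \<open>w \<in> borel_measurable lborel\<close> by simp
    then show ?thesis by (simp add: Complex_eq)
  qed
  ultimately show ?thesis by (intro bexI[of _ "\<lambda>x. Complex (u x) (w x)"] bexI[of _ N]) auto
qed

lemma AE_null_set: "N \<in> null_sets lborel \<Longrightarrow> (\<And>x. x \<notin> N \<Longrightarrow> P x) \<Longrightarrow> AE x in lebesgue. P x"
  by (rule AE_completion) (auto simp: eventually_ae_filter)

lemma BMO_ball_bmo:
  fixes b b' :: "real ^ 'n::finite \<Rightarrow> complex"
  assumes b: "b \<in> BMO" and b' [measurable]: "b' \<in> borel_measurable borel"
    and N: "N \<in> null_sets lborel" "\<And>x. x \<notin> N \<Longrightarrow> b x = b' x"
  shows "\<exists>\<Theta>. ball_bmo b' (ball_mean b) \<Theta>"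
proof -
  have li: "set_integrable lebesgue K b" if "compact K" for K
    using b that by (simp add: BMO_def locally_integrable_def)
  have int: "integrable lborel (\<lambda>y. indicator (ball x r) y *\<^sub>R b' y)" for x r
  proof -
    have "integrable lebesgue (\<lambda>y. indicator (cball x r) y *\<^sub>R b y)"
      using li[of "cball x r"] by (simp add: set_integrable_def)
    then have "integrable lebesgue (\<lambda>y. indicator (ball x r) y *\<^sub>R (indicator (cball x r) y *\<^sub>R b y))"
      by (rule integrable_mult_indicator[rotated]) simp
    moreover have "(\<lambda>y. indicator (ball x r) y *\<^sub>R (indicator (cball x r) y *\<^sub>R b y)) = (\<lambda>y. indicator (ball x r) y *\<^sub>R b y)"
      by (auto simp: fun_eq_iff indicator_def)
    ultimately have "integrable lebesgue (\<lambda>y. indicator (ball x r) y *\<^sub>R b y)" by simp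
    moreover have "AE y in lebesgue. indicator (ball x r) y *\<^sub>R b' y = indicator (ball x r) y *\<^sub>R b y"
      by (rule AE_null_set[OF N(1)]) (simp add: N(2))
    moreover have m: "(\<lambda>y. indicator (ball x r) y *\<^sub>R b' y) \<in> borel_measurable lborel" by measurable
    ultimately have "integrable lebesgue (\<lambda>y. indicator (ball x r) y *\<^sub>R b' y)"
      by (subst integrable_cong_AE[where g="\<lambda>y. indicator (ball x r) y *\<^sub>R b y"]) (auto intro: measurable_completion)
    then show ?thesis using integrable_completion[OF m] by simp
  qed
  define w where "w = unit_ball_vol (real CARD('n))"
  have w: "w > 0" by (simp add: w_def)
  have "bmo_norm b < top" using b by (simp add: BMO_def)
  then obtain B where B: "B \<ge> 0" "bmo_norm b = ennreal B" by (cases "bmo_norm b") auto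
  \<comment> \<open>The summand 1 keeps the constant positive, as \<open>ball_bmo\<close> demands,
    also when the seminorm of b is 0.\<close>
  have osc: "(\<integral>\<^sup>+ y\<in>ball x r. ennreal (norm (b' y - ball_mean b x r)) \<partial>lborel) \<le> ennreal ((B * w + 1) * r ^ CARD('n))"
    if r: "r > 0" for x r
  proof -
    define V where "V = w * r ^ CARD('n)"
    have V: "V > 0" using w r by (simp add: V_def)
    have eV: "emeasure lebesgue (ball x r) = ennreal V" using r by (simp add: emeasure_ball_vec V_def w_def)
    define I where "I = (\<integral>\<^sup>+ y\<in>ball x r. ennreal (norm (b y - ball_mean b x r)) \<partial>lebesgue)"
    have "I / emeasure lebesgue (ball x r) \<le> bmo_norm b"
      unfolding bmo_norm_def I_def by (rule SUP_upper2[of x], simp, rule SUP_upper2[of r]) (use r in auto)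
    then have "ennreal V * (I / ennreal V) \<le> ennreal V * ennreal B" unfolding eV B(2) by (intro mult_left_mono) auto
    moreover have "ennreal V * (I / ennreal V) = I"
      using V by (simp add: ennreal_times_divide mult.commute[of "ennreal V"] mult_divide_eq_ennreal)
    ultimately have "I \<le> ennreal (V * B)" using V B by (simp add: ennreal_mult)
    also have "\<dots> \<le> ennreal ((B * w + 1) * r ^ CARD('n))"
      using r by (intro ennreal_leI) (simp add: V_def algebra_simps)
    finally have I: "I \<le> ennreal ((B * w + 1) * r ^ CARD('n))" .
    have "(\<integral>\<^sup>+ y\<in>ball x r. ennreal (norm (b' y - ball_mean b x r)) \<partial>lborel) =
        (\<integral>\<^sup>+ y\<in>ball x r. ennreal (norm (b' y - ball_mean b x r)) \<partial>lebesgue)"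
      by (simp add: nn_integral_completion)
    also have "\<dots> = I"
      unfolding I_def by (rule nn_integral_cong_AE, rule AE_null_set[OF N(1)]) (simp add: N(2))
    finally show ?thesis using I by simp
  qed
  have "B * w + 1 > 0" using B w by (simp add: add_nonneg_pos)
  then have "ball_bmo b' (ball_mean b) (B * w + 1)"
    using int osc by (simp add: ball_bmo_def)
  then show ?thesis by blast
qed

text \<open>\<open>locally_integrable\<close> speaks about compact sets only; b is the pointwise
  limit of its restrictions to growing balls.\<close>

lemma BMO_measurable:
  fixes b :: "real ^ 'n::finite \<Rightarrow> complex"
  assumes "b \<in> BMO" shows "b \<in> borel_measurable lebesgue"
proof (rule borel_measurable_LIMSEQ_metric)
  show "(\<lambda>y. indicator (cball 0 (real n)) y *\<^sub>R b y) \<in> borel_measurable lebesgue" for n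
  proof (rule borel_measurable_integrable)
    show "integrable lebesgue (\<lambda>y. indicator (cball 0 (real n)) y *\<^sub>R b y)"
      using assms by (simp add: BMO_def locally_integrable_def set_integrable_def)
  qed
  fix x :: "real ^ 'n"
  obtain n0 where n0: "norm x \<le> real n0" using real_arch_simple by blast
  have "\<forall>\<^sub>F n in sequentially. indicator (cball 0 (real n)) x *\<^sub>R b x = b x"
    by (rule eventually_sequentiallyI[of n0]) (use n0 in auto)
  then show "(\<lambda>n. indicator (cball 0 (real n)) x *\<^sub>R b x) \<longlonglongrightarrow> b x" by (rule tendsto_eventually)
qed

section \<open>Quasi-triangle inequality\<close>

text \<open>For exponents below 1 Minkowski's inequality fails. The maximum, unlike the sum,
  commutes with powers and roots, so it can be carried through the coordinates at the cost of one
  constant for each.\<close>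

lemma cnorm_max_le:
  fixes u w :: "real ^ 'n::finite \<Rightarrow> ennreal"
  assumes p: "p j > 0" and [measurable]: "u \<in> borel_measurable borel" "w \<in> borel_measurable borel"
  shows "cnorm p j (\<lambda>x. max (u x) (w x)) x \<le> ennreal (2 powr (1 / p j)) * max (cnorm p j u x) (cnorm p j w x)"
proof -
  define A where "A = (\<integral>\<^sup>+ t. u (upd_coord x j t) powe p j \<partial>lborel)"
  define B where "B = (\<integral>\<^sup>+ t. w (upd_coord x j t) powe p j \<partial>lborel)"
  have "(\<integral>\<^sup>+ t. max (u (upd_coord x j t)) (w (upd_coord x j t)) powe p j \<partial>lborel) \<le>
     (\<integral>\<^sup>+ t. u (upd_coord x j t) powe p j + w (upd_coord x j t) powe p j \<partial>lborel)"
    using p by (intro nn_integral_mono) (simp add: powe_max add_increasing add_increasing2)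
  also have "\<dots> = A + B" by (simp add: A_def B_def nn_integral_add)
  also have "\<dots> \<le> 2 * max A B" unfolding mult_2 by (intro add_mono) auto
  finally have "cnorm p j (\<lambda>x. max (u x) (w x)) x \<le> (2 * max A B) powe (1 / p j)"
    unfolding cnorm_def using p by (intro powe_mono) auto
  also have "\<dots> = 2 powe (1 / p j) * max (A powe (1 / p j)) (B powe (1 / p j))"
    using p by (simp add: powe_mult powe_max)
  also have "(2 :: ennreal) powe (1 / p j) = ennreal (2 powr (1 / p j))"
    using powe_ennreal[of 2 "1 / p j"] by simp
  finally show ?thesis by (simp add: cnorm_def A_def B_def)
qed

lemma mnorm_max_le:
  fixes js :: "'n::finite list"
  assumes "\<And>j. j \<in> set js \<Longrightarrow> p j > 0"
  shows "\<exists>C\<ge>1. \<forall>u\<in>borel_measurable borel. \<forall>w\<in>borel_measurable borel. \<forall>x :: real ^ 'n.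
    mnorm p js (\<lambda>x. max (u x) (w x)) x \<le> ennreal C * max (mnorm p js u x) (mnorm p js w x)"
  using assms
proof (induction js)
  case Nil
  show ?case by (intro exI[of _ 1]) simp
next
  case (Cons j js)
  have p: "p j > 0" "\<And>j. j \<in> set js \<Longrightarrow> p j > 0" using Cons.prems by auto
  obtain C where C: "C \<ge> 1" "\<And>u w (x :: real ^ 'n). u \<in> borel_measurable borel \<Longrightarrow> w \<in> borel_measurable borel \<Longrightarrow>
    mnorm p js (\<lambda>x. max (u x) (w x)) x \<le> ennreal C * max (mnorm p js u x) (mnorm p js w x)"
    using Cons.IH[OF p(2)] by blast
  define c where "c = 2 powr (1 / p j)"
  have c: "c \<ge> 1" unfolding c_def using p by (intro ge_one_powr_ge_zero) auto
  show ?case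
  proof (intro exI[of _ "c * C"] conjI ballI allI)
    show "1 \<le> c * C" using c C(1) mult_mono[of 1 c 1 C] by simp
    fix u w :: "real ^ 'n \<Rightarrow> ennreal" and x :: "real ^ 'n"
    assume [measurable]: "u \<in> borel_measurable borel" "w \<in> borel_measurable borel"
    have "mnorm p (j # js) (\<lambda>x. max (u x) (w x)) x \<le> mnorm p js (\<lambda>y. ennreal c * max (cnorm p j u y) (cnorm p j w y)) x"
      unfolding mnorm.simps c_def by (intro mnorm_mono p cnorm_max_le) auto
    also have "\<dots> = ennreal c * mnorm p js (\<lambda>y. max (cnorm p j u y) (cnorm p j w y)) x"
      by (rule mnorm_cmult[OF p(2)]) measurable
    also have "\<dots> \<le> ennreal c * (ennreal C * max (mnorm p js (cnorm p j u) x) (mnorm p js (cnorm p j w) x))"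
      by (intro mult_left_mono C(2)) auto
    finally show "mnorm p (j # js) (\<lambda>x. max (u x) (w x)) x \<le> ennreal (c * C) * max (mnorm p (j # js) u x) (mnorm p (j # js) w x)"
      using c C(1) by (simp add: ennreal_mult mult.assoc)
  qed
qed

lemma nrm_sum_quasi:
  fixes p :: "'n::{finite,linorder} \<Rightarrow> real"
  assumes p: "\<And>a. p a > 0" and "finite I"
  shows "\<exists>C\<ge>1. \<forall>f. (\<forall>i\<in>I. f i \<in> borel_measurable borel) \<longrightarrow> nrm p (\<lambda>x. \<Sum>i\<in>I. f i x) \<le> ennreal C * (\<Sum>i\<in>I. nrm p (f i))"
  using assms(2)
proof (induction I rule: finite_induct)
  case empty
  show ?case by (intro exI[of _ 1]) simp
next
  case (insert i I)
  obtain C where C: "C \<ge> 1" "\<And>f. (\<forall>i\<in>I. f i \<in> borel_measurable borel) \<Longrightarrow> nrm p (\<lambda>x. \<Sum>i\<in>I. f i x) \<le> ennreal C * (\<Sum>i\<in>I. nrm p (f i))"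
    using insert.IH by blast
  obtain c where c: "c \<ge> 1" "\<And>u w (x :: real ^ 'n::{finite,linorder}). u \<in> borel_measurable borel \<Longrightarrow> w \<in> borel_measurable borel \<Longrightarrow>
    mnorm p coords (\<lambda>x. max (u x) (w x)) x \<le> ennreal c * max (mnorm p coords u x) (mnorm p coords w x)"
    using mnorm_max_le[where p=p and js=coords] p by blast
  show ?case
  proof (intro exI[of _ "2 * c * C"] conjI allI impI)
    have "1 * 1 * 1 \<le> 2 * c * C" using c(1) C(1) by (intro mult_mono) auto
    then show "1 \<le> 2 * c * C" by simp
    fix f :: "_ \<Rightarrow> real ^ 'n::{finite,linorder} \<Rightarrow> ennreal" assume f: "\<forall>i\<in>insert i I. f i \<in> borel_measurable borel"
    define u where "u = f i"
    define w where "w x = (\<Sum>i\<in>I. f i x)" for x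
    have [measurable]: "u \<in> borel_measurable borel" "w \<in> borel_measurable borel"
      using f unfolding u_def w_def by (auto intro!: borel_measurable_sum)
    have "nrm p (\<lambda>x. \<Sum>i\<in>insert i I. f i x) \<le> nrm p (\<lambda>x. 2 * max (u x) (w x))"
    proof (rule nrm_mono[OF p])
      fix x
      have "u x + w x \<le> 2 * max (u x) (w x)" unfolding mult_2 by (intro add_mono) auto
      then show "(\<Sum>i\<in>insert i I. f i x) \<le> 2 * max (u x) (w x)" using insert by (simp add: u_def w_def)
    qed
    also have "\<dots> = 2 * nrm p (\<lambda>x. max (u x) (w x))" by (rule nrm_cmult[OF p]) measurable
    also have "\<dots> \<le> 2 * (ennreal c * max (nrm p u) (nrm p w))"
      unfolding nrm_def by (intro mult_left_mono c(2)) auto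
    also have "\<dots> \<le> 2 * (ennreal c * (ennreal C * nrm p u + ennreal C * (\<Sum>i\<in>I. nrm p (f i))))"
    proof (intro mult_left_mono)
      have "nrm p w \<le> ennreal C * (\<Sum>i\<in>I. nrm p (f i))" unfolding w_def by (rule C(2)) (use f in auto)
      moreover have "1 * nrm p u \<le> ennreal C * nrm p u" using C(1) by (intro mult_right_mono) auto
      ultimately show "max (nrm p u) (nrm p w) \<le> ennreal C * nrm p u + ennreal C * (\<Sum>i\<in>I. nrm p (f i))"
        by (auto intro: add_increasing add_increasing2)
    qed auto
    also have "\<dots> = ennreal (2 * c * C) * (\<Sum>i\<in>insert i I. nrm p (f i))"
      using insert c(1) C(1) by (simp add: u_def ennreal_mult distrib_left mult.assoc)
    finally show "nrm p (\<lambda>x. \<Sum>i\<in>insert i I. f i x) \<le> ennreal (2 * c * C) * (\<Sum>i\<in>insert i I. nrm p (f i))" .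
  qed
qed

section \<open>Boundedness on generalized mixed Morrey spaces\<close>

lemma measurable_lebesgue_cong_null:
  fixes f g :: "real ^ 'n::finite \<Rightarrow> ennreal"
  assumes g: "g \<in> borel_measurable borel" and N: "N \<in> null_sets lborel" and eq: "\<And>x. x \<notin> N \<Longrightarrow> f x = g x"
  shows "f \<in> borel_measurable lebesgue"
proof (rule measurableI)
  fix A :: "ennreal set" assume "A \<in> sets borel"
  then have "g -` A \<in> sets borel" using measurable_sets[OF g, of A] by simp
  moreover have "N \<in> sets borel" using N by (auto simp: null_sets_def)
  ultimately have "g -` A - N \<in> sets lebesgue" by (intro sets_completionI_sets) auto
  moreover have "f -` A \<inter> N \<in> sets lebesgue"
  proof -
    have "N \<in> null_sets lebesgue" using N by (rule null_sets_completionI)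
    then have "f -` A \<inter> N \<in> null_sets lebesgue" by (rule null_sets_completion_subset[rotated]) auto
    then show ?thesis by (rule null_setsD2)
  qed
  moreover have "f -` A \<inter> space lebesgue = (g -` A - N) \<union> (f -` A \<inter> N)" using eq by auto
  ultimately show "f -` A \<inter> space lebesgue \<in> sets lebesgue" by (metis sets.Un)
qed simp

lemma morrey_norm_cong_null:
  assumes "N \<in> null_sets lborel" "\<And>x. x \<notin> N \<Longrightarrow> F x = G x"
  shows "morrey_norm \<phi> q F = morrey_norm \<phi> q G"
proof -
  have "mixed_norm q (\<lambda>y. F y * indicator (ball x r) y) = mixed_norm q (\<lambda>y. G y * indicator (ball x r) y)" for x r
    by (rule mixed_norm_cong_null[OF assms(1)]) (simp add: assms(2))
  then show ?thesis by (simp add: morrey_norm_def)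
qed

text \<open>The estimate on single balls for a Borel representative, before division by \<phi> and
  by the norm of the ball. In this form the estimates for the different i can be added.\<close>

definition local_bound ::
    "nat \<Rightarrow> (nat \<Rightarrow> (real ^ 'n::{finite,linorder}) \<times> real \<Rightarrow> real) \<Rightarrow> (nat \<Rightarrow> real ^ 'n::{finite,linorder})
      \<Rightarrow> ((real ^ 'n::{finite,linorder}) \<times> real \<Rightarrow> real) \<Rightarrow> real ^ 'n::{finite,linorder} \<Rightarrow> real
      \<Rightarrow> ((nat \<Rightarrow> real ^ 'n::{finite,linorder} \<Rightarrow> complex) \<Rightarrow> real ^ 'n::{finite,linorder} \<Rightarrow> ennreal)
      \<Rightarrow> (nat \<Rightarrow> real ^ 'n::{finite,linorder} \<Rightarrow> complex) \<Rightarrow> bool" where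
  "local_bound m \<phi>s qs \<phi> q C S f \<longleftrightarrow>
     (\<exists>S'\<in>borel_measurable borel. \<exists>N\<in>null_sets lborel. (\<forall>x. x \<notin> N \<longrightarrow> S f x = S' x) \<and>
        (\<forall>z r. r > 0 \<longrightarrow> nrm (($) q) (\<lambda>y. S' y * indicator (ball z r) y) \<le>
          ennreal (C * \<phi> (z, r)) * nrm (($) q) (indicator (ball z r)) *
            (\<Prod>k\<in>{1..m}. morrey_norm (\<phi>s k) (qs k) (\<lambda>x. ennreal (norm (f k x))))))"

lemma morrey_boundedI:
  fixes q :: "real ^ 'n::{finite,linorder}"
  assumes C: "C > 0" and q: "\<And>j. q $ j > 0" and \<phi>: "\<And>z r. r > 0 \<Longrightarrow> \<phi> (z, r) > 0"
    and H: "\<And>f. \<forall>k\<in>{1..m}. f k \<in> morrey_space (\<phi>s k) (qs k) \<Longrightarrow>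
      local_bound m \<phi>s qs \<phi> q C S f"
  shows "morrey_bounded m \<phi>s qs \<phi> q S"
  unfolding morrey_bounded_def
proof (intro exI[of _ C] conjI allI impI C)
  fix f assume f: "\<forall>k\<in>{1..m}. f k \<in> morrey_space (\<phi>s k) (qs k)"
  define M where "M = (\<Prod>k\<in>{1..m}. morrey_norm (\<phi>s k) (qs k) (\<lambda>x. ennreal (norm (f k x))))"
  obtain S' N where S' [measurable]: "S' \<in> borel_measurable borel" and N: "N \<in> null_sets lborel"
    and eq: "\<And>x. x \<notin> N \<Longrightarrow> S f x = S' x"
    and bd: "\<And>z r. r > 0 \<Longrightarrow> nrm (($) q) (\<lambda>y. S' y * indicator (ball z r) y) \<le>
          ennreal (C * \<phi> (z, r)) * nrm (($) q) (indicator (ball z r)) * M"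
    using H[OF f] unfolding M_def local_bound_def by blast
  show "S f \<in> borel_measurable lebesgue" by (rule measurable_lebesgue_cong_null[OF S' N eq])
  have "morrey_norm \<phi> q S' \<le> ennreal C * M"
    unfolding morrey_norm_def
  proof (intro SUP_least)
    fix z :: "real ^ 'n::{finite,linorder}" and r :: real assume "r \<in> {0<..}"
    then have r: "r > 0" by simp
    define w where "w = nrm (($) q) (indicator (ball z r))"
    define a where "a = ennreal (\<phi> (z, r))"
    have 1: "mixed_norm q (\<lambda>y. S' y * indicator (ball z r) y) = nrm (($) q) (\<lambda>y. S' y * indicator (ball z r) y)"
      unfolding nrm_def by (rule mixed_norm_eq_mnorm) (use q in auto)
    have 2: "mixed_norm q (indicator (ball z r)) = w"
      unfolding w_def nrm_def by (rule mixed_norm_eq_mnorm) (use q in auto)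
    have wt: "w < top" unfolding w_def using nrm_ball_le[where p="($) q" and z=z, OF q r] by (rule le_less_trans) simp
    have w0: "w \<noteq> 0"
    proof -
      have "ennreal ((2 * (r / real CARD('n))) powr sig (($) q)) \<le> w" unfolding w_def by (rule nrm_ball_ge[OF q r])
      moreover have "ennreal ((2 * (r / real CARD('n))) powr sig (($) q)) > 0" using r by simp
      ultimately show ?thesis by auto
    qed
    have a0: "a \<noteq> 0" "a < top" using \<phi>[OF r, of z] by (auto simp: a_def)
    have "inverse a * inverse w * nrm (($) q) (\<lambda>y. S' y * indicator (ball z r) y) \<le>
      inverse a * inverse w * (ennreal (C * \<phi> (z, r)) * w * M)"
      unfolding w_def by (intro mult_left_mono bd r) auto
    also have "\<dots> = (a * inverse a) * (w * inverse w) * (ennreal C * M)"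
      using C \<phi>[OF r] by (simp add: a_def ennreal_mult less_imp_le ac_simps)
    also have "\<dots> = ennreal C * M"
      using a0 w0 wt by (simp add: divide_ennreal_def[symmetric] ennreal_divide_self)
    finally show "inverse (ennreal (\<phi> (z, r))) * inverse (mixed_norm q (indicator (ball z r))) *
       mixed_norm q (\<lambda>y. S' y * indicator (ball z r) y) \<le> ennreal C * M"
      unfolding 1 2 a_def .
  qed
  then show "morrey_norm \<phi> q (S f) \<le> ennreal C * (\<Prod>k\<in>{1..m}. morrey_norm (\<phi>s k) (qs k) (\<lambda>x. ennreal (norm (f k x))))"
    using morrey_norm_cong_null[OF N eq, where \<phi>=\<phi> and q=q] by (simp add: M_def)
qed

text \<open>The supremum of the product of averages is at most the product of the maximal functions,
  so Hoelder's inequality on the ball separates the m factors, and each has a local estimate. The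
  integrals \<open>J k\<close> multiply to the left side of the condition on \<phi>, and the powers
  of r combine because \<open>sig\<close> of q is the sum of the \<open>sig (P k)\<close>.\<close>

lemma max_comm_i_estimate:
  fixes m :: nat
    and qs :: "nat \<Rightarrow> real ^ 'n::{finite,linorder}"
    and q :: "real ^ 'n::{finite,linorder}"
    and \<phi>s :: "nat \<Rightarrow> (real ^ 'n::{finite,linorder}) \<times> real \<Rightarrow> real"
    and \<phi> :: "(real ^ 'n::{finite,linorder}) \<times> real \<Rightarrow> real"
    and b :: "nat \<Rightarrow> real ^ 'n::{finite,linorder} \<Rightarrow> complex"
  assumes qs: "\<And>k j. k \<in> {1..m} \<Longrightarrow> 1 < qs k $ j"
    and q: "\<And>j. 1 / q $ j = (\<Sum>k\<in>{1..m}. 1 / qs k $ j)"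
    and \<phi>: "\<And>z r. r > 0 \<Longrightarrow> \<phi> (z, r) > 0"
    and \<phi>s: "\<And>k z r. k \<in> {1..m} \<Longrightarrow> r > 0 \<Longrightarrow> \<phi>s k (z, r) > 0"
    and i: "i \<in> {1..m}" and b: "b i \<in> BMO" and Phi: "cond_Phi m \<phi>s \<phi> i"
  shows "\<exists>C>0. \<forall>f. (\<forall>k\<in>{1..m}. f k \<in> morrey_space (\<phi>s k) (qs k)) \<longrightarrow>
    local_bound m \<phi>s qs \<phi> q C (max_comm_i m b i) f"
proof -
  define P where "P k = (($) (qs k))" for k
  have P1: "P k a > 1" if "k \<in> {1..m}" for k a using qs[OF that] by (simp add: P_def)
  have P0: "P k a > 0" if "k \<in> {1..m}" for k a using P1[OF that, of a] by simp
  have ne: "{1..m} \<noteq> {}" using i by auto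
  have q0: "q $ j > 0" for j
  proof -
    have "1 / q $ j > 0" unfolding q using P0 ne by (intro sum_pos) (auto simp: P_def)
    then show ?thesis by simp
  qed
  have sigq: "sig (($) q) = (\<Sum>k\<in>{1..m}. sig (P k))"
    unfolding sig_def P_def q by (rule sum.swap)
  obtain b' Nb where b' [measurable]: "b' \<in> borel_measurable borel" and Nb: "Nb \<in> null_sets lborel" "\<And>x. x \<notin> Nb \<Longrightarrow> b i x = b' x"
    using complex_borel_representative[OF BMO_measurable[OF b]] by blast
  obtain \<Theta> where bmo: "ball_bmo b' (ball_mean (b i)) \<Theta>" using BMO_ball_bmo[OF b b' Nb] by blast
  obtain C0 where C0: "C0 > 0" "\<And>z r. r > 0 \<Longrightarrow>
      (\<integral>\<^sup>+ t\<in>{r<..}. ennreal ((1 + ln (t / r)) * (\<phi>s i (z, t) / t)) \<partial>lebesgue)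
          * (\<Prod>k\<in>{1..m} - {i}. \<integral>\<^sup>+ t\<in>{r<..}. ennreal (\<phi>s k (z, t) / t) \<partial>lebesgue)
        \<le> ennreal (C0 * \<phi> (z, r))"
    using Phi unfolding cond_Phi_def by blast
  have "\<forall>k\<in>{1..m}. \<exists>C>0. \<forall>f\<in>borel_measurable borel. \<forall>z r. r > 0 \<longrightarrow>
    nrm (P k) (\<lambda>y. HL_max f y * indicator (ball z r) y) \<le>
      ennreal (C * r powr sig (P k)) * (\<integral>\<^sup>+ s\<in>{r<..}. ennreal (1 / s) * ball_norm (P k) f z s \<partial>lborel)"
    using HL_max_local P1 by blast
  then obtain cH where cH: "\<And>k. k \<in> {1..m} \<Longrightarrow> cH k > 0" "\<And>k f z r. k \<in> {1..m} \<Longrightarrow> f \<in> borel_measurable borel \<Longrightarrow> r > 0 \<Longrightarrow>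
    nrm (P k) (\<lambda>y. HL_max f y * indicator (ball z r) y) \<le>
      ennreal (cH k * r powr sig (P k)) * (\<integral>\<^sup>+ s\<in>{r<..}. ennreal (1 / s) * ball_norm (P k) f z s \<partial>lborel)"
    using bchoice[of "{1..m}" "\<lambda>k C. C > 0 \<and> (\<forall>f\<in>borel_measurable borel. \<forall>z r. r > 0 \<longrightarrow>
      nrm (P k) (\<lambda>y. HL_max f y * indicator (ball z r) y) \<le>
      ennreal (C * r powr sig (P k)) * (\<integral>\<^sup>+ s\<in>{r<..}. ennreal (1 / s) * ball_norm (P k) f z s \<partial>lborel))"] by blast
  obtain cC where cC: "cC > 0" "\<And>f z r. f \<in> borel_measurable borel \<Longrightarrow> r > 0 \<Longrightarrow>
    nrm (P i) (\<lambda>y. max_commutator b' f y * indicator (ball z r) y) \<le>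
      ennreal (cC * r powr sig (P i)) * (\<integral>\<^sup>+ s\<in>{r<..}. ennreal ((1 + ln (s / r)) / s) * ball_norm (P i) f z s \<partial>lborel)"
    using max_commutator_local[where p="P i", OF P1[OF i] bmo] by blast
  define ck where "ck k = (if k = i then cC else cH k)" for k
  define d where "d k = ck k * 2 powr sig (P k)" for k
  have d0: "d k > 0" if "k \<in> {1..m}" for k using that cH(1) cC(1) by (simp add: d_def ck_def)
  define J where "J k z r = (if k = i then (\<integral>\<^sup>+ t\<in>{r<..}. ennreal ((1 + ln (t / r)) * (\<phi>s i (z, t) / t)) \<partial>lebesgue)
      else (\<integral>\<^sup>+ t\<in>{r<..}. ennreal (\<phi>s k (z, t) / t) \<partial>lebesgue))" for k z r
  have J: "(\<Prod>k\<in>{1..m}. J k z r) \<le> ennreal (C0 * \<phi> (z, r))" if "r > 0" for z r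
  proof -
    have "(\<Prod>k\<in>{1..m}. J k z r) = J i z r * (\<Prod>k\<in>{1..m} - {i}. J k z r)" using i by (intro prod.remove) auto
    also have "(\<Prod>k\<in>{1..m} - {i}. J k z r) = (\<Prod>k\<in>{1..m} - {i}. \<integral>\<^sup>+ t\<in>{r<..}. ennreal (\<phi>s k (z, t) / t) \<partial>lebesgue)"
      by (intro prod.cong) (auto simp: J_def)
    finally show ?thesis using C0(2)[OF that, of z] by (simp add: J_def)
  qed
  \<comment> \<open>Converts the power of r into that of 2 r / d, the side of the cube inscribed in
    the ball in \<open>nrm_ball_ge\<close>, with d the dimension.\<close>
  define e where "e = (real CARD('n) / 2) powr sig (($) q)"
  have e0: "e > 0" by (simp add: e_def)
  define C where "C = C0 * (prod d {1..m} * e)"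
  have C: "C > 0" unfolding C_def using C0(1) e0 d0 by (intro mult_pos_pos prod_pos) auto
  show ?thesis
  proof (intro exI[of _ C] conjI allI impI C)
    fix f :: "nat \<Rightarrow> real ^ 'n::{finite,linorder} \<Rightarrow> complex"
    assume f: "\<forall>k\<in>{1..m}. f k \<in> morrey_space (\<phi>s k) (qs k)"
    define M where "M k = morrey_norm (\<phi>s k) (qs k) (\<lambda>x. ennreal (norm (f k x)))" for k
    have "\<forall>k\<in>{1..m}. \<exists>g. g \<in> borel_measurable borel \<and> (\<exists>N\<in>null_sets lborel. \<forall>x. x \<notin> N \<longrightarrow> f k x = g x)"
      using f complex_borel_representative unfolding morrey_space_def by blast
    then obtain g where g: "\<And>k. k \<in> {1..m} \<Longrightarrow> g k \<in> borel_measurable borel"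
      "\<And>k. k \<in> {1..m} \<Longrightarrow> \<exists>N\<in>null_sets lborel. \<forall>x. x \<notin> N \<longrightarrow> f k x = g k x"
      using bchoice[of "{1..m}" "\<lambda>k g. g \<in> borel_measurable borel \<and> (\<exists>N\<in>null_sets lborel. \<forall>x. x \<notin> N \<longrightarrow> f k x = g x)"] by blast
    define F where "F k y = ennreal (norm (g k y))" for k y
    have Fm [measurable]: "F k \<in> borel_measurable borel" if "k \<in> {1..m}" for k
      using g(1)[OF that] unfolding F_def by measurable
    have FM: "morrey_norm (\<phi>s k) (qs k) (F k) = M k" if k: "k \<in> {1..m}" for k
    proof -
      obtain N where "N \<in> null_sets lborel" "\<And>x. x \<notin> N \<Longrightarrow> f k x = g k x" using g(2)[OF k] by blast
      then show ?thesis unfolding M_def F_def by (intro morrey_norm_cong_null) auto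
    qed
    have M_fin: "M k < top" if "k \<in> {1..m}" for k using f that unfolding M_def morrey_space_def by auto
    define S' where "S' x = max_commutator b' (F i) x * (SUP r\<in>{0<..}. \<Prod>k\<in>{1..m} - {i}. avg (F k) x r)" for x
    have Sm: "S' \<in> borel_measurable borel"
    proof -
      have "(\<lambda>x. SUP r\<in>{0<..}. \<Prod>k\<in>{1..m} - {i}. avg (F k) x r) \<in> borel_measurable borel"
      proof (rule SUP_prod_avg_measurable)
        fix k assume "k \<in> {1..m} - {i}"
        then have [measurable]: "F k \<in> borel_measurable borel" using Fm by auto
        show "(\<lambda>(x, y). F k y) \<in> borel_measurable (borel \<Otimes>\<^sub>M borel)" by measurable
      qed simp
      moreover have "max_commutator b' (F i) \<in> borel_measurable borel" by (rule max_commutator_measurable[OF Fm[OF i] b'])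
      ultimately show ?thesis unfolding S'_def by (intro borel_measurable_times_ennreal)
    qed
    have avg_eq: "(\<integral>\<^sup>+ y\<in>ball x r. G y \<partial>lebesgue) / emeasure lebesgue (ball x r) = avg G' x r"
      if "N \<in> null_sets lborel" "\<And>y. y \<notin> N \<Longrightarrow> G y = G' y" for G G' N and x :: "real ^ 'n::{finite,linorder}" and r
    proof -
      have "(\<integral>\<^sup>+ y\<in>ball x r. G y \<partial>lebesgue) = (\<integral>\<^sup>+ y\<in>ball x r. G' y \<partial>lebesgue)"
        by (rule nn_integral_cong_AE, rule AE_null_set[OF that(1)]) (simp add: that(2))
      also have "\<dots> = (\<integral>\<^sup>+ y\<in>ball x r. G' y \<partial>lborel)" by (simp add: nn_integral_completion)
      finally show ?thesis by (simp add: avg_def)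
    qed
    \<comment> \<open>Changes on null sets disappear in the averages; only the value of b i at x
      itself stands outside an integral, so the null set \<open>Nb\<close> serves for every
      f.\<close>
    have eq: "max_comm_i m b i f x = S' x" if x: "x \<notin> Nb" for x
    proof -
      obtain Ni where Ni: "Ni \<in> null_sets lborel" "\<And>x. x \<notin> Ni \<Longrightarrow> f i x = g i x" using g(2)[OF i] by blast
      have "(\<integral>\<^sup>+ y\<in>ball x r. ennreal (norm (b i x - b i y) * norm (f i y)) \<partial>lebesgue) / emeasure lebesgue (ball x r) =
          avg (\<lambda>y. ennreal (norm (b' x - b' y)) * F i y) x r" for r
      proof (rule avg_eq[OF null_sets.Un[OF Nb(1) Ni(1)]])
        fix y assume "y \<notin> Nb \<union> Ni"
        then show "ennreal (norm (b i x - b i y) * norm (f i y)) = ennreal (norm (b' x - b' y)) * F i y"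
          using Nb(2) Ni(2) x by (simp add: F_def ennreal_mult)
      qed
      moreover have "(\<integral>\<^sup>+ y\<in>ball x r. ennreal (norm (f k y)) \<partial>lebesgue) / emeasure lebesgue (ball x r) = avg (F k) x r"
        if k: "k \<in> {1..m} - {i}" for k r
      proof -
        obtain N where "N \<in> null_sets lborel" "\<And>x. x \<notin> N \<Longrightarrow> f k x = g k x" using g(2)[of k] k by blast
        then show ?thesis by (intro avg_eq) (auto simp: F_def)
      qed
      ultimately show ?thesis unfolding max_comm_i_def S'_def max_commutator_def by simp
    qed
    define Op where "Op k = (if k = i then max_commutator b' (F i) else HL_max (F k))" for k
    have Opm [measurable]: "Op k \<in> borel_measurable borel" if "k \<in> {1..m}" for k
      using max_commutator_measurable[OF Fm[OF i] b'] HL_max_measurable[OF Fm[OF that]] by (simp add: Op_def)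
    have Op_bd: "nrm (P k) (\<lambda>y. Op k y * indicator (ball z r) y) \<le> ennreal (d k * r powr sig (P k)) * (M k * J k z r)"
      if k: "k \<in> {1..m}" and r: "r > 0" for k z r
    proof -
      have qk: "\<And>j. 0 < qs k $ j" using P0[OF k] by (simp add: P_def)
      have fin: "morrey_norm (\<phi>s k) (qs k) (F k) < top" using M_fin[OF k] FM[OF k] by simp
      have pos: "ck k > 0" using cC(1) cH(1)[OF k] by (simp add: ck_def)
      define \<omega> where "\<omega> u = (if k = i then 1 + ln u else 1 :: real)" for u
      have \<omega>m: "\<omega> \<in> borel_measurable borel" unfolding \<omega>_def by measurable
      have "nrm (P k) (\<lambda>y. Op k y * indicator (ball z r) y) \<le>
        ennreal (ck k * r powr sig (P k)) * (\<integral>\<^sup>+ s\<in>{r<..}. ennreal (\<omega> (s / r) / s) * ball_norm (P k) (F k) z s \<partial>lborel)"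
        using cC(2)[OF Fm[OF i] r, of z] cH(2)[OF k Fm[OF k] r, of z] by (simp add: Op_def ck_def \<omega>_def)
      also have "\<dots> \<le> ennreal (ck k * r powr sig (P k)) * (ennreal (2 powr sig (P k)) * M k *
          (\<integral>\<^sup>+ s\<in>{r<..}. ennreal (\<omega> (s / r) * (\<phi>s k (z, s) / s)) \<partial>lebesgue))"
        unfolding P_def FM[OF k, symmetric]
      proof (intro mult_left_mono integral_ball_norm_le_morrey Fm k qk \<phi>s r fin \<omega>m)
        show "0 \<le> \<omega> s" if "1 \<le> s" for s using that by (simp add: \<omega>_def)
      qed auto
      also have "(\<integral>\<^sup>+ s\<in>{r<..}. ennreal (\<omega> (s / r) * (\<phi>s k (z, s) / s)) \<partial>lebesgue) = J k z r"
        by (simp add: \<omega>_def J_def)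
      also have "ennreal (ck k * r powr sig (P k)) * (ennreal (2 powr sig (P k)) * M k * J k z r) =
          ennreal (d k * r powr sig (P k)) * (M k * J k z r)"
        using pos by (simp add: d_def ennreal_mult ac_simps)
      finally show ?thesis .
    qed
    show "local_bound m \<phi>s qs \<phi> q C (max_comm_i m b i) f"
      unfolding local_bound_def
    proof (intro bexI[of _ S'] bexI[of _ Nb] conjI allI impI eq Sm Nb(1))
      fix z :: "real ^ 'n::{finite,linorder}" and r :: real assume r: "r > 0"
      have "nrm (($) q) (\<lambda>y. S' y * indicator (ball z r) y) \<le> nrm (($) q) (\<lambda>y. \<Prod>k\<in>{1..m}. Op k y * indicator (ball z r) y)"
      proof (rule nrm_mono[OF q0])
        fix y
        show "S' y * indicator (ball z r) y \<le> (\<Prod>k\<in>{1..m}. Op k y * indicator (ball z r) y)"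
        proof (cases "y \<in> ball z r")
          case True
          have "(SUP r\<in>{0<..}. \<Prod>k\<in>{1..m} - {i}. avg (F k) y r) \<le> (\<Prod>k\<in>{1..m} - {i}. HL_max (F k) y)"
            unfolding HL_max_def by (intro SUP_least prod_mono_ennreal SUP_upper)
          then have "S' y \<le> Op i y * (\<Prod>k\<in>{1..m} - {i}. HL_max (F k) y)"
            unfolding S'_def by (simp add: Op_def mult_left_mono)
          also have "(\<Prod>k\<in>{1..m} - {i}. HL_max (F k) y) = (\<Prod>k\<in>{1..m} - {i}. Op k y)"
            by (intro prod.cong) (auto simp: Op_def)
          also have "Op i y * (\<Prod>k\<in>{1..m} - {i}. Op k y) = (\<Prod>k\<in>{1..m}. Op k y)"
            using i by (intro prod.remove[symmetric]) auto
          finally show ?thesis using True by simp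
        qed simp
      qed
      also have "\<dots> \<le> (\<Prod>k\<in>{1..m}. nrm (P k) (\<lambda>y. Op k y * indicator (ball z r) y))"
        unfolding nrm_def
      proof (rule mnorm_prod_Holder)
        show "(\<lambda>y. Op k y * indicator (ball z r) y) \<in> borel_measurable borel" if "k \<in> {1..m}" for k
          using Opm[OF that] by measurable
      qed (use ne P0 q in \<open>auto simp: P_def\<close>)
      also have "\<dots> \<le> (\<Prod>k\<in>{1..m}. ennreal (d k * r powr sig (P k)) * (M k * J k z r))"
        by (intro prod_mono_ennreal Op_bd r)
      also have "\<dots> = (\<Prod>k\<in>{1..m}. ennreal (d k * r powr sig (P k))) * ((\<Prod>k\<in>{1..m}. M k) * (\<Prod>k\<in>{1..m}. J k z r))"
        by (simp only: prod.distrib)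
      also have "(\<Prod>k\<in>{1..m}. ennreal (d k * r powr sig (P k))) = ennreal (\<Prod>k\<in>{1..m}. d k * r powr sig (P k))"
        by (intro prod_ennreal mult_nonneg_nonneg less_imp_le[OF d0] powr_ge_zero)
      also have "(\<Prod>k\<in>{1..m}. d k * r powr sig (P k)) = prod d {1..m} * r powr sig (($) q)"
        unfolding prod.distrib sigq using r by (subst powr_sum) auto
      also have "r powr sig (($) q) = e * (2 * (r / real CARD('n))) powr sig (($) q)"
        using r by (simp add: e_def powr_mult[symmetric])
      also have "ennreal (prod d {1..m} * (e * (2 * (r / real CARD('n))) powr sig (($) q))) * ((\<Prod>k\<in>{1..m}. M k) * (\<Prod>k\<in>{1..m}. J k z r)) \<le>
        (ennreal (prod d {1..m} * e) * nrm (($) q) (indicator (ball z r))) * ((\<Prod>k\<in>{1..m}. M k) * ennreal (C0 * \<phi> (z, r)))"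
      proof (rule mult_mono)
        have "prod d {1..m} \<ge> 0" using d0 by (intro prod_nonneg) (auto intro: less_imp_le)
        then have "ennreal (prod d {1..m} * (e * (2 * (r / real CARD('n))) powr sig (($) q))) =
           ennreal (prod d {1..m} * e) * ennreal ((2 * (r / real CARD('n))) powr sig (($) q))"
          using e0 by (subst ennreal_mult[symmetric]) (auto simp: mult.assoc)
        also have "\<dots> \<le> ennreal (prod d {1..m} * e) * nrm (($) q) (indicator (ball z r))"
          by (intro mult_left_mono nrm_ball_ge q0 r) auto
        finally show "ennreal (prod d {1..m} * (e * (2 * (r / real CARD('n))) powr sig (($) q))) \<le>
          ennreal (prod d {1..m} * e) * nrm (($) q) (indicator (ball z r))" .
        show "(\<Prod>k\<in>{1..m}. M k) * (\<Prod>k\<in>{1..m}. J k z r) \<le> (\<Prod>k\<in>{1..m}. M k) * ennreal (C0 * \<phi> (z, r))"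
          by (intro mult_left_mono J r) auto
      qed auto
      also have "\<dots> = (ennreal (C0 * \<phi> (z, r)) * ennreal (prod d {1..m} * e)) * nrm (($) q) (indicator (ball z r)) * (\<Prod>k\<in>{1..m}. M k)"
        by (simp only: ac_simps)
      also have "ennreal (C0 * \<phi> (z, r)) * ennreal (prod d {1..m} * e) = ennreal (C * \<phi> (z, r))"
      proof -
        have "prod d {1..m} * e \<ge> 0" using d0 e0 by (intro mult_nonneg_nonneg prod_nonneg) (auto intro: less_imp_le)
        then show ?thesis using C0(1) \<phi>[OF r, of z]
          by (subst ennreal_mult[symmetric]) (auto simp: C_def ac_simps less_imp_le)
      qed
      finally show "nrm (($) q) (\<lambda>y. S' y * indicator (ball z r) y) \<le>
          ennreal (C * \<phi> (z, r)) * nrm (($) q) (indicator (ball z r)) *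
            (\<Prod>k\<in>{1..m}. morrey_norm (\<phi>s k) (qs k) (\<lambda>x. ennreal (norm (f k x))))"
        by (simp add: M_def)
    qed
  qed
qed

theorem theorem5p7:
  fixes m :: nat
    and qs :: "nat \<Rightarrow> real ^ 'n::{finite,linorder}"
    and q :: "real ^ 'n::{finite,linorder}"
    and \<phi>s :: "nat \<Rightarrow> (real ^ 'n::{finite,linorder}) \<times> real \<Rightarrow> real"
    and \<phi> :: "(real ^ 'n::{finite,linorder}) \<times> real \<Rightarrow> real"
    and b :: "nat \<Rightarrow> real ^ 'n::{finite,linorder} \<Rightarrow> complex"
  assumes "m \<ge> 2"
    and "\<forall>k\<in>{1..m}. \<forall>j. 1 < qs k $ j"
    and "\<forall>j. 1 / q $ j = (\<Sum>k\<in>{1..m}. 1 / qs k $ j)"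
    and "morrey_weight \<phi>"
    and "\<forall>k\<in>{1..m}. morrey_weight (\<phi>s k)"
    and "\<forall>k\<in>{1..m}. b k \<in> BMO"
  shows "(\<forall>i\<in>{1..m}. cond_Phi m \<phi>s \<phi> i \<longrightarrow>
            morrey_bounded m \<phi>s qs \<phi> q (max_comm_i m b i))
       \<and> ((\<forall>i\<in>{1..m}. cond_Phi m \<phi>s \<phi> i) \<longrightarrow>
            morrey_bounded m \<phi>s qs \<phi> q (max_comm m b))"
proof -
  have qs: "1 < qs k $ j" if "k \<in> {1..m}" for k j using assms(2) that by blast
  have q: "1 / q $ j = (\<Sum>k\<in>{1..m}. 1 / qs k $ j)" for j using assms(3) by blast
  have \<phi>: "\<phi> (z, r) > 0" if "r > 0" for z r using assms(4) that by (simp add: morrey_weight_def)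
  have \<phi>s: "\<phi>s k (z, r) > 0" if "k \<in> {1..m}" "r > 0" for k z r using assms(5) that by (simp add: morrey_weight_def)
  have b: "b i \<in> BMO" if "i \<in> {1..m}" for i using assms(6) that by blast
  have q0: "q $ j > 0" for j
  proof -
    have "1 / q $ j > 0" unfolding q
    proof (rule sum_pos)
      show "0 < 1 / qs k $ j" if "k \<in> {1..m}" for k using qs[OF that, of j] by simp
    qed (use assms(1) in auto)
    then show ?thesis by simp
  qed
  have est: "\<exists>C>0. \<forall>f. (\<forall>k\<in>{1..m}. f k \<in> morrey_space (\<phi>s k) (qs k)) \<longrightarrow>
      local_bound m \<phi>s qs \<phi> q C (max_comm_i m b i) f" if "i \<in> {1..m}" "cond_Phi m \<phi>s \<phi> i" for i
    by (rule max_comm_i_estimate) (fact qs q \<phi> \<phi>s b[OF that(1)] that)+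
  show ?thesis
  proof (intro conjI ballI impI)
    fix i assume i: "i \<in> {1..m}" and Phi: "cond_Phi m \<phi>s \<phi> i"
    obtain C where C: "C > 0" "\<And>f. \<forall>k\<in>{1..m}. f k \<in> morrey_space (\<phi>s k) (qs k) \<Longrightarrow>
      local_bound m \<phi>s qs \<phi> q C (max_comm_i m b i) f"
      using est[OF i Phi] by blast
    show "morrey_bounded m \<phi>s qs \<phi> q (max_comm_i m b i)"
      by (rule morrey_boundedI[OF C(1) q0 \<phi> C(2)])
  next
    assume Phi: "\<forall>i\<in>{1..m}. cond_Phi m \<phi>s \<phi> i"
    have "\<forall>i\<in>{1..m}. \<exists>C>0. \<forall>f. (\<forall>k\<in>{1..m}. f k \<in> morrey_space (\<phi>s k) (qs k)) \<longrightarrow>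
        local_bound m \<phi>s qs \<phi> q C (max_comm_i m b i) f" using est Phi by blast
    from bchoice[OF this] obtain C where C: "\<And>i. i \<in> {1..m} \<Longrightarrow> C i > 0"
      "\<And>i f. i \<in> {1..m} \<Longrightarrow> \<forall>k\<in>{1..m}. f k \<in> morrey_space (\<phi>s k) (qs k) \<Longrightarrow>
        local_bound m \<phi>s qs \<phi> q (C i) (max_comm_i m b i) f"
      by blast
    \<comment> \<open>Some q_j may be below 1, so the sum over i is estimated by the quasi-triangle
      inequality instead of Minkowski's.\<close>
    obtain c where c: "c \<ge> 1" "\<And>f. (\<forall>i\<in>{1..m}. f i \<in> borel_measurable borel) \<Longrightarrow>
        nrm (($) q) (\<lambda>x. \<Sum>i\<in>{1..m}. f i x) \<le> ennreal c * (\<Sum>i\<in>{1..m}. nrm (($) q) (f i))"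
      using nrm_sum_quasi[where p="($) q" and I="{1..m}"] q0 by blast
    define C' where "C' = c * (\<Sum>i\<in>{1..m}. C i)"
    have sC: "(\<Sum>i\<in>{1..m}. C i) > 0" using C(1) assms(1) by (intro sum_pos) auto
    show "morrey_bounded m \<phi>s qs \<phi> q (max_comm m b)"
    proof (rule morrey_boundedI[where C=C'])
      show "q $ j > 0" for j by (rule q0)
      show "\<phi> (z, r) > 0" if "r > 0" for z r by (rule \<phi>[OF that])
      show "C' > 0" using c(1) sC by (simp add: C'_def)
      fix f assume f: "\<forall>k\<in>{1..m}. f k \<in> morrey_space (\<phi>s k) (qs k)"
      define M where "M = (\<Prod>k\<in>{1..m}. morrey_norm (\<phi>s k) (qs k) (\<lambda>x. ennreal (norm (f k x))))"
      define Q where "Q i S' N \<longleftrightarrow> S' \<in> borel_measurable borel \<and> N \<in> null_sets lborel \<and>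
          (\<forall>x. x \<notin> N \<longrightarrow> max_comm_i m b i f x = S' x) \<and>
          (\<forall>z r. r > 0 \<longrightarrow> nrm (($) q) (\<lambda>y. S' y * indicator (ball z r) y) \<le>
            ennreal (C i * \<phi> (z, r)) * nrm (($) q) (indicator (ball z r)) * M)" for i S' N
      have "\<exists>S' N. Q i S' N" if "i \<in> {1..m}" for i
        using C(2)[OF that f] unfolding local_bound_def Q_def M_def by blast
      then have "\<forall>i\<in>{1..m}. \<exists>S'. \<exists>N. Q i S' N" by blast
      from bchoice[OF this] obtain S where "\<forall>i\<in>{1..m}. \<exists>N. Q i (S i) N" by blast
      from bchoice[OF this] obtain N where SN: "\<And>i. i \<in> {1..m} \<Longrightarrow> Q i (S i) (N i)" by blast
      have Sm: "S i \<in> borel_measurable borel" if "i \<in> {1..m}" for i using SN[OF that] by (simp add: Q_def)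
      show "local_bound m \<phi>s qs \<phi> q C' (max_comm m b) f"
        unfolding local_bound_def M_def[symmetric]
      proof (intro bexI[of _ "\<lambda>x. \<Sum>i\<in>{1..m}. S i x"] bexI[of _ "\<Union>i\<in>{1..m}. N i"] conjI allI impI)
        show "(\<lambda>x. \<Sum>i\<in>{1..m}. S i x) \<in> borel_measurable borel" using Sm by (intro borel_measurable_sum) auto
        show "(\<Union>i\<in>{1..m}. N i) \<in> null_sets lborel" using SN by (intro null_sets_UN') (auto simp: Q_def)
        show "max_comm m b f x = (\<Sum>i\<in>{1..m}. S i x)" if "x \<notin> (\<Union>i\<in>{1..m}. N i)" for x
          unfolding max_comm_def using SN that by (intro sum.cong refl) (auto simp: Q_def)
        fix z :: "real ^ 'n::{finite,linorder}" and r :: real assume r: "r > 0"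
        define w where "w = nrm (($) q) (indicator (ball z r))"
        have "nrm (($) q) (\<lambda>y. (\<Sum>i\<in>{1..m}. S i y) * indicator (ball z r) y) =
            nrm (($) q) (\<lambda>y. \<Sum>i\<in>{1..m}. S i y * indicator (ball z r) y)" by (simp only: sum_distrib_right)
        also have "\<dots> \<le> ennreal c * (\<Sum>i\<in>{1..m}. nrm (($) q) (\<lambda>y. S i y * indicator (ball z r) y))"
          using Sm by (intro c(2)) (auto intro!: borel_measurable_times_ennreal)
        also have "\<dots> \<le> ennreal c * (\<Sum>i\<in>{1..m}. ennreal (C i * \<phi> (z, r)) * w * M)"
          using SN r unfolding w_def by (intro mult_left_mono sum_mono) (auto simp: Q_def)
        also have "\<dots> = ennreal c * (\<Sum>i\<in>{1..m}. ennreal (C i * \<phi> (z, r))) * w * M"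
          by (simp only: sum_distrib_right mult.assoc)
        also have "(\<Sum>i\<in>{1..m}. ennreal (C i * \<phi> (z, r))) = ennreal (\<Sum>i\<in>{1..m}. C i * \<phi> (z, r))"
          by (rule sum_ennreal) (use C(1) \<phi>[OF r, of z] in \<open>auto intro: mult_nonneg_nonneg less_imp_le\<close>)
        also have "(\<Sum>i\<in>{1..m}. C i * \<phi> (z, r)) = (\<Sum>i\<in>{1..m}. C i) * \<phi> (z, r)" by (simp only: sum_distrib_right)
        also have "ennreal c * ennreal ((\<Sum>i\<in>{1..m}. C i) * \<phi> (z, r)) = ennreal (C' * \<phi> (z, r))"
          using c(1) sC \<phi>[OF r, of z] by (subst ennreal_mult[symmetric]) (auto simp: C'_def mult.assoc)
        finally show "nrm (($) q) (\<lambda>y. (\<Sum>i\<in>{1..m}. S i y) * indicator (ball z r) y) \<le>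
          ennreal (C' * \<phi> (z, r)) * nrm (($) q) (indicator (ball z r)) * M"
          by (simp add: w_def)
      qed
    qed
  qed
qed

end
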